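(* Let $X$ be a smooth complex projective variety of dimension $n$, let $L$ be a very ample line bundle on $X$, and let $\omega$ be a K\"ahler form on $X$ in the class $c_1(L)$. Then there exist an open subset $U\subset X$ (in the usual classical topology), a finite subset $\mathcal{A}=\{\beta_1,\dots,\beta_r\}\subset\mathbb{Z}^n$ such that the differences of elements of $\mathcal{A}$ generate the lattice $\mathbb{Z}^n$, and a point $c\in(\mathbb{C}^* )^r$, such that $(U,\omega)$ is symplectomorphic to $((\mathbb{C}^* )^n,\omega_{\mathcal{A},c})$.
   Context: $\mathbb{C}^*=\mathbb{C}\setminus\{0\}$. For $u=(u_1,\dots,u_n)\in(\mathbb{C}^* )^n$ and $\alpha=(a_1,\dots,a_n)\in\mathbb{Z}^n$ write $u^\alpha=u_1^{a_1}\cdots u_n^{a_n}$. For a finite set $\mathcal{A}=\{\beta_1,\dots,\beta_r\}\subset\mathbb{Z}^n$ whose set of differences generates $\mathbb{Z}^n$, and $c=(c_1,\dots,c_r)\in(\mathbb{C}^* )^r$, let $\psi_{\mathcal{A},c}:(\mathbb{C}^* )^n\to\mathbb{CP}^{r-1}$, $u\mapsto(u^{\beta_1}c_1:\cdots:u^{\beta_r}c_r)$ (an isomorphism onto its image). Let $\Omega$ be the Fubini-Study K\"ahler form on $\mathbb{CP}^{r-1}$ associated to the standard Hermitian product on $\mathbb{C}^r$, normalized to represent $c_1(\mathcal{O}(1))$. Then $\omega_{\mathcal{A},c}:=\psi_{\mathcal{A},c}^*\Omega$, a K\"ahler form on $(\mathbb{C}^* )^n$. *)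

theory Defs
  imports
    "HOL-Analysis.Analysis"
    "HOL-Computational_Algebra.Group_Closure"
begin

text \<open>
  Conventions. A subset of the projective space of lines in \<open>complex ^ 'm\<close> is encoded by its cone,
  i.e. its preimage under the quotient map from the nonzero vectors; functions, maps and differential
  forms on it are encoded by their pullbacks to the cone. The quotient map is a surjective
  submersion with fibres the orbits of the nonzero scalars, so forms on the projective manifold
  correspond exactly to those forms on the cone which are invariant under the scalars and vanish
  on vectors tangent to the orbits. Complex structures are given by multiplication with \<open>\<i>\<close>.
\<close>

section \<open>Projective varieties\<close>

text \<open>Homogeneous polynomial functions of degree \<open>d\<close> in the variables indexed by the finite set \<open>J\<close>.\<close>

definition hpoly :: "'j set \<Rightarrow> nat \<Rightarrow> (('j \<Rightarrow> complex) \<Rightarrow> complex) set" where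
  "hpoly J d = {p. \<exists>a :: ('j \<Rightarrow> nat) \<Rightarrow> complex.
     p = (\<lambda>x. \<Sum>e | (\<forall>j. j \<notin> J \<longrightarrow> e j = 0) \<and> (\<Sum>j\<in>J. e j) = d. a e * (\<Prod>j\<in>J. x j ^ e j))}"

text \<open>Cones of Zariski closed subsets of the projective space with homogeneous coordinates indexed
  by \<open>J\<close>; coordinates outside \<open>J\<close> are zero by convention.\<close>

definition zariski_closed :: "'j set \<Rightarrow> ('j \<Rightarrow> complex) set \<Rightarrow> bool" where
  "zariski_closed J Z \<longleftrightarrow> (\<exists>P. P \<subseteq> (\<Union>d. hpoly J d) \<and>
     Z = {z. z \<noteq> (\<lambda>_. 0) \<and> (\<forall>j. j \<notin> J \<longrightarrow> z j = 0) \<and> (\<forall>p\<in>P. p z = 0)})"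

definition proj_closed :: "(complex ^ 'm) set \<Rightarrow> bool" where
  "proj_closed Z \<longleftrightarrow> zariski_closed UNIV (vec_nth ` Z)"

definition zariski_open_in :: "(complex ^ 'm) set \<Rightarrow> (complex ^ 'm) set \<Rightarrow> bool" where
  "zariski_open_in X W \<longleftrightarrow> (\<exists>Z. proj_closed Z \<and> W = X - Z)"

definition irreducible_closed :: "(complex ^ 'm) set \<Rightarrow> bool" where
  "irreducible_closed X \<longleftrightarrow> proj_closed X \<and> X \<noteq> {} \<and>
     (\<forall>Y Z. proj_closed Y \<longrightarrow> proj_closed Z \<longrightarrow> X = Y \<union> Z \<longrightarrow> X = Y \<or> X = Z)"

text \<open>Krull dimension, through chains of irreducible closed subsets.\<close>

definition has_chain :: "(complex ^ 'm) set \<Rightarrow> nat \<Rightarrow> bool" where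
  "has_chain X n \<longleftrightarrow> (\<exists>Y :: nat \<Rightarrow> (complex ^ 'm) set.
     (\<forall>i\<le>n. irreducible_closed (Y i) \<and> Y i \<subseteq> X) \<and> (\<forall>i<n. Y i \<subset> Y (Suc i)))"

definition has_dimension :: "(complex ^ 'm) set \<Rightarrow> nat \<Rightarrow> bool" where
  "has_dimension X n \<longleftrightarrow> has_chain X n \<and> \<not> has_chain X (Suc n)"

text \<open>The Zariski tangent space at \<open>x\<close> of the cone: the common kernel of the differentials of the
  elements of the homogeneous ideal of \<open>X\<close>. It is a complex subspace containing the line of \<open>x\<close>, and
  its quotient by that line is (up to a twist) the tangent space of \<open>X\<close>; so the rank condition below
  is the Jacobian criterion.\<close>

definition cone_tangent :: "(complex ^ 'm::finite) set \<Rightarrow> complex ^ 'm \<Rightarrow> (complex ^ 'm) set" where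
  "cone_tangent X x = {v. \<forall>d. \<forall>p \<in> hpoly UNIV d. (\<forall>y\<in>X. p (vec_nth y) = 0) \<longrightarrow>
     frechet_derivative (\<lambda>y. p (vec_nth y)) (at x) v = 0}"

definition smooth_projective_variety :: "(complex ^ 'm::finite) set \<Rightarrow> nat \<Rightarrow> bool" where
  "smooth_projective_variety X n \<longleftrightarrow> irreducible_closed X \<and> has_dimension X n \<and>
     (\<forall>x\<in>X. vec.dim (cone_tangent X x) = n + 1)"

section \<open>Algebraic line bundles\<close>

definition regular_on :: "(complex ^ 'm) set \<Rightarrow> (complex ^ 'm) set \<Rightarrow> (complex ^ 'm \<Rightarrow> complex) \<Rightarrow> bool" where
  "regular_on X W f \<longleftrightarrow> (\<forall>x\<in>W. \<exists>V d. \<exists>p \<in> hpoly UNIV d. \<exists>q \<in> hpoly UNIV d.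
     zariski_open_in X V \<and> x \<in> V \<and> V \<subseteq> W \<and>
     (\<forall>y\<in>V. q (vec_nth y) \<noteq> 0 \<and> f y = p (vec_nth y) / q (vec_nth y)))"

text \<open>A line bundle is given by a trivialising Zariski open cover \<open>W\<close> (with an arbitrary index type)
  and transition functions \<open>g\<close>. Sections are families of functions with \<open>s k = g k l * s l\<close> on overlaps.\<close>

definition line_bundle ::
  "(complex ^ 'm) set \<Rightarrow> ('k \<Rightarrow> (complex ^ 'm) set) \<Rightarrow> ('k \<Rightarrow> 'k \<Rightarrow> complex ^ 'm \<Rightarrow> complex) \<Rightarrow> bool" where
  "line_bundle X W g \<longleftrightarrow>
     (\<forall>k. zariski_open_in X (W k)) \<and> (\<Union>k. W k) = X \<and>
     (\<forall>k l. regular_on X (W k \<inter> W l) (g k l)) \<and>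
     (\<forall>k l. \<forall>x \<in> W k \<inter> W l. g k l x \<noteq> 0) \<and>
     (\<forall>k. \<forall>x \<in> W k. g k k x = 1) \<and>
     (\<forall>k l j. \<forall>x \<in> W k \<inter> W l \<inter> W j. g k l x * g l j x = g k j x)"

definition global_section ::
  "(complex ^ 'm) set \<Rightarrow> ('k \<Rightarrow> (complex ^ 'm) set) \<Rightarrow> ('k \<Rightarrow> 'k \<Rightarrow> complex ^ 'm \<Rightarrow> complex) \<Rightarrow>
    ('k \<Rightarrow> complex ^ 'm \<Rightarrow> complex) \<Rightarrow> bool" where
  "global_section X W g s \<longleftrightarrow> (\<forall>k. regular_on X (W k) (s k)) \<and>
     (\<forall>k l. \<forall>x \<in> W k \<inter> W l. s k x = g k l x * s l x)"

text \<open>A regular map \<open>F\<close> from \<open>X\<close> to projective \<open>m\<close>-space, given by a choice of homogeneous coordinates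
  at every point, is a closed embedding: it is injective, its image is closed, and the inverse on
  the image is regular, i.e. locally given by homogeneous polynomials of equal degree
  wherever these do not vanish simultaneously.\<close>

definition closed_embedding ::
  "(complex ^ 'm) set \<Rightarrow> nat \<Rightarrow> (complex ^ 'm \<Rightarrow> nat \<Rightarrow> complex) \<Rightarrow> bool" where
  "closed_embedding X m F \<longleftrightarrow>
     (\<forall>x\<in>X. \<forall>y\<in>X. (\<exists>t. t \<noteq> 0 \<and> (\<forall>j. F y j = t * F x j)) \<longrightarrow> (\<exists>t. t \<noteq> 0 \<and> y = t *s x)) \<and>
     zariski_closed {..m} {z. \<exists>x\<in>X. \<exists>t. t \<noteq> 0 \<and> z = (\<lambda>j. t * F x j)} \<and>
     (\<forall>x\<in>X. \<exists>d. \<exists>q :: 'm \<Rightarrow> (nat \<Rightarrow> complex) \<Rightarrow> complex.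
        (\<forall>i. q i \<in> hpoly {..m} d) \<and> (\<exists>i. q i (F x) \<noteq> 0) \<and>
        (\<forall>y\<in>X. (\<exists>i. q i (F y) \<noteq> 0) \<longrightarrow> (\<exists>t. t \<noteq> 0 \<and> (\<forall>i. q i (F y) = t * y $ i))))"

text \<open>Very ample: some global sections \<open>s 0, \<dots>, s m\<close> without common zeros define a closed embedding.
  The point \<open>(s 0 : \<dots> : s m)\<close> does not depend on the trivialisation, so any index \<open>k\<close> will do.\<close>

definition very_ample ::
  "(complex ^ 'm) set \<Rightarrow> ('k \<Rightarrow> (complex ^ 'm) set) \<Rightarrow> ('k \<Rightarrow> 'k \<Rightarrow> complex ^ 'm \<Rightarrow> complex) \<Rightarrow> bool" where
  "very_ample X W g \<longleftrightarrow> (\<exists>m. \<exists>s :: nat \<Rightarrow> 'k \<Rightarrow> complex ^ 'm \<Rightarrow> complex.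
     (\<forall>j\<le>m. global_section X W g (s j)) \<and>
     (\<forall>k. \<forall>x\<in>W k. \<exists>j\<le>m. s j k x \<noteq> 0) \<and>
     closed_embedding X m (\<lambda>x j. if j \<le> m then s j (SOME k. x \<in> W k) x else 0))"

section \<open>Smooth functions and differential forms\<close>

primrec Ck_on :: "nat \<Rightarrow> 'a::euclidean_space set \<Rightarrow> ('a \<Rightarrow> 'b::real_normed_vector) \<Rightarrow> bool" where
  "Ck_on 0 V f \<longleftrightarrow> continuous_on V f"
| "Ck_on (Suc k) V f \<longleftrightarrow> (\<forall>x\<in>V. f differentiable (at x)) \<and>
     (\<forall>v. Ck_on k V (\<lambda>x. frechet_derivative f (at x) v))"

definition smooth_on :: "'a::euclidean_space set \<Rightarrow> ('a \<Rightarrow> 'b::real_normed_vector) \<Rightarrow> bool" where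
  "smooth_on V f \<longleftrightarrow> (\<forall>k. Ck_on k V f)"

text \<open>\<open>G\<close> is a smooth extension of \<open>f\<close>, defined on \<open>S\<close>, to a neighbourhood of \<open>x\<close> in the ambient space.
  A function on a submanifold is smooth iff it has such extensions at all points, and its
  differential is the restriction of that of \<open>G\<close> to the tangent space.\<close>

definition smooth_ext ::
  "'a::euclidean_space set \<Rightarrow> ('a \<Rightarrow> 'b::real_normed_vector) \<Rightarrow> 'a \<Rightarrow> ('a \<Rightarrow> 'b) \<Rightarrow> bool" where
  "smooth_ext S f x G \<longleftrightarrow> (\<exists>V. open V \<and> x \<in> V \<and> smooth_on V G \<and> (\<forall>y \<in> S \<inter> V. G y = f y))"

text \<open>Likewise for forms on the cone of \<open>X\<close>, whose values matter on tangent vectors only.\<close>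

definition form1_ext ::
  "(complex ^ 'm::finite) set \<Rightarrow> (complex ^ 'm \<Rightarrow> complex ^ 'm \<Rightarrow> real) \<Rightarrow> complex ^ 'm \<Rightarrow>
    (complex ^ 'm \<Rightarrow> complex ^ 'm \<Rightarrow> real) \<Rightarrow> bool" where
  "form1_ext X \<eta> x G \<longleftrightarrow> (\<exists>V. open V \<and> x \<in> V \<and> (\<forall>y\<in>V. linear (G y)) \<and>
     (\<forall>v. smooth_on V (\<lambda>y. G y v)) \<and>
     (\<forall>y \<in> X \<inter> V. \<forall>v \<in> cone_tangent X y. G y v = \<eta> y v))"

definition form2_ext ::
  "(complex ^ 'm::finite) set \<Rightarrow> (complex ^ 'm \<Rightarrow> complex ^ 'm \<Rightarrow> complex ^ 'm \<Rightarrow> real) \<Rightarrow> complex ^ 'm \<Rightarrow>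
    (complex ^ 'm \<Rightarrow> complex ^ 'm \<Rightarrow> complex ^ 'm \<Rightarrow> real) \<Rightarrow> bool" where
  "form2_ext X \<omega> x G \<longleftrightarrow> (\<exists>V. open V \<and> x \<in> V \<and>
     (\<forall>y\<in>V. bilinear (G y) \<and> (\<forall>v. G y v v = 0)) \<and>
     (\<forall>v w. smooth_on V (\<lambda>y. G y v w)) \<and>
     (\<forall>y \<in> X \<inter> V. \<forall>v \<in> cone_tangent X y. \<forall>w \<in> cone_tangent X y. G y v w = \<omega> y v w))"

definition one_form ::
  "(complex ^ 'm::finite) set \<Rightarrow> (complex ^ 'm \<Rightarrow> complex ^ 'm \<Rightarrow> real) \<Rightarrow> bool" where
  "one_form X \<eta> \<longleftrightarrow> (\<forall>x\<in>X. (\<exists>G. form1_ext X \<eta> x G) \<and> (\<forall>t. \<eta> x (t *s x) = 0) \<and>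
     (\<forall>t. t \<noteq> 0 \<longrightarrow> (\<forall>v \<in> cone_tangent X x. \<eta> (t *s x) (t *s v) = \<eta> x v)))"

definition two_form ::
  "(complex ^ 'm::finite) set \<Rightarrow> (complex ^ 'm \<Rightarrow> complex ^ 'm \<Rightarrow> complex ^ 'm \<Rightarrow> real) \<Rightarrow> bool" where
  "two_form X \<omega> \<longleftrightarrow> (\<forall>x\<in>X. (\<exists>G. form2_ext X \<omega> x G) \<and>
     (\<forall>t. \<forall>v \<in> cone_tangent X x. \<omega> x (t *s x) v = 0) \<and>
     (\<forall>t. t \<noteq> 0 \<longrightarrow> (\<forall>v \<in> cone_tangent X x. \<forall>w \<in> cone_tangent X x.
        \<omega> (t *s x) (t *s v) (t *s w) = \<omega> x v w)))"

text \<open>Exterior derivatives of forms on open subsets of the ambient space.\<close>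

definition ext_d1 :: "('a::real_normed_vector \<Rightarrow> 'a \<Rightarrow> real) \<Rightarrow> 'a \<Rightarrow> 'a \<Rightarrow> 'a \<Rightarrow> real" where
  "ext_d1 G x v w = frechet_derivative (\<lambda>y. G y w) (at x) v - frechet_derivative (\<lambda>y. G y v) (at x) w"

definition ext_d2 :: "('a::real_normed_vector \<Rightarrow> 'a \<Rightarrow> 'a \<Rightarrow> real) \<Rightarrow> 'a \<Rightarrow> 'a \<Rightarrow> 'a \<Rightarrow> 'a \<Rightarrow> real" where
  "ext_d2 G x u v w = frechet_derivative (\<lambda>y. G y v w) (at x) u -
     frechet_derivative (\<lambda>y. G y u w) (at x) v + frechet_derivative (\<lambda>y. G y u v) (at x) w"

definition closed_form ::
  "(complex ^ 'm::finite) set \<Rightarrow> (complex ^ 'm \<Rightarrow> complex ^ 'm \<Rightarrow> complex ^ 'm \<Rightarrow> real) \<Rightarrow> bool" where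
  "closed_form X \<omega> \<longleftrightarrow> two_form X \<omega> \<and> (\<forall>x\<in>X. \<exists>G. form2_ext X \<omega> x G \<and>
     (\<forall>u \<in> cone_tangent X x. \<forall>v \<in> cone_tangent X x. \<forall>w \<in> cone_tangent X x. ext_d2 G x u v w = 0))"

definition exact_form ::
  "(complex ^ 'm::finite) set \<Rightarrow> (complex ^ 'm \<Rightarrow> complex ^ 'm \<Rightarrow> complex ^ 'm \<Rightarrow> real) \<Rightarrow> bool" where
  "exact_form X \<omega> \<longleftrightarrow> (\<exists>\<eta>. one_form X \<eta> \<and> (\<forall>x\<in>X. \<exists>G. form1_ext X \<eta> x G \<and>
     (\<forall>v \<in> cone_tangent X x. \<forall>w \<in> cone_tangent X x. \<omega> x v w = ext_d1 G x v w)))"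

text \<open>On the cone, positivity is required of vectors transverse to the orbits, i.e. of those that
  represent nonzero tangent vectors of \<open>X\<close>.\<close>

definition kaehler_form ::
  "(complex ^ 'm::finite) set \<Rightarrow> (complex ^ 'm \<Rightarrow> complex ^ 'm \<Rightarrow> complex ^ 'm \<Rightarrow> real) \<Rightarrow> bool" where
  "kaehler_form X \<omega> \<longleftrightarrow> closed_form X \<omega> \<and> (\<forall>x\<in>X. \<forall>v \<in> cone_tangent X x.
     (\<forall>w \<in> cone_tangent X x. \<omega> x (\<i> *s v) (\<i> *s w) = \<omega> x v w) \<and>
     ((\<forall>t. v \<noteq> t *s x) \<longrightarrow> \<omega> x v (\<i> *s v) > 0))"

section \<open>The first Chern class\<close>

text \<open>The squared norm of a section \<open>s\<close> is \<open>h k x * (cmod (s k x))^2\<close>.\<close>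

definition hermitian_metric ::
  "(complex ^ 'm::finite) set \<Rightarrow> ('k \<Rightarrow> (complex ^ 'm) set) \<Rightarrow> ('k \<Rightarrow> 'k \<Rightarrow> complex ^ 'm \<Rightarrow> complex) \<Rightarrow>
    ('k \<Rightarrow> complex ^ 'm \<Rightarrow> real) \<Rightarrow> bool" where
  "hermitian_metric X W g h \<longleftrightarrow>
     (\<forall>k. \<forall>x\<in>W k. h k x > 0 \<and> (\<exists>G. smooth_ext (W k) (h k) x G) \<and>
        (\<forall>t. t \<noteq> 0 \<longrightarrow> h k (t *s x) = h k x)) \<and>
     (\<forall>k l. \<forall>x \<in> W k \<inter> W l. h l x = (cmod (g k l x))\<^sup>2 * h k x)"

text \<open>The form \<open>(\<i> / 2\<pi>) \<partial>\<partial>\<^sup>- f\<close>, for a real function \<open>f\<close>: since \<open>\<partial>\<^sup>- f = (df + \<i> df \<circ> J) / 2\<close>, it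
  equals \<open>- d (df \<circ> J) / 4\<pi>\<close>.\<close>

definition ddbar :: "(complex ^ 'm \<Rightarrow> real) \<Rightarrow> complex ^ 'm::finite \<Rightarrow> complex ^ 'm \<Rightarrow> complex ^ 'm \<Rightarrow> real" where
  "ddbar f x v w = - ext_d1 (\<lambda>y u. frechet_derivative f (at y) (\<i> *s u)) x v w / (4 * pi)"

text \<open>The Chern form of a hermitian line bundle, i.e. \<open>\<i> / 2\<pi>\<close> times the curvature of its Chern
  connection; this curvature is \<open>- \<partial>\<partial>\<^sup>- log h\<close>.\<close>

definition chern_form ::
  "(complex ^ 'm::finite) set \<Rightarrow> ('k \<Rightarrow> (complex ^ 'm) set) \<Rightarrow> ('k \<Rightarrow> complex ^ 'm \<Rightarrow> real) \<Rightarrow>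
    (complex ^ 'm \<Rightarrow> complex ^ 'm \<Rightarrow> complex ^ 'm \<Rightarrow> real) \<Rightarrow> bool" where
  "chern_form X W h \<kappa> \<longleftrightarrow> (\<forall>k. \<forall>x\<in>W k. \<exists>f. smooth_ext (W k) (\<lambda>y. ln (h k y)) x f \<and>
     (\<forall>v \<in> cone_tangent X x. \<forall>w \<in> cone_tangent X x. \<kappa> x v w = - ddbar f x v w))"

text \<open>The first Chern class as a de Rham cohomology class, i.e. a set of cohomologous closed forms.\<close>

definition first_chern_class ::
  "(complex ^ 'm::finite) set \<Rightarrow> ('k \<Rightarrow> (complex ^ 'm) set) \<Rightarrow> ('k \<Rightarrow> 'k \<Rightarrow> complex ^ 'm \<Rightarrow> complex) \<Rightarrow>
    (complex ^ 'm \<Rightarrow> complex ^ 'm \<Rightarrow> complex ^ 'm \<Rightarrow> real) set" where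
  "first_chern_class X W g = {\<alpha>. closed_form X \<alpha> \<and> (\<exists>h \<kappa>. hermitian_metric X W g h \<and>
     chern_form X W h \<kappa> \<and> exact_form X (\<lambda>x v w. \<alpha> x v w - \<kappa> x v w))}"

section \<open>The torus and its toric Kaehler forms\<close>

text \<open>The coordinates of the torus and of its lattice of exponents are indexed by a subset \<open>I\<close> of a
  finite type, coordinates outside \<open>I\<close> being zero; the dimension is \<open>card I\<close>, which may be \<open>0\<close>.\<close>

definition torus :: "'n set \<Rightarrow> (complex ^ 'n) set" where
  "torus I = {u. \<forall>i. u $ i \<noteq> 0 \<longleftrightarrow> i \<in> I}"

definition lattice :: "'n set \<Rightarrow> (int ^ 'n) set" where
  "lattice I = {\<beta>. \<forall>i. i \<notin> I \<longrightarrow> \<beta> $ i = 0}"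

text \<open>Since \<open>0 powi 0 = 1\<close>, only the coordinates in \<open>I\<close> contribute when \<open>\<beta> \<in> lattice I\<close>.\<close>

definition monomial_at :: "int ^ 'n::finite \<Rightarrow> complex ^ 'n \<Rightarrow> complex" where
  "monomial_at \<beta> u = (\<Prod>i\<in>UNIV. (u $ i) powi (\<beta> $ i))"

definition herm :: "'j set \<Rightarrow> ('j \<Rightarrow> complex) \<Rightarrow> ('j \<Rightarrow> complex) \<Rightarrow> complex" where
  "herm J v w = (\<Sum>j\<in>J. v j * cnj (w j))"

text \<open>The pullback to the nonzero vectors \<open>z\<close> (with coordinates indexed by \<open>J\<close>) of the Fubini-Study form,
  \<open>(\<i> / 2\<pi>) \<partial>\<partial>\<^sup>- log \<bar>z\<bar>\<^sup>2\<close>; projective lines have area \<open>1\<close>.\<close>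

definition fubini_study :: "'j set \<Rightarrow> ('j \<Rightarrow> complex) \<Rightarrow> ('j \<Rightarrow> complex) \<Rightarrow> ('j \<Rightarrow> complex) \<Rightarrow> real" where
  "fubini_study J z v w =
     - Im (herm J v w / herm J z z - herm J v z * herm J z w / (herm J z z)\<^sup>2) / pi"

text \<open>The pullback of the Fubini-Study form by the map with homogeneous coordinates
  \<open>c \<beta> * monomial_at \<beta> u\<close>, for \<open>\<beta> \<in> A\<close>.\<close>

definition toric_form :: "(int ^ 'n::finite) set \<Rightarrow> (int ^ 'n \<Rightarrow> complex) \<Rightarrow>
    complex ^ 'n \<Rightarrow> complex ^ 'n \<Rightarrow> complex ^ 'n \<Rightarrow> real" where
  "toric_form A c u v w = fubini_study A (\<lambda>\<beta>. monomial_at \<beta> u * c \<beta>)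
     (\<lambda>\<beta>. frechet_derivative (\<lambda>y. monomial_at \<beta> y * c \<beta>) (at u) v)
     (\<lambda>\<beta>. frechet_derivative (\<lambda>y. monomial_at \<beta> y * c \<beta>) (at u) w)"

section \<open>Symplectomorphisms\<close>

definition classical_open_in :: "(complex ^ 'm) set \<Rightarrow> (complex ^ 'm) set \<Rightarrow> bool" where
  "classical_open_in X U \<longleftrightarrow> openin (top_of_set X) U \<and> (\<forall>x\<in>U. \<forall>t. t \<noteq> 0 \<longrightarrow> t *s x \<in> U)"

text \<open>\<open>\<Psi>\<close> induces a diffeomorphism from the open subset \<open>U\<close> of \<open>X\<close> onto the torus, which pulls \<open>\<omega>'\<close> back
  to \<open>\<omega>\<close>. The inverse being smooth means that it locally has smooth homogeneous coordinates \<open>\<sigma>\<close>.\<close>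

definition symplectomorphism ::
  "(complex ^ 'm::finite) set \<Rightarrow> (complex ^ 'm) set \<Rightarrow>
    (complex ^ 'm \<Rightarrow> complex ^ 'm \<Rightarrow> complex ^ 'm \<Rightarrow> real) \<Rightarrow>
    'n set \<Rightarrow> (complex ^ 'n::finite \<Rightarrow> complex ^ 'n \<Rightarrow> complex ^ 'n \<Rightarrow> real) \<Rightarrow>
    (complex ^ 'm \<Rightarrow> complex ^ 'n) \<Rightarrow> bool" where
  "symplectomorphism X U \<omega> I \<omega>' \<Psi> \<longleftrightarrow>
     \<Psi> ` U = torus I \<and>
     (\<forall>x\<in>U. \<forall>y\<in>U. \<Psi> x = \<Psi> y \<longleftrightarrow> (\<exists>t. t \<noteq> 0 \<and> y = t *s x)) \<and>
     (\<forall>x\<in>U. \<exists>G. smooth_ext U \<Psi> x G \<and>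
        (\<forall>v \<in> cone_tangent X x. \<forall>w \<in> cone_tangent X x.
           \<omega> x v w = \<omega>' (\<Psi> x) (frechet_derivative G (at x) v) (frechet_derivative G (at x) w))) \<and>
     (\<forall>u \<in> torus I. \<exists>V \<sigma>. open V \<and> u \<in> V \<and> smooth_on V \<sigma> \<and>
        (\<forall>y \<in> V \<inter> torus I. \<sigma> y \<in> U \<and> \<Psi> (\<sigma> y) = y))"

definition symplectomorphic_to_torus ::
  "(complex ^ 'm::finite) set \<Rightarrow> (complex ^ 'm) set \<Rightarrow>
    (complex ^ 'm \<Rightarrow> complex ^ 'm \<Rightarrow> complex ^ 'm \<Rightarrow> real) \<Rightarrow>
    'n set \<Rightarrow> (complex ^ 'n::finite \<Rightarrow> complex ^ 'n \<Rightarrow> complex ^ 'n \<Rightarrow> real) \<Rightarrow> bool" where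
  "symplectomorphic_to_torus X U \<omega> I \<omega>' \<longleftrightarrow> (\<exists>\<Psi>. symplectomorphism X U \<omega> I \<omega>' \<Psi>)"

end

theory Submission
  imports Defs "HOL-Complex_Analysis.Complex_Analysis"
begin

text \<open>
The variety degenerates to affine space. Choose a point \<open>p\<close> of \<open>X\<close>. Since the sections of \<open>L\<close> embed
\<open>X\<close>, there are \<open>n\<close> combinations \<open>\<sigma>\<^sub>i\<close> of them that vanish at \<open>p\<close> to first order with independent
differentials (\<open>dual_frame\<close>). For \<open>0 < t < 2\<close> the family of sections \<open>\<sigma>\<^sub>i\<close>, \<open>t s\<^sub>l\<close> has no base points, so
it pulls a Fubini-Study form back to \<open>X\<close>; call it \<open>\<Phi>\<^sub>t\<close>. It lies in the class of \<open>\<omega>\<close>, and with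
\<open>w = (1 - t)\<^sup>2\<close> the forms \<open>w \<Phi>\<^sub>t + (1 - w) \<omega>\<close> on the slices of \<open>X \<times> (0, 2)\<close> are restrictions of one closed
form \<open>Om\<close> on the product: the difference of the terms has a global primitive on \<open>X\<close>, and this is multiplied
by \<open>w\<close> before the differential is taken. The slices of \<open>Om\<close> are positive, and the slice at \<open>t = 1\<close> is \<open>\<omega>\<close>.

The kernel of \<open>Om\<close> is a line field transverse to the slices, and its flow carries slice to slice
preserving the forms (\<open>flow_smooth\<close>). Because \<open>X\<close> is compact the flow is defined on all of \<open>0 < t < 2\<close>.

Near \<open>p\<close> the quotients \<open>x\<^sub>i = \<sigma>\<^sub>i / s\<^sub>*\<close> are coordinates, where \<open>s\<^sub>*\<close> is a section with \<open>s\<^sub>*(p) \<noteq> 0\<close>. In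
the rescaled coordinates \<open>u = x / t\<close> the sections become, up to the common factor \<open>t s\<^sub>*\<close>, the functions
\<open>u\<^sub>i\<close> and \<open>s\<^sub>l / s\<^sub>*\<close>; at \<open>t = 0\<close> the latter are the constants \<open>s\<^sub>l(p) / s\<^sub>*(p)\<close>. So \<open>Om\<close> extends smoothly to
\<open>t = 0\<close>, where \<open>u\<close> ranges over the whole of affine space, and its slice there is the
Fubini-Study form of \<open>(c\<^sub>0 : u\<^sub>1 : \<dots> : u\<^sub>n)\<close> with \<open>c\<^sub>0\<^sup>2 = \<Sum>\<^sub>l |s\<^sub>l(p) / s\<^sub>*(p)|\<^sup>2\<close>
(\<open>ext_primU_zero\<close>): the toric form of \<open>{0, e\<^sub>1, \<dots>, e\<^sub>n}\<close>. The flow of the kernel from \<open>t = 0\<close> to \<open>t = 1\<close>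
embeds the torus symplectically in \<open>X\<close>, and its image is the set \<open>U\<close>: the points whose backward orbits tend
to \<open>p\<close> with rescaled coordinates converging to a point of the torus.

All objects on \<open>X\<close> are handled on its cone of nonzero vectors, so that functions and forms are
homogeneous and are equal, near each point of the cone, to restrictions of smooth ones
on the ambient space.
\<close>

section \<open>Smooth functions and one-forms\<close>

lemmas around_open = eventually_nhds_in_open
lemmas around_self = eventually_nhds_x_imp_x
lemmas deriv_bl = bounded_linear_imp_has_derivative
lemmas deriv_transform = has_derivative_transform_within_open
lemmas lin_bl = linear_conv_bounded_linear
lemmas vs_assoc = vector_smult_assoc

notation scaleR (infixr "*r" 75)
notation has_vector_derivative (infix "has'_vd" 50)

abbreviation around :: "'a::topological_space => ('a => bool) => bool" where
 "around x P == eventually P (nhds x)"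

abbreviation fd :: "('a::real_normed_vector => 'b::real_normed_vector) => 'a => 'a => 'b" where
 "fd f x == frechet_derivative f (at x)"

lemma fd_eq: "(f has_derivative f') (at x) ==> fd f x = f'"
 using frechet_derivative_at by metis

lemma fd_cong:
 assumes "open V" "x : V" "!!y. y : V ==> f y = g y"
 shows "fd f x = fd g x"
proof -
 have "(f has_derivative f') (at x) \<longleftrightarrow> (g has_derivative f') (at x)" for f'
  using deriv_transform[OF _ assms(1,2)] assms(3) by metis
 then show ?thesis by (simp add: frechet_derivative_def)
qed

lemma Ck_on_subset: "Ck_on k V f ==> U \<subseteq> V ==> Ck_on k U f"
 by (induction k arbitrary: f) (auto intro: continuous_on_subset)

lemma Ck_on_cong:
 assumes "open V" "!!y. y : V ==> f y = g y"
 shows "Ck_on k V f \<longleftrightarrow> Ck_on k V g"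
 using assms(2)
proof (induction k arbitrary: f g)
 case 0 then show ?case by (simp cong: continuous_on_cong_simp)
next
 case (Suc k)
 have "f differentiable (at x) \<longleftrightarrow> g differentiable (at x)" if "x : V" for x
  using deriv_transform[OF _ assms(1) that] Suc.prems
  unfolding differentiable_def by metis
 moreover have "Ck_on k V (%x. fd f x v) \<longleftrightarrow> Ck_on k V (%x. fd g x v)" for v
  by (rule Suc.IH) (metis fd_cong[OF assms(1)] Suc.prems)
 ultimately show ?case by simp
qed

lemma Ck_on_mono_Suc: "Ck_on (Suc k) V f ==> open V ==> Ck_on k V f"
proof (induction k arbitrary: f)
 case 0 then show ?case
  by (auto intro!: differentiable_imp_continuous_on differentiable_at_imp_differentiable_on)
next
 case (Suc k) then show ?case by auto
qed

lemma Ck_on_mono: "Ck_on k V f ==> open V ==> j <= k ==> Ck_on j V f"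
 by (induction k) (auto simp: le_Suc_eq simp del: Ck_on.simps intro: Ck_on_mono_Suc)

lemma Ck_on_SucI:
 assumes "open V" "!!x. x : V ==> (f has_derivative f' x) (at x)" "!!v. Ck_on k V (%x. f' x v)"
 shows "Ck_on (Suc k) V f"
proof -
 have "Ck_on k V (%x. fd f x v)" for v
  using Ck_on_cong[OF assms(1), of "%x. fd f x v" "%x. f' x v"] assms(3) fd_eq[OF assms(2)] by simp
 then show ?thesis using assms(2) by (auto simp: differentiable_def)
qed

lemma Ck_on_SucD: "Ck_on (Suc k) V f ==> x : V ==> (f has_derivative fd f x) (at x)"
 by (simp add: frechet_derivative_works)

lemma Ck_on_continuous: "Ck_on k V f ==> open V ==> continuous_on V f"
 using Ck_on_mono[of k V f 0] by simp

lemma Ck_on_local: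
 assumes "!!x. x : V ==> EX U. open U & x : U & U \<subseteq> V & Ck_on k U f"
 shows "Ck_on k V f"
 using assms
proof (induction k arbitrary: f)
 case 0
 have "open V" using 0 by (subst open_subopen) blast
 moreover have "isCont f x" if "x : V" for x
  using 0[OF that] by (auto simp: continuous_on_eq_continuous_at)
 ultimately show ?case by (simp add: continuous_on_eq_continuous_at)
next
 case (Suc k)
 have "Ck_on k V (%x. fd f x v)" for v
  using Suc.prems by (intro Suc.IH) (metis Ck_on.simps(2))
 then show ?case using Suc.prems by simp (metis )
qed

lemma Ck_on_const: "Ck_on k V (%x. c)"
 by (induction k arbitrary: c) auto

lemma Ck_on_bounded_linear:
 assumes "bounded_linear h" "open V" shows "Ck_on k V f ==> Ck_on k V (%x. h (f x))"
proof (induction k arbitrary: f)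
 case 0 then show ?case using bounded_linear.continuous_on[OF assms(1)] by simp
next
 case (Suc k)
 show ?case
 proof (rule Ck_on_SucI[OF assms(2)])
  show "((%x. h (f x)) has_derivative (%v. h (fd f x v))) (at x)" if "x : V" for x
  using bounded_linear.has_derivative[OF assms(1) Ck_on_SucD[OF Suc.prems that]] .
  show "Ck_on k V (%x. h (fd f x v))" for v
  using Suc by simp
 qed
qed

lemma Ck_on_id: "open V ==> Ck_on k V (%x. x)"
proof (cases k)
 case (Suc j)
 assume "open V" then show ?thesis unfolding Suc
  by (rule Ck_on_SucI[OF _ has_derivative_ident Ck_on_const])
qed simp

lemma Ck_on_add:
 assumes "open V" shows "Ck_on k V f ==> Ck_on k V g ==> Ck_on k V (%x. f x + g x)"
proof (induction k arbitrary: f g)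
 case 0 then show ?case by (auto intro: continuous_on_add)
next
 case (Suc k)
 show ?case
 proof (rule Ck_on_SucI[OF assms])
  show "((%x. f x + g x) has_derivative (%v. fd f x v + fd g x v)) (at x)" if "x : V" for x
  using Suc.prems[THEN Ck_on_SucD, OF that] by (rule has_derivative_add)
  show "Ck_on k V (%x. fd f x v + fd g x v)" for v
  using Suc by simp
 qed
qed

lemma Ck_on_bilinear:
 assumes "bounded_bilinear h" "open V"
 shows "Ck_on k V f ==> Ck_on k V g ==> Ck_on k V (%x. h (f x) (g x))"
proof (induction k arbitrary: f g)
 case 0 then show ?case using bounded_bilinear.continuous_on[OF assms(1)] by simp
next
 case (Suc k)
 show ?case
 proof (rule Ck_on_SucI[OF assms(2)])
  show "((%x. h (f x) (g x)) has_derivative (%v. h (f x) (fd g x v) + h (fd f x v) (g x))) (at x)"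
  if "x : V" for x
  using bounded_bilinear.FDERIV[OF assms(1) Suc.prems[THEN Ck_on_SucD, OF that]] .
  show "Ck_on k V (%x. h (f x) (fd g x v) + h (fd f x v) (g x))" for v
  using Suc Suc.prems[THEN Ck_on_mono_Suc, OF assms(2)] by (intro Ck_on_add[OF assms(2)]) auto
 qed
qed

lemma Ck_on_sum:
 assumes "open V" shows "(!!i. i : S ==> Ck_on k V (f i)) ==> Ck_on k V (%x. SUM i:S. f i x)"
 by (induction S rule: infinite_finite_induct) (auto intro: Ck_on_add[OF assms] Ck_on_const)

lemma linear_expand:
 fixes v :: "'a::euclidean_space"
 assumes "linear A" shows "A v = (SUM b:Basis. (v \<bullet> b) *r A b)"
proof -
 interpret linear A by fact
 have "A v = A (SUM b:Basis. (v \<bullet> b) *r b)" by (simp add: euclidean_representation)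
 then show ?thesis by (simp add: sum scale)
qed

lemma Ck_on_linear_family:
 fixes w :: "'a::euclidean_space => 'b::euclidean_space"
 assumes "open V" "!!x. x : V ==> linear (A x)" "!!b. b : Basis ==> Ck_on k V (%x. A x b)" "Ck_on k V w"
 shows "Ck_on k V (%x. A x (w x))"
proof -
 have "Ck_on k V (%x. SUM b:Basis. (w x \<bullet> b) *r A x b)"
  using assms(3,4) by (intro Ck_on_sum Ck_on_bilinear[OF bounded_bilinear_scaleR] assms(1)
  Ck_on_bounded_linear[OF bounded_linear_inner_left])
 then show ?thesis
  using Ck_on_cong[OF assms(1), of "%x. A x (w x)" "%x. SUM b:Basis. (w x \<bullet> b) *r A x b" k]
  linear_expand[OF assms(2)] by blast
qed

lemma Ck_on_compose:
 fixes f :: "'a::euclidean_space => 'b::euclidean_space"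
 assumes "open V" "open U" "f ` V \<subseteq> U"
 shows "Ck_on k V f ==> Ck_on k U g ==> Ck_on k V (%x. g (f x))"
proof (induction k arbitrary: g)
 case 0 then show ?case using assms by (auto intro: continuous_on_compose2)
next
 case (Suc k)
 have der: "((%x. g (f x)) has_derivative (%v. fd g (f x) (fd f x v))) (at x)" if "x : V" for x
  using diff_chain_at[OF Ck_on_SucD[OF Suc.prems(1) that] Ck_on_SucD[OF Suc.prems(2)]] assms(3) that
  by (auto simp: o_def)
 show ?case
 proof (rule Ck_on_SucI[OF assms(1) der])
  have f: "Ck_on k V f" using Suc.prems(1) assms(1) by (rule Ck_on_mono_Suc)
  show "Ck_on k V (%x. fd g (f x) (fd f x v))" for v
  proof (rule Ck_on_linear_family[OF assms(1)])
  show "linear (fd g (f x))" if "x : V" for x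
  using that Ck_on_SucD[OF Suc.prems(2)] assms(3) has_derivative_linear by blast
  show "Ck_on k V (%x. fd g (f x) b)" for b using Suc.IH[OF f, of "%x. fd g x b"] Suc.prems(2) by simp
  show "Ck_on k V (%x. fd f x v)" using Suc.prems(1) by simp
  qed
 qed
qed

lemma Ck_on_inverse:
 "open V ==> 0 ~: V ==> Ck_on k V (inverse :: 'a::{real_normed_div_algebra, euclidean_space} => 'a)"
proof (induction k)
 case 0 then show ?case by (auto intro!: continuous_on_inverse continuous_on_id)
next
 case (Suc k)
 show ?case
 proof (rule Ck_on_SucI)
  show "(inverse has_derivative (%v. - (inverse x * v * inverse x))) (at x)" if "x : V" for x :: 'a
  using that Suc.prems has_derivative_inverse'[of x] by auto
  show "Ck_on k V (%x. - (inverse x * v * inverse x))" for v :: 'a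
  using Suc by (intro Ck_on_bounded_linear[OF bounded_linear_minus[OF bounded_linear_ident]]
  Ck_on_bilinear[OF bounded_bilinear_mult] Ck_on_const) auto
 qed (use Suc in auto)
qed

lemma Ck_on_ln: "open V ==> V \<subseteq> {0<..} ==> Ck_on k V (ln :: real => real)"
proof (cases k)
 case 0 assume "V \<subseteq> {0<..}" then show ?thesis unfolding 0 by (auto intro!: continuous_on_ln)
next
 case (Suc j)
 assume V: "open V" "V \<subseteq> {0<..}"
 show ?thesis unfolding Suc
 proof (rule Ck_on_SucI[OF V(1)])
  show "(ln has_derivative (%v. inverse x * v)) (at x)" if "x : V" for x :: real
  using DERIV_ln[of x] that V unfolding has_field_derivative_def by auto
  show "Ck_on j V (%x. inverse x * v)" for v :: real
  using V by (intro Ck_on_bilinear[OF bounded_bilinear_mult] Ck_on_const Ck_on_inverse) auto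
 qed
qed

lemma linear_inj_bounded_below:
 fixes A :: "'a::euclidean_space => 'b::euclidean_space"
 assumes "linear A" "inj A"
 obtains c where "c > 0" "!!v. norm v <= c * norm (A v)"
proof -
 from linear_injective_left_inverse[OF assms] obtain g where g: "linear g" "g \<circ> A = id" by blast
 then obtain K where K: "K > 0" "!!v. norm (g v) <= norm v * K"
  using bounded_linear.pos_bounded lin_bl by metis
 have "norm v <= K * norm (A v)" for v using K(2)[of "A v"] g(2) by (simp add: fun_eq_iff mult.commute)
 then show thesis using that K(1) by blast
qed

lemma has_derivative_cont_mult_vanish:
 fixes f :: "'a::real_normed_vector => real" and g :: "'a => 'b::real_normed_vector"
 assumes "isCont f x" "(g has_derivative g') (at x)" "g x = 0"
 shows "((%y. f y *r g y) has_derivative (%v. f x *r g' v)) (at x)"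
proof -
 interpret g': bounded_linear g' using assms(2) by (rule has_derivative_bounded_linear)
 have 1: "((%y. f x *r g y) has_derivative (%v. f x *r g' v)) (at x)"
  using has_derivative_scaleR_right[OF assms(2)] .
 have 2: "((%y. (f y - f x) *r g y) has_derivative (%v. 0)) (at x)"
 proof (rule has_derivativeI)
  from g'.bounded obtain K where K: "!!v. norm (g' v) <= norm v * K" by blast
  from assms(2) have lim: "(%y. (g y - g x - g' (y - x)) /\<^sub>R norm (y - x)) \<midarrow>x\<rightarrow> 0"
  unfolding has_derivative_at_within by simp
  have b: "Bfun (%y. g y /\<^sub>R norm (y - x)) (at x)"
  proof (rule BfunI)
  have "\<forall>\<^sub>F y in at x. norm ((g y - g x - g' (y - x)) /\<^sub>R norm (y - x)) < 1"
  using tendstoD[OF lim, of 1] by simp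
  then show "\<forall>\<^sub>F y in at x. norm (g y /\<^sub>R norm (y - x)) <= 1 + \<bar>K\<bar>"
  proof eventually_elim
  case (elim y)
  have "norm (g' (y - x) /\<^sub>R norm (y - x)) <= \<bar>K\<bar>"
  proof (cases "y = x")
  case False
  then have "norm (g' (y - x)) <= norm (y - x) * \<bar>K\<bar>" using K[of "y-x"]
  by (smt (verit) mult_left_mono norm_ge_zero)
  then show ?thesis using False by (simp add: divide_simps mult.commute)
  qed simp
  moreover have "g y /\<^sub>R norm (y - x) = (g y - g x - g' (y - x)) /\<^sub>R norm (y - x) + g' (y - x) /\<^sub>R norm (y - x)"
  using assms(3) by (simp add: scaleR_diff_right)
  ultimately show ?case using elim norm_triangle_ineq by (smt (verit))
  qed
  qed
  have z: "Zfun (%y. f y - f x) (at x)"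
  using assms(1) by (simp add: isCont_def tendsto_Zfun_iff)
  have "Zfun (%y. (f y - f x) *r (g y /\<^sub>R norm (y - x))) (at x)"
  using bounded_bilinear.Zfun_prod_Bfun[OF bounded_bilinear_scaleR z b] .
  then show "((%y. ((f y - f x) *r g y - (f x - f x) *r g x - 0) /\<^sub>R norm (y - x)) \<longlongrightarrow> 0) (at x)"
  by (simp add: tendsto_Zfun_iff mult.commute)
 qed simp
 from has_derivative_add[OF 1 2] show ?thesis by (simp add: scaleR_diff_left)
qed

lemma solve_continuous_at:
 fixes A :: "'a::euclidean_space => 'b::euclidean_space => 'c::euclidean_space"
 assumes V: "open V" and lin: "!!x. x : V ==> linear (A x)" and inj: "!!x. x : V ==> inj (A x)"
  and A: "!!b. b : Basis ==> continuous_on V (%x. A x b)"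
  and c: "continuous_on V c" and eq: "!!x. x : V ==> A x (y x) = c x" and x0: "x0 : V"
 shows "isCont y x0"
proof -
 obtain K where K: "K > 0" "!!v. norm v <= K * norm (A x0 v)"
  using linear_inj_bounded_below[OF lin[OF x0] inj[OF x0]] by blast
 define e where "e x = (SUM b:Basis. norm (A x b - A x0 b))" for x
 have le: "norm (A x v - A x0 v) <= e x * norm v" if "x : V" for x v
 proof -
  have "A x v - A x0 v = (SUM b:Basis. (v \<bullet> b) *r (A x b - A x0 b))"
  by (simp add: linear_expand[OF lin[OF that], of v] linear_expand[OF lin[OF x0], of v] sum_subtractf scaleR_diff_right)
  also have "norm ... <= (SUM b:Basis. norm v * norm (A x b - A x0 b))"
  by (intro sum_norm_le) (simp add: mult_right_mono Basis_le_norm)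
  finally show ?thesis by (simp add: e_def sum_distrib_left mult.commute)
 qed
 have e0: "(e \<longlongrightarrow> 0) (at x0)"
 proof -
  have "((%x. SUM b:Basis. norm (A x b - A x0 b)) \<longlongrightarrow> (SUM b:(Basis::'b set). norm (A x0 b - A x0 b))) (at x0)"
  using A V x0 by (intro tendsto_sum tendsto_norm tendsto_diff tendsto_const)
  (metis continuous_on_eq_continuous_at isCont_def)
  then show ?thesis by (simp add: e_def[abs_def])
 qed
 have c0: "(c \<longlongrightarrow> c x0) (at x0)" using c V x0 by (metis continuous_on_eq_continuous_at isCont_def)
 define M where "M x = 2 * K * (norm (c x - c x0) + e x * norm (y x0))" for x
 have M0: "(M \<longlongrightarrow> 0) (at x0)"
 proof -
  have "(M \<longlongrightarrow> 2 * K * (norm (c x0 - c x0) + 0 * norm (y x0))) (at x0)"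
  unfolding M_def[abs_def] by (intro tendsto_intros c0 e0)
  then show ?thesis by simp
 qed
 have ev: "\<forall>\<^sub>F x in at x0. norm (y x - y x0) <= M x"
 proof -
  have "\<forall>\<^sub>F x in at x0. dist (e x) 0 < 1 / (2 * K)" using tendstoD[OF e0] K(1) by simp
  moreover have "\<forall>\<^sub>F x in at x0. x : V" using V x0 by (simp add: eventually_at_in_open')
  ultimately show ?thesis
  proof eventually_elim
  case (elim x)
  interpret A0: linear "A x0" using lin x0 by blast
  let ?d = "y x - y x0"
  have d: "A x ?d = (c x - c x0) - (A x (y x0) - A x0 (y x0))"
  using linear_diff[OF lin[OF elim(2)], of "y x" "y x0"] eq[OF elim(2)] eq[OF x0] by (simp add: algebra_simps)
  have "norm ?d <= K * norm (A x0 ?d)" by (rule K)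
  also have "A x0 ?d = (c x - c x0) - (A x (y x0) - A x0 (y x0)) - (A x ?d - A x0 ?d)" using d by simp
  also have "norm ... <= norm (c x - c x0) + e x * norm (y x0) + e x * norm ?d"
  using le[OF elim(2), of "y x0"] le[OF elim(2), of ?d]
  by (meson add_mono norm_triangle_le_diff order_trans order_refl)
  finally have 1: "norm ?d <= K * (norm (c x - c x0) + e x * norm (y x0)) + (K * e x) * norm ?d"
  using K(1) by (simp add: algebra_simps)
  have "e x >= 0" by (simp add: e_def sum_nonneg)
  then have "K * e x <= 1/2" using elim(1) K(1) by (simp add: field_simps)
  then have "(K * e x) * norm ?d <= 1/2 * norm ?d" by (rule mult_right_mono) simp
  then show ?case using 1 by (simp add: M_def algebra_simps)
  qed
 qed
 have "((%x. y x - y x0) \<longlongrightarrow> 0) (at x0)"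
  using Lim_null_comparison[OF ev M0] .
 then show ?thesis by (simp add: isCont_def LIM_zero_iff)
qed

lemma solve_has_derivative:
 fixes A :: "'a::euclidean_space => 'b::euclidean_space => 'c::euclidean_space"
 assumes V: "open V" and lin: "!!x. x : V ==> linear (A x)" and inj: "!!x. x : V ==> inj (A x)"
  and A: "!!b. b : Basis ==> ((%x. A x b) has_derivative A' b) (at x0)"
  and c: "(c has_derivative c') (at x0)" and y: "isCont y x0"
  and eq: "!!x. x : V ==> A x (y x) = c x" and x0: "x0 : V"
 obtains y' where "(y has_derivative y') (at x0)"
  "!!v. A x0 (y' v) = c' v - (SUM b:Basis. (y x0 \<bullet> b) *r A' b v)"
proof -
 from linear_injective_left_inverse[OF lin[OF x0] inj[OF x0]] obtain g where g: "linear g" "g \<circ> A x0 = id" by blast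
 have gA: "g (A x0 v) = v" for v using g(2) by (simp add: fun_eq_iff)
 have bg: "bounded_linear g" using g lin_bl by blast
 define R where "R x = (SUM b:Basis. (y x \<bullet> b) *r (A x b - A x0 b))" for x
 have R: "R x = A x (y x) - A x0 (y x)" if "x : V" for x
  by (simp add: R_def linear_expand[OF lin[OF that], of "y x"] linear_expand[OF lin[OF x0], of "y x"] sum_subtractf scaleR_diff_right)
 have "(R has_derivative (%v. SUM b:Basis. (y x0 \<bullet> b) *r A' b v)) (at x0)"
  unfolding R_def[abs_def]
 proof (intro has_derivative_sum has_derivative_cont_mult_vanish)
  fix b :: 'b assume b: "b : Basis"
  show "isCont (%x. y x \<bullet> b) x0" using y by (intro continuous_intros)
  show "((%x. A x b - A x0 b) has_derivative A' b) (at x0)"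
  using has_derivative_diff[OF A[OF b] has_derivative_const[of "A x0 b"]] by simp
 qed simp
 note RD = this
 define y' where "y' v = g (c' v - (SUM b:Basis. (y x0 \<bullet> b) *r A' b v))" for v
 have D: "((%x. c x - R x) has_derivative (%v. c' v - (SUM b:Basis. (y x0 \<bullet> b) *r A' b v))) (at x0)"
  by (intro has_derivative_diff c RD)
 have 1: "((%x. g (c x - R x)) has_derivative y') (at x0)"
  unfolding y'_def[abs_def] by (rule bounded_linear.has_derivative[OF bg D])
 have yg: "y x = g (c x - R x)" if "x : V" for x
  using R[OF that] eq[OF that] gA[of "y x"] by simp
 have yd: "(y has_derivative y') (at x0)"
  by (rule deriv_transform[OF 1 V x0]) (simp add: yg)
 have 2: "((%x. c x - R x) has_derivative (%v. A x0 (y' v))) (at x0)"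
 proof (rule deriv_transform[OF _ V x0])
  show "((%x. A x0 (y x)) has_derivative (%v. A x0 (y' v))) (at x0)"
  using bounded_linear.has_derivative[OF _ yd] lin[OF x0] lin_bl by blast
  show "A x0 (y x) = c x - R x" if "x : V" for x using R[OF that] eq[OF that] by simp
 qed
 show thesis
 proof (rule that[OF yd])
  show "A x0 (y' v) = c' v - (SUM b:Basis. (y x0 \<bullet> b) *r A' b v)" for v
  using has_derivative_unique[OF 2 D] by (simp add: fun_eq_iff)
 qed
qed

text \<open>Induction on \<open>k\<close>: by \<open>solve_has_derivative\<close> the derivative of a solution \<open>y\<close> of \<open>A y = c\<close> solves a system with the
same matrix, whose right-hand side involves \<open>y\<close> and the derivatives of \<open>A\<close> and \<open>c\<close>.\<close>

lemma Ck_on_solve: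
 fixes A :: "'a::euclidean_space => 'b::euclidean_space => 'c::euclidean_space"
 assumes V: "open V" and lin: "!!x. x : V ==> linear (A x)" and inj: "!!x. x : V ==> inj (A x)"
 shows "(!!b. b : Basis ==> Ck_on k V (%x. A x b)) ==> Ck_on k V c ==>
  (!!x. x : V ==> A x (y x) = c x) ==> Ck_on k V y"
proof (induction k arbitrary: c y)
 case 0
 then show ?case
  using solve_continuous_at[where A=A and c=c and y=y, OF V lin inj] V by (auto simp: continuous_on_eq_continuous_at)
next
 case (Suc k)
 have A: "((%x. A x b) has_derivative fd (%x. A x b) x) (at x)" if "b : Basis" "x : V" for x b
  using Ck_on_SucD[OF Suc.prems(1)] that by blast
 have A': "Ck_on k V (%x. A x b)" "Ck_on k V (%x. fd (%x. A x b) x v)" if "b : Basis" for b v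
  using Suc.prems(1)[OF that] Ck_on_mono_Suc[OF _ V, of k "%x. A x b"] by auto
 have c: "(c has_derivative fd c x) (at x)" if "x : V" for x
  using Ck_on_SucD[OF Suc.prems(2)] that by blast
 have c': "Ck_on k V c" "Ck_on k V (%x. fd c x v)" for v
  using Suc.prems(2) Ck_on_mono_Suc[OF _ V, of k c] by auto
 have yk: "Ck_on k V y" using Suc.IH[OF A'(1) c'(1) Suc.prems(3)] by blast
 have yc: "isCont y x" if "x : V" for x
  using Ck_on_continuous[OF yk V] V that by (simp add: continuous_on_eq_continuous_at)
 have y': "(y has_derivative fd y x) (at x)"
  "A x (fd y x v) = fd c x v - (SUM b:Basis. (y x \<bullet> b) *r fd (%x. A x b) x v)" if x: "x : V" for x v
 proof -
  obtain y' where y': "(y has_derivative y') (at x)"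
  "!!v. A x (y' v) = fd c x v - (SUM b:Basis. (y x \<bullet> b) *r fd (%x. A x b) x v)"
  using solve_has_derivative[OF V lin inj A[OF _ x] c[OF x] yc[OF x] Suc.prems(3) x] by blast
  show "(y has_derivative fd y x) (at x)"
  "A x (fd y x v) = fd c x v - (SUM b:Basis. (y x \<bullet> b) *r fd (%x. A x b) x v)"
  using y' fd_eq[OF y'(1)] by auto
 qed
 show ?case
 proof (rule Ck_on_SucI[OF V y'(1)])
  fix v
  have "Ck_on k V (%x. fd c x v + (SUM b:Basis. - (y x \<bullet> b) *r fd (%x. A x b) x v))"
  using A'(2) c'(2) yk
  by (intro Ck_on_add[OF V] Ck_on_sum[OF V] Ck_on_bilinear[OF bounded_bilinear_scaleR V]
  Ck_on_bounded_linear[OF bounded_linear_minus[OF bounded_linear_inner_left] V])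
  then have "Ck_on k V (%x. fd c x v - (SUM b:Basis. (y x \<bullet> b) *r fd (%x. A x b) x v))"
  by (simp add: sum_negf)
  then show "Ck_on k V (%x. fd y x v)"
  using Suc.IH[of "%x. fd c x v - (SUM b:Basis. (y x \<bullet> b) *r fd (%x. A x b) x v)" "%x. fd y x v"] A'(1) y'(2) by blast
 qed
qed

definition smooth_at :: "'a::euclidean_space => ('a => 'b::real_normed_vector) => bool" where
 "smooth_at x f \<longleftrightarrow> (EX V. open V & x : V & smooth_on V f)"

lemma smooth_atI: "smooth_on V f ==> open V ==> x : V ==> smooth_at x f"
 unfolding smooth_at_def by blast

lemma smooth_on_open_iff: "open V ==> smooth_on V f \<longleftrightarrow> (ALL x:V. smooth_at x f)"
proof
 assume V: "open V" and s: "ALL x:V. smooth_at x f"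
 show "smooth_on V f" unfolding smooth_on_def
 proof (intro allI Ck_on_local)
  fix k x assume "x : V"
  then obtain U where "open U" "x : U" "smooth_on U f" using s unfolding smooth_at_def by blast
  then show "EX U. open U & x : U & U \<subseteq> V & Ck_on k U f"
  using V \<open>x : V\<close> by (intro exI[of _ "U \<inter> V"]) (auto simp: smooth_on_def intro: Ck_on_subset)
 qed
qed (auto intro: smooth_atI)

lemma smooth_around: "smooth_at x f ==> around x (%y. smooth_at y f)"
 unfolding smooth_at_def eventually_nhds by blast

text \<open>Two germs are smooth on a common neighbourhood, on which the calculus of \<open>Ck_on\<close> applies.\<close>

lemma smooth_at2:
 assumes "smooth_at x f" "smooth_at x g"
 obtains V where "open V" "x : V" "!!k. Ck_on k V f" "!!k. Ck_on k V g"
proof -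
 obtain U W where "open U" "x : U" "smooth_on U f" "open W" "x : W" "smooth_on W g"
  using assms unfolding smooth_at_def by blast
 then show thesis by (intro that[of "U \<inter> W"]) (auto simp: smooth_on_def intro: Ck_on_subset)
qed

lemma smooth_atI_Ck: "open V ==> x : V ==> (!!k. Ck_on k V f) ==> smooth_at x f"
 unfolding smooth_at_def smooth_on_def by blast

lemma smooth_at1:
 assumes "smooth_at x f"
 obtains V where "open V" "x : V" "!!k. Ck_on k V f"
 using smooth_at2[OF assms assms] by metis

lemma smooth_deriv: "smooth_at x f ==> (f has_derivative fd f x) (at x)"
 using smooth_at1 Ck_on_SucD by metis

lemma smooth_lin: "smooth_at x f ==> linear (fd f x)"
 using smooth_deriv has_derivative_linear by blast

lemma smooth_isCont: "smooth_at x f ==> isCont f x"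
 using smooth_deriv has_derivative_continuous by blast

lemma smooth_cong:
 assumes "open V" "x : V" "!!y. y : V ==> f y = g y" shows "smooth_at x f \<longleftrightarrow> smooth_at x g"
proof -
 have "smooth_at x g" if sf: "smooth_at x f" and fg: "!!y. y : V ==> f y = g y" for f g :: "'a => 'b"
 proof -
  obtain U where U: "open U" "x : U" "!!k. Ck_on k U f" using smooth_at1[OF sf] by blast
  have "Ck_on k (U \<inter> V) g" for k
  using Ck_on_cong[of "U \<inter> V" f g k] Ck_on_subset[OF U(3), of "U \<inter> V" k] U(1) assms(1) fg by auto
  then show ?thesis using U assms by (intro smooth_atI_Ck[of "U \<inter> V"]) auto
 qed
 then show ?thesis using assms(3) by metis
qed

lemma smooth_const [simp, intro]: "smooth_at x (%x. c)"
 by (rule smooth_atI_Ck[of UNIV]) (auto intro: Ck_on_const)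

lemma smooth_ident [simp, intro]: "smooth_at x (%x. x)"
 by (rule smooth_atI_Ck[of UNIV]) (auto intro: Ck_on_id)

lemma smooth_bl: "bounded_linear h ==> smooth_at x f ==> smooth_at x (%x. h (f x))"
 by (erule smooth_at1, rule smooth_atI_Ck) (auto intro: Ck_on_bounded_linear)

lemma smooth_bilinear:
 "bounded_bilinear h ==> smooth_at x f ==> smooth_at x g ==> smooth_at x (%x. h (f x) (g x))"
 by (erule (1) smooth_at2, rule smooth_atI_Ck) (auto intro: Ck_on_bilinear)

lemma smooth_add: "smooth_at x f ==> smooth_at x g ==> smooth_at x (%x. f x + g x)"
 by (erule (1) smooth_at2, rule smooth_atI_Ck) (auto intro: Ck_on_add)

lemma smooth_minus: "smooth_at x f ==> smooth_at x (%x. - f x)"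
 by (rule smooth_bl[OF bounded_linear_minus[OF bounded_linear_ident]])

lemma smooth_diff: "smooth_at x f ==> smooth_at x g ==> smooth_at x (%x. f x - g x)"
 using smooth_add[OF _ smooth_minus, of x f g] by simp

lemma smooth_sum: "(!!i. i : S ==> smooth_at x (f i)) ==> smooth_at x (%x. SUM i:S. f i x)"
 by (induction S rule: infinite_finite_induct) (auto intro: smooth_add)

lemma smooth_mult: "smooth_at x f ==> smooth_at x g ==> smooth_at x (%x. f x * g x)"
 for f :: "'a::euclidean_space => 'b::real_normed_algebra"
 by (rule smooth_bilinear[OF bounded_bilinear_mult])

lemma smooth_scaleR: "smooth_at x f ==> smooth_at x g ==> smooth_at x (%x. f x *r g x)"
 by (rule smooth_bilinear[OF bounded_bilinear_scaleR])

lemma smooth_inner: "smooth_at x f ==> smooth_at x g ==> smooth_at x (%x. f x \<bullet> g x)"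
 by (rule smooth_bilinear[OF bounded_bilinear_inner])

lemma smooth_power: "smooth_at x f ==> smooth_at x (%x. f x ^ n)"
 for f :: "'a::euclidean_space => 'b::real_normed_algebra_1"
 by (induction n) (auto intro: smooth_mult)

lemma smooth_fst: "smooth_at x f ==> smooth_at x (%x. fst (f x))"
 by (rule smooth_bl[OF bounded_linear_fst])

lemma smooth_snd: "smooth_at x f ==> smooth_at x (%x. snd (f x))"
 by (rule smooth_bl[OF bounded_linear_snd])

lemma smooth_Pair: "smooth_at x f ==> smooth_at x g ==> smooth_at x (%x. (f x, g x))"
 using smooth_add[OF smooth_bl[OF bounded_linear_Pair[OF bounded_linear_ident bounded_linear_zero]]
  smooth_bl[OF bounded_linear_Pair[OF bounded_linear_zero bounded_linear_ident]], of x f g] by simp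

lemma smooth_compose:
 fixes f :: "'a::euclidean_space => 'b::euclidean_space"
 assumes "smooth_at x f" "smooth_at (f x) g" shows "smooth_at x (%x. g (f x))"
proof -
 obtain V where V: "open V" "x : V" "!!k. Ck_on k V f" using smooth_at1[OF assms(1)] by blast
 obtain U where U: "open U" "f x : U" "!!k. Ck_on k U g" using smooth_at1[OF assms(2)] by blast
 have "open (V \<inter> f -` U)"
  using continuous_open_preimage[OF Ck_on_continuous[OF V(3) V(1)] V(1) U(1)] .
 moreover have "Ck_on k (V \<inter> f -` U) (%x. g (f x))" for k
  by (rule Ck_on_compose[OF calculation U(1) _ Ck_on_subset[OF V(3)] U(3)]) auto
 ultimately show ?thesis using V(2) U(2) by (intro smooth_atI_Ck[of "V \<inter> f -` U"]) auto
qed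

lemma smooth_inverse: "smooth_at x f ==> f x ~= 0 ==> smooth_at x (%x. inverse (f x))"
 for f :: "'a::euclidean_space => 'b::{real_normed_div_algebra, euclidean_space}"
 by (rule smooth_compose[of x f inverse]) (auto intro!: smooth_atI_Ck[of "- {0}"] Ck_on_inverse)

lemma smooth_divide: "smooth_at x f ==> smooth_at x g ==> g x ~= 0 ==> smooth_at x (%x. f x / g x)"
 for f :: "'a::euclidean_space => 'b::{real_normed_field, euclidean_space}"
 using smooth_mult[OF _ smooth_inverse] by (simp add: divide_inverse)

lemma smooth_ln: "smooth_at x f ==> f x > 0 ==> smooth_at x (%x. ln (f x :: real))"
 by (rule smooth_compose[of x f ln]) (auto intro!: smooth_atI_Ck[of "{0<..}"] Ck_on_ln)

lemma smooth_Re: "smooth_at x f ==> smooth_at x (%x. Re (f x))"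
 by (rule smooth_bl[OF bounded_linear_Re])

lemma smooth_Im: "smooth_at x f ==> smooth_at x (%x. Im (f x))"
 by (rule smooth_bl[OF bounded_linear_Im])

lemma smooth_cnj: "smooth_at x f ==> smooth_at x (%x. cnj (f x))"
 by (rule smooth_bl[OF bounded_linear_cnj])

lemma smooth_of_real: "smooth_at x f ==> smooth_at x (%x. complex_of_real (f x))"
 by (rule smooth_bl[OF bounded_linear_of_real])

lemma bounded_linear_vec_nth': "bounded_linear (%x. x $ i)"
 by (rule bounded_linear_vec_nth)

lemma smooth_vec_nth: "smooth_at x f ==> smooth_at x (%x. f x $ i)"
 for f :: "'a::euclidean_space => 'b::euclidean_space ^ 'n"
 by (rule smooth_bl[OF bounded_linear_vec_nth])

lemma smooth_eucl:
 fixes f :: "'a::euclidean_space => 'b::euclidean_space"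
 assumes "!!b. b : Basis ==> smooth_at x (%x. f x \<bullet> b)" shows "smooth_at x f"
proof -
 have "smooth_at x (%x. SUM b:Basis. (f x \<bullet> b) *r b)"
  by (intro smooth_sum smooth_scaleR assms smooth_const)
 then show ?thesis by (simp add: euclidean_representation)
qed

lemma smooth_vec_lambda:
 fixes f :: "'n::finite => 'a::euclidean_space => 'b::euclidean_space"
 assumes "!!i. smooth_at x (f i)" shows "smooth_at x (%x. \<chi> i. f i x)"
proof (rule smooth_eucl)
 fix b :: "'b ^ 'n" assume "b : Basis"
 then show "smooth_at x (%x. (\<chi> i. f i x) \<bullet> b)"
  by (simp add: inner_vec_def) (intro smooth_sum smooth_inner assms smooth_const)
qed

lemma smooth_vscale: "smooth_at x f ==> smooth_at x g ==> smooth_at x (%x. f x *s (g x :: complex ^ 'n))"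
proof -
 assume "smooth_at x f" "smooth_at x g"
 then have "smooth_at x (%x. \<chi> i. f x * g x $ i)"
  by (intro smooth_vec_lambda smooth_mult smooth_vec_nth)
 then show ?thesis by (simp add: vector_scalar_mult_def)
qed

lemma smooth_fd: "smooth_at x f ==> smooth_at x (%y. fd f y v)"
proof -
 assume "smooth_at x f"
 then obtain V where V: "open V" "x : V" "!!k. Ck_on k V f" by (rule smooth_at1) blast
 have "Ck_on k V (%y. fd f y v)" for k using V(3)[of "Suc k"] by simp
 then show ?thesis using V by (intro smooth_atI_Ck[of V]) auto
qed

lemma around_openE:
 assumes "around x (%y. P y)" obtains V where "open V" "x : V" "!!y. y : V ==> P y"
 using assms unfolding eventually_nhds by blast

lemma smooth_linear_family:
 fixes w :: "'a::euclidean_space => 'b::euclidean_space"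
 assumes "around x (%y. linear (A y))" "!!b. smooth_at x (%y. A y b)" "smooth_at x w"
 shows "smooth_at x (%y. A y (w y))"
proof -
 obtain V where V: "open V" "x : V" "!!y. y : V ==> linear (A y)"
  using around_openE[OF assms(1)] by blast
 have "smooth_at x (%y. SUM b:Basis. (w y \<bullet> b) *r A y b)"
  by (intro smooth_sum smooth_scaleR smooth_inner assms smooth_const)
 then show ?thesis
  using smooth_cong[OF V(1,2), of "%y. A y (w y)" "%y. SUM b:Basis. (w y \<bullet> b) *r A y b"]
  linear_expand[OF V(3)] by blast
qed

lemma smooth_fd_app:
 fixes f :: "'b::euclidean_space => 'c::real_normed_vector" and w :: "'b => 'b"
 assumes "smooth_at x f" "smooth_at x w" shows "smooth_at x (%y. fd f y (w y))"
proof (rule smooth_linear_family[OF _ smooth_fd[OF assms(1)] assms(2)])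
 show "around x (%y. linear (fd f y))"
  using smooth_around[OF assms(1)] by (rule eventually_mono) (rule smooth_lin)
qed

lemma smooth_fd_compose:
 fixes f :: "'b::euclidean_space => 'c::real_normed_vector" and g :: "'a::euclidean_space => 'b"
 assumes "smooth_at (g x) f" "smooth_at x g" "smooth_at x w"
 shows "smooth_at x (%y. fd f (g y) (w y))"
proof (rule smooth_linear_family)
 have "isCont g x" by (rule smooth_isCont[OF assms(2)])
 then have "filterlim g (nhds (g x)) (nhds x)" by (simp add: tendsto_at_iff_tendsto_nhds isCont_def)
 from eventually_compose_filterlim[OF smooth_around[OF assms(1)] this]
 show "around x (%y. linear (fd f (g y)))" by (auto elim: eventually_mono intro: smooth_lin)
 show "smooth_at x (%y. fd f (g y) b)" for b
  using smooth_compose[OF assms(2) smooth_fd[OF assms(1)]] .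
qed (fact assms)

lemma fd_linear_family:
 fixes w :: "'a::euclidean_space => 'b::euclidean_space"
 assumes "around x (%y. linear (A y))" "!!b. smooth_at x (%y. A y b)" "smooth_at x w"
 shows "fd (%y. A y (w y)) x v = fd (%y. A y (w x)) x v + A x (fd w x v)"
proof -
 obtain V where V: "open V" "x : V" "!!y. y : V ==> linear (A y)"
  using around_openE[OF assms(1)] by blast
 have E: "fd (%y. A y (u y)) x = fd (%y. SUM b:Basis. (u y \<bullet> b) *r A y b) x" for u
  by (rule fd_cong[OF V(1,2)]) (rule linear_expand[OF V(3)])
 have D: "((%y. SUM b:Basis. (u y \<bullet> b) *r A y b) has_derivative
  (%v. SUM b:Basis. (u x \<bullet> b) *r fd (%y. A y b) x v + (fd u x v \<bullet> b) *r A x b)) (at x)" if "smooth_at x u" for u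
  by (intro has_derivative_sum has_derivative_scaleR smooth_deriv assms has_derivative_inner_left that)
 show ?thesis unfolding E using fd_eq[OF D[OF assms(3)]] fd_eq[OF D[OF smooth_const[of x "w x"]]]
  by (simp add: sum.distrib linear_expand[OF V(3)[OF V(2)], of "fd w x v"])
qed

lemma fd_compose:
 "smooth_at x f ==> smooth_at (f x) g ==> fd (%x. g (f x)) x v = fd g (f x) (fd f x v)"
 using fd_eq[OF diff_chain_at[OF smooth_deriv smooth_deriv], of x f g]
 by (simp add: o_def)

lemma around_compose:
 assumes "smooth_at x (g :: _ => _::real_normed_vector)" "around (g x) (%y. P y)"
 shows "around x (%y. P (g y))"
proof -
 have "filterlim g (nhds (g x)) (nhds x)" using smooth_isCont[OF assms(1)]
  by (simp add: tendsto_at_iff_tendsto_nhds isCont_def)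
 from eventually_compose_filterlim[OF assms(2) this] show ?thesis .
qed

text \<open>The second difference quotient in the directions \<open>v\<close> and \<open>w\<close> is an intermediate value of each mixed derivative,
whence their symmetry.\<close>

lemma second_difference_mvt:
 fixes f :: "'a::euclidean_space => real"
 assumes f: "!!y. y : ball x r ==> smooth_at y f" and h: "0 < h" "h * (norm v + norm w) < r"
 obtains y where "norm (y - x) <= h * (norm v + norm w)"
  "f (x + h *r v + h *r w) - f (x + h *r v) - f (x + h *r w) + f x = h * h * fd (%z. fd f z v) y w"
proof -
 have inb: "x + s *r v + t *r w : ball x r" "norm (s *r v + t *r w) <= h * (norm v + norm w)"
  if "0 <= s" "s <= h" "0 <= t" "t <= h" for s t
 proof -
  have "norm (s *r v + t *r w) <= s * norm v + t * norm w"
  using norm_triangle_ineq[of "s *r v" "t *r w"] that by simp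
  also have "... <= h * (norm v + norm w)" using that by (simp add: distrib_left add_mono mult_right_mono)
  finally show "norm (s *r v + t *r w) <= h * (norm v + norm w)" .
  then show "x + s *r v + t *r w : ball x r"
  using h norm_minus_cancel[of "s *r v + t *r w"] by (simp add: dist_norm add.assoc del: norm_minus_cancel)
 qed
 have line: "((%s. g (a + s *r u)) has_real_derivative fd g (a + s *r u) u) (at s)"
  if "smooth_at (a + s *r u) g" for g :: "'a => real" and a u s
 proof -
  have 1: "((%s. a + s *r u) has_derivative (%d. d *r u)) (at s)" by (auto intro!: derivative_eq_intros)
  have "((%s. g (a + s *r u)) has_derivative (%d. fd g (a + s *r u) (d *r u))) (at s)"
  using diff_chain_at[OF 1 smooth_deriv[OF that]] by (simp add: o_def)
  moreover have "(%d. fd g (a + s *r u) (d *r u)) = (*) (fd g (a + s *r u) u)"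
  using linear_scale[OF smooth_lin[OF that]] by (simp add: fun_eq_iff mult.commute)
  ultimately show ?thesis unfolding has_field_derivative_def by simp
 qed
 let ?F = "%s. f (x + h *r w + s *r v) - f (x + s *r v)"
 have "EX s. 0 < s & s < h & ?F h - ?F 0 = (h - 0) * (fd f (x + h *r w + s *r v) v - fd f (x + s *r v) v)"
 proof (rule MVT2[OF h(1)])
  fix s assume s: "0 <= s" "s <= h"
  show "(?F has_real_derivative (fd f (x + h *r w + s *r v) v - fd f (x + s *r v) v)) (at s)"
  using inb(1)[OF s, of h] inb(1)[OF s, of 0] h(1) s
  by (intro DERIV_diff line f) (auto simp: algebra_simps)
 qed
 then obtain s where s: "0 < s" "s < h" "?F h - ?F 0 = h * (fd f (x + h *r w + s *r v) v - fd f (x + s *r v) v)" by auto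
 let ?G = "%t. fd f (x + s *r v + t *r w) v"
 have "EX t. 0 < t & t < h & ?G h - ?G 0 = (h - 0) * fd (%z. fd f z v) (x + s *r v + t *r w) w"
 proof (rule MVT2[OF h(1)])
  fix t assume t: "0 <= t" "t <= h"
  show "(?G has_real_derivative fd (%z. fd f z v) (x + s *r v + t *r w) w) (at t)"
  using inb(1)[of s t] t s by (intro line smooth_fd f) auto
 qed
 then obtain t where t: "0 < t" "t < h" "?G h - ?G 0 = h * fd (%z. fd f z v) (x + s *r v + t *r w) w" by auto
 show thesis
 proof (rule that[of "x + s *r v + t *r w"])
  show "norm (x + s *r v + t *r w - x) <= h * (norm v + norm w)"
  using inb(2)[of s t] s t by (simp add: add.assoc)
  have "x + h *r w + s *r v = x + s *r v + h *r w" "x + h *r w + h *r v = x + h *r v + h *r w" by simp_all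
  then show "f (x + h *r v + h *r w) - f (x + h *r v) - f (x + h *r w) + f x
  = h * h * fd (%z. fd f z v) (x + s *r v + t *r w) w"
  using s(3) t(3) by (simp add: algebra_simps)
 qed
qed

lemma fd_symmetric_real:
 fixes f :: "'a::euclidean_space => real"
 assumes "smooth_at x f" shows "fd (%z. fd f z v) x w = fd (%z. fd f z w) x v"
proof (rule ccontr)
 assume ne: "fd (%z. fd f z v) x w ~= fd (%z. fd f z w) x v"
 define e where "e = \<bar>fd (%z. fd f z v) x w - fd (%z. fd f z w) x v\<bar> / 2"
 have e: "e > 0" using ne by (simp add: e_def)
 obtain V where V: "open V" "x : V" "!!y. y : V ==> smooth_at y f"
  using smooth_around[OF assms] unfolding eventually_nhds by blast
 have c: "isCont (%y. fd (%z. fd f z v) y w) x" for v w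
  using assms by (intro smooth_isCont smooth_fd)
 have cn: "((%y. fd (%z. fd f z v) y w) \<longlongrightarrow> fd (%z. fd f z v) x w) (nhds x)" for v w
  using tendsto_at_iff_tendsto_nhds[of "%y. fd (%z. fd f z v) y w" x] c[of v w] unfolding isCont_def by blast
 have "around x (%y. y : V & dist (fd (%z. fd f z v) y w) (fd (%z. fd f z v) x w) < e &
  dist (fd (%z. fd f z w) y v) (fd (%z. fd f z w) x v) < e)"
  by (intro eventually_conj tendstoD[OF cn e] around_open V)
 then obtain r where r: "r > 0" "!!y. dist y x < r ==> y : V & dist (fd (%z. fd f z v) y w) (fd (%z. fd f z v) x w) < e &
  dist (fd (%z. fd f z w) y v) (fd (%z. fd f z w) x v) < e"
  unfolding eventually_nhds_metric by blast
 define h where "h = r / (2 * (norm v + norm w + 1))"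
 have np: "norm v + norm w + 1 > 0" by (simp add: add_nonneg_pos)
 have h: "h > 0" using r np by (simp add: h_def)
 have "h * (norm v + norm w) <= h * (norm v + norm w + 1)" using h by simp
 also have "... = r / 2" using np by (simp add: h_def field_simps)
 finally have h2: "h * (norm v + norm w) < r" "h * (norm w + norm v) < r" using r(1) by (auto simp: add.commute)
 have sm: "smooth_at y f" if "y : ball x r" for y using r(2)[of y] V(3) that by (simp add: dist_commute)
 obtain y where y: "norm (y - x) <= h * (norm v + norm w)"
  "f (x + h *r v + h *r w) - f (x + h *r v) - f (x + h *r w) + f x = h * h * fd (%z. fd f z v) y w"
  using second_difference_mvt[OF sm h h2(1)] by blast
 obtain y' where y': "norm (y' - x) <= h * (norm w + norm v)"
  "f (x + h *r w + h *r v) - f (x + h *r w) - f (x + h *r v) + f x = h * h * fd (%z. fd f z w) y' v"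
  using second_difference_mvt[OF sm h h2(2)] by blast
 have "x + h *r w + h *r v = x + h *r v + h *r w" by simp
 from y'(2)[unfolded this] have "h * h * fd (%z. fd f z v) y w = h * h * fd (%z. fd f z w) y' v"
  using y(2) by linarith
 then have eq: "fd (%z. fd f z v) y w = fd (%z. fd f z w) y' v" using h by simp
 have "dist (fd (%z. fd f z v) y w) (fd (%z. fd f z v) x w) < e" "dist (fd (%z. fd f z w) y' v) (fd (%z. fd f z w) x v) < e"
  using r(2)[of y] r(2)[of y'] y(1) y'(1) h2 by (auto simp: dist_norm)
 moreover have "\<bar>fd (%z. fd f z v) x w - fd (%z. fd f z w) x v\<bar> <= \<bar>fd (%z. fd f z v) y w - fd (%z. fd f z v) x w\<bar>
  + \<bar>fd (%z. fd f z w) y' v - fd (%z. fd f z w) x v\<bar>" using eq by linarith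
 moreover have "\<bar>fd (%z. fd f z v) x w - fd (%z. fd f z w) x v\<bar> = e + e" by (simp add: e_def)
 ultimately show False unfolding dist_real_def by (metis add_strict_mono not_le)
qed

lemma fd_bl: "bounded_linear h ==> smooth_at x f ==> fd (%y. h (f y)) x v = h (fd f x v)"
 using fd_eq[OF bounded_linear.has_derivative[OF _ smooth_deriv]] by metis

lemma fd_symmetric:
 fixes f :: "'a::euclidean_space => 'b::euclidean_space"
 assumes "smooth_at x f" shows "fd (%z. fd f z v) x w = fd (%z. fd f z w) x v"
proof (rule euclidean_eqI)
 fix b :: 'b
 obtain V where V: "open V" "x : V" "!!y. y : V ==> smooth_at y f"
  using smooth_around[OF assms] unfolding eventually_nhds by blast
 have bl: "bounded_linear (%u. u \<bullet> b)" by (rule bounded_linear_inner_left)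
 have 1: "fd (%z. fd f z v) x w \<bullet> b = fd (%z. fd (%y. f y \<bullet> b) z v) x w" for v w
 proof -
  have "fd (%z. fd f z v) x w \<bullet> b = fd (%z. fd f z v \<bullet> b) x w"
  using fd_bl[OF bl smooth_fd[OF assms]] by simp
  also have "fd (%z. fd f z v \<bullet> b) x = fd (%z. fd (%y. f y \<bullet> b) z v) x"
  by (rule fd_cong[OF V(1,2)]) (simp add: fd_bl[OF bl V(3)])
  finally show ?thesis .
 qed
 show "fd (%z. fd f z v) x w \<bullet> b = fd (%z. fd f z w) x v \<bullet> b"
  unfolding 1 by (intro fd_symmetric_real smooth_inner assms smooth_const)
qed

definition smooth_form :: "'a::euclidean_space => ('a => 'a => real) => bool" where
 "smooth_form x G \<longleftrightarrow> (around x (%y. linear (G y))) & (ALL v. smooth_at x (%y. G y v))"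

definition pullback :: "('a::euclidean_space => 'b::euclidean_space) => ('b => 'b => real) => 'a => 'a => real" where
 "pullback phi G y v = G (phi y) (fd phi y v)"

lemma smooth_form_pullback:
 assumes "smooth_at x phi" "smooth_form (phi x) G" shows "smooth_form x (pullback phi G)"
proof -
 have 1: "around x (%y. linear (G (phi y)))"
  using assms(2) by (intro around_compose[OF assms(1)]) (simp add: smooth_form_def)
 have "smooth_at x (%y. pullback phi G y v)" for v
  unfolding pullback_def
  by (rule smooth_linear_family[OF 1 smooth_compose[OF assms(1)] smooth_fd[OF assms(1)]])
  (use assms(2) in \<open>simp add: smooth_form_def\<close>)
 moreover have "around x (%y. linear (pullback phi G y))"
  using 1 smooth_around[OF assms(1)]
 proof eventually_elim
  case (elim y)
  then show ?case using linear_compose[OF smooth_lin[OF elim(2)] elim(1)]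
  by (simp add: pullback_def[abs_def] o_def)
 qed
 ultimately show ?thesis by (simp add: smooth_form_def)
qed

lemma ext_d1_pullback:
 assumes s: "smooth_at x phi" and G: "smooth_form (phi x) G"
 shows "ext_d1 (pullback phi G) x v w = ext_d1 G (phi x) (fd phi x v) (fd phi x w)"
proof -
 have lin: "around x (%y. linear (G (phi y)))"
  using G by (intro around_compose[OF s]) (simp add: smooth_form_def)
 have l: "linear (G (phi x))" using around_self[OF lin] .
 have sm: "smooth_at x (%y. G (phi y) b)" for b
  by (rule smooth_compose[OF s]) (use G in \<open>simp add: smooth_form_def\<close>)
 have "fd (%y. G (phi y) (fd phi y w)) x v
  = fd (%y. G y (fd phi x w)) (phi x) (fd phi x v) + G (phi x) (fd (%y. fd phi y w) x v)" for v w
  using fd_linear_family[OF lin sm smooth_fd[OF s], of w v] G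
  fd_compose[OF s, of "%y. G y (fd phi x w)" v] by (simp add: smooth_form_def)
 then show ?thesis
  by (simp add: ext_d1_def pullback_def fd_symmetric[OF s, of v w])
qed

lemma fd_diff: "smooth_at x f ==> smooth_at x g ==> fd (%y. f y - g y) x v = fd f x v - fd g x v"
 using fd_eq[OF has_derivative_diff[OF smooth_deriv smooth_deriv], of x f g] by metis

lemma fd_add: "smooth_at x f ==> smooth_at x g ==> fd (%y. f y + g y) x v = fd f x v + fd g x v"
 using fd_eq[OF has_derivative_add[OF smooth_deriv smooth_deriv], of x f g] by metis

lemma fd_mult: "smooth_at x f ==> smooth_at x g ==>
  fd (%y. f y * g y :: 'b::real_normed_algebra) x v = f x * fd g x v + fd f x v * g x"
 using fd_eq[OF has_derivative_mult[OF smooth_deriv smooth_deriv], of x f g] by metis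

lemma ext_d2_ext_d1:
 assumes "smooth_form x G" shows "ext_d2 (ext_d1 G) x u v w = 0"
proof -
 have s: "smooth_at x (%y. G y v)" for v using assms by (simp add: smooth_form_def)
 have "fd (%y. ext_d1 G y v w) x u = fd (%y. fd (%y. G y w) y v) x u - fd (%y. fd (%y. G y v) y w) x u" for u v w
  unfolding ext_d1_def by (rule fd_diff) (intro smooth_fd s)+
 then show ?thesis unfolding ext_d2_def
  using fd_symmetric[OF s, of u v w] fd_symmetric[OF s, of v u w] fd_symmetric[OF s, of w u v] by simp
qed

lemma ext_d1_cong:
 assumes "open V" "x : V" "!!y v. y : V ==> G y v = H y v" shows "ext_d1 G x v w = ext_d1 H x v w"
 unfolding ext_d1_def using fd_cong[OF assms(1,2), of "%y. G y v" "%y. H y v" for v] assms(3) by metis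

lemma vector_derivative_continuous_on:
 "(!!t. t : S ==> (e has_vd e' t) (at t within S)) ==> continuous_on S e"
 using has_vector_derivative_continuous by (metis continuous_on_eq_continuous_within)

section \<open>Ordinary differential equations and smooth flows\<close>

text \<open>A Gronwall inequality on short intervals: the maximum \<open>m\<close> of \<open>norm (e t)\<close> satisfies
\<open>m \<le> norm (e t0) + (b - a) (L m + R)\<close>, and \<open>L (b - a) \<le> 1 / 2\<close> absorbs the term in \<open>m\<close>.\<close>

lemma ode_bound:
 fixes e :: "real => 'a::real_normed_vector"
 assumes t0: "t0 : {a..b}" and t: "t : {a..b}"
  and der: "!!t. t : {a..b} ==> (e has_vd e' t) (at t within {a..b})"
  and bd: "!!t. t : {a..b} ==> norm (e' t) <= L * norm (e t) + R"
  and L: "L >= 0" "L * (b - a) <= 1/2"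
 shows "norm (e t) <= 2 * (norm (e t0) + (b - a) * R)"
proof -
 have c: "continuous_on {a..b} e"
  using vector_derivative_continuous_on[OF der] .
 obtain s where s: "s : {a..b}" "!!u. u : {a..b} ==> norm (e u) <= norm (e s)"
  using continuous_attains_sup[of "{a..b}" "%u. norm (e u)"] t0 continuous_on_norm[OF c] by auto
 define B where "B = L * norm (e s) + R"
 have B: "norm (e' u) <= B" if "u : {a..b}" for u
  using bd[OF that] mult_left_mono[OF s(2)[OF that] L(1)] by (simp add: B_def)
 have B0: "B >= 0" using B[OF t0] norm_ge_zero[of "e' t0"] by linarith
 have "norm (e s - e t0) <= B * norm (s - t0)"
 proof (rule differentiable_bound[of "{a..b}"])
  show "(e has_derivative (%h. h *r e' u)) (at u within {a..b})" if "u : {a..b}" for u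
  using der[OF that] unfolding has_vector_derivative_def .
  show "onorm (%h. h *r e' u) <= B" if "u : {a..b}" for u
  using B[OF that] B0 by (intro onorm_bound) (auto simp: mult.commute[of B] intro!: mult_left_mono)
 qed (use s t0 in auto)
 also have "... <= B * (b - a)" using s(1) t0 B0 by (intro mult_left_mono) auto
 finally have "norm (e s) <= norm (e t0) + B * (b - a)"
  using norm_triangle_sub[of "e s" "e t0"] by linarith
 also have "B * (b - a) = (L * (b - a)) * norm (e s) + (b - a) * R" by (simp add: B_def algebra_simps)
 also have "(L * (b - a)) * norm (e s) <= 1/2 * norm (e s)" using L(2) by (rule mult_right_mono) simp
 finally have "norm (e s) <= 2 * (norm (e t0) + (b - a) * R)" by simp
 then show ?thesis using s(2)[OF t] by linarith
qed

text \<open>Picard iteration as a contraction of the bounded continuous functions on the line; clamping the time to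
\<open>{-d..d}\<close> makes the integral operator preserve that space.\<close>

lemma lipschitz_ode_exists:
 fixes V :: "'a::euclidean_space => 'a"
 assumes L: "L > 0" and lip: "!!x y. norm (V x - V y) <= L * norm (x - y)" and d: "d > 0" "d * L <= 1/4"
 obtains x where "x 0 = z" "!!t. t : {-d..d} ==> (x has_vd V (x t)) (at t within {-d..d})"
proof -
 define c where "c t = max (-d) (min d t)" for t :: real
 have c: "c t : {-d..d}" for t using d(1) by (auto simp: c_def)
 have ccont: "continuous_on UNIV c" unfolding c_def by (intro continuous_intros)
 have Vc: "continuous_on A V" for A
  by (rule continuous_on_subset[OF lipschitz_on_continuous_on[of L]]) (use L lip in \<open>auto simp: lipschitz_on_def dist_norm\<close>)
 define I where "I x t = integral {-d..t} (%s. V (apply_bcontfun x s))" for x t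
 define f where "f x t = z + I x (c t) - I x 0" for x t
 have Vx: "continuous_on A (%s. V (apply_bcontfun x s))" for x A
  by (rule continuous_on_compose2[OF Vc[of UNIV]]) (auto intro: continuous_on_subset[OF _ subset_UNIV])
 have int: "(%s. V (apply_bcontfun x s)) integrable_on {a..b}" for x and a b :: real
  by (rule integrable_continuous_real) (rule Vx)
 have fc: "continuous_on UNIV (f x)" for x
 proof -
  have "continuous_on {-d..d} (I x)" unfolding I_def by (rule indefinite_integral_continuous_1[OF int])
  moreover have "range c \<subseteq> {-d..d}" using c by blast
  ultimately have "continuous_on UNIV (%t. I x (c t))" using continuous_on_compose2[OF _ ccont] by blast
  then show ?thesis
  unfolding f_def by (intro continuous_intros)
 qed
 have fb: "f x : bcontfun" for x
 proof -
  have "range (f x) \<subseteq> f x ` {-d..d}"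
  proof
  fix y assume "y : range (f x)"
  then obtain t where "y = f x t" by auto
  also have "... = f x (c t)" using c[of t] d by (auto simp: f_def c_def)
  finally show "y : f x ` {-d..d}" using c by blast
  qed
  moreover have "bounded (f x ` {-d..d})"
  by (intro compact_imp_bounded compact_continuous_image continuous_on_subset[OF fc]) auto
  ultimately show ?thesis using fc bounded_subset by (auto simp: bcontfun_def)
 qed
 define F where "F x = Bcontfun (f x)" for x
 have Fa: "apply_bcontfun (F x) = f x" for x unfolding F_def by (rule Bcontfun_inverse[OF fb])
 have Ile: "norm (I x t - I y t) <= 1/2 * dist x y" if t: "t : {-d..d}" for x y t
 proof -
  have "norm (I x t - I y t) = norm (integral (cbox (-d) t) (%s. V (apply_bcontfun x s) - V (apply_bcontfun y s)))"
  unfolding I_def using int by (simp add: integral_diff)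
  also have "... <= (L * dist x y) * measure lborel (cbox (-d) t)"
  proof (rule integrable_bound)
  show "norm (V (apply_bcontfun x s) - V (apply_bcontfun y s)) <= L * dist x y" for s
  using lip[of "apply_bcontfun x s" "apply_bcontfun y s"] dist_bounded[of x s y] L
  by (smt (verit) dist_norm mult_left_mono)
  qed (use L int in \<open>auto intro!: integrable_diff\<close>)
  also have "... = (L * (t + d)) * dist x y" using t by simp
  also have "... <= 1/2 * dist x y"
  proof (rule mult_right_mono)
  have "L * (t + d) <= L * (2 * d)" using t L by (intro mult_left_mono) auto
  then show "L * (t + d) <= 1/2" using d(2) by (simp add: mult.commute)
  qed simp
  finally show ?thesis .
 qed
 have I0: "norm (I x 0 - I y 0) <= 1/4 * dist x y" for x y
 proof -
  have "norm (I x 0 - I y 0) = norm (integral (cbox (-d) 0) (%s. V (apply_bcontfun x s) - V (apply_bcontfun y s)))"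
  unfolding I_def using int by (simp add: integral_diff)
  also have "... <= (L * dist x y) * measure lborel (cbox (-d) 0)"
  proof (rule integrable_bound)
  show "norm (V (apply_bcontfun x s) - V (apply_bcontfun y s)) <= L * dist x y" for s
  using lip[of "apply_bcontfun x s" "apply_bcontfun y s"] dist_bounded[of x s y] L
  by (smt (verit) dist_norm mult_left_mono)
  qed (use L int in \<open>auto intro!: integrable_diff\<close>)
  also have "... = (d * L) * dist x y" using d by simp
  also have "... <= 1/4 * dist x y" using d(2) by (rule mult_right_mono) simp
  finally show ?thesis .
 qed
 have "EX! x. F x = x"
 proof (rule banach_fix_type[of "3/4"])
  show "ALL x y. dist (F x) (F y) <= 3/4 * dist x y"
  proof (intro allI dist_bound)
  fix x y t
  have "norm (f x t - f y t) <= norm (I x (c t) - I y (c t)) + norm (I x 0 - I y 0)"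
  using norm_triangle_ineq4[of "I x (c t) - I y (c t)" "I x 0 - I y 0"] by (simp add: f_def algebra_simps)
  then show "dist (apply_bcontfun (F x) t) (apply_bcontfun (F y) t) <= 3/4 * dist x y"
  unfolding Fa dist_norm[of "f x t"] using Ile[OF c[of t], of x y] I0[of x y] by linarith
  qed
 qed auto
 then obtain x where x: "F x = x" by blast
 define y where "y = apply_bcontfun x"
 have y: "y t = f x t" for t unfolding y_def using Fa[of x] x by simp
 show thesis
 proof (rule that)
  show "y 0 = z" using d by (simp add: y f_def c_def)
  fix t assume t: "t : {-d..d}"
  have "(I x has_vd V (y t)) (at t within {-d..d})"
  unfolding I_def y_def by (rule integral_has_vector_derivative[OF Vx t])
  then have "((%t. z + I x t - I x 0) has_vd V (y t)) (at t within {-d..d})"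
  by (auto intro!: derivative_eq_intros)
  moreover have "z + I x t - I x 0 = y t" if "t : {-d..d}" for t
  using that by (auto simp: y f_def c_def)
  ultimately show "(y has_vd V (y t)) (at t within {-d..d})"
  using has_vector_derivative_transform[OF t] by (metis (no_types, lifting))
 qed
qed

lemma smooth_second_order:
 fixes V :: "'a::euclidean_space => 'b::euclidean_space"
 assumes "smooth_at z V"
 obtains r L K where "r > 0" "L > 0" "K > 0" "!!y. y : cball z r ==> smooth_at y V"
  "!!x y. x : cball z r ==> y : cball z r ==> norm (V x - V y) <= L * norm (x - y)"
  "!!x v. x : cball z r ==> norm (fd V x v) <= L * norm v"
  "!!x y. x : cball z r ==> y : cball z r ==> norm (V x - V y - fd V y (x - y)) <= K * (norm (x - y))\<^sup>2"
proof -
 obtain U where U: "open U" "z : U" "!!y. y : U ==> smooth_at y V"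
  using smooth_around[OF assms] unfolding eventually_nhds by blast
 obtain r where r: "r > 0" "cball z r \<subseteq> U" using U open_contains_cball by blast
 have sm: "smooth_at y V" if "y : cball z r" for y using U(3) r that by blast
 define B where "B = cball z r"
 have cB: "compact B" "convex B" "z : B" using r by (auto simp: B_def)
 have bnd: "EX M>=0. ALL y:B. norm (g y) <= M" if "!!y. y : B ==> smooth_at y g" for g :: "'a => 'b"
 proof -
  have "continuous_on B g" using that smooth_isCont by (auto intro!: continuous_at_imp_continuous_on)
  then have "bounded (g ` B)" using cB compact_continuous_image compact_imp_bounded by blast
  then obtain M where "ALL y:B. norm (g y) <= M" unfolding bounded_iff by blast
  then show ?thesis using cB(3) norm_ge_zero order_trans by blast
 qed
 have lin: "EX M>=0. ALL y:B. ALL v. norm (fd g y v) <= M * norm v" if s: "!!y. y : B ==> smooth_at y g" for g :: "'a => 'b"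
 proof -
  have "ALL b. EX M>=0. ALL y:B. norm (fd g y b) <= M" using bnd[OF smooth_fd[OF s]] by blast
  then obtain M where M: "!!b. M b >= (0::real)" "!!b y. y : B ==> norm (fd g y b) <= M b" by metis
  have "norm (fd g y v) <= (SUM b:Basis. M b) * norm v" if "y : B" for y v
  proof -
  have "norm (fd g y v) = norm (SUM b:Basis. (v \<bullet> b) *r fd g y b)"
  using linear_expand[OF smooth_lin[OF s[OF that]], of v] by simp
  also have "... <= (SUM b:Basis. norm v * M b)"
  by (intro sum_norm_le) (simp add: mult_mono M that Basis_le_norm)
  finally show ?thesis by (simp only: sum_distrib_right mult.commute[of "norm v"])
  qed
  then show ?thesis using M by (intro exI[of _ "SUM b:Basis. M b"]) (auto intro: sum_nonneg)
 qed
 have lip: "norm (g x - g y) <= M * norm (x - y)"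
  if "!!y. y : B ==> smooth_at y g" "!!y v. y : B ==> norm (fd g y v) <= M * norm v" "M >= 0" "x : B" "y : B"
  for g :: "'a => 'b" and M x y
  using that cB
  by (intro differentiable_bound[of B g "fd g"]) (auto intro!: onorm_bound has_derivative_at_withinI[OF smooth_deriv])
 obtain L where L: "L >= 0" "!!y v. y : B ==> norm (fd V y v) <= L * norm v"
  using lin[of V] sm unfolding B_def by blast
 have "ALL b. EX M>=0. ALL y:B. ALL v. norm (fd (%z. fd V z b) y v) <= M * norm v"
  using lin[OF smooth_fd] sm unfolding B_def by blast
 then obtain M where M: "!!b. M b >= (0::real)" "!!b y v. y : B ==> norm (fd (%z. fd V z b) y v) <= M b * norm v" by metis
 define K where "K = (SUM b:(Basis::'a set). M b)"
 have K: "K >= 0" unfolding K_def by (intro sum_nonneg) (rule M)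
 have DV: "norm (fd V x v - fd V y v) <= K * norm (x - y) * norm v" if "x : B" "y : B" for x y v
 proof -
  have sx: "linear (fd V x)" "linear (fd V y)" using that sm smooth_lin unfolding B_def by blast+
  have "norm (fd V x v - fd V y v) = norm (SUM b:Basis. (v \<bullet> b) *r (fd V x b - fd V y b))"
  using linear_expand[OF sx(1), of v] linear_expand[OF sx(2), of v] by (simp add: scaleR_diff_right sum_subtractf)
  also have "... <= (SUM b:Basis. norm v * (M b * norm (x - y)))"
  proof (intro sum_norm_le)
  fix b :: 'a assume b: "b : Basis"
  have "norm (fd V x b - fd V y b) <= M b * norm (x - y)"
  using sm by (intro lip M that smooth_fd) (auto simp: B_def)
  then show "norm ((v \<bullet> b) *r (fd V x b - fd V y b)) <= norm v * (M b * norm (x - y))"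
  using Basis_le_norm[OF b] by (simp add: mult_mono)
  qed
  also have "... = K * norm (x - y) * norm v" by (simp add: K_def sum_distrib_right sum_distrib_left mult_ac)
  finally show ?thesis .
 qed
 have quad: "norm (V x - V y - fd V y (x - y)) <= K * (norm (x - y))\<^sup>2" if xy: "x : B" "y : B" for x y
 proof -
  let ?S = "closed_segment y x"
  have S: "?S \<subseteq> B" using xy cB by (simp add: closed_segment_subset)
  have n: "norm (u - y) <= norm (x - y)" if "u : ?S" for u using segment_bound1[OF that] .
  have "norm ((V x - fd V y x) - (V y - fd V y y)) <= (K * norm (x - y)) * norm (x - y)"
  proof (rule differentiable_bound[of ?S])
  fix u assume u: "u : ?S"
  have s: "smooth_at u V" "smooth_at y V" using u S xy sm unfolding B_def by blast+
  show "((%u. V u - fd V y u) has_derivative (%v. fd V u v - fd V y v)) (at u within ?S)"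
  using lin_bl smooth_lin[OF s(2)]
  by (intro has_derivative_diff has_derivative_at_withinI[OF smooth_deriv[OF s(1)]]
  deriv_bl) blast
  show "onorm (%v. fd V u v - fd V y v) <= K * norm (x - y)"
  proof (rule onorm_bound)
  show "norm (fd V u v - fd V y v) <= K * norm (x - y) * norm v" for v
  using DV[of u y v] u S xy n[OF u] K
  by (meson mult_left_mono mult_right_mono norm_ge_zero order_trans subsetD)
  qed (use K in auto)
  qed auto
  moreover have "fd V y (x - y) = fd V y x - fd V y y"
  using linear_diff[OF smooth_lin, of y V x y] sm xy unfolding B_def by blast
  then have "V x - V y - fd V y (x - y) = (V x - fd V y x) - (V y - fd V y y)" by simp
  ultimately show ?thesis by (simp only: power2_eq_square mult.assoc)
 qed
 show thesis
 proof (rule that[of r "L + 1" "K + 1"])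
  show "norm (V x - V y) <= (L + 1) * norm (x - y)" if "x : cball z r" "y : cball z r" for x y
  proof -
  have "norm (V x - V y) <= L * norm (x - y)" using that sm L by (intro lip) (auto simp: B_def)
  then show ?thesis by (simp add: distrib_right add_increasing2)
  qed
  show "norm (fd V x v) <= (L + 1) * norm v" if "x : cball z r" for x v
  using L(2)[of x v] that by (simp add: B_def distrib_right add_increasing2)
  show "norm (V x - V y - fd V y (x - y)) <= (K + 1) * (norm (x - y))\<^sup>2" if "x : cball z r" "y : cball z r" for x y
  using quad[of x y] that by (simp add: B_def distrib_right add_increasing2)
 qed (use r L K sm in auto)
qed

lemma ode_unique:
 fixes V :: "'a::euclidean_space => 'a"
 assumes sm: "!!z. z : O' ==> smooth_at z V"
  and x: "!!t. t : {a..b} ==> x t : O' & (x has_vd V (x t)) (at t within {a..b})"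
  and y: "!!t. t : {a..b} ==> y t : O' & (y has_vd V (y t)) (at t within {a..b})"
  and t0: "t0 : {a..b}" "x t0 = y t0" and t: "t : {a..b}"
 shows "x t = y t"
proof -
 have cx: "continuous_on {a..b} x" and cy: "continuous_on {a..b} y"
  using vector_derivative_continuous_on[of "{a..b}" x "%t. V (x t)"] vector_derivative_continuous_on[of "{a..b}" y "%t. V (y t)"] x y by auto
 have loc: "EX T. openin (top_of_set {a..b}) T & s : T & (ALL u:T. x s = y s \<longleftrightarrow> x u = y u)" if s: "s : {a..b}" for s
 proof (cases "x s = y s")
  case False
  have "openin (top_of_set {a..b}) ({a..b} \<inter> (%u. x u - y u) -` (- {0}))"
  by (intro continuous_openin_preimage_gen continuous_on_diff cx cy) auto
  then show ?thesis using False s by (intro exI[of _ "{a..b} \<inter> (%u. x u - y u) -` (- {0})"]) auto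
 next
  case True
  obtain r L K where r: "r > 0" "L > 0" "!!u v. u : cball (x s) r ==> v : cball (x s) r ==> norm (V u - V v) <= L * norm (u - v)"
  using smooth_second_order[of "x s" V] sm x[OF s] by metis
  obtain d1 where d1: "d1 > 0" "!!u. u : {a..b} ==> dist u s < d1 ==> dist (x u) (x s) < r"
  using cx s r(1) unfolding continuous_on_iff by metis
  obtain d2 where d2: "d2 > 0" "!!u. u : {a..b} ==> dist u s < d2 ==> dist (y u) (y s) < r"
  using cy s r(1) unfolding continuous_on_iff by metis
  define d where "d = min (min d1 d2 / 2) (1 / (4 * L))"
  have d: "d > 0" "d < d1" "d < d2" "d <= 1 / (4 * L)" using d1 d2 r(2) by (auto simp: d_def)
  have "x u = y u" if u: "u : {a..b}" "dist u s < d" for u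
  proof -
  let ?J = "{max a (s - d)..min b (s + d)}"
  have J: "?J \<subseteq> {a..b}" by auto
  have "norm (x u - y u) <= 2 * (norm (x s - y s) + (min b (s + d) - max a (s - d)) * 0)"
  proof (rule ode_bound[where L=L])
  fix w assume w: "w : ?J"
  show "((%u. x u - y u) has_vd (V (x w) - V (y w))) (at w within ?J)"
  using x y w J by (intro has_vector_derivative_diff) (blast intro: has_vector_derivative_within_subset)+
  have "dist w s < d1" "dist w s < d2" using w d by (auto simp: dist_real_def)
  then show "norm (V (x w) - V (y w)) <= L * norm (x w - y w) + 0"
  using r(3)[of "x w" "y w"] d1(2)[of w] d2(2)[of w] w J True by (auto simp: dist_commute)
  next
  have "L * (min b (s + d) - max a (s - d)) <= L * (2 * d)" using r(2) by (intro mult_left_mono) auto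
  also have "... <= 1/2" using d(4) r(2) by (simp add: field_simps)
  finally show "L * (min b (s + d) - max a (s - d)) <= 1/2" .
  qed (use s u d r in \<open>auto simp: dist_real_def\<close>)
  then show ?thesis using True by simp
  qed
  then show ?thesis using True s d(1)
  by (intro exI[of _ "{a..b} \<inter> ball s d"] conjI openin_open_Int open_ball) (simp_all add: dist_commute)
 qed
 show ?thesis
 proof (rule connected_induction_simple[of "{a..b}" t0 t "%s. x s = y s"])
  fix s assume "s : {a..b}"
  then show "EX T. openin (top_of_set {a..b}) T & s : T & (ALL u:T. ALL w:T. x u = y u --> x w = y w)"
  using loc by metis
 qed (use t0 t in auto)
qed

lemma smooth_ode_exists:
 fixes V :: "'a::euclidean_space => 'a"
 assumes "smooth_at z0 V" and R: "R > 0" and D: "D > 0"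
 obtains d r L K phi where "d > 0" "r > 0" "d <= D" "r <= R" "L > 0" "K > 0" "d * L <= 1/4"
  "!!y. y : cball z0 r ==> smooth_at y V"
  "!!x y. x : cball z0 r ==> y : cball z0 r ==> norm (V x - V y) <= L * norm (x - y)"
  "!!x v. x : cball z0 r ==> norm (fd V x v) <= L * norm v"
  "!!x y. x : cball z0 r ==> y : cball z0 r ==> norm (V x - V y - fd V y (x - y)) <= K * (norm (x - y))\<^sup>2"
  "!!z. phi 0 z = z"
  "!!z t. z : cball z0 (r / 4) ==> t : {-d..d} ==> phi t z : cball z0 r"
  "!!z t. z : cball z0 (r / 4) ==> t : {-d..d} ==> ((%s. phi s z) has_vd V (phi t z)) (at t within {-d..d})"
  "continuous_on ({-d..d} \<times> cball z0 (r / 4)) (%p. phi (fst p) (snd p))"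
proof -
 obtain r' L K where r': "r' > 0" "L > 0" "K > 0" "!!y. y : cball z0 r' ==> smooth_at y V"
  "!!x y. x : cball z0 r' ==> y : cball z0 r' ==> norm (V x - V y) <= L * norm (x - y)"
  "!!x v. x : cball z0 r' ==> norm (fd V x v) <= L * norm v"
  "!!x y. x : cball z0 r' ==> y : cball z0 r' ==> norm (V x - V y - fd V y (x - y)) <= K * (norm (x - y))\<^sup>2"
  using smooth_second_order[OF assms(1)] by metis
 define r where "r = min r' R"
 have rr: "r <= r'" "r <= R" "r > 0" using r'(1) R by (auto simp: r_def)
 then have sub: "x : cball z0 r ==> x : cball z0 r'" for x by auto
 note r = rr(3) r'(2,3) r'(4)[OF sub] r'(5)[OF sub sub] r'(6)[OF sub] r'(7)[OF sub sub]
 define c where "c = closest_point (cball z0 r)"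
 have cin: "c x : cball z0 r" for x unfolding c_def using r(1) by (intro closest_point_in_set) auto
 have clip: "norm (c x - c y) <= norm (x - y)" for x y
  using closest_point_lipschitz[of "cball z0 r" x y] r(1) by (auto simp: c_def dist_norm)
 have cself: "c x = x" if "x : cball z0 r" for x unfolding c_def using that by (rule closest_point_self)
 define W where "W x = V (c x)" for x
 have lip: "norm (W x - W y) <= L * norm (x - y)" for x y
  using order_trans[OF r(5)[OF cin[of x] cin[of y]] mult_left_mono[OF clip[of x y]]] r(2) by (simp add: W_def)
 define M where "M = norm (V z0)"
 define d where "d = min D (min (1 / (4 * L)) (r / (8 * (M + 1))))"
 have M0: "M >= 0" by (simp add: M_def)
 have dD: "d <= D" by (simp add: d_def)
 have d: "d > 0" "d * L <= 1/4" "d * M <= r / 8"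
 proof -
  show "d > 0" using r(1,2) M0 D by (simp add: d_def add_nonneg_pos)
  have "d * L <= 1 / (4 * L) * L" using r(2) by (intro mult_right_mono) (auto simp: d_def)
  then show "d * L <= 1/4" using r(2) by simp
  have "d * M <= r / (8 * (M + 1)) * (M + 1)"
  using M0 r(1) by (intro mult_mono) (auto simp: d_def)
  also have "... = r / 8" using M0 by (simp add: field_simps)
  finally show "d * M <= r / 8" .
 qed
 have "EX x. x 0 = z & (ALL t:{-d..d}. (x has_vd W (x t)) (at t within {-d..d}))" for z
  using lipschitz_ode_exists[OF r(2) lip d(1,2), of z] by metis
 then obtain phi' where phi': "!!z. phi' z 0 = z" "!!z t. t : {-d..d} ==> (phi' z has_vd W (phi' z t)) (at t within {-d..d})"
  by metis
 have inb: "phi' z t : cball z0 r" if z: "z : cball z0 (r / 4)" and t: "t : {-d..d}" for z t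
 proof -
  have "norm (phi' z t - z0) <= 2 * (norm (phi' z 0 - z0) + (d - (-d)) * M)"
  proof (rule ode_bound[where L=L])
  fix s assume s: "s : {-d..d}"
  show "((%s. phi' z s - z0) has_vd W (phi' z s)) (at s within {-d..d})"
  using has_vector_derivative_diff[OF phi'(2)[OF s] has_vector_derivative_const[of z0]] by simp
  have "W z0 = V z0" using cself[of z0] r(1) by (simp add: W_def)
  then show "norm (W (phi' z s)) <= L * norm (phi' z s - z0) + M"
  using lip[of "phi' z s" z0] norm_triangle_sub[of "W (phi' z s)" "W z0"] by (simp add: M_def)
  qed (use d t r in \<open>auto simp: mult.commute\<close>)
  also have "... <= 2 * (r / 4 + 2 * (r / 8))" using z d(3) by (auto simp: phi'(1) dist_norm norm_minus_commute)
  finally show ?thesis by (simp add: dist_norm norm_minus_commute)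
 qed
 have der: "((%s. phi' z s) has_vd V (phi' z t)) (at t within {-d..d})"
  if "z : cball z0 (r / 4)" "t : {-d..d}" for z t
  using phi'(2)[OF that(2), of z] cself[OF inb[OF that]] by (simp add: W_def)
 have lipz: "norm (phi' z t - phi' w t) <= 2 * norm (z - w)" if t: "t : {-d..d}" for z w t
 proof -
  have "norm (phi' z t - phi' w t) <= 2 * (norm (phi' z 0 - phi' w 0) + (d - (-d)) * 0)"
  proof (rule ode_bound[where L=L])
  fix s assume s: "s : {-d..d}"
  show "((%s. phi' z s - phi' w s) has_vd W (phi' z s) - W (phi' w s)) (at s within {-d..d})"
  by (intro has_vector_derivative_diff phi'(2) s)
  qed (use d t r lip in \<open>auto simp: mult.commute\<close>)
  then show ?thesis by (simp add: phi'(1))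
 qed
 have cont: "continuous_on ({-d..d} \<times> cball z0 (r / 4)) (%p. phi' (snd p) (fst p))"
  unfolding continuous_on_def
 proof
  fix p assume p: "p : {-d..d} \<times> cball z0 (r / 4)"
  obtain t z where pp: "p = (t, z)" by (cases p)
  have t: "t : {-d..d}" and z: "z : cball z0 (r / 4)" using p by (auto simp: pp)
  let ?F = "at (t, z) within {-d..d} \<times> cball z0 (r / 4)"
  have "continuous_on {-d..d} (phi' z)" by (rule vector_derivative_continuous_on[OF phi'(2)])
  then have "(phi' z \<longlongrightarrow> phi' z t) (at t within {-d..d})" using t by (simp add: continuous_on_def)
  moreover have "continuous_on ({-d..d} \<times> cball z0 (r / 4)) (%p. phi' z (fst p))"
  by (rule continuous_on_compose2[OF \<open>continuous_on {-d..d} (phi' z)\<close>]) (auto intro: continuous_on_fst)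
  ultimately have 1: "((%p. norm (phi' z (fst p) - phi' z t) + 2 * norm (snd p - z)) \<longlongrightarrow> norm (phi' z t - phi' z t) + 2 * norm (z - z)) ?F"
  using t z by (intro tendsto_intros tendsto_eq_intros) (auto simp: continuous_on_def)
  have "((%p. phi' (snd p) (fst p) - phi' z t) \<longlongrightarrow> 0) ?F"
  proof (rule Lim_null_comparison)
  show "\<forall>\<^sub>F p in ?F. norm (phi' (snd p) (fst p) - phi' z t) <= norm (phi' z (fst p) - phi' z t) + 2 * norm (snd p - z)"
  unfolding eventually_at_filter
  proof (rule always_eventually, intro allI impI)
  fix q assume "q : {-d..d} \<times> cball z0 (r / 4)"
  then show "norm (phi' (snd q) (fst q) - phi' z t) <= norm (phi' z (fst q) - phi' z t) + 2 * norm (snd q - z)"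
  using lipz[of "fst q" "snd q" z] norm_triangle_ineq[of "phi' (snd q) (fst q) - phi' z (fst q)" "phi' z (fst q) - phi' z t"] by auto
  qed
  qed (use 1 in simp)
  then show "((%p. phi' (snd p) (fst p)) \<longlongrightarrow> phi' (snd p) (fst p)) (at p within {-d..d} \<times> cball z0 (r / 4))"
  by (simp add: pp Lim_null[symmetric])
 qed
 show thesis
 proof (rule that[of d r L K "%t z. phi' z t"])
  show "continuous_on ({-d..d} \<times> cball z0 (r / 4)) (%p. phi' (snd p) (fst p))" by (rule cont)
 qed (use r d dD rr phi'(1) inb der in auto)
qed

lemma has_derivative_quadratic:
 fixes f :: "'a::real_normed_vector => 'b::real_normed_vector"
 assumes A: "bounded_linear A" and V: "open V" "x : V"
  and q: "!!y. y : V ==> norm (f y - f x - A (y - x)) <= C * (norm (y - x))\<^sup>2"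
 shows "(f has_derivative A) (at x)"
proof (rule has_derivativeI[OF A])
 have "((%y. C * norm (y - x)) \<longlongrightarrow> C * norm (x - x)) (at x)" by (intro tendsto_intros)
 then have lim: "((%y. C * norm (y - x)) \<longlongrightarrow> 0) (at x)" by simp
 have ev: "\<forall>\<^sub>F y in at x. norm ((f y - f x - A (y - x)) /\<^sub>R norm (y - x)) <= C * norm (y - x)"
  using eventually_at_in_open'[OF V]
 proof eventually_elim
  case (elim y)
  show ?case
  proof (cases "y = x")
  case False
  then show ?thesis using q[OF elim] by (simp add: divide_simps power2_eq_square mult.assoc)
  qed (use A in \<open>simp add: linear_simps\<close>)
 qed
 show "((%y. (f y - f x - A (y - x)) /\<^sub>R norm (y - x)) \<longlongrightarrow> 0) (at x)"
  by (rule Lim_null_comparison[OF ev lim])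
qed

definition variation :: "('a::euclidean_space => 'a) => 'a \<times> 'a => 'a \<times> 'a" where
 "variation V p = (V (fst p), fd V (fst p) (snd p))"

lemma smooth_variation:
 assumes "smooth_at z V" shows "smooth_at (z, y) (variation V)"
 unfolding variation_def[abs_def]
proof (intro smooth_Pair)
 have f: "smooth_at (z, y) fst" "smooth_at (z, y) snd"
  by (auto intro: smooth_bl[OF bounded_linear_fst, of _ "%p. p", simplified]
  smooth_bl[OF bounded_linear_snd, of _ "%p. p", simplified])
 show "smooth_at (z, y) (%p. V (fst p))" by (rule smooth_compose[OF f(1)]) (simp add: assms)
 show "smooth_at (z, y) (%p. fd V (fst p) (snd p))"
  by (rule smooth_fd_compose[OF _ f]) (simp add: assms)
qed

text \<open>The derivative \<open>Phi\<close> of the flow in the initial value is the solution of the variational equation: the error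
\<open>phi t z' - phi t z - Phi t z (z' - z)\<close> satisfies a linear equation up to a quadratic term, so \<open>ode_bound\<close>
makes it quadratic in \<open>z' - z\<close>.\<close>

lemma flow_C1:
 fixes V :: "'a::euclidean_space => 'a"
 assumes sm: "smooth_at z0 V" and R: "R > 0"
 obtains d rho phi Phi where "d > 0" "rho > 0"
  "!!z. phi 0 z = z" "!!z b. Phi 0 z b = b"
  "!!t z. t : {-d..d} ==> z : ball z0 rho ==> phi t z : cball z0 R & smooth_at (phi t z) V"
  "!!t z. t : {-d..d} ==> z : ball z0 rho ==> ((%s. phi s z) has_vd V (phi t z)) (at t within {-d..d})"
  "!!t z b. t : {-d..d} ==> z : ball z0 rho ==>
  ((%s. Phi s z b) has_vd fd V (phi t z) (Phi t z b)) (at t within {-d..d})"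
  "!!b. continuous_on ({-d<..<d} \<times> ball z0 rho) (%p. Phi (fst p) (snd p) b)"
  "!!t z. t : {-d<..<d} ==> z : ball z0 rho ==>
  ((%p. phi (fst p) (snd p)) has_derivative
  (%h. fst h *r V (phi t z) + (SUM b:Basis. (snd h \<bullet> b) *r Phi t z b))) (at (t, z))"
proof -
 obtain r1 L K where r1: "r1 > 0" "L > 0" "K > 0" "!!y. y : cball z0 r1 ==> smooth_at y V"
  "!!x y. x : cball z0 r1 ==> y : cball z0 r1 ==> norm (V x - V y) <= L * norm (x - y)"
  "!!x v. x : cball z0 r1 ==> norm (fd V x v) <= L * norm v"
  "!!x y. x : cball z0 r1 ==> y : cball z0 r1 ==> norm (V x - V y - fd V y (x - y)) <= K * (norm (x - y))\<^sup>2"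
  using smooth_second_order[OF sm] by metis
 let ?R = "min R r1" and ?D = "1 / (4 * L)"
 have RD: "?R > 0" "?D > 0" using R r1 by auto
 show thesis
 proof (rule smooth_ode_exists[OF smooth_variation[OF sm, of 0] RD], goal_cases)
 case F: (1 d r L' K' F)
 define rho where "rho = r / 8"
 define c where "c = r / 8"
 have pos: "rho > 0" "c > 0" using F(2) by (auto simp: rho_def c_def)
 define phi where "phi t z = fst (F t (z, 0))" for t z
 define Phi' where "Phi' t z b = inverse c *r snd (F t (z, c *r b))" for t z b
 define Phi where "Phi t z v = (SUM b:Basis. (v \<bullet> b) *r Phi' t z b)" for t z v
 have inb: "(z, y) : cball (z0, 0) (r / 4)" if "z : cball z0 rho" "norm y <= c" for z y
 proof -
  have "dist (z0, 0) (z, y) <= dist z0 z + norm y"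
  by (simp add: dist_Pair_Pair real_sqrt_sum_squares_triangle_ineq[THEN order_trans] sqrt_sum_squares_le_sum)
  then show ?thesis using that by (simp add: rho_def c_def)
 qed
 have F1: "fst (F t p) : cball z0 r" if "p : cball (z0, 0) (r / 4)" "t : {-d..d}" for t p
  using F(13)[OF that] dist_fst_le[of "(z0, 0)" "F t p"] by (simp del: mem_cball_0)
 have F1V: "((%s. fst (F s p)) has_vd V (fst (F t p))) (at t within {-d..d})"
  if "p : cball (z0, 0) (r / 4)" "t : {-d..d}" for t p
  using bounded_linear.has_vector_derivative[OF bounded_linear_fst F(14)[OF that]] by (simp add: variation_def)
 have F2V: "((%s. snd (F s p)) has_vd fd V (fst (F t p)) (snd (F t p))) (at t within {-d..d})"
  if "p : cball (z0, 0) (r / 4)" "t : {-d..d}" for t p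
  using bounded_linear.has_vector_derivative[OF bounded_linear_snd F(14)[OF that]] by (simp add: variation_def)
 have r_sub: "x : cball z0 R" "x : cball z0 r1" if "x : cball z0 r" for x using that F(4) by auto
 have phi0: "phi 0 z = z" for z by (simp add: phi_def F(12))
 have phiin: "phi t z : cball z0 r" if "t : {-d..d}" "z : cball z0 rho" for t z
  unfolding phi_def using that pos by (intro F1 inb) auto
 have phiV: "((%s. phi s z) has_vd V (phi t z)) (at t within {-d..d})"
  if "t : {-d..d}" "z : cball z0 rho" for t z
  unfolding phi_def using that pos by (intro F1V inb) auto
 have indep: "fst (F t (z, y)) = phi t z" if t: "t : {-d..d}" and z: "z : cball z0 rho" "norm y <= c" for t z y
 proof (rule ode_unique[of "cball z0 r1" V "-d" d "%t. fst (F t (z, y))" "%t. phi t z" 0])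
  show "fst (F s (z, y)) : cball z0 r1 & ((%t. fst (F t (z, y))) has_vd V (fst (F s (z, y)))) (at s within {- d..d})"
  if "s : {-d..d}" for s using F1[OF inb[OF z] that] F1V[OF inb[OF z] that] r_sub by blast
  show "phi s z : cball z0 r1 & ((%t. phi t z) has_vd V (phi s z)) (at s within {- d..d})"
  if "s : {-d..d}" for s using phiin[OF that z(1)] phiV[OF that z(1)] r_sub by blast
 qed (use r1 t F(1,12) phi0 in auto)
 have nb: "norm (c *r b) <= c" if "b : Basis" for b :: 'a using pos that by simp
 have lin: "linear (fd V (phi t z))" if "t : {-d..d}" "z : cball z0 rho" for t z
  using smooth_lin r1(4) r_sub(2) phiin[OF that] by blast
 have Phi'V: "((%s. Phi' s z b) has_vd fd V (phi t z) (Phi' t z b)) (at t within {-d..d})"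
  if "t : {-d..d}" "z : cball z0 rho" "b : Basis" for t z b
 proof -
  have "((%s. inverse c *r snd (F s (z, c *r b))) has_vd
  inverse c *r fd V (phi t z) (snd (F t (z, c *r b)))) (at t within {-d..d})"
  using bounded_linear.has_vector_derivative[OF bounded_linear_scaleR_right F2V[OF inb[OF that(2) nb[OF that(3)]] that(1)]]
  indep[OF that(1,2) nb[OF that(3)]] by simp
  then show ?thesis unfolding Phi'_def using linear_scale[OF lin[OF that(1,2)]] by simp
 qed
 have PhiV: "((%s. Phi s z v) has_vd fd V (phi t z) (Phi t z v)) (at t within {-d..d})"
  if "t : {-d..d}" "z : cball z0 rho" for t z v
 proof -
  interpret A: linear "fd V (phi t z)" by (rule lin[OF that])
  have "((%s. Phi s z v) has_vd (SUM b:Basis. (v \<bullet> b) *r fd V (phi t z) (Phi' t z b))) (at t within {-d..d})"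
  unfolding Phi_def
  by (intro has_vector_derivative_sum bounded_linear.has_vector_derivative[OF bounded_linear_scaleR_right] Phi'V that)
  then show ?thesis by (simp add: Phi_def A.sum A.scale)
 qed
 have Phi0: "Phi 0 z v = v" for z v using pos by (simp add: Phi_def Phi'_def F(12) euclidean_representation)
 have Phi'c: "continuous_on ({-d<..<d} \<times> ball z0 rho) (%p. Phi' (fst p) (snd p) b)" if b: "b : Basis" for b
 proof -
  have ib: "(z, c *r b) : cball (z0, 0) (r / 4)" if "z : ball z0 rho" for z
  using inb[OF _ nb[OF b], of z] that by (simp del: mem_cball add: ball_subset_cball[THEN subsetD])
  have "continuous_on ({-d<..<d} \<times> ball z0 rho) (%p. F (fst (fst p, (snd p, c *r b))) (snd (fst p, (snd p, c *r b))))"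
  by (rule continuous_on_compose2[OF F(15)])
  (use ib in \<open>auto intro!: continuous_intros simp del: mem_cball mem_ball\<close>)
  then show ?thesis unfolding Phi'_def by (intro continuous_intros) simp
 qed
 have Phic: "continuous_on ({-d<..<d} \<times> ball z0 rho) (%p. Phi (fst p) (snd p) v)" for v
  unfolding Phi_def by (intro continuous_intros Phi'c)
 have dL: "L * (d - - d) <= 1/2" using F(3) r1(2) by (simp add: field_simps)
 have lip: "norm (phi t z - phi t w) <= 2 * norm (z - w)" if t: "t : {-d..d}" and z: "z : cball z0 rho" "w : cball z0 rho" for t z w
 proof -
  have "norm (phi t z - phi t w) <= 2 * (norm (phi 0 z - phi 0 w) + (d - (-d)) * 0)"
  proof (rule ode_bound[where L=L])
  fix s assume s: "s : {-d..d}"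
  show "((%s. phi s z - phi s w) has_vd V (phi s z) - V (phi s w)) (at s within {-d..d})"
  by (intro has_vector_derivative_diff phiV s z)
  show "norm (V (phi s z) - V (phi s w)) <= L * norm (phi s z - phi s w) + 0"
  using r1(5) r_sub(2) phiin[OF s] z by simp
  qed (use t F(1) r1(2) dL in auto)
  then show ?thesis by (simp add: phi0)
 qed
 have quad: "norm (phi t w - phi t z - Phi t z (w - z)) <= (16 * d * K) * (norm (w - z))\<^sup>2"
  if t: "t : {-d..d}" and z: "z : cball z0 rho" "w : cball z0 rho" for t z w
 proof -
  let ?e = "%s. phi s w - phi s z - Phi s z (w - z)"
  have "norm (?e t) <= 2 * (norm (?e 0) + (d - (-d)) * (K * (2 * norm (w - z))\<^sup>2))"
  proof (rule ode_bound[where L=L])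
  fix s assume s: "s : {-d..d}"
  let ?D = "fd V (phi s z)"
  show "(?e has_vd V (phi s w) - V (phi s z) - ?D (Phi s z (w - z))) (at s within {-d..d})"
  by (intro has_vector_derivative_diff phiV PhiV s z)
  have in1: "phi s z : cball z0 r1" "phi s w : cball z0 r1" using r_sub(2) phiin[OF s] z by auto
  have "?D (Phi s z (w - z)) = ?D (phi s w - phi s z) - ?D (?e s)"
  using linear_diff[OF lin[OF s z(1)], of "phi s w - phi s z" "Phi s z (w - z)"]
  linear_diff[OF lin[OF s z(1)], of "phi s w - phi s z" "?e s"] by simp
  then have "V (phi s w) - V (phi s z) - ?D (Phi s z (w - z)) = ?D (?e s) + (V (phi s w) - V (phi s z) - ?D (phi s w - phi s z))" by simp
  also have "norm ... <= L * norm (?e s) + K * (norm (phi s w - phi s z))\<^sup>2"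
  by (intro norm_triangle_le add_mono r1 in1)
  also have "K * (norm (phi s w - phi s z))\<^sup>2 <= K * (2 * norm (w - z))\<^sup>2"
  using lip[OF s z(2,1)] r1(3) by (intro mult_left_mono power_mono) auto
  finally show "norm (V (phi s w) - V (phi s z) - ?D (Phi s z (w - z))) <= L * norm (?e s) + K * (2 * norm (w - z))\<^sup>2" by simp
  qed (use t F(1) r1(2) dL in auto)
  then show ?thesis by (simp add: phi0 Phi0 power2_eq_square mult_ac)
 qed
 have Philin: "linear (Phi t z)" for t z
  by (rule linearI) (simp_all add: Phi_def inner_add_left scaleR_add_left sum.distrib scaleR_sum_right)
 have dz: "((%z. phi t z) has_derivative Phi t z) (at z)" if "t : {-d..d}" "z : ball z0 rho" for t z
  by (rule has_derivative_quadratic[where V="ball z0 rho" and C="16 * d * K"])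
  (use that quad Philin in \<open>auto simp: lin_bl[symmetric]\<close>)
 have joint: "((%p. phi (fst p) (snd p)) has_derivative (%h. fst h *r V (phi t z) + Phi t z (snd h))) (at (t, z))"
  if t: "t : {-d<..<d}" and z: "z : ball z0 rho" for t z
 proof -
  have bl: "bounded_linear (Phi t z)" for t z using Philin lin_bl by blast
  have ap: "blinfun_apply (Blinfun (Phi t z)) = Phi t z" for t z by (rule bounded_linear_Blinfun_apply[OF bl])
  have cb: "continuous_on ({-d<..<d} \<times> ball z0 rho) (%(t, z). Blinfun (Phi t z))"
  by (rule continuous_on_blinfun_componentwise) (use Phic in \<open>simp add: case_prod_beta ap\<close>)
  have "((%(t, z). phi t z) has_derivative (%(tx, ty). (%s. s *r V (phi t z)) tx + blinfun_apply (Blinfun (Phi t z)) ty))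
  (at (t, z) within {-d<..<d} \<times> ball z0 rho)"
  proof (rule has_derivative_partialsI)
  show "((%s. phi s z) has_derivative (%s. s *r V (phi t z))) (at t within {-d<..<d})"
  using phiV[of t z] t z unfolding has_vector_derivative_def
  by (auto intro: has_derivative_subset)
  show "((%z. phi s z) has_derivative blinfun_apply (Blinfun (Phi s w))) (at w within ball z0 rho)"
  if "s : {-d<..<d}" "w : ball z0 rho" for s w
  using dz[of s w] that by (auto simp: ap intro: has_derivative_at_withinI)
  show "continuous (at (t, z) within {-d<..<d} \<times> ball z0 rho) (%(t, z). Blinfun (Phi t z))"
  using cb t z by (auto simp: continuous_on_eq_continuous_within)
  qed (use z in auto)
  moreover have "at (t, z) within {-d<..<d} \<times> ball z0 rho = at (t, z)"
  using t z by (intro at_within_open open_Times) auto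
  ultimately show ?thesis by (simp add: case_prod_beta' ap)
 qed
 have Phiexp: "Phi t z v = (SUM b:Basis. (v \<bullet> b) *r Phi t z b)" for t z v
  by (rule linear_expand[OF Philin])
 show thesis
 proof (rule that[of d rho phi Phi])
  show "((%p. phi (fst p) (snd p)) has_derivative
  (%h. fst h *r V (phi t z) + (SUM b:Basis. (snd h \<bullet> b) *r Phi t z b))) (at (t, z))"
  if "t : {-d<..<d}" "z : ball z0 rho" for t z
  using joint[OF that] by (simp only: Phiexp[symmetric])
  show "phi t z : cball z0 R & smooth_at (phi t z) V" if "t : {-d..d}" "z : ball z0 rho" for t z
  using phiin[OF that(1), of z] that(2) r_sub r1(4) by simp
  show "((%s. phi s z) has_vd V (phi t z)) (at t within {-d..d})"
  if "t : {-d..d}" "z : ball z0 rho" for t z using that by (intro phiV) auto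
  show "((%s. Phi s z b) has_vd fd V (phi t z) (Phi t z b)) (at t within {-d..d})"
  if "t : {-d..d}" "z : ball z0 rho" for t z b using that by (intro PhiV) auto
 qed (rule F(1) pos(1) phi0 Phi0 Phic)+
 qed
qed

lemma Ck_on_integral:
 fixes G :: "'a::euclidean_space \<times> real => 'b::euclidean_space"
 assumes U: "open U" "convex U" and W: "open W" "U \<times> {0..1} \<subseteq> W"
 shows "Ck_on k W G ==> Ck_on k U (%x. integral {0..1} (%s. G (x, s)))"
proof (induction k arbitrary: G)
 case 0
 then have "continuous_on (U \<times> cbox 0 1) (%(x, s). G (x, s))"
  using W by (auto intro: continuous_on_subset simp: case_prod_beta')
 from integral_continuous_on_param[OF this] show ?case by simp
next
 case (Suc k)
 have G: "(G has_derivative fd G p) (at p)" if "p : W" for p using Ck_on_SucD[OF Suc.prems that] .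
 have C: "Ck_on k W (%p. fd G p v)" for v using Suc.prems unfolding Ck_on.simps by blast
 let ?G' = "%x s. Blinfun (%v. fd G (x, s) (v, 0))"
 have bl: "bounded_linear (%v. fd G p (v, 0))" if "p : W" for p
  using bounded_linear_compose[OF has_derivative_bounded_linear[OF G[OF that]]
  bounded_linear_Pair[OF bounded_linear_ident bounded_linear_zero]] .
 have ap: "blinfun_apply (?G' x s) = (%v. fd G (x, s) (v, 0))" if "x : U" "s : {0..1}" for x s
  using bounded_linear_Blinfun_apply[OF bl] that W by blast
 have cb: "continuous_on (U \<times> cbox 0 1) (%(x, s). ?G' x s)"
 proof (rule continuous_on_blinfun_componentwise)
  fix i :: 'a
  have "continuous_on (U \<times> cbox 0 1) (%p. fd G p (i, 0))"
  using Ck_on_continuous[OF C W(1)] W(2) by (auto intro: continuous_on_subset)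
  then show "continuous_on (U \<times> cbox 0 1) (%p. blinfun_apply (case p of (x, s) => ?G' x s) i)"
  by (rule continuous_on_eq) (auto simp: ap)
 qed
 have int: "(%s. G (x, s)) integrable_on cbox 0 1" if "x : U" for x
  by (rule integrable_continuous, rule continuous_on_compose2[OF Ck_on_continuous[OF Suc.prems W(1)]])
  (use that W(2) in \<open>auto intro!: continuous_intros\<close>)
 have der: "((%x. integral (cbox 0 1) (%s. G (x, s))) has_derivative blinfun_apply (integral (cbox 0 1) (?G' x))) (at x)"
  if x: "x : U" for x
 proof -
  have "((%x. integral (cbox 0 1) (%s. G (x, s))) has_derivative blinfun_apply (integral (cbox 0 1) (?G' x))) (at x within U)"
  proof (rule leibniz_rule[OF _ int cb x U(2)])
  fix y s assume y: "y : U" "s : cbox 0 (1::real)"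
  have "((%x. (x, s)) has_derivative (%v. (v, 0))) (at y)"
  by (intro has_derivative_Pair has_derivative_ident has_derivative_const)
  moreover have "(y, s) : W" using y W(2) by auto
  ultimately have "((%x. G (x, s)) has_derivative (%v. fd G (y, s) (v, 0))) (at y)"
  using diff_chain_at[OF _ G, of "%x. (x, s)" "%v. (v, 0)" y] by (simp add: o_def)
  then show "((%x. G (x, s)) has_derivative blinfun_apply (?G' y s)) (at y within U)"
  using ap[OF y(1), of s] y(2) by (auto intro: has_derivative_at_withinI)
  qed
  then show ?thesis using at_within_open[OF x U(1)] by simp
 qed
 show ?case
 proof (rule Ck_on_SucI[OF U(1)])
  fix x assume x: "x : U"
  have "(?G' x) integrable_on cbox 0 1"
  proof (rule integrable_continuous)
  have "continuous_on (cbox 0 1) (%s. case (x, s) of (x, s) => ?G' x s)"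
  by (rule continuous_on_compose2[OF cb]) (use x in \<open>auto intro!: continuous_intros\<close>)
  then show "continuous_on (cbox 0 1) (?G' x)" by simp
  qed
  then have "blinfun_apply (integral (cbox 0 1) (?G' x)) v = integral (cbox 0 1) (%s. blinfun_apply (?G' x s) v)" for v
  by (rule blinfun_apply_integral)
  also have "integral (cbox 0 1) (%s. blinfun_apply (?G' x s) v) = integral (cbox 0 1) (%s. fd G (x, s) (v, 0))" for v
  by (rule integral_cong) (simp add: ap[OF x])
  finally have "blinfun_apply (integral (cbox 0 1) (?G' x)) v = integral {0..1} (%s. fd G (x, s) (v, 0))" for v
  by simp
  then have "blinfun_apply (integral (cbox 0 1) (?G' x)) = (%v. integral {0..1} (%s. fd G (x, s) (v, 0)))" by blast
  then show "((%x. integral {0..1} (%s. G (x, s))) has_derivative (%v. integral {0..1} (%s. fd G (x, s) (v, 0)))) (at x)"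
  using der[OF x] by simp
 next
  show "Ck_on k U (%x. integral {0..1} (%s. fd G (x, s) (v, 0)))" for v
  by (rule Suc.IH[OF C])
 qed
qed

text \<open>Since \<open>q (t, z) = t \<integral> g (t s, z) ds\<close> over \<open>{0..1}\<close>, regularity of \<open>g\<close> passes to \<open>q\<close>. In the smoothness of flows this
gives the regularity in the initial value without a derivative in that direction.\<close>

lemma Ck_on_primitive:
 fixes q g :: "real \<times> 'a::euclidean_space => 'b::euclidean_space"
 assumes d: "d > 0" and N: "open N" "convex N"
  and q0: "!!z. z : N ==> q (0, z) = 0"
  and qd: "!!t z. t : {-d<..<d} ==> z : N ==> ((%s. q (s, z)) has_vd g (t, z)) (at t)"
  and g: "Ck_on k ({-d<..<d} \<times> N) g"
 shows "Ck_on k ({-d<..<d} \<times> N) q"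
proof -
 let ?D = "{-d<..<d} \<times> N"
 have D: "open ?D" "convex ?D" using N by (auto intro: open_Times convex_Times)
 let ?m = "%x :: (real \<times> 'a) \<times> real. (fst (fst x) * snd x, snd (fst x))"
 define W where "W = ?m -` ?D"
 have W: "open W" unfolding W_def by (intro open_vimage D(1) continuous_intros)
 have sub: "?D \<times> {0..1} \<subseteq> W"
 proof clarsimp
  fix t z s assume "- d < t" "t < d" "z : N" "0 <= s" "s <= (1::real)"
  then have "\<bar>t * s\<bar> < d" unfolding abs_mult by (intro le_less_trans[OF mult_right_le_one_le]) auto
  then show "((t, z), s) : W" using \<open>z : N\<close> by (auto simp: W_def)
 qed
 have "Ck_on k W (%x. g (?m x))"
 proof (rule Ck_on_compose[OF W D(1) _ _ g])
  have "smooth_on W ?m" unfolding smooth_on_open_iff[OF W]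
  by (intro ballI smooth_Pair smooth_mult smooth_fst smooth_snd smooth_ident)
  then show "Ck_on k W ?m" by (simp add: smooth_on_def)
 qed (auto simp: W_def)
 then have I: "Ck_on k ?D (%x. integral {0..1} (%s. g (?m (x, s))))" by (rule Ck_on_integral[OF D W sub])
 have "Ck_on k ?D (%x. fst x *r integral {0..1} (%s. g (?m (x, s))))"
  by (intro Ck_on_bilinear[OF bounded_bilinear_scaleR D(1)] I Ck_on_bounded_linear[OF bounded_linear_fst D(1)] Ck_on_id D(1))
 moreover have "fst x *r integral {0..1} (%s. g (?m (x, s))) = q x" if "x : ?D" for x
 proof -
  obtain t z where x: "x = (t, z)" by (cases x)
  have tz: "t : {-d<..<d}" "z : N" using that x by auto
  have "((%s. t *r g (t * s, z)) has_integral (q (t * 1, z) - q (t * 0, z))) {0..1}"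
  proof (rule fundamental_theorem_of_calculus)
  fix s assume s: "s : {0..1::real}"
  have "t * s : {-d<..<d}" using sub that s x by (force simp: W_def)
  have m: "((%s. t * s) has_vd t) (at s)"
  by (auto intro!: derivative_eq_intros simp: has_real_derivative_iff_has_vector_derivative[symmetric])
  from vector_diff_chain_at[OF m qd[OF \<open>t * s : {-d<..<d}\<close> tz(2)]]
  show "((%s. q (t * s, z)) has_vd t *r g (t * s, z)) (at s within {0..1})"
  by (auto simp: o_def intro!: has_vector_derivative_at_within)
  qed simp
  then have "((%s. t *r g (t * s, z)) has_integral q (t, z)) {0..1}" using q0[OF tz(2)] by simp
  from integral_unique[OF this] show ?thesis by (simp add: x)
 qed
 ultimately show ?thesis using Ck_on_cong[OF D(1), of "%x. fst x *r integral {0..1} (%s. g (?m (x, s)))" q k] by blast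
qed

lemma open_smooth_at: "open {z. smooth_at z f}"
 by (subst open_subopen) (use smooth_around in \<open>force simp: eventually_nhds\<close>)

lemma smooth_fst_id: "smooth_at p fst" and smooth_snd_id: "smooth_at p snd"
 for p :: "'a::euclidean_space \<times> 'b::euclidean_space"
 using smooth_fst[OF smooth_ident, of p] smooth_snd[OF smooth_ident, of p] by simp_all

lemma fd_fst: "fd fst p = fst" and fd_snd: "fd snd p = snd"
 by (rule fd_eq, rule deriv_bl, rule bounded_linear_fst)
  (rule fd_eq, rule deriv_bl, rule bounded_linear_snd)

lemma fd_variation:
 assumes "smooth_at z V"
 shows "fst (fd (variation V) (z, y) h) = fd V z (fst h)"
  "snd (fd (variation V) (z, y) h) = fd (%x. fd V x y) z (fst h) + fd V z (snd h)"
proof -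
 have sv: "smooth_at (z, y) (variation V)" by (rule smooth_variation[OF assms])
 have f: "smooth_at (fst (z, y)) V" using assms by simp
 have "fst (fd (variation V) (z, y) h) = fd (%p. fst (variation V p)) (z, y) h"
  using fd_bl[OF bounded_linear_fst sv] by simp
 also have "... = fd V z (fst h)"
  using fd_compose[OF smooth_fst_id f] by (simp add: variation_def fd_fst)
 finally show "fst (fd (variation V) (z, y) h) = fd V z (fst h)" .
 have "around (z, y) (%p. linear (fd V (fst p)))"
  by (rule around_compose[OF smooth_fst_id])
  (use smooth_around[OF assms] in \<open>auto elim: eventually_mono intro: smooth_lin\<close>)
 moreover have "smooth_at (z, y) (%p. fd V (fst p) b)" for b
  by (rule smooth_compose[OF smooth_fst_id]) (simp add: assms smooth_fd)
 ultimately have "fd (%p. fd V (fst p) (snd p)) (z, y) h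
  = fd (%p. fd V (fst p) y) (z, y) h + fd V z (fd snd (z, y) h)"
  using fd_linear_family[where A="%p. fd V (fst p)" and w=snd and x="(z, y)" and v=h] smooth_snd_id by fastforce
 moreover have "fd (%p. fd V (fst p) y) (z, y) h = fd (%x. fd V x y) z (fst h)"
  using fd_compose[OF smooth_fst_id, of "(z, y)" "%x. fd V x y" h] smooth_fd[OF f] by (simp add: fd_fst)
 moreover have "snd (fd (variation V) (z, y) h) = fd (%p. snd (variation V p)) (z, y) h"
  using fd_bl[OF bounded_linear_snd sv] by simp
 ultimately show "snd (fd (variation V) (z, y) h) = fd (%x. fd V x y) z (fst h) + fd V z (snd h)"
  by (simp add: variation_def fd_snd)
qed

text \<open>Bootstrapping. The flow \<open>phi\<close> has the derivative \<open>A\<close>, the fundamental solution of the variational equation; the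
flow \<open>F\<close> of that equation has a derivative too, so \<open>A\<close> is differentiable, with derivative \<open>zet\<close>, say. Variation of constants
writes \<open>zet = A q\<close>, where the time derivative of \<open>q\<close> is an expression in \<open>phi\<close> and \<open>A\<close> only. So if \<open>phi\<close> and \<open>A\<close> are
\<open>k\<close> times differentiable then so are \<open>q\<close> and \<open>zet\<close>, hence \<open>phi\<close> and \<open>A\<close> are \<open>k + 1\<close> times differentiable.\<close>

theorem flow_box:
 fixes V :: "'a::euclidean_space => 'a"
 assumes sm: "smooth_at z0 V" and R: "R > 0"
 obtains d rho phi where "d > 0" "rho > 0" "!!z. phi 0 z = z"
  "smooth_on ({-d<..<d} \<times> ball z0 rho) (%p. phi (fst p) (snd p))"
  "!!t z. t : {-d<..<d} ==> z : ball z0 rho ==> phi t z : cball z0 R & smooth_at (phi t z) V &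
  ((%s. phi s z) has_vd V (phi t z)) (at t)"
proof -
 show thesis
 proof (rule flow_C1[OF sm R], goal_cases)
 case F1: (1 d1 rho1 phi Phi)
 show thesis
 proof (rule flow_C1[OF smooth_variation[OF sm, of 0] zero_less_one], goal_cases)
 case F2: (1 d2 rho2 F Xi)
 define d where "d = min d1 d2"
 define rho where "rho = min rho1 (rho2 / 2)"
 define eps where "eps = rho2 / 2"
 have pos: "d > 0" "rho > 0" "eps > 0" using F1 F2 by (auto simp: d_def rho_def eps_def)
 let ?D = "{-d<..<d} \<times> ball z0 rho"
 have D: "open ?D" by (intro open_Times) auto
 have td: "t : {-d1..d1}" "t : {-d2..d2}" "t : {-d1<..<d1}" "t : {-d2<..<d2}" if "t : {-d<..<d}" for t
  using that by (auto simp: d_def)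
 have zb: "z : ball z0 rho1" if "z : ball z0 rho" for z using that by (auto simp: rho_def)
 have pb: "(z, eps *r b) : ball (z0, 0) rho2" if z: "z : ball z0 rho" and b: "b : Basis" for z b :: 'a
 proof -
  have "dist (z0, 0) (z, eps *r b) <= dist z0 z + norm (eps *r b)"
  by (simp add: dist_Pair_Pair real_sqrt_sum_squares_triangle_ineq[THEN order_trans] sqrt_sum_squares_le_sum)
  also have "... < rho2 / 2 + rho2 / 2" using z b pos by (auto simp: rho_def eps_def)
  finally show ?thesis by simp
 qed
 define A where "A t z v = (SUM b:Basis. (v \<bullet> b) *r Phi t z b)" for t z v
 have Alin: "linear (A t z)" for t z
  by (rule linearI) (simp_all add: A_def inner_add_left scaleR_add_left sum.distrib scaleR_sum_right)
 have vlin: "linear (fd V (phi t z))" if "t : {-d<..<d}" "z : ball z0 rho" for t z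
  using F1(5)[OF td(1)[OF that(1)] zb[OF that(2)]] smooth_lin by blast
 have AV: "((%s. A s z v) has_vd fd V (phi t z) (A t z v)) (at t within {-d1..d1})"
  if "t : {-d<..<d}" "z : ball z0 rho" for t z v
 proof -
  interpret L: linear "fd V (phi t z)" by (rule vlin[OF that])
  have "((%s. A s z v) has_vd (SUM b:Basis. (v \<bullet> b) *r fd V (phi t z) (Phi t z b))) (at t within {-d1..d1})"
  unfolding A_def
  by (intro has_vector_derivative_sum bounded_linear.has_vector_derivative[OF bounded_linear_scaleR_right] F1(7) td zb that)
  then show ?thesis by (simp add: A_def L.sum L.scale)
 qed
 have A0: "A 0 z v = v" for z v by (simp add: A_def F1(4) euclidean_representation)
 have AB: "A t z b = Phi t z b" if "b : Basis" for t z b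
 proof -
  have "A t z b = (SUM c:Basis. (if c = b then 1 else 0) *r Phi t z c)"
  unfolding A_def using that by (intro sum.cong) (auto simp: inner_Basis)
  also have "... = (SUM c:Basis. if c = b then Phi t z c else 0)" by (intro sum.cong) auto
  finally show ?thesis using that by simp
 qed
 let ?O = "{p. smooth_at p (variation V)}"
 have varA: "((phi s z, A s z v) : ?O) & ((%s. (phi s z, A s z v)) has_vd variation V (phi s z, A s z v)) (at s within {-\<bar>t\<bar>..\<bar>t\<bar>})"
  if t: "t : {-d<..<d}" and z: "z : ball z0 rho" and s: "s : {-\<bar>t\<bar>..\<bar>t\<bar>}" for t z s v
 proof -
  have sd: "s : {-d<..<d}" and sub: "{-\<bar>t\<bar>..\<bar>t\<bar>} \<subseteq> {-d1..d1}" using t s by (auto simp: d_def)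
  have "smooth_at (phi s z, A s z v) (variation V)"
  using F1(5)[OF td(1)[OF sd] zb[OF z]] by (intro smooth_variation) blast
  moreover have "((%s. (phi s z, A s z v)) has_vd (V (phi s z), fd V (phi s z) (A s z v))) (at s within {-d1..d1})"
  by (intro has_vector_derivative_Pair F1(6)[OF td(1)[OF sd] zb[OF z]] AV[OF sd z])
  ultimately show ?thesis using has_vector_derivative_within_subset[OF _ sub] by (simp add: variation_def)
 qed
 have inj: "inj (A t z)" if t: "t : {-d<..<d}" and z: "z : ball z0 rho" for t z
 proof (subst linear_injective_0[OF Alin], safe)
  fix v assume v: "A t z v = 0"
  have "(phi 0 z, A 0 z v) = (phi 0 z, A 0 z 0)"
  proof (rule ode_unique[where V="variation V" and O'="?O" and a="-\<bar>t\<bar>" and b="\<bar>t\<bar>" and ?t0.0=t and t=0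
  and x="%s. (phi s z, A s z v)" and y="%s. (phi s z, A s z 0)"])
  show "(phi t z, A t z v) = (phi t z, A t z 0)" using v linear_0[OF Alin] by simp
  qed (use varA[OF t z] in auto)
  then show "v = 0" by (simp add: A0)
 qed
 have FF: "F t (z, eps *r b) = (phi t z, eps *r Phi t z b)" if t: "t : {-d<..<d}" and z: "z : ball z0 rho" and b: "b : Basis" for t z b
 proof -
  have "F t (z, eps *r b) = (phi t z, A t z (eps *r b))"
  proof (rule ode_unique[where V="variation V" and O'="?O" and a="-\<bar>t\<bar>" and b="\<bar>t\<bar>" and ?t0.0=0 and t=t
  and x="%s. F s (z, eps *r b)" and y="%s. (phi s z, A s z (eps *r b))"])
  fix s assume s: "s : {-\<bar>t\<bar>..\<bar>t\<bar>}"
  have sd: "s : {-d2..d2}" and sub: "{-\<bar>t\<bar>..\<bar>t\<bar>} \<subseteq> {-d2..d2}" using t s by (auto simp: d_def)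
  show "F s (z, eps *r b) : ?O & ((%s. F s (z, eps *r b)) has_vd variation V (F s (z, eps *r b))) (at s within {-\<bar>t\<bar>..\<bar>t\<bar>})"
  using F2(5)[OF sd pb[OF z b]] has_vector_derivative_within_subset[OF F2(6)[OF sd pb[OF z b]] sub] by simp
  show "(phi s z, A s z (eps *r b)) : ?O & ((%s. (phi s z, A s z (eps *r b))) has_vd variation V (phi s z, A s z (eps *r b))) (at s within {-\<bar>t\<bar>..\<bar>t\<bar>})"
  by (rule varA[OF t z s])
  qed (auto simp: F2(3) F1(3) A0)
  then show ?thesis using linear_scale[OF Alin] AB[OF b] by simp
 qed
 define Tht where "Tht t z b w = (SUM B:Basis. ((w, 0) \<bullet> B) *r Xi t (z, eps *r b) B)" for t z b and w :: 'a
 have FD: "((%p. F (fst p) (snd p, eps *r b)) has_derivative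
  (%h. fst h *r variation V (phi t z, eps *r Phi t z b) + Tht t z b (snd h))) (at (t, z))"
  if t: "t : {-d<..<d}" and z: "z : ball z0 rho" and b: "b : Basis" for t z b
 proof -
  have "((%p. (fst p, (snd p, eps *r b))) has_derivative (%h. (fst h, (snd h, 0)))) (at (t, z))"
  by (intro has_derivative_Pair has_derivative_const deriv_bl bounded_linear_fst bounded_linear_snd)
  moreover have "((%p. F (fst p) (snd p)) has_derivative
  (%h. fst h *r variation V (F t (z, eps *r b)) + (SUM B:Basis. (snd h \<bullet> B) *r Xi t (z, eps *r b) B)))
  (at (fst (t, z), (snd (t, z), eps *r b)))"
  using F2(9)[OF td(4)[OF t] pb[OF z b]] by simp
  ultimately show ?thesis using diff_chain_at[of "%p. (fst p, (snd p, eps *r b))"]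
  by (fastforce simp: o_def Tht_def FF[OF that])
 qed
 have FP: "F (fst p) (snd p, eps *r b) = (phi (fst p) (snd p), eps *r Phi (fst p) (snd p) b)" if "p : ?D" "b : Basis" for p b
  using FF[of "fst p" "snd p" b] that by auto
 define zet where "zet t z b w = inverse eps *r snd (Tht t z b w)" for t z b w
 have inveps: "inverse eps * (x * eps) = x" for x using pos by simp
 have PhiD: "((%p. Phi (fst p) (snd p) b) has_derivative
  (%h. fst h *r fd V (phi t z) (Phi t z b) + zet t z b (snd h))) (at (t, z))"
  if t: "t : {-d<..<d}" and z: "z : ball z0 rho" and b: "b : Basis" for t z b
 proof -
  have "((%p. inverse eps *r snd (F (fst p) (snd p, eps *r b))) has_derivative
  (%h. inverse eps *r snd (fst h *r variation V (phi t z, eps *r Phi t z b) + Tht t z b (snd h)))) (at (t, z))"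
  by (intro has_derivative_scaleR_right has_derivative_snd FD that)
  then have "((%p. inverse eps *r snd (F (fst p) (snd p, eps *r b))) has_derivative
  (%h. fst h *r fd V (phi t z) (Phi t z b) + zet t z b (snd h))) (at (t, z))"
  using linear_scale[OF vlin[OF t z]] inveps by (simp add: variation_def zet_def scaleR_add_right)
  then show ?thesis
  by (rule deriv_transform[OF _ D]) (use t z pos FP[OF _ b] in auto)
 qed
 have Tht1: "fst (Tht t z b w) = A t z w" if t: "t : {-d<..<d}" and z: "z : ball z0 rho" and b: "b : Basis" for t z b w
 proof -
  have "((%p. fst (F (fst p) (snd p, eps *r b))) has_derivative
  (%h. fst (fst h *r variation V (phi t z, eps *r Phi t z b) + Tht t z b (snd h)))) (at (t, z))"
  by (intro has_derivative_fst FD that)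
  then have "((%p. phi (fst p) (snd p)) has_derivative
  (%h. fst (fst h *r variation V (phi t z, eps *r Phi t z b) + Tht t z b (snd h)))) (at (t, z))"
  by (rule deriv_transform[OF _ D]) (use t z FP[OF _ b] in auto)
  from has_derivative_unique[OF this F1(9)[OF td(3)[OF t] zb[OF z]]]
  show ?thesis by (auto simp: fun_eq_iff A_def dest: spec[of _ "0::real"])
 qed
 have ThtV: "((%s. Tht s z b w) has_vd fd (variation V) (phi t z, eps *r Phi t z b) (Tht t z b w)) (at t)"
  if t: "t : {-d<..<d}" and z: "z : ball z0 rho" and b: "b : Basis" for t z b w
 proof -
  let ?p = "(z, eps *r b)"
  have "smooth_at (F t ?p) (variation V)" using F2(5)[OF td(2)[OF t] pb[OF z b]] by blast
  then interpret L: linear "fd (variation V) (F t ?p)" by (rule smooth_lin)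
  have "((%s. Tht s z b w) has_vd (SUM B:Basis. ((w, 0) \<bullet> B) *r fd (variation V) (F t ?p) (Xi t ?p B))) (at t within {-d2..d2})"
  unfolding Tht_def
  by (intro has_vector_derivative_sum bounded_linear.has_vector_derivative[OF bounded_linear_scaleR_right] F2(7) td pb t z b)
  moreover have "at t within {-d2..d2} = at t"
  using td(4)[OF t] by (intro at_within_interior) (simp add: interior_atLeastAtMost_real)
  ultimately show ?thesis by (simp add: Tht_def L.sum[unfolded FF[OF that]] L.scale[unfolded FF[OF that]] FF[OF that])
 qed
 define H where "H t z b w = fd (%x. fd V x (A t z w)) (phi t z) (Phi t z b)" for t z b w
 have zetV: "((%s. zet s z b w) has_vd H t z b w + fd V (phi t z) (zet t z b w)) (at t)"
  if t: "t : {-d<..<d}" and z: "z : ball z0 rho" and b: "b : Basis" for t z b w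
 proof -
  have sV: "smooth_at (phi t z) V" using F1(5)[OF td(1)[OF t] zb[OF z]] by blast
  have "((%s. zet s z b w) has_vd inverse eps *r snd (fd (variation V) (phi t z, eps *r Phi t z b) (Tht t z b w))) (at t)"
  unfolding zet_def
  by (intro bounded_linear.has_vector_derivative[OF bounded_linear_scaleR_right]
  bounded_linear.has_vector_derivative[OF bounded_linear_snd] ThtV that)
  moreover have "inverse eps *r snd (fd (variation V) (phi t z, eps *r Phi t z b) (Tht t z b w)) = H t z b w + fd V (phi t z) (zet t z b w)"
  using pos linear_scale[OF vlin[OF t z]] linear_scale[OF smooth_lin[OF smooth_fd[OF sV]]]
  unfolding fd_variation(2)[OF sV] Tht1[OF that] fd_symmetric[OF sV, of "eps *r Phi t z b"] H_def zet_def
  by (simp add: scaleR_add_right)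
  ultimately show ?thesis by simp
 qed
 have zet0: "zet 0 z b w = 0" for z b w
  by (simp add: zet_def Tht_def F2(4) euclidean_representation)
 define q where "q b w p = inv (A (fst p) (snd p)) (zet (fst p) (snd p) b w)" for b w and p :: "real \<times> 'a"
 define g where "g b w p = inv (A (fst p) (snd p)) (H (fst p) (snd p) b w)" for b w and p :: "real \<times> 'a"
 have bij: "bij (A t z)" if "t : {-d<..<d}" "z : ball z0 rho" for t z
  using linear_injective_imp_surjective[OF Alin inj[OF that]] inj[OF that] by (simp add: bij_def)
 have Aq: "A t z (q b w (t, z)) = zet t z b w" and Ag: "A t z (g b w (t, z)) = H t z b w"
  if "t : {-d<..<d}" "z : ball z0 rho" for t z b w
  using bij_is_surj[OF bij[OF that]] by (simp_all add: q_def g_def surj_f_inv_f)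
 have q0: "q b w (0, z) = 0" if "z : ball z0 rho" for b w z
  using Aq[of 0 z b w] that pos by (simp add: A0 zet0)
 have qV: "((%s. q b w (s, z)) has_vd g b w (t, z)) (at t)"
  if t: "t : {-d<..<d}" and z: "z : ball z0 rho" and b: "b : Basis" for t z b w
 proof -
  have AVt: "((%s. A s z v) has_vd fd V (phi s z) (A s z v)) (at s)" if s: "s : {-d<..<d}" for s v
  using AV[OF s z, of v] at_within_interior[of s "{-d1..d1}"] td(3)[OF s] by (simp add: interior_atLeastAtMost_real)
  have cA: "continuous_on {-d<..<d} (%s. A s z v)" for v
  by (intro continuous_at_imp_continuous_on ballI) (use AVt has_vector_derivative_continuous in blast)
  have czet: "continuous_on {-d<..<d} (%s. zet s z b w)"
  by (intro continuous_at_imp_continuous_on ballI) (use zetV[OF _ z b] has_vector_derivative_continuous in blast)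
  have qc: "isCont (%s. q b w (s, z)) t"
  by (rule solve_continuous_at[where V="{-d<..<d}" and A="%s. A s z" and c="%s. zet s z b w"])
  (use Alin inj z cA czet Aq t in auto)
  obtain q' where q': "((%s. q b w (s, z)) has_derivative q') (at t)"
  "!!v. A t z (q' v) = v *r (H t z b w + fd V (phi t z) (zet t z b w)) - (SUM c:Basis. (q b w (t, z) \<bullet> c) *r (v *r fd V (phi t z) (A t z c)))"
  proof (rule solve_has_derivative[where V="{-d<..<d}" and A="%s. A s z" and c="%s. zet s z b w" and y="%s. q b w (s, z)" and ?x0.0=t])
  show "((%s. A s z c) has_derivative (%v. v *r fd V (phi t z) (A t z c))) (at t)" for c
  using AVt[OF t] by (simp add: has_vector_derivative_def)
  show "((%s. zet s z b w) has_derivative (%v. v *r (H t z b w + fd V (phi t z) (zet t z b w)))) (at t)"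
  using zetV[OF t z b] by (simp add: has_vector_derivative_def)
  qed (use Alin inj z qc Aq t in auto)
  have "fd V (phi t z) (A t z (q b w (t, z))) = (SUM c:Basis. (q b w (t, z) \<bullet> c) *r fd V (phi t z) (A t z c))"
  using linear_expand[OF linear_compose[OF Alin vlin[OF t z]], of t z "q b w (t, z)"] by (simp add: o_def)
  then have "A t z (q' 1) = H t z b w" using q'(2)[of 1] Aq[OF t z, of b w] by simp
  then have "q' 1 = g b w (t, z)" using Ag[OF t z, of b w] injD[OF inj[OF t z]] by metis
  moreover have "q' = (%v. v *r q' 1)"
  proof
  show "q' v = v *r q' 1" for v using linear_scale[OF has_derivative_linear[OF q'(1)], of v 1] by simp
  qed
  ultimately have "q' = (%v. v *r g b w (t, z))" by simp
  with q'(1) show ?thesis by (simp only: has_vector_derivative_def)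
 qed
 let ?U = "{z. smooth_at z V}"
 have U: "open ?U" by (rule open_smooth_at)
 have CV: "Ck_on k ?U V" "Ck_on k ?U (%z. fd V z v)" "Ck_on k ?U (%z. fd (%x. fd V x v) z w)" for k v w
 proof -
  have "smooth_on ?U V" "smooth_on ?U (%z. fd V z v)" "smooth_on ?U (%z. fd (%x. fd V x v) z w)"
  unfolding smooth_on_open_iff[OF U] by (auto intro: smooth_fd)
  then show "Ck_on k ?U V" "Ck_on k ?U (%z. fd V z v)" "Ck_on k ?U (%z. fd (%x. fd V x v) z w)"
  by (auto simp: smooth_on_def)
 qed
 have phiU: "(%p. phi (fst p) (snd p)) ` ?D \<subseteq> ?U" using F1(5) td(1) zb by fastforce
 have sV: "smooth_at (phi (fst p) (snd p)) V" if "p : ?D" for p using phiU that by blast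
 have main: "Ck_on k ?D (%p. phi (fst p) (snd p)) & (ALL b:Basis. Ck_on k ?D (%p. Phi (fst p) (snd p) b))" for k
 proof (induction k)
  case 0
  have "isCont (%p. phi (fst p) (snd p)) (t, z)" if "t : {-d<..<d}" "z : ball z0 rho" for t z
  using F1(9)[OF td(3)[OF that(1)] zb[OF that(2)]] by (rule has_derivative_continuous)
  then have "continuous_on ?D (%p. phi (fst p) (snd p))" by (intro continuous_at_imp_continuous_on) auto
  moreover have "?D \<subseteq> {-d1<..<d1} \<times> ball z0 rho1" using td zb by auto
  ultimately show ?case using continuous_on_subset[OF F1(8)] by auto
 next
  case (Suc k)
  have cphi: "Ck_on k ?D (%p. phi (fst p) (snd p))" and cPhi: "!!b. b : Basis ==> Ck_on k ?D (%p. Phi (fst p) (snd p) b)"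
  using Suc by auto
  have cV: "Ck_on k ?D (%p. V (phi (fst p) (snd p)))"
  "Ck_on k ?D (%p. fd V (phi (fst p) (snd p)) v)"
  "Ck_on k ?D (%p. fd (%x. fd V x v) (phi (fst p) (snd p)) w)" for v w
  by (rule Ck_on_compose[OF D U phiU cphi], rule CV)+
  have cA: "Ck_on k ?D (%p. A (fst p) (snd p) w)" for w unfolding A_def
  by (intro Ck_on_sum[OF D] Ck_on_bounded_linear[OF bounded_linear_scaleR_right D] cPhi)
  have cH: "Ck_on k ?D (%p. H (fst p) (snd p) b w)" if b: "b : Basis" for b w
  unfolding H_def
  proof (rule Ck_on_linear_family[OF D, where A="%p c. fd (%x. fd V x c) (phi (fst p) (snd p)) (Phi (fst p) (snd p) b)"])
  show "linear (%c. fd (%x. fd V x c) (phi (fst p) (snd p)) (Phi (fst p) (snd p) b))" if "p : ?D" for p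
  unfolding fd_symmetric[OF sV[OF that], of _ "Phi (fst p) (snd p) b"]
  by (rule smooth_lin[OF smooth_fd[OF sV[OF that]]])
  show "Ck_on k ?D (%p. fd (%x. fd V x c) (phi (fst p) (snd p)) (Phi (fst p) (snd p) b))" for c
  by (rule Ck_on_linear_family[OF D _ cV(3) cPhi[OF b]]) (rule smooth_lin[OF smooth_fd[OF sV]])
  qed (rule cA)
  have cg: "Ck_on k ?D (g b w)" if b: "b : Basis" for b w
  by (rule Ck_on_solve[where A="%p. A (fst p) (snd p)", OF D Alin _ cA cH[OF b]]) (use inj Ag in auto)
  have cq: "Ck_on k ?D (q b w)" if b: "b : Basis" for b w
  by (rule Ck_on_primitive[where g="g b w"]) (use pos q0 qV[OF _ _ b] cg[OF b] in auto)
  have czet: "Ck_on k ?D (%p. zet (fst p) (snd p) b w)" if b: "b : Basis" for b w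
  proof -
  have "Ck_on k ?D (%p. A (fst p) (snd p) (q b w p))"
  by (rule Ck_on_linear_family[OF D Alin cA cq[OF b]])
  moreover have "A (fst p) (snd p) (q b w p) = zet (fst p) (snd p) b w" if "p : ?D" for p
  using Aq[of "fst p" "snd p" b w] that by auto
  ultimately show ?thesis
  using Ck_on_cong[OF D, of "%p. A (fst p) (snd p) (q b w p)" "%p. zet (fst p) (snd p) b w" k] by blast
  qed
  show ?case
  proof (intro conjI ballI)
  show "Ck_on (Suc k) ?D (%p. phi (fst p) (snd p))"
  proof (rule Ck_on_SucI[OF D])
  show "((%p. phi (fst p) (snd p)) has_derivative
  (%h. fst h *r V (phi (fst p) (snd p)) + A (fst p) (snd p) (snd h))) (at p)" if "p : ?D" for p
  using F1(9)[of "fst p" "snd p"] td(3)[of "fst p"] zb[of "snd p"] that unfolding A_def by auto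
  show "Ck_on k ?D (%p. fst h *r V (phi (fst p) (snd p)) + A (fst p) (snd p) (snd h))" for h
  by (intro Ck_on_add[OF D] Ck_on_bounded_linear[OF bounded_linear_scaleR_right D] cV(1) cA)
  qed
  fix b :: 'a assume b: "b : Basis"
  show "Ck_on (Suc k) ?D (%p. Phi (fst p) (snd p) b)"
  proof (rule Ck_on_SucI[OF D])
  show "((%p. Phi (fst p) (snd p) b) has_derivative
  (%h. fst h *r fd V (phi (fst p) (snd p)) (Phi (fst p) (snd p) b) + zet (fst p) (snd p) b (snd h))) (at p)" if "p : ?D" for p
  using PhiD[of "fst p" "snd p", OF _ _ b] that by auto
  show "Ck_on k ?D (%p. fst h *r fd V (phi (fst p) (snd p)) (Phi (fst p) (snd p) b) + zet (fst p) (snd p) b (snd h))" for h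
  by (intro Ck_on_add[OF D] Ck_on_bounded_linear[OF bounded_linear_scaleR_right D] czet[OF b]
  Ck_on_linear_family[OF D _ cV(2) cPhi[OF b]] smooth_lin[OF sV])
  qed
  qed
 qed
 show thesis
 proof (rule that[of d rho phi])
  show "smooth_on ?D (%p. phi (fst p) (snd p))" using main by (simp add: smooth_on_def)
  fix t z assume tz: "t : {-d<..<d}" "z : ball z0 rho"
  have "at t within {-d1..d1} = at t"
  using td(3)[OF tz(1)] by (intro at_within_interior) (simp add: interior_atLeastAtMost_real)
  then show "phi t z : cball z0 R & smooth_at (phi t z) V & ((%s. phi s z) has_vd V (phi t z)) (at t)"
  using F1(5,6)[OF td(1)[OF tz(1)] zb[OF tz(2)]] by simp
 qed (rule pos F1(3))+
 qed
 qed
qed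

section \<open>Inverse functions and polynomials\<close>

lemma smooth_inverse_function:
 fixes f :: "'a::euclidean_space => 'a"
 assumes f: "smooth_at x0 f" and inj: "inj (fd f x0)"
 obtains U V g where "open U" "x0 : U" "open V" "f x0 : V"
  "!!x. x : U ==> f x : V & g (f x) = x & smooth_at x f & inj (fd f x)"
  "!!y. y : V ==> g y : U & f (g y) = y & smooth_at y g"
proof -
 obtain W where W: "open W" "x0 : W" "!!x. x : W ==> smooth_at x f"
  using smooth_around[OF f] unfolding eventually_nhds by blast
 define f' where "f' x = Blinfun (fd f x)" for x
 have lin: "linear (fd f x)" if "x : W" for x using smooth_lin[OF W(3)[OF that]] .
 have ap: "blinfun_apply (f' x) = fd f x" if "x : W" for x
  unfolding f'_def using lin[OF that] by (intro bounded_linear_Blinfun_apply) (simp add: lin_bl)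
 obtain h where h: "linear h" "h \<circ> fd f x0 = id"
  using linear_injective_left_inverse[OF lin[OF W(2)] inj] by blast
 have c: "continuous_on W f'"
 proof (rule continuous_on_blinfun_componentwise)
  fix b
  have "continuous_on W (%x. fd f x b)"
  using W(3) smooth_isCont[OF smooth_fd] by (intro continuous_at_imp_continuous_on) blast
  then show "continuous_on W (%x. blinfun_apply (f' x) b)"
  by (rule continuous_on_eq) (simp add: ap)
 qed
 obtain U V g g' where I: "open U" "U \<subseteq> W" "x0 : U" "open V" "f x0 : V" "homeomorphism U V f g"
  "!!y. y : V ==> (g has_derivative g' y) (at y)"
  "!!y. y : V ==> g' y = inv (blinfun_apply (f' (g y)))"
  "!!y. y : V ==> bij (blinfun_apply (f' (g y)))"
 proof (rule inverse_function_theorem[OF W(1) _ c W(2), where invf="Blinfun h"])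
  show "(f has_derivative blinfun_apply (f' x)) (at x)" if "x : W" for x
  using smooth_deriv[OF W(3)[OF that]] ap[OF that] by simp
  have "blinfun_apply (Blinfun h) = h"
  using h(1) by (intro bounded_linear_Blinfun_apply) (simp add: lin_bl)
  then show "Blinfun h o\<^sub>L f' x0 = id_blinfun"
  using h(2) ap[OF W(2)] by (intro blinfun_eqI) (simp add: fun_eq_iff)
 qed (rule that, assumption+)
 have UV: "g y : U" "f (g y) = y" if "y : V" for y
  using I(6) that by (auto simp: homeomorphism_def)
 have VU: "f x : V" "g (f x) = x" if "x : U" for x
  using I(6) that by (auto simp: homeomorphism_def)
 have bij: "bij (fd f (g y))" if "y : V" for y
  using I(9)[OF that] ap UV(1)[OF that] I(2) by (metis subsetD)
 have der: "(g has_derivative g' y) (at y)" "fd f (g y) (g' y v) = v" if "y : V" for y v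
 proof -
  show "(g has_derivative g' y) (at y)" by (rule I(7)[OF that])
  have "g' y = inv (fd f (g y))" using I(8)[OF that] ap UV(1)[OF that] I(2) by (metis subsetD)
  then show "fd f (g y) (g' y v) = v" using bij[OF that] by (simp add: bij_is_surj surj_f_inv_f)
 qed
 have Cg: "Ck_on k V g" for k
 proof (induction k)
  case 0
  show ?case using I(6) by (simp add: homeomorphism_def)
 next
  case (Suc k)
  have sf: "smooth_on W f" "smooth_on W (%x. fd f x b)" for b
  using W(3) by (auto simp: smooth_on_open_iff[OF W(1)] intro: smooth_fd)
  show ?case
  proof (rule Ck_on_SucI[OF I(4) der(1)])
  fix v
  show "Ck_on k V (%y. g' y v)"
  proof (rule Ck_on_solve[OF I(4), where A="%y. fd f (g y)" and c="%y. v"])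
  show "Ck_on k V (%y. fd f (g y) b)" for b
  using sf(2)[of b] UV(1) I(2) by (intro Ck_on_compose[OF I(4) W(1) _ Suc.IH]) (auto simp: smooth_on_def)
  qed (use lin UV I(2) bij bij_is_inj der(2) Ck_on_const in blast)+
  qed
 qed
 show thesis
 proof (rule that[of U V g])
  show "f x : V & g (f x) = x & smooth_at x f & inj (fd f x)" if "x : U" for x
  using VU[OF that] W(3) I(2) bij[of "f x"] that bij_is_inj by fastforce
  show "g y : U & f (g y) = y & smooth_at y g" if "y : V" for y
  using UV[OF that] Cg I(4) that by (auto intro: smooth_atI_Ck)
 qed (rule I)+
qed

text \<open>Minors and partial derivatives of equations of \<open>X\<close> stay in this class, with no degrees to keep track of.\<close>

inductive polyf :: "(complex ^ 'm => complex) => bool" where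
 polyf_const: "polyf (%y. c)"
| polyf_coord: "polyf (%y. y $ j)"
| polyf_add: "polyf f ==> polyf g ==> polyf (%y. f y + g y)"
| polyf_mult: "polyf f ==> polyf g ==> polyf (%y. f y * g y)"

lemma polyf_sum: "(!!i. i : S ==> polyf (f i)) ==> polyf (%y. SUM i:S. f i y)"
 by (induction S rule: infinite_finite_induct) (auto intro: polyf.intros)

lemma polyf_prod: "(!!i. i : S ==> polyf (f i)) ==> polyf (%y. PROD i:S. f i y)"
 by (induction S rule: infinite_finite_induct) (auto intro: polyf.intros)

lemma polyf_power: "polyf f ==> polyf (%y. f y ^ n)"
 by (induction n) (auto intro: polyf.intros)

lemma polyf_minus: "polyf f ==> polyf (%y. - f y)"
 using polyf_mult[OF polyf_const[of "-1"]] by simp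

lemma polyf_diff: "polyf f ==> polyf g ==> polyf (%y. f y - g y)"
 using polyf_add[OF _ polyf_minus] by simp

lemma polyf_det: "(!!i j. polyf (%y. M y $ i $ j)) ==> polyf (%y. det (M y))"
 unfolding det_def by (intro polyf_sum polyf_mult polyf_prod) (auto intro: polyf_const)

lemma polyf_smooth: "polyf f ==> smooth_at y f"
 by (induction rule: polyf.induct)
  (auto intro: smooth_add smooth_mult smooth_vec_nth)

lemma polyf_derivative:
 "polyf f ==> EX d. (ALL j. polyf (d j)) & (ALL y. (f has_derivative (%v. SUM j:UNIV. v $ j * d j y)) (at y))"
proof (induction rule: polyf.induct)
 case (polyf_const c)
 show ?case by (rule exI[of _ "%j y. 0"]) (auto intro: polyf.intros)
next
 case (polyf_coord i)
 have "((%y. y $ i) has_derivative (%v. v $ i)) (at y)" for y :: "complex ^ 'a"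
  by (rule deriv_bl[OF bounded_linear_vec_nth])
 moreover have "(SUM j:UNIV. v $ j * (if j = i then 1 else 0)) = v $ i" for v :: "complex ^ 'a"
  by (simp add: if_distrib cong: if_cong)
 ultimately show ?case by (intro exI[of _ "%j y. if j = i then 1 else 0"]) (auto intro: polyf.intros)
next
 case (polyf_add f g)
 then obtain d e where d: "!!j. polyf (d j)" "!!y. (f has_derivative (%v. SUM j:UNIV. v $ j * d j y)) (at y)"
  and e: "!!j. polyf (e j)" "!!y. (g has_derivative (%v. SUM j:UNIV. v $ j * e j y)) (at y)" by blast
 show ?case
  using has_derivative_add[OF d(2) e(2)] d(1) e(1)
  by (intro exI[of _ "%j y. d j y + e j y"]) (auto intro: polyf.intros simp: sum.distrib distrib_left)
next
 case (polyf_mult f g)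
 then obtain d e where d: "!!j. polyf (d j)" "!!y. (f has_derivative (%v. SUM j:UNIV. v $ j * d j y)) (at y)"
  and e: "!!j. polyf (e j)" "!!y. (g has_derivative (%v. SUM j:UNIV. v $ j * e j y)) (at y)" by blast
 have "f y * (SUM j:UNIV. v $ j * e j y) + (SUM j:UNIV. v $ j * d j y) * g y
  = (SUM j:UNIV. v $ j * (f y * e j y + d j y * g y))" for v y
  by (simp add: sum_distrib_left sum_distrib_right sum.distrib distrib_left mult_ac)
 then show ?case
  using has_derivative_mult[OF d(2) e(2)] d(1) e(1) polyf_mult(1,2)
  by (intro exI[of _ "%j y. f y * e j y + d j y * g y"] conjI allI polyf.polyf_add polyf.polyf_mult) auto
qed

definition pd :: "(complex ^ 'm => complex) => 'm => complex ^ 'm => complex" where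
 "pd f j y = fd f y (axis j 1)"

lemma polyf_pd:
 assumes "polyf f" shows "polyf (pd f j)" "fd f y v = (SUM j:UNIV. v $ j * pd f j y)"
proof -
 obtain d where d: "!!j. polyf (d j)" "!!y. (f has_derivative (%v. SUM j:UNIV. v $ j * d j y)) (at y)"
  using polyf_derivative[OF assms] by blast
 have eq: "fd f y v = (SUM j:UNIV. v $ j * d j y)" for y v using fd_eq[OF d(2)] by metis
 have "pd f j = d j" for j by (auto simp: pd_def eq axis_def if_distrib if_distribR cong: if_cong)
 then show "polyf (pd f j)" "fd f y v = (SUM j:UNIV. v $ j * pd f j y)" using d eq by auto
qed

lemma fd_polyf_scale: "polyf f ==> fd f y (c *s v) = c * fd f y v"
 by (simp add: polyf_pd(2) sum_distrib_left mult_ac)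

lemma hpoly_polyf:
 fixes p :: "('m::finite => complex) => complex"
 assumes "p : hpoly UNIV d" shows "polyf (%y. p (vec_nth y))"
 using assms unfolding hpoly_def
 by (auto intro!: polyf_sum polyf_mult polyf_const polyf_prod polyf_power polyf_coord)

lemma hpoly_scale:
 assumes "p : hpoly J d" shows "p (%j. c * x j) = c ^ d * p x"
proof -
 obtain a where p: "p = (%x. SUM e | (ALL j. j ~: J --> e j = 0) & (SUM j:J. e j) = d. a e * (PROD j:J. x j ^ e j))"
  using assms unfolding hpoly_def by blast
 have "(PROD j:J. (c * x j) ^ e j) = c ^ (SUM j:J. e j) * (PROD j:J. x j ^ e j)" for e :: "_ => nat"
  by (simp add: power_mult_distrib prod.distrib power_sum)
 then show ?thesis by (auto simp: p sum_distrib_left mult_ac intro!: sum.cong)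
qed

lemma hpoly_add:
 assumes "p : hpoly J d" "q : hpoly J d" shows "(%x. p x + q x) : hpoly J d"
proof -
 let ?S = "{e. (ALL j. j ~: J --> e j = 0) & (SUM j:J. e j) = d}"
 obtain a b where "p = (%x. SUM e:?S. a e * (PROD j:J. x j ^ e j))" "q = (%x. SUM e:?S. b e * (PROD j:J. x j ^ e j))"
  using assms unfolding hpoly_def by blast
 then have "(%x. p x + q x) = (%x. SUM e:?S. (a e + b e) * (PROD j:J. x j ^ e j))"
  by (simp add: sum.distrib distrib_right)
 then show ?thesis unfolding hpoly_def by (auto intro!: exI[of _ "%e. a e + b e"])
qed

lemma hpoly_zero: "(%x. 0) : hpoly J d"
 unfolding hpoly_def by (auto intro!: exI[of _ "%e. 0"])

lemma hpoly_sum: "(!!i. i : S ==> f i : hpoly J d) ==> (%x. SUM i:S. f i x) : hpoly J d"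
 by (induction S rule: infinite_finite_induct) (auto intro: hpoly_add hpoly_zero)

lemma finite_exponents: "finite {e :: 'm::finite => nat. (SUM j:UNIV. e j) = d}"
proof (rule finite_subset)
 show "{e :: 'm => nat. (SUM j:UNIV. e j) = d} \<subseteq> PiE UNIV (%_. {..d})"
 proof
  fix e :: "'m => nat" assume e: "e : {e. (SUM j:UNIV. e j) = d}"
  have "e j <= d" for j using member_le_sum[of j UNIV e] e by simp
  then show "e : PiE UNIV (%_. {..d})" by (simp add: PiE_UNIV_domain)
 qed
qed (simp add: finite_PiE)

lemma hpoly_monomial:
 fixes e :: "'m::finite => nat"
 assumes "(SUM j:UNIV. e j) = d" shows "(%x. c * (PROD j:UNIV. x j ^ e j)) : hpoly UNIV d"
proof -
 have "c * (PROD j:UNIV. x j ^ e j) = (SUM f | (SUM j:UNIV. f j) = d. (if f = e then c else 0) * (PROD j:UNIV. x j ^ f j))" for x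
 proof -
  have "(SUM f | (SUM j:UNIV. f j) = d. (if f = e then c else 0) * (PROD j:UNIV. x j ^ f j))
  = (SUM f | (SUM j:UNIV. f j) = d. (if f = e then c * (PROD j:UNIV. x j ^ f j) else 0))"
  by (intro sum.cong) auto
  then show ?thesis using assms by (simp add: finite_exponents)
 qed
 then show ?thesis unfolding hpoly_def by (auto intro!: exI[of _ "%f. if f = e then c else 0"])
qed

lemma hpoly_mult:
 fixes p q :: "('m::finite => complex) => complex"
 assumes "p : hpoly UNIV d" "q : hpoly UNIV d'" shows "(%x. p x * q x) : hpoly UNIV (d + d')"
proof -
 let ?S = "%d. {e. (SUM j:UNIV. e j) = d}"
 obtain a where a: "p = (%x. SUM e:?S d. a e * (PROD j:UNIV. x j ^ e j))"
  using assms(1) unfolding hpoly_def by auto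
 obtain b where b: "q = (%x. SUM e:?S d'. b e * (PROD j:UNIV. x j ^ e j))"
  using assms(2) unfolding hpoly_def by auto
 have eq: "(%x. p x * q x) = (%x. SUM e:?S d. SUM f:?S d'. (a e * b f) * (PROD j:UNIV. x j ^ (e j + f j)))"
  by (simp add: a b sum_product power_add prod.distrib mult_ac)
 show ?thesis unfolding eq
  by (intro hpoly_sum hpoly_monomial) (simp add: sum.distrib)
qed

lemma polyf_homogeneous_components:
 fixes f :: "complex ^ 'm::finite => complex"
 shows "polyf f ==> EX K F. (ALL d. F d : hpoly UNIV d) & (ALL y. f y = (SUM d<=K. F d (vec_nth y)))"
proof (induction rule: polyf.induct)
 case (polyf_const c)
 have "(%x :: 'm => complex. if d = 0 then c else 0) : hpoly UNIV d" for d
  using hpoly_monomial[of "%_::'m. 0" 0 c] hpoly_zero by auto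
 then show ?case by (intro exI[of _ 0] exI[of _ "%d x. if d = 0 then c else 0"]) auto
next
 case (polyf_coord j)
 have "(%x :: 'm => complex. if d = 1 then x j else 0) : hpoly UNIV d" for d
 proof (cases "d = 1")
  case True
  have "(PROD i:UNIV. x i ^ (if i = j then 1 else 0)) = x j" for x :: "'m => complex"
  by (subst prod.remove[of _ j]) auto
  then show ?thesis using True hpoly_monomial[of "%i. if i = j then 1 else 0" 1 1] by simp
 qed (use hpoly_zero in auto)
 then show ?case by (intro exI[of _ 1] exI[of _ "%d x. if d = 1 then x j else 0"]) (auto simp: atMost_Suc)
next
 case (polyf_add f g)
 then obtain K F L G where F: "!!d. F d : hpoly UNIV d" "!!y. f y = (SUM d<=K. F d (vec_nth y))"
  and G: "!!d. G d : hpoly UNIV d" "!!y. g y = (SUM d<=L. G d (vec_nth y))" by metis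
 let ?H = "%d x. (if d <= K then F d x else 0) + (if d <= L then G d x else 0)"
 have "?H d : hpoly UNIV d" for d
  by (intro hpoly_add; cases "d <= K"; cases "d <= L"; simp add: F(1) G(1) hpoly_zero)
 moreover have "f y + g y = (SUM d<=max K L. ?H d (vec_nth y))" for y
 proof -
  have "(SUM d<=max K L. if d <= K then F d (vec_nth y) else 0) = (SUM d<=K. F d (vec_nth y))"
  "(SUM d<=max K L. if d <= L then G d (vec_nth y) else 0) = (SUM d<=L. G d (vec_nth y))"
  by (rule sum.mono_neutral_cong_right; auto)+
  then show ?thesis by (simp add: sum.distrib F G)
 qed
 ultimately show ?case by (intro exI[of _ "max K L"] exI[of _ ?H]) auto
next
 case (polyf_mult f g)
 then obtain K F L G where F: "!!d. F d : hpoly UNIV d" "!!y. f y = (SUM d<=K. F d (vec_nth y))"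
  and G: "!!d. G d : hpoly UNIV d" "!!y. g y = (SUM d<=L. G d (vec_nth y))" by metis
 let ?P = "{..K} \<times> {..L}"
 let ?H = "%k x. SUM p | p : ?P & fst p + snd p = k. F (fst p) x * G (snd p) x"
 have "?H k : hpoly UNIV k" for k
  using hpoly_mult F(1) G(1) by (intro hpoly_sum) blast
 moreover have "f y * g y = (SUM k<=K + L. ?H k (vec_nth y))" for y
 proof -
  have "f y * g y = (SUM p:?P. F (fst p) (vec_nth y) * G (snd p) (vec_nth y))"
  by (simp add: F G sum_product sum.cartesian_product case_prod_beta)
  also have "... = (SUM k<=K + L. ?H k (vec_nth y))"
  by (rule sum.group[symmetric]) auto
  finally show ?thesis .
 qed
 ultimately show ?case by (intro exI[of _ "K + L"] exI[of _ ?H]) auto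
qed

lemma polyf_compose_scale: "polyf f ==> polyf (%y. f (c *s y))"
 by (induction rule: polyf.induct) (auto intro: polyf.intros)

lemma bl_vscale: "bounded_linear (%v. c *s (v :: complex ^ 'm))"
proof -
 have "linear (%v. c *s (v :: complex ^ 'm))"
  by (rule linearI) (auto simp: vec_eq_iff algebra_simps)
 then show ?thesis by (simp add: lin_bl)
qed

lemma bl_vscale_left: "bounded_linear (%c. c *s (v :: complex ^ 'm))"
proof -
 have "linear (%c. c *s (v :: complex ^ 'm))"
  by (rule linearI) (auto simp: vec_eq_iff algebra_simps)
 then show ?thesis by (simp add: lin_bl)
qed

lemma proj_closed_eqs:
 assumes "proj_closed (Z :: (complex ^ 'm::finite) set)"
 obtains P where "P \<subseteq> (\<Union>d. hpoly UNIV d)" "Z = {x. x ~= 0 & (ALL p:P. p (vec_nth x) = 0)}"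
proof -
 obtain P where P: "P \<subseteq> (\<Union>d. hpoly UNIV d)" "vec_nth ` Z = {z. z ~= (%_. 0) & (ALL p:P. p z = 0)}"
  using assms unfolding proj_closed_def zariski_closed_def by auto
 have "x : Z \<longleftrightarrow> x ~= 0 & (ALL p:P. p (vec_nth x) = 0)" for x
 proof -
  have "x : Z \<longleftrightarrow> vec_nth x : vec_nth ` Z" by (auto simp: vec_nth_inject)
  then show ?thesis using P(2) by (auto simp: vec_eq_iff fun_eq_iff)
 qed
 then show thesis using P(1) by (intro that[of P]) auto
qed

text \<open>Smoothness of the variety means that the Zariski tangent spaces have the expected dimension.\<close>

locale smooth_cone =
 fixes X :: "(complex ^ 'm::finite) set" and n :: nat
 assumes closed_X: "proj_closed X" and dim_T: "!!x. x : X ==> vec.dim (cone_tangent X x) = n + 1"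
begin

abbreviation T where "T == cone_tangent X"

definition vanishing :: "(complex ^ 'm => complex) => bool" where
 "vanishing f \<longleftrightarrow> polyf f & (ALL x:X. f x = 0)"

lemmas X_eqs = proj_closed_eqs[OF closed_X]

lemma zero_notin_X: "0 ~: X"
 by (rule X_eqs) auto

lemma scale_X: "x : X ==> c ~= 0 ==> c *s x : X"
proof (rule X_eqs)
 fix P assume P: "P \<subseteq> (\<Union>d. hpoly UNIV d)" "X = {x. x ~= 0 & (ALL p:P. p (vec_nth x) = 0)}" and x: "x : X" "c ~= 0"
 have "p (vec_nth (c *s x)) = 0" if p: "p : P" for p
 proof -
  obtain d where "p : hpoly UNIV d" using P(1) p by blast
  moreover have "vec_nth (c *s x) = (%j. c * x $ j)" by (auto simp: vector_scalar_mult_def)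
  ultimately show ?thesis using hpoly_scale[of p UNIV d c "vec_nth x"] x(1) p P(2) by auto
 qed
 then show "c *s x : X" using x P(2) by auto
qed

lemma vanishing_tangent:
 assumes f: "vanishing f" and x: "x : X" and v: "v : T x" shows "fd f x v = 0"
proof -
 obtain K F where F: "!!d. F d : hpoly UNIV d" "!!y. f y = (SUM d<=K. F d (vec_nth y))"
  using polyf_homogeneous_components f unfolding vanishing_def by metis
 have van: "F d (vec_nth y) = 0" if y: "y : X" and d: "d <= K" for y d
 proof (rule ccontr)
  assume ne: "F d (vec_nth y) ~= 0"
  have "(SUM d<=K. F d (vec_nth y) * c ^ d) = 0" if c: "c ~= 0" for c
  proof -
  have "vec_nth (c *s y) = (%j. c * y $ j)" by (auto simp: vector_scalar_mult_def)
  then have "f (c *s y) = (SUM d<=K. F d (vec_nth y) * c ^ d)"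
  using hpoly_scale[OF F(1), of _ c "vec_nth y"] by (simp add: F(2) mult.commute)
  then show ?thesis using f scale_X[OF y c] by (simp add: vanishing_def)
  qed
  then have "UNIV - {0} \<subseteq> {c. (SUM d<=K. F d (vec_nth y) * c ^ d) = 0}" by auto
  moreover have "finite {c. (SUM d<=K. F d (vec_nth y) * c ^ d) = 0}"
  using polyfun_rootbound[of K "%d. F d (vec_nth y)"] ne d by blast
  ultimately have "finite (UNIV - {0::complex})" using finite_subset by blast
  then show False using infinite_UNIV_char_0 by (metis finite_Diff2 finite.emptyI finite_insert)
 qed
 have "((%y. SUM d<=K. F d (vec_nth y)) has_derivative (%v. SUM d<=K. fd (%y. F d (vec_nth y)) x v)) (at x)"
  by (intro has_derivative_sum smooth_deriv polyf_smooth hpoly_polyf[OF F(1)])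
 moreover have "f = (%y. SUM d<=K. F d (vec_nth y))" using F(2) by blast
 ultimately have "(f has_derivative (%v. SUM d<=K. fd (%y. F d (vec_nth y)) x v)) (at x)" by (simp only:)
 from fun_cong[OF fd_eq[OF this]] have "fd f x v = (SUM d<=K. fd (%y. F d (vec_nth y)) x v)" .
 also have "... = 0"
 proof (intro sum.neutral ballI)
  fix d assume "d : {..K}"
  then have "ALL y:X. F d (vec_nth y) = 0" using van by simp
  then show "fd (%y. F d (vec_nth y)) x v = 0" using v F(1)[of d] unfolding cone_tangent_def by blast
 qed
 finally show ?thesis .
qed

lemma T_iff: "x : X ==> v : T x \<longleftrightarrow> (ALL f. vanishing f --> fd f x v = 0)"
 using vanishing_tangent hpoly_polyf unfolding cone_tangent_def vanishing_def by blast

lemma subspace_T: "x : X ==> vec.subspace (T x)"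
proof (rule vec.subspaceI)
 assume x: "x : X"
 have v: "polyf f" if "vanishing f" for f using that by (simp add: vanishing_def)
 have l: "linear (fd f x)" if "vanishing f" for f using smooth_lin polyf_smooth v that by blast
 show "0 : T x" using T_iff[OF x] linear_0[OF l] by blast
 show "a + b : T x" if "a : T x" "b : T x" for a b
  using that linear_add[OF l] unfolding T_iff[OF x] by simp
 show "c *s a : T x" if "a : T x" for a c
  using that fd_polyf_scale[OF v] unfolding T_iff[OF x] by simp
qed

lemma T_add: "x : X ==> a : T x ==> b : T x ==> a + b : T x"
 and T_scale: "x : X ==> a : T x ==> c *s a : T x"
 and T_diff: "x : X ==> a : T x ==> b : T x ==> a - b : T x"
 and T_zero: "x : X ==> 0 : T x"
 using subspace_T vec.subspace_add vec.subspace_scale vec.subspace_diff vec.subspace_0 by blast+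

lemma tangent_map:
 fixes F :: "'a::real_normed_vector => complex ^ 'm"
 assumes F: "(F has_derivative F') (at z)" and V: "open V" "z : V" "!!y. y : V ==> F y : X"
 shows "F' v : T (F z)"
proof -
 have "fd f (F z) (F' v) = 0" if f: "vanishing f" for f
 proof -
  have s: "smooth_at (F z) f" using f polyf_smooth unfolding vanishing_def by blast
  have "((%y. f (F y)) has_derivative (%v. fd f (F z) (F' v))) (at z)"
  using diff_chain_at[OF F smooth_deriv[OF s]] by (simp add: o_def)
  moreover have "((%y. f (F y)) has_derivative (%v. 0)) (at z)"
  by (rule deriv_transform[OF has_derivative_const[of 0] V(1,2)])
  (use f V(3) in \<open>simp add: vanishing_def\<close>)
  ultimately show ?thesis using has_derivative_unique by metis
 qed
 then show ?thesis using T_iff V by blast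
qed

lemma radial_T: "x : X ==> c *s x : T x"
proof -
 assume x: "x : X"
 have "(1::complex) *s x : T ((1::complex) *s x)"
 proof (rule tangent_map[where F="%c::complex. c *s x" and V="- {0}"])
  show "((%c. c *s x) has_derivative (%c. c *s x)) (at (1::complex))"
  by (rule deriv_bl[OF bl_vscale_left])
 qed (use scale_X[OF x] in auto)
 then show ?thesis using T_scale[OF x, of x c] by simp
qed

lemma T_cone: "x : X ==> c ~= 0 ==> T (c *s x) = T x"
proof -
 have *: "v : T (c *s x)" if x: "x : X" and c: "c ~= 0" and v: "v : T x" for x c v
 proof -
  have "fd f (c *s x) v = 0" if f: "vanishing f" for f
  proof -
  have "vanishing (%y. f (c *s y))"
  using f scale_X[OF _ c] polyf_compose_scale by (auto simp: vanishing_def)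
  then have "fd (%y. f (c *s y)) x v = 0" using vanishing_tangent x v by blast
  moreover have "smooth_at (c *s x) f" "smooth_at x (%y. c *s y)"
  using f polyf_smooth smooth_bl[OF bl_vscale smooth_ident] by (auto simp: vanishing_def)
  ultimately have "fd f (c *s x) (fd (%y. c *s y) x v) = 0" using fd_compose[of x "%y. c *s y" f v] by simp
  moreover have "fd (%y. c *s y) x v = c *s v"
  using fd_eq[OF deriv_bl[OF bl_vscale]] by metis
  moreover have "polyf f" using f by (simp add: vanishing_def)
  ultimately show ?thesis using fd_polyf_scale[of f "c *s x" c v] c by simp
  qed
  then show ?thesis using T_iff[OF scale_X[OF x c]] by blast
 qed
 assume x: "x : X" and c: "c ~= 0"
 have "T (c *s x) \<subseteq> T (inverse c *s (c *s x))"
  using *[OF scale_X[OF x c], of "inverse c"] c by auto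
 then show "T (c *s x) = T x" using *[OF x c] c by (auto simp: vs_assoc)
qed

text \<open>The annihilator of the tangent space consists of differentials of equations: these differentials form a
subspace, and a functional outside it would be separated from it by a tangent vector.\<close>

lemma tangent_annihilator:
 assumes x: "x : X" and a: "!!v. v : T x ==> (SUM j:UNIV. v $ j * a $ j) = 0"
 obtains f where "vanishing f" "!!v. fd f x v = (SUM j:UNIV. v $ j * a $ j)"
proof -
 define A where "A = {a. EX f. vanishing f & (ALL v. fd f x v = (SUM j:UNIV. v $ j * a $ j))}"
 have A0: "0 : A" unfolding A_def
  by (auto intro!: exI[of _ "%y. 0"] simp: vanishing_def intro: polyf_const)
 have Aadd: "a + b : A" if "a : A" "b : A" for a b
 proof -
  obtain f where "vanishing f" "!!v. fd f x v = (SUM j:UNIV. v $ j * a $ j)" using \<open>a : A\<close> unfolding A_def by blast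
  moreover obtain g where "vanishing g" "!!v. fd g x v = (SUM j:UNIV. v $ j * b $ j)" using \<open>b : A\<close> unfolding A_def by blast
  ultimately show ?thesis unfolding A_def
  using fd_add[OF polyf_smooth polyf_smooth, of f g x]
  by (auto intro!: exI[of _ "%y. f y + g y"] simp: vanishing_def distrib_left sum.distrib intro: polyf_add)
 qed
 have Asc: "c *s a : A" if "a : A" for a c
 proof -
  obtain f where f: "vanishing f" "!!v. fd f x v = (SUM j:UNIV. v $ j * a $ j)" using \<open>a : A\<close> unfolding A_def by blast
  then have "fd (%y. c * f y) x v = (SUM j:UNIV. v $ j * (c *s a) $ j)" for v
  using fd_bl[OF bounded_linear_mult_right polyf_smooth, of f c x]
  by (simp add: vanishing_def sum_distrib_left mult_ac)
  moreover have "vanishing (%y. c * f y)" using f by (auto simp: vanishing_def intro: polyf_mult polyf_const)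
  ultimately show ?thesis unfolding A_def by blast
 qed
 have Asub: "subspace A"
 proof (rule subspaceI)
  show "c *r a : A" if "a : A" for a c
  using Asc[OF that, of "of_real c"] by (simp add: vector_scalar_mult_def scaleR_vec_def scaleR_conv_of_real)
 qed (use A0 Aadd in auto)
 obtain a1 a2 where a12: "a1 : A" "!!b. b : A ==> orthogonal a2 b" "a = a1 + a2"
  using orthogonal_subspace_decomp_exists[of A a] span_eq_iff[THEN iffD2, OF Asub] by metis
 define v where "v = (\<chi> j. cnj (a2 $ j))"
 have vb: "(SUM j:UNIV. v $ j * b $ j) = 0" if b: "b : A" for b
 proof -
  have re: "Re (SUM j:UNIV. v $ j * b $ j) = a2 \<bullet> b" for b
  by (simp add: v_def inner_vec_def inner_complex_def)
  have "(SUM j:UNIV. v $ j * (\<i> *s b) $ j) = \<i> * (SUM j:UNIV. v $ j * b $ j)"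
  by (simp add: sum_distrib_left mult_ac)
  then have "Im (SUM j:UNIV. v $ j * b $ j) = - (a2 \<bullet> (\<i> *s b))" using re[of "\<i> *s b"] by simp
  then show ?thesis using re[of b] a12(2)[OF b] a12(2)[OF Asc[OF b, of \<i>]]
  by (simp add: orthogonal_def complex_eq_iff)
 qed
 have "v : T x"
 proof (subst T_iff[OF x], intro allI impI)
  fix f assume f: "vanishing f"
  have "fd f x w = (SUM j:UNIV. w $ j * (\<chi> j. pd f j x) $ j)" for w
  using polyf_pd(2)[of f x w] f by (simp add: vanishing_def)
  then have "(\<chi> j. pd f j x) : A" using f unfolding A_def by blast
  from vb[OF this] show "fd f x v = 0" using polyf_pd(2)[of f x v] f by (simp add: vanishing_def)
 qed
 from a[OF this] have "(SUM j:UNIV. v $ j * a2 $ j) = 0"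
  using vb[OF a12(1)] by (simp add: a12(3) distrib_left sum.distrib)
 moreover have "Re (SUM j:UNIV. v $ j * a2 $ j) = a2 \<bullet> a2" by (simp add: v_def inner_vec_def inner_complex_def)
 ultimately have "a2 = 0" by simp
 then have "a : A" using a12 by simp
 then show thesis using that unfolding A_def by blast
qed

lemma tangent_projection:
 assumes "x : X"
 obtains pr where "!!v. pr v : T x" "!!v. v : T x ==> pr v = v" "!!v w. pr (v + w) = pr v + pr w" "!!c v. pr (c *s v) = c *s pr v"
proof -
 have "EX g. g ` UNIV \<subseteq> T x & Vector_Spaces.linear (*s) (*s) g & (ALL v:T x. g (id v) = v)"
  by (rule vec.linear_exists_left_inverse_on[OF vec.linear_id subspace_T[OF assms]]) simp
 then obtain g where g: "g ` UNIV \<subseteq> T x" "Vector_Spaces.linear (*s) (*s) g" "!!v. v:T x ==> g v = v" by auto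
 interpret Vector_Spaces.linear "(*s)" "(*s)" g by (rule g)
 show thesis by (rule that[of g]) (use g add scale in auto)
qed

end

section \<open>Local structure of the cone\<close>

lemma norm_vscale: "norm (c *s (v :: complex ^ 'm)) = cmod c * norm v"
 by (simp add: norm_vec_def norm_mult L2_set_right_distrib)

lemma det_nonzero_iff_inj: "det (A :: complex ^ 'm ^ 'm) ~= 0 \<longleftrightarrow> inj ((*v) A)"
 by (simp add: invertible_det_nz[symmetric] invertible_left_inverse matrix_left_invertible_injective)

context smooth_cone
begin

text \<open>Equations with differential \<open>1 - pr\<close> at \<open>x0\<close> (\<open>tangent_annihilator\<close>), plus \<open>pr\<close>, form a local diffeomorphism \<open>Tht\<close> of
the ambient space that maps \<open>X\<close> into \<open>T x0\<close>. The point is that the inverse maps \<open>T x0\<close> into \<open>X\<close>. As the tangent spaces of \<open>X\<close>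
have constant dimension, the constant field \<open>w : T x0\<close> corresponds, up to a factor, to a polynomial field \<open>th w\<close> that is
tangent to \<open>X\<close>; its derivation \<open>D w\<close> preserves the polynomials that vanish on \<open>X\<close>. So such a polynomial has zero
derivatives of all orders at \<open>x0\<close> along each complex line of the chart, on which it is holomorphic, and it vanishes there.\<close>

lemma local_structure:
 assumes x0: "x0 : X"
 obtains N r kap pr where "open N" "x0 : N"
  "!!z. z : N ==> smooth_at z r & smooth_at z kap & r z : X"
  "!!z. z : N ==> z : X \<longleftrightarrow> kap z = 0"
  "!!z. z : N ==> z : X ==> r z = z"
  "!!z v. z : N ==> z : X ==> v : T z ==> fd r z v = v"
  "!!v. pr v : T x0" "!!v. v : T x0 ==> pr v = v" "linear pr"
  "fd r x0 = pr" "!!v. fd kap x0 v = v - pr v" "!!z. pr (kap z) = 0"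
proof -
 obtain pr where pr: "!!v. pr v : T x0" "!!v. v : T x0 ==> pr v = v" "!!v w. pr (v + w) = pr v + pr w" "!!c v. pr (c *s v) = c *s pr v"
  using tangent_projection[OF x0] by metis
 have prl: "Vector_Spaces.linear (*s) (*s) pr" by unfold_locales (simp_all add: pr)
 have pr_scaleR: "pr (c *r v) = c *r pr v" for c v
  using pr(4)[of "of_real c" v] by (simp add: vector_scalar_mult_def scaleR_vec_def scaleR_conv_of_real)
 have lin: "linear pr" by (rule linearI) (simp_all add: pr pr_scaleR)
 then have bl: "bounded_linear pr" by (simp add: lin_bl)
 have comp: "pr v $ i = (SUM j:UNIV. v $ j * pr (axis j 1) $ i)" for v i by (rule linear_componentwise[OF prl])
 have prpr: "pr (pr v) = pr v" for v by (rule pr(2)[OF pr(1)])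
 have comp': "v $ i = (SUM j:UNIV. v $ j * axis j 1 $ i)" for v :: "complex ^ 'm" and i
  by (simp add: axis_def if_distrib cong: if_cong)
 have "EX f. vanishing f & (ALL v. fd f x0 v = (v - pr v) $ i)" for i
 proof -
  have e: "(SUM j:UNIV. v $ j * (\<chi> j. (axis j 1 - pr (axis j 1)) $ i) $ j) = (v - pr v) $ i" for v
  by (simp add: comp[of v] right_diff_distrib sum_subtractf comp'[of v i, symmetric])
  show ?thesis
  proof (rule tangent_annihilator[OF x0, of "\<chi> j. (axis j 1 - pr (axis j 1)) $ i"])
  show "(SUM j:UNIV. v $ j * (\<chi> j. (axis j 1 - pr (axis j 1)) $ i) $ j) = 0" if "v : T x0" for v
  unfolding e using pr(2)[OF that] by simp
  qed (unfold e, blast)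
 qed
 then obtain f0 where f0: "!!i. vanishing (f0 i)" "!!i v. fd (f0 i) x0 v = (v - pr v) $ i" by metis
 define K where "K i z = f0 i z - (SUM j:UNIV. f0 j z * pr (axis j 1) $ i)" for i z
 define kap where "kap z = (\<chi> i. K i z)" for z
 have kapeq: "kap z = (\<chi> i. f0 i z) - pr (\<chi> i. f0 i z)" for z
  by (simp add: kap_def K_def vec_eq_iff comp[of "\<chi> i. f0 i z"])
 have prkap: "pr (kap z) = 0" for z using linear_diff[OF lin] prpr by (simp add: kapeq)
 have Kp: "polyf (K i)" for i unfolding K_def[abs_def]
  using f0(1) by (intro polyf_diff polyf_sum polyf_mult polyf_const) (auto simp: vanishing_def)
 have Kv: "vanishing (K i)" for i
  unfolding vanishing_def using Kp f0(1) by (auto simp: K_def vanishing_def)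
 have kaps: "smooth_at z kap" for z unfolding kap_def[abs_def] by (intro smooth_vec_lambda polyf_smooth Kp)
 have kapfd: "fd kap z v $ i = fd (K i) z v" for z v i
  using fd_bl[OF bounded_linear_vec_nth kaps, of i z v] by (simp add: kap_def)
 have kapx0: "fd kap x0 v = v - pr v" for v
 proof -
  have s: "smooth_at x0 (%z. \<chi> i. f0 i z)"
  using f0(1) by (intro smooth_vec_lambda polyf_smooth) (simp add: vanishing_def)
  have i: "fd (%z. \<chi> i. f0 i z) x0 v = v - pr v"
  using fd_bl[OF bounded_linear_vec_nth s, of _ v] by (simp add: vec_eq_iff f0(2))
  have "fd kap x0 v = fd (%z. \<chi> i. f0 i z) x0 v - fd (%z. pr (\<chi> i. f0 i z)) x0 v"
  unfolding kapeq[abs_def] by (intro fd_diff s smooth_bl[OF bl])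
  also have "... = (v - pr v) - pr (v - pr v)" by (simp add: fd_bl[OF bl s] i)
  finally show ?thesis using linear_diff[OF lin] prpr by simp
 qed
 define M where "M z = (\<chi> i j. pr (axis j 1) $ i + pd (K i) j z)" for z
 have Mv: "M z *v v = pr v + fd kap z v" for z v
  by (simp add: vec_eq_iff M_def matrix_vector_mult_def kapfd polyf_pd(2)[OF Kp] comp[of v] distrib_left sum.distrib mult.commute[of _ "v $ _"])
 define dM where "dM z = det (M z)" for z
 have Mp: "polyf (%z. M z $ i $ j)" for i j
  unfolding M_def by (simp add: polyf_add polyf_const polyf_pd(1)[OF Kp])
 have dMp: "polyf dM" unfolding dM_def[abs_def] by (rule polyf_det) (rule Mp)
 define th where "th w z = (\<chi> k. det (\<chi> i j. if j = k then w $ i else M z $ i $ j) * dM z)" for w z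
 have thp: "polyf (%z. th w z $ k)" for w k unfolding th_def
 proof (simp, intro polyf_mult dMp polyf_det)
  show "polyf (%z. (\<chi> i j. if j = k then w $ i else M z $ i $ j) $ i $ j)" for i j
  by (cases "j = k") (simp_all add: Mp polyf_const)
 qed
 have Mth: "M z *v th w z = (dM z)\<^sup>2 *s w" if "dM z ~= 0" for z w
 proof -
  define x where "x = (\<chi> k. det (\<chi> i j. if j = k then w $ i else M z $ i $ j) / dM z)"
  have "M z *v x = w" using cramer[of "M z" x w] that by (simp add: x_def dM_def)
  moreover have "th w z = (dM z)\<^sup>2 *s x" using that by (simp add: th_def x_def vec_eq_iff power2_eq_square)
  ultimately show ?thesis by (simp add: vec.scale)
 qed
 have ker: "v : T z" if z: "z : X" "dM z ~= 0" and v: "fd kap z v = 0" for z v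
 proof -
  let ?S = "{v. fd kap z v = 0}"
  have injM: "inj ((*v) (M z))" using z(2) by (simp add: dM_def det_nonzero_iff_inj)
  have "vec.subspace ?S"
  proof (rule vec.subspaceI)
  show "c *s a : ?S" if "a : ?S" for a c
  using that fd_polyf_scale[OF Kp] kapfd by (auto simp: vec_eq_iff)
  qed (simp_all add: linear_0[OF smooth_lin[OF kaps]] linear_add[OF smooth_lin[OF kaps]])
  moreover have sub: "T z \<subseteq> ?S"
  using vanishing_tangent[OF Kv z(1)] kapfd by (auto simp: vec_eq_iff)
  moreover have "vec.dim ?S <= vec.dim (T z)"
  proof -
  have "vec.dim ?S = vec.dim ((*v) (M z) ` ?S)"
  using vec.dim_image_eq[OF matrix_vector_mul_linear_gen, of "M z" ?S] injM by (simp add: inj_on_subset)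
  also have "... <= vec.dim (T x0)"
  by (rule vec.dim_subset) (auto simp: Mv pr(1))
  finally show ?thesis using dim_T x0 z by simp
  qed
  ultimately have "T z = ?S" using vec.subspace_dim_equal[OF subspace_T[OF z(1)]] by blast
  then show ?thesis using v by blast
 qed
 define D where "D w f z = (SUM k:UNIV. th w z $ k * pd f k z)" for w f z
 have Dp: "polyf (D w f)" if "polyf f" for w f unfolding D_def[abs_def]
  by (intro polyf_sum polyf_mult thp polyf_pd that)
 have Dv: "vanishing (D w f)" if w: "w : T x0" and f: "vanishing f" for w f
  unfolding vanishing_def
 proof (intro conjI ballI)
  show "polyf (D w f)" using f by (intro Dp) (simp add: vanishing_def)
  fix z assume z: "z : X"
  have e: "D w f z = fd f z (th w z)" using f by (simp add: D_def polyf_pd(2) vanishing_def)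
  show "D w f z = 0"
  proof (cases "dM z = 0")
  case True then show ?thesis by (simp add: D_def th_def)
  next
  case False
  have w': "(dM z)\<^sup>2 *s w : T x0" using T_scale[OF x0 w] .
  have eq: "pr (th w z) + fd kap z (th w z) = (dM z)\<^sup>2 *s w" using Mth[OF False] Mv by metis
  have "pr (fd kap z (th w z)) = 0"
  proof -
  have "pr (fd kap z (th w z)) = fd (%z. pr (kap z)) z (th w z)"
  using fd_bl[OF bl kaps] by simp
  then show ?thesis by (simp add: prkap)
  qed
  then have "pr (th w z) = pr ((dM z)\<^sup>2 *s w)" using arg_cong[OF eq, of pr] by (simp add: pr(3) prpr)
  then have "fd kap z (th w z) = 0" using eq pr(2)[OF w'] by simp
  then have "th w z : T z" using ker[OF z False] by blast
  then show ?thesis using vanishing_tangent[OF f z] e by simp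
  qed
 qed
 define Tht where "Tht z = pr (z - x0) + kap z" for z
 have Thts: "smooth_at z Tht" for z unfolding Tht_def[abs_def]
  by (intro smooth_add smooth_bl[OF bl] smooth_diff smooth_ident smooth_const kaps)
 have Thtfd: "fd Tht z v = M z *v v" for z v
 proof -
  have "fd Tht z v = fd (%z. pr (z - x0)) z v + fd kap z v" unfolding Tht_def[abs_def]
  by (intro fd_add smooth_bl[OF bl] smooth_diff smooth_ident smooth_const kaps)
  also have "fd (%z. pr (z - x0)) z v = pr v"
  using fd_bl[OF bl, of z "%z. z - x0" v] fd_diff[of z "%z. z" "%z. x0" v] smooth_diff[of z "%z. z" "%z. x0"] by simp
  finally show ?thesis by (simp add: Mv)
 qed
 have Thtx0: "fd Tht x0 v = v" for v by (simp add: Thtfd Mv kapx0)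
 have injTht: "inj (fd Tht x0)" by (simp add: Thtx0 inj_def)
 obtain U V g where UV: "open U" "x0 : U" "open V" "Tht x0 : V"
  "!!x. x : U ==> Tht x : V & g (Tht x) = x & smooth_at x Tht & inj (fd Tht x)"
  "!!y. y : V ==> g y : U & Tht (g y) = y & smooth_at y g"
  by (rule smooth_inverse_function[OF Thts injTht], rule that, assumption+)
 have kap0: "kap z = 0" if "z : X" for z using that Kv by (simp add: kap_def vec_eq_iff vanishing_def)
 have Tht0: "Tht x0 = 0" using kap0[OF x0] linear_0[OF lin] by (simp add: Tht_def)
 have g0: "g 0 = x0" using UV(2,5) Tht0 by metis
 have "isCont g 0" using UV(4,6) Tht0 smooth_isCont by metis
 moreover have "g 0 ~= 0" using g0 x0 zero_notin_X by metis
 ultimately have "\<forall>\<^sub>F y in at 0. g y ~= 0" using tendsto_imp_eventually_ne by (metis isCont_def)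
 then have "around 0 (%y. g y ~= 0)" using \<open>g 0 ~= 0\<close> by (simp add: eventually_nhds_conv_at)
 moreover have "around 0 (%y. y : V)" using UV(3,4) Tht0 around_open by metis
 ultimately have "around 0 (%y. y : V & g y ~= 0)" by eventually_elim simp
 then obtain rho where rho: "rho > 0" "!!y. norm y < rho ==> y : V & g y ~= 0"
  unfolding eventually_nhds_metric by (auto simp: dist_norm)
 have dM0: "dM z ~= 0" if "z : U" for z
 proof -
  have "fd Tht z = (*v) (M z)" by (rule ext) (rule Thtfd)
  then show ?thesis using UV(5)[OF that] by (simp add: dM_def det_nonzero_iff_inj)
 qed
 have fdg: "M (g y) *v fd g y v = v" if "y : V" for y v
 proof -
  have "fd (%y. Tht (g y)) y v = fd Tht (g y) (fd g y v)"
  using fd_compose[of y g Tht v] UV(6)[OF that] Thts by blast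
  moreover have "fd (%y. Tht (g y)) y = fd (%y. y) y"
  by (rule fd_cong[OF UV(3) that]) (use UV(6) in blast)
  ultimately show ?thesis by (simp add: Thtfd)
 qed
 have line: "((%s. f (g (s *s w))) has_field_derivative (D w f (g (s *s w)) * inverse ((dM (g (s *s w)))\<^sup>2))) (at s)"
  if f: "polyf f" and s: "s *s w : V" for f w s
 proof -
  let ?p = "g (s *s w)"
  have pU: "?p : U" using UV(6)[OF s] by blast
  have d: "dM ?p ~= 0" by (rule dM0[OF pU])
  have sg: "smooth_at (s *s w) g" using UV(6)[OF s] by blast
  have eq: "fd g (s *s w) (c *s w) = (c / (dM ?p)\<^sup>2) *s th w ?p" for c
  proof -
  have "M ?p *v fd g (s *s w) (c *s w) = M ?p *v ((c / (dM ?p)\<^sup>2) *s th w ?p)"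
  using d by (simp add: fdg[OF s] vec.scale Mth[OF d] vs_assoc)
  moreover have "inj ((*v) (M ?p))" using d by (simp add: dM_def det_nonzero_iff_inj)
  ultimately show ?thesis by (simp add: inj_eq)
  qed
  have "((%s. s *s w) has_derivative (%c. c *s w)) (at s)"
  by (rule deriv_bl[OF bl_vscale_left])
  from diff_chain_at[OF diff_chain_at[OF this smooth_deriv[OF sg]] , of f "fd f ?p"]
  have "((%s. f (g (s *s w))) has_derivative (%c. fd f ?p (fd g (s *s w) (c *s w)))) (at s)"
  using smooth_deriv[OF polyf_smooth[OF f]] by (simp add: o_def)
  moreover have "fd f ?p (fd g (s *s w) (c *s w)) = D w f ?p * inverse ((dM ?p)\<^sup>2) * c" for c
  proof -
  have "fd f ?p (th w ?p) = D w f ?p" using polyf_pd(2)[OF f] by (simp add: D_def)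
  then show ?thesis by (simp add: eq fd_polyf_scale[OF f] divide_inverse mult_ac)
  qed
  ultimately show ?thesis by (simp add: has_field_derivative_def)
 qed
 have zero: "f (g w) = 0" if w: "w : T x0" "norm w < rho" and f: "vanishing f" for w f
 proof (cases "w = 0")
  case True
  then show ?thesis using g0 f x0 by (simp add: vanishing_def)
 next
  case False
  define B where "B = ball (0::complex) (rho / norm w)"
  have sV: "s *s w : V" if "s : B" for s
  proof -
  have "cmod s * norm w < rho" using that False by (simp add: B_def pos_less_divide_eq)
  then show ?thesis using rho(2) by (simp add: norm_vscale)
  qed
  have B: "open B" "0 : B" using rho(1) False by (auto simp: B_def)
  have hol: "(%s. f (g (s *s w))) holomorphic_on B" if "polyf f" for f
  using line[OF that sV] by (intro holomorphic_onI) (metis field_differentiable_at_within field_differentiable_def)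
  let ?q = "%s. inverse ((dM (g (s *s w)))\<^sup>2)"
  have hq: "?q holomorphic_on B"
  using hol[OF dMp] dM0 sV UV(6) by (intro holomorphic_intros) auto
  have van: "vanishing f ==> (deriv ^^ k) (%s. f (g (s *s w))) 0 = 0" for k f
  proof (induction k arbitrary: f rule: less_induct)
  case (less k)
  show ?case
  proof (cases k)
  case 0
  then show ?thesis using less.prems g0 x0 by (simp add: vanishing_def)
  next
  case (Suc j)
  have f: "polyf f" using less.prems by (simp add: vanishing_def)
  have "(deriv ^^ Suc j) (%s. f (g (s *s w))) 0 = (deriv ^^ j) (deriv (%s. f (g (s *s w)))) 0"
  by (simp add: funpow_Suc_right del: funpow.simps)
  also have "... = (deriv ^^ j) (%s. D w f (g (s *s w)) * ?q s) 0"
  proof (rule higher_deriv_cong_ev)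
  show "around 0 (%s. deriv (%s. f (g (s *s w))) s = D w f (g (s *s w)) * ?q s)"
  using around_open[OF B] by eventually_elim (rule DERIV_imp_deriv[OF line[OF f sV]])
  qed simp
  also have "... = (SUM i = 0..j. of_nat (j choose i) * (deriv ^^ i) (%s. D w f (g (s *s w))) 0 * (deriv ^^ (j - i)) ?q 0)"
  by (rule higher_deriv_mult[OF hol[OF Dp[OF f]] hq B])
  also have "... = 0"
  using less.IH[OF _ Dv[OF w(1) less.prems]] Suc by (intro sum.neutral) auto
  finally show ?thesis by (simp add: Suc)
  qed
  qed
  have "f (g (1 *s w)) = 0"
  proof (rule holomorphic_fun_eq_0_on_ball[where z=0 and r="rho / norm w" and f="%s. f (g (s *s w))"])
  show "(%s. f (g (s *s w))) holomorphic_on ball 0 (rho / norm w)"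
  using hol[of f] f by (simp add: B_def vanishing_def)
  show "1 : ball (0::complex) (rho / norm w)" using w False by (simp add: pos_less_divide_eq)
  qed (rule van[OF f])
  then show ?thesis by simp
 qed
 have gX: "g w : X" if w: "w : T x0" "norm w < rho" for w
 proof -
  obtain P where P: "P \<subseteq> (\<Union>d. hpoly UNIV d)" "X = {x. x ~= 0 & (ALL p:P. p (vec_nth x) = 0)}" by (rule X_eqs)
  have "p (vec_nth (g w)) = 0" if "p : P" for p
  proof -
  have "vanishing (%y. p (vec_nth y))"
  unfolding vanishing_def
  proof
  show "polyf (%y. p (vec_nth y))" using P(1) that hpoly_polyf by blast
  show "ALL x:X. p (vec_nth x) = 0" using P(2) that by blast
  qed
  from zero[OF w this] show ?thesis .
  qed
  then show ?thesis using P(2) rho(2)[OF w(2)] by simp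
 qed
 define N where "N = U \<inter> (%z. pr (z - x0)) -` ball 0 rho"
 define r where "r z = g (pr (z - x0))" for z
 have "continuous_on UNIV (%z. pr (z - x0))"
  by (intro linear_continuous_on_compose[OF _ lin] continuous_intros)
 then have Nopen: "open N" unfolding N_def by (intro open_Int UV open_vimage) auto
 have x0N: "x0 : N" using UV rho linear_0[OF lin] by (simp add: N_def)
 have NV: "pr (z - x0) : V" "norm (pr (z - x0)) < rho" if "z : N" for z using that rho(2) by (auto simp: N_def)
 have rs: "smooth_at z r" if "z : N" for z unfolding r_def[abs_def]
 proof (rule smooth_compose[where f="%z. pr (z - x0)" and g=g])
  show "smooth_at z (%z. pr (z - x0))"
  by (intro smooth_bl[OF bl] smooth_diff smooth_ident smooth_const)
  show "smooth_at (pr (z - x0)) g" using UV(6)[OF NV(1)[OF that]] by blast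
 qed
 have rX: "r z : X" if "z : N" for z unfolding r_def by (rule gX[OF pr(1) NV(2)[OF that]])
 have rid: "r z = z" if "z : N" "kap z = 0" for z
 proof -
  have "r z = g (Tht z)" using that by (simp add: r_def Tht_def)
  then show ?thesis using UV(5) that by (simp add: N_def)
 qed
 have fdr: "fd r z v = fd g (pr (z - x0)) (pr v)" if "z : N" for z v
 proof -
  have s: "smooth_at z (%z. pr (z - x0))" "smooth_at z (%z. z - x0)"
  by (intro smooth_bl[OF bl] smooth_diff smooth_ident smooth_const)+
  have "fd (%z. pr (z - x0)) z v = pr v"
  using fd_bl[OF bl s(2)] fd_diff[of z "%z. z" "%z. x0" v] by simp
  then show ?thesis unfolding r_def[abs_def]
  using fd_compose[OF s(1), of g v] UV(6)[OF NV(1)[OF that]] by simp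
 qed
 have fdr_inj: "fd r z v = v'" if z: "z : N" and v: "M (r z) *v v' = pr v" for z v v'
 proof -
  have "M (r z) *v fd r z v = pr v" using fdg[OF NV(1)[OF z]] by (simp add: fdr[OF z] r_def)
  moreover have "r z : U" using UV(6)[OF NV(1)[OF z]] by (simp add: r_def)
  then have "inj ((*v) (M (r z)))" using dM0 by (simp add: dM_def det_nonzero_iff_inj)
  ultimately show ?thesis using v by (metis injD)
 qed
 show thesis
 proof (rule that[of N r kap pr])
  show "z : X \<longleftrightarrow> kap z = 0" if "z : N" for z using kap0 rid[OF that] rX[OF that] by metis
  show "r z = z" if "z : N" "z : X" for z using rid[OF that(1) kap0[OF that(2)]] .
  show "fd r z v = v" if z: "z : N" "z : X" and v: "v : T z" for z v
  proof (rule fdr_inj[OF z(1)])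
  have "fd kap z v = 0" using vanishing_tangent[OF Kv z(2) v] kapfd by (simp add: vec_eq_iff)
  then show "M (r z) *v v = pr v" by (simp add: Mv rid[OF z(1) kap0[OF z(2)]])
  qed
  show "fd r x0 = pr"
  proof
  fix v
  show "fd r x0 v = pr v"
  by (rule fdr_inj[OF x0N]) (simp add: rid[OF x0N kap0[OF x0]] Mv kapx0 prpr)
  qed
  show "smooth_at z r & smooth_at z kap & r z : X" if "z : N" for z using rs kaps rX that by blast
 qed (rule Nopen x0N pr(1) pr(2) lin kapx0 prkap; assumption)+
qed

end

section \<open>Connection forms and the Fubini-Study form\<close>

text \<open>A primitive of the Fubini-Study form on families without common zeros. A common factor changes it by a closed form only
(\<open>connection_form_mult\<close>, \<open>ext_d1_connection_single\<close>).\<close>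

definition connection_form :: "'j set => ('j => 'a::euclidean_space => complex) => 'a => 'a => real" where
 "connection_form J Z y v = Im (herm J (%j. fd (Z j) y v) (%j. Z j y)) / (2 * pi * Re (herm J (%j. Z j y) (%j. Z j y)))"

lemma Re_herm_self: "Re (herm J z z) = (SUM j:J. (cmod (z j))\<^sup>2)"
 by (simp add: herm_def complex_norm_square[symmetric] flip: of_real_power)

lemma herm_self: "herm J z z = of_real (SUM j:J. (cmod (z j))\<^sup>2)"
 by (simp add: herm_def complex_norm_square[symmetric])

lemma herm_cnj: "cnj (herm J v w) = herm J w v"
 by (simp add: herm_def mult.commute)

lemma herm_self_pos: "finite J ==> j : J ==> z j ~= 0 ==> Re (herm J z z) > 0"
 unfolding Re_herm_self by (rule sum_pos2[of _ j]) auto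

lemma herm_add_left: "herm J (%j. u j + v j) w = herm J u w + herm J v w"
 by (simp add: herm_def distrib_right sum.distrib)

lemma herm_scale_left: "herm J (%j. c * v j) w = c * herm J v w"
 by (simp add: herm_def sum_distrib_left mult_ac)

lemma herm_scale_right: "herm J v (%j. c * w j) = cnj c * herm J v w"
 by (simp add: herm_def sum_distrib_left mult_ac)

lemma smooth_herm:
 assumes "!!j. j : J ==> smooth_at x (f j)" "!!j. j : J ==> smooth_at x (g j)"
 shows "smooth_at x (%y. herm J (%j. f j y) (%j. g j y))"
 unfolding herm_def using assms by (intro smooth_sum smooth_mult smooth_cnj)

lemma smooth_eventually_all:
 assumes "finite J" "!!j. j : J ==> smooth_at x (f j)"
 shows "around x (%y. ALL j:J. smooth_at y (f j))"
 using assms by (subst eventually_ball_finite_distrib) (auto intro: smooth_around)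

lemma linear_connection_form:
 assumes "!!j. j : J ==> linear (fd (Z j) y)" shows "linear (connection_form J Z y)"
proof (rule linearI)
 show "connection_form J Z y (u + v) = connection_form J Z y u + connection_form J Z y v" for u v
  using assms by (simp add: connection_form_def herm_def linear_add[OF assms] distrib_right sum.distrib add_divide_distrib)
 show "connection_form J Z y (c *r u) = c *r connection_form J Z y u" for u c
  using assms by (simp add: connection_form_def herm_def linear_scale[OF assms] sum_distrib_left)
qed

lemma smooth_form_connection:
 assumes J: "finite J" and Z: "!!j. j : J ==> smooth_at x (Z j)" and pos: "Re (herm J (%j. Z j x) (%j. Z j x)) > 0"
 shows "smooth_form x (connection_form J Z)"
 unfolding smooth_form_def
proof
 show "around x (%y. linear (connection_form J Z y))"
  using smooth_eventually_all[OF J Z] by (rule eventually_mono) (auto intro: linear_connection_form smooth_lin)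
 show "ALL v. smooth_at x (%y. connection_form J Z y v)"
  unfolding connection_form_def using pos
  by (intro allI smooth_divide smooth_Im smooth_herm smooth_fd Z smooth_mult smooth_const smooth_Re) auto
qed

lemma fd_mult_divide:
 fixes a b :: "'a::euclidean_space => real"
 assumes "smooth_at x a" "smooth_at x b" "b x ~= 0"
 shows "fd (%y. a y / b y) x v = (fd a x v * b x - a x * fd b x v) / (b x)\<^sup>2"
proof -
 have "((%y. a y / b y) has_derivative (%v. - a x * (inverse (b x) * fd b x v * inverse (b x)) + fd a x v / b x)) (at x)"
  using has_derivative_divide[OF smooth_deriv[OF assms(1)] smooth_deriv[OF assms(2)] assms(3)] .
 from fun_cong[OF fd_eq[OF this], of v] show ?thesis using assms(3) by (simp add: field_simps power2_eq_square)
qed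

lemma ext_d1_connection:
 assumes J: "finite J" and Z: "!!j. j : J ==> smooth_at x (Z j)" and pos: "Re (herm J (%j. Z j x) (%j. Z j x)) > 0"
 shows "ext_d1 (connection_form J Z) x v w = fubini_study J (%j. Z j x) (%j. fd (Z j) x v) (%j. fd (Z j) x w)"
proof -
 define R where "R = Re (herm J (%j. Z j x) (%j. Z j x))"
 let ?h = "%v w. herm J (%j. fd (Z j) x v) (%j. fd (Z j) x w)"
 let ?z = "%v. herm J (%j. fd (Z j) x v) (%j. Z j x)"
 let ?S = "%v w. herm J (%j. fd (%y. fd (Z j) y w) x v) (%j. Z j x)"
 have dh: "fd (%y. herm J (%j. f j y) (%j. g j y)) x v
  = herm J (%j. fd (f j) x v) (%j. g j x) + herm J (%j. f j x) (%j. fd (g j) x v)"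
  if f: "!!j. j : J ==> smooth_at x (f j)" and g: "!!j. j : J ==> smooth_at x (g j)" for f g v
 proof -
  have "((%y. SUM j:J. f j y * cnj (g j y)) has_derivative (%v. SUM j:J. f j x * cnj (fd (g j) x v) + fd (f j) x v * cnj (g j x))) (at x)"
  by (intro has_derivative_sum has_derivative_mult has_derivative_cnj smooth_deriv f g)
  from fun_cong[OF fd_eq[OF this], of v] show ?thesis by (simp add: herm_def sum.distrib add.commute)
 qed
 have num: "fd (%y. Im (herm J (%j. fd (Z j) y w) (%j. Z j y))) x v = Im (?S v w) + Im (?h w v)" for v w
 proof -
  have "smooth_at x (%y. herm J (%j. fd (Z j) y w) (%j. Z j y))" by (intro smooth_herm smooth_fd Z)
  from fd_bl[OF bounded_linear_Im this, of v] dh[of "%j y. fd (Z j) y w" Z v]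
  show ?thesis by (simp add: smooth_fd Z)
 qed
 have den: "fd (%y. 2 * pi * Re (herm J (%j. Z j y) (%j. Z j y))) x v = 2 * pi * (2 * Re (?z v))" for v
 proof -
  have "fd (%y. 2 * pi * Re (herm J (%j. Z j y) (%j. Z j y))) x v = 2 * pi * fd (%y. Re (herm J (%j. Z j y) (%j. Z j y))) x v"
  by (rule fd_bl[OF bounded_linear_mult_right]) (intro smooth_Re smooth_herm Z)
  also have "fd (%y. Re (herm J (%j. Z j y) (%j. Z j y))) x v = Re (?z v + cnj (?z v))"
  proof -
  have "smooth_at x (%y. herm J (%j. Z j y) (%j. Z j y))" by (intro smooth_herm Z)
  from fd_bl[OF bounded_linear_Re this, of v] dh[of Z Z v] show ?thesis by (simp add: Z herm_cnj)
  qed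
  finally show ?thesis by simp
 qed
 have D: "fd (%y. connection_form J Z y w) x v
  = ((Im (?S v w) + Im (?h w v)) * (2 * pi * R) - Im (?z w) * (2 * pi * (2 * Re (?z v)))) / (2 * pi * R)\<^sup>2" for v w
  unfolding connection_form_def
  by (subst fd_mult_divide) (use pos in \<open>auto simp: num den R_def intro!: smooth_Im smooth_herm smooth_fd Z smooth_mult smooth_Re\<close>)
 have sym: "?S v w = ?S w v"
  unfolding herm_def by (intro sum.cong refl) (simp add: fd_symmetric[OF Z, of _ v w])
 have hh: "Im (?h w v) = - Im (?h v w)" using arg_cong[OF herm_cnj[of J "%j. fd (Z j) x v" "%j. fd (Z j) x w"], of Im] by simp
 have Rne: "R ~= 0" using pos by (simp add: R_def)
 have hzz: "herm J (%j. Z j x) (%j. Z j x) = of_real R"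
  unfolding R_def Re_herm_self by (rule herm_self)
 have zw: "herm J (%j. Z j x) (%j. fd (Z j) x w) = cnj (?z w)" by (simp add: herm_cnj)
 have "ext_d1 (connection_form J Z) x v w
  = ((- 2 * Im (?h v w)) * (2 * pi * R) - Im (?z w) * (2 * pi * (2 * Re (?z v))) + Im (?z v) * (2 * pi * (2 * Re (?z w)))) / (2 * pi * R)\<^sup>2"
  unfolding ext_d1_def D by (simp add: sym hh diff_divide_distrib[symmetric] algebra_simps)
 also have "... = - (Im (?h v w) / R - (Im (?z v) * Re (?z w) - Re (?z v) * Im (?z w)) / R\<^sup>2) / pi"
  using Rne by (simp add: field_simps power2_eq_square)
 also have "... = fubini_study J (%j. Z j x) (%j. fd (Z j) x v) (%j. fd (Z j) x w)"
  unfolding fubini_study_def hzz zw by (simp flip: of_real_power)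
 finally show ?thesis .
qed

lemma herm_Cauchy_Schwarz:
 "(cmod (herm J v z))\<^sup>2 <= Re (herm J v v) * Re (herm J z z)"
proof -
 have "cmod (herm J v z) <= (SUM j:J. \<bar>cmod (v j)\<bar> * \<bar>cmod (z j)\<bar>)"
  unfolding herm_def by (rule order_trans[OF norm_sum]) (simp add: norm_mult)
 also have "... <= L2_set (%j. cmod (v j)) J * L2_set (%j. cmod (z j)) J" by (rule L2_set_mult_ineq)
 finally have "(cmod (herm J v z))\<^sup>2 <= (L2_set (%j. cmod (v j)) J * L2_set (%j. cmod (z j)) J)\<^sup>2"
  by (rule power_mono) simp
 then show ?thesis by (simp add: L2_set_def power_mult_distrib sum_nonneg Re_herm_self)
qed

lemma fubini_study_i:
 assumes "Re (herm J z z) > 0"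
 shows "fubini_study J z v (%j. \<i> * v j) = (Re (herm J v v) * Re (herm J z z) - (cmod (herm J v z))\<^sup>2) / (Re (herm J z z))\<^sup>2 / pi"
proof -
 define R where "R = Re (herm J z z)"
 have hz: "herm J z z = of_real R" and hv: "herm J v v = of_real (Re (herm J v v))"
  unfolding R_def Re_herm_self by (rule herm_self)+
 have 1: "herm J v (%j. \<i> * v j) = - \<i> * of_real (Re (herm J v v))" using hv by (simp add: herm_scale_right)
 have 2: "herm J v z * herm J z (%j. \<i> * v j) = - \<i> * of_real ((cmod (herm J v z))\<^sup>2)"
  using complex_norm_square[of "herm J v z"] herm_cnj[of J v z] by (simp add: herm_scale_right)
 have R: "R > 0" using assms by (simp add: R_def)
 show ?thesis unfolding fubini_study_def 1 2 hz R_def[symmetric]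
  using R by (simp add: field_simps power2_eq_square flip: of_real_power of_real_mult)
qed

lemma fubini_study_nonneg: "Re (herm J z z) > 0 ==> fubini_study J z v (%j. \<i> * v j) >= 0"
 using herm_Cauchy_Schwarz[of J v z] by (simp add: fubini_study_i)

lemma connection_form_mult:
 assumes Z: "!!j. j : J ==> smooth_at y (Z j)" and g: "smooth_at y g" "g y ~= 0"
  and pos: "Re (herm J (%j. Z j y) (%j. Z j y)) > 0"
 shows "connection_form J (%j y. g y * Z j y) y v = connection_form J Z y v + connection_form {()} (%_. g) y v"
proof -
 define R where "R = Re (herm J (%j. Z j y) (%j. Z j y))"
 define G where "G = (cmod (g y))\<^sup>2"
 have GR: "G > 0" "R > 0" using g pos by (auto simp: G_def R_def)
 have gg: "g y * cnj (g y) = of_real G" unfolding G_def complex_norm_square ..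
 have zz: "herm J (%j. Z j y) (%j. Z j y) = of_real R" unfolding R_def Re_herm_self by (rule herm_self)
 have "herm J (%j. fd (%y. g y * Z j y) y v) (%j. g y * Z j y)
  = herm J (%j. g y * fd (Z j) y v + fd g y v * Z j y) (%j. g y * Z j y)"
  unfolding herm_def by (intro sum.cong refl) (simp add: fd_mult[OF g(1) Z])
 also have "... = (g y * cnj (g y)) * herm J (%j. fd (Z j) y v) (%j. Z j y) + (fd g y v * cnj (g y)) * herm J (%j. Z j y) (%j. Z j y)"
  by (simp only: herm_add_left herm_scale_left herm_scale_right) (simp add: algebra_simps)
 finally have 1: "Im (herm J (%j. fd (%y. g y * Z j y) y v) (%j. g y * Z j y))
  = G * Im (herm J (%j. fd (Z j) y v) (%j. Z j y)) + R * Im (fd g y v * cnj (g y))"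
  by (simp add: gg zz)
 have 2: "Re (herm J (%j. g y * Z j y) (%j. g y * Z j y)) = G * R"
  using gg zz by (simp add: herm_scale_left herm_scale_right mult.assoc[symmetric])
 have 3: "Re (herm {()} (%_. g y) (%_. g y)) = G" by (simp add: herm_def gg)
 show ?thesis unfolding connection_form_def 1 2 3 R_def[symmetric] using GR by (simp add: herm_def field_simps)
qed

lemma ext_d1_connection_single:
 assumes "smooth_at x g" "g x ~= 0" shows "ext_d1 (connection_form {()} (%_. g)) x v w = 0"
proof -
 have pos: "Re (herm {()} (%_. g x) (%_. g x)) > 0" using assms by (intro herm_self_pos[of _ "()"]) auto
 have "ext_d1 (connection_form {()} (%_. g)) x v w = fubini_study {()} (%_. g x) (%_. fd g x v) (%_. fd g x w)"
  using ext_d1_connection[where J="{()}" and Z="%_. g" and x=x and v=v and w=w] pos assms by simp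
 also have "... = 0" using assms(2) by (simp add: fubini_study_def herm_def power2_eq_square)
 finally show ?thesis .
qed

lemma connection_form_pullback:
 assumes "smooth_at y phi" "!!j. j : J ==> smooth_at (phi y) (Z j)"
 shows "connection_form J (%j y. Z j (phi y)) y v = pullback phi (connection_form J Z) y v"
proof -
 have "herm J (%j. fd (%y. Z j (phi y)) y v) (%j. Z j (phi y)) = herm J (%j. fd (Z j) (phi y) (fd phi y v)) (%j. Z j (phi y))"
  unfolding herm_def by (intro sum.cong refl) (simp add: fd_compose[OF assms(1) assms(2)])
 then show ?thesis by (simp add: connection_form_def pullback_def)
qed

lemma smooth_form_add: "smooth_form x G ==> smooth_form x H ==> smooth_form x (%y v. G y v + H y v)"
 unfolding smooth_form_def
proof (elim conjE, intro conjI allI)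
 assume "around x (%y. linear (G y))" "around x (%y. linear (H y))"
 then show "around x (%y. linear (%v. G y v + H y v))" by eventually_elim (rule linear_compose_add)
qed (auto intro: smooth_add)

lemma form_scale:
 assumes "smooth_at x a" "smooth_form x G" shows "smooth_form x (%y v. a y * G y v)"
 unfolding smooth_form_def
proof
 have "around x (%y. linear (G y))" using assms(2) by (simp add: smooth_form_def)
 then show "around x (%y. linear (%v. a y * G y v))"
  by (rule eventually_mono) (use linear_compose_scale_right[where 'b=real] in force)
qed (use assms in \<open>auto simp: smooth_form_def intro: smooth_mult\<close>)

lemma ext_d1_add: "smooth_form x G ==> smooth_form x H ==>
  ext_d1 (%y v. G y v + H y v) x v w = ext_d1 G x v w + ext_d1 H x v w"
 by (simp add: smooth_form_def ext_d1_def fd_add)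

lemma ext_d1_scale: "smooth_at x a ==> smooth_form x G ==>
  ext_d1 (%y v. a y * G y v) x v w = a x * ext_d1 G x v w + fd a x v * G x w - fd a x w * G x v"
 by (simp add: smooth_form_def ext_d1_def fd_mult algebra_simps)

lemma ext_d1_bilinear:
 assumes "smooth_form x G" shows "bilinear (ext_d1 G x)"
proof -
 have s: "smooth_at x (%y. G y v)" for v using assms by (simp add: smooth_form_def)
 obtain V where V: "open V" "x : V" "!!y. y : V ==> linear (G y)"
  using assms around_openE unfolding smooth_form_def by metis
 have add: "fd (%y. G y (v + w)) x u = fd (%y. G y v) x u + fd (%y. G y w) x u" for u v w
  using fd_cong[OF V(1,2), of "%y. G y (v + w)" "%y. G y v + G y w"] linear_add[OF V(3)] fd_add[OF s s] by simp
 have sc: "fd (%y. G y (c *r v)) x u = c * fd (%y. G y v) x u" for u v c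
  using fd_cong[OF V(1,2), of "%y. G y (c *r v)" "%y. c * G y v"] linear_scale[OF V(3)]
  fd_bl[OF bounded_linear_mult_right s] by simp
 note l = smooth_lin[OF s]
 show ?thesis unfolding bilinear_def
  by (auto intro!: linearI simp: ext_d1_def add sc linear_add[OF l] linear_scale[OF l] algebra_simps)
qed

lemma ext_d1_skew: "ext_d1 G x v w = - ext_d1 G x w v"
 by (simp add: ext_d1_def)

lemma smooth_ext_d1: "smooth_form x G ==> smooth_at x (%y. ext_d1 G y v w)"
 unfolding ext_d1_def smooth_form_def by (intro smooth_diff smooth_fd) auto

lemma form_around: "smooth_form x G ==> around x (%y. linear (G y) & smooth_form y G)"
proof -
 assume G: "smooth_form x G"
 have lin: "around x (%y. linear (G y))" using G by (simp add: smooth_form_def)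
 then have lin2: "around x (%y. around y (%z. linear (G z)))" by (rule eventually_eventually[THEN iffD2])
 have "around x (%y. ALL b:Basis. smooth_at y (%z. G z b))"
  using G by (intro smooth_eventually_all) (auto simp: smooth_form_def)
 with lin lin2 show ?thesis
 proof eventually_elim
  case (elim y)
  have "smooth_at y (%z. G z v)" for v
  proof -
  obtain V where V: "open V" "y : V" "!!z. z : V ==> linear (G z)" using elim(2) around_openE by metis
  have "smooth_at y (%z. SUM b:Basis. (v \<bullet> b) *r G z b)" using elim(3) by (intro smooth_sum smooth_scaleR smooth_const) auto
  then show ?thesis
  using smooth_cong[OF V(1,2), of "%z. G z v" "%z. SUM b:Basis. (v \<bullet> b) *r G z b"] linear_expand[OF V(3)] by blast
  qed
  then show ?case using elim by (simp add: smooth_form_def)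
 qed
qed

text \<open>Cartan's formula without Lie derivatives: pull the form back to the product with the time axis. There it is closed and
its contraction with the time direction is \<open>0\<close>, so its coefficients do not depend on the time.\<close>

lemma flow_invariance:
 fixes Psi :: "'p::euclidean_space \<times> real => 'q::euclidean_space"
 assumes Psi: "smooth_at (p, t) Psi" and L: "smooth_form (Psi (p, t)) L"
  and ker: "around (p, t) (%q. ALL v. ext_d1 L (Psi q) (fd Psi q (v, 0)) (fd Psi q (0, 1)) = 0)"
 shows "((%s. ext_d1 L (Psi (p, s)) (fd Psi (p, s) (v, 0)) (fd Psi (p, s) (w, 0))) has_real_derivative 0) (at t)"
proof -
 define Gam where "Gam = pullback Psi L"
 have Gam: "smooth_form (p, t) Gam" unfolding Gam_def by (rule smooth_form_pullback[OF Psi L])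
 have "around (p, t) (%q. smooth_at q Psi & smooth_form (Psi q) L)"
  using smooth_around[OF Psi] around_compose[OF Psi form_around[OF L]]
  by eventually_elim simp
 then have ev: "around (p, t) (%q. ALL u v. ext_d1 Gam q u v = ext_d1 L (Psi q) (fd Psi q u) (fd Psi q v))"
  by (rule eventually_mono) (simp add: Gam_def ext_d1_pullback)
 obtain V where V: "open V" "(p, t) : V"
  "!!q. q : V ==> (ALL u v. ext_d1 Gam q u v = ext_d1 L (Psi q) (fd Psi q u) (fd Psi q v)) &
  (ALL v. ext_d1 L (Psi q) (fd Psi q (v, 0)) (fd Psi q (0, 1)) = 0)"
  using around_openE[OF eventually_conj[OF ev ker]] by metis
 have zero: "fd (%q. ext_d1 Gam q (v, 0) (0, 1)) (p, t) = (%_. 0)" for v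
  using fd_cong[OF V(1,2), of "%q. ext_d1 Gam q (v, 0) (0, 1)" "%_. 0"] V(3) by simp
 have zero': "fd (%q. ext_d1 Gam q (0, 1) (v, 0)) (p, t) = (%_. 0)" for v
  using fd_cong[OF V(1,2), of "%q. ext_d1 Gam q (0, 1) (v, 0)" "%_. 0"] V(3) ext_d1_skew[of Gam _ "(0, 1)"] by simp
 have "fd (%q. ext_d1 Gam q (v, 0) (w, 0)) (p, t) (0, 1) = 0"
  using ext_d2_ext_d1[OF Gam, of "(0, 1)" "(v, 0)" "(w, 0)"] unfolding ext_d2_def zero zero' by simp
 moreover have "((%q. ext_d1 Gam q (v, 0) (w, 0)) has_derivative fd (%q. ext_d1 Gam q (v, 0) (w, 0)) (p, t)) (at (p, t))"
  by (rule smooth_deriv[OF smooth_ext_d1[OF Gam]])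
 moreover have m: "((%s. (p, s)) has_derivative (%s. (0, s))) (at t)"
  by (intro has_derivative_Pair has_derivative_const has_derivative_ident)
 ultimately have "((%s. ext_d1 Gam (p, s) (v, 0) (w, 0)) has_derivative (%s. 0)) (at t)"
 proof -
  let ?D = "fd (%q. ext_d1 Gam q (v, 0) (w, 0)) (p, t)"
  assume 1: "?D (0, 1) = 0" and 2: "((%q. ext_d1 Gam q (v, 0) (w, 0)) has_derivative ?D) (at (p, t))"
  have "?D (0, s) = 0" for s
  using linear_scale[OF has_derivative_linear[OF 2], of s "(0, 1)"] 1 by simp
  then show ?thesis using diff_chain_at[OF m 2] by (simp add: o_def)
 qed
 moreover have "open ((%s. (p, s)) -` V)" by (intro open_vimage V(1) continuous_intros)
 ultimately have "((%s. ext_d1 L (Psi (p, s)) (fd Psi (p, s) (v, 0)) (fd Psi (p, s) (w, 0))) has_derivative (%s. 0)) (at t)"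
  by (rule deriv_transform) (use V(2,3) in auto)
 then show ?thesis by (simp add: has_field_derivative_def lambda_zero)
qed

lemma ext_d1_eq_along:
 assumes phi: "smooth_at y phi" "phi y = y" and v: "fd phi y v = v" "fd phi y w = w"
  and L: "smooth_form y L" "smooth_form y L'"
  and eq: "around y (%z. ALL u. L (phi z) (fd phi z u) = L' (phi z) (fd phi z u))"
 shows "ext_d1 L y v w = ext_d1 L' y v w"
proof -
 obtain V where V: "open V" "y : V" "!!z u. z : V ==> L (phi z) (fd phi z u) = L' (phi z) (fd phi z u)"
  using around_openE[OF eq] by metis
 have "ext_d1 (pullback phi L) y v w = ext_d1 (pullback phi L') y v w"
  by (rule ext_d1_cong[OF V(1,2)]) (simp add: pullback_def V(3))
 then show ?thesis using ext_d1_pullback[of y phi L v w] ext_d1_pullback[of y phi L' v w] phi v L by simp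
qed

section \<open>Functions and forms on the cone\<close>

definition holo_at :: "complex ^ 'm => (complex ^ 'm => complex) => bool" where
 "holo_at x G \<longleftrightarrow> smooth_at x G & (around x (%y. ALL v. fd G y (\<i> *s v) = \<i> * fd G y v))"

lemma holo_at_fd: "holo_at x G ==> fd G x (\<i> *s v) = \<i> * fd G x v"
 unfolding holo_at_def using around_self by fastforce

lemma holo_at_eventually: "holo_at x G ==> around x (%y. holo_at y G)"
proof -
 assume G: "holo_at x G"
 have 1: "around x (%y. smooth_at y G)" using G smooth_around unfolding holo_at_def by blast
 have "around x (%y. around y (%z. ALL v. fd G z (\<i> *s v) = \<i> * fd G z v))"
  using G unfolding holo_at_def by (simp add: eventually_eventually)
 with 1 show ?thesis by eventually_elim (simp add: holo_at_def)
qed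

lemma holo_at_fd_scale:
 assumes "holo_at x G" shows "fd G x (c *s v) = c * fd G x v"
proof -
 have l: "linear (fd G x)" using assms by (simp add: holo_at_def smooth_lin)
 have "c *s v = Re c *r v + Im c *r (\<i> *s v)"
  by (simp add: vec_eq_iff complex_eq_iff)
 then have "fd G x (c *s v) = Re c *r fd G x v + Im c *r (\<i> * fd G x v)"
  using linear_add[OF l] linear_scale[OF l] holo_at_fd[OF assms] by simp
 also have "... = (Re c + \<i> * Im c) * fd G x v"
  by (simp add: scaleR_conv_of_real algebra_simps)
 finally show ?thesis using complex_eq[of c] by simp
qed

context smooth_cone
begin

text \<open>Retractions replace charts of \<open>X\<close>: identities between functions and forms that hold on \<open>X\<close> are differentiated after
composition with a retraction.\<close>

lemma retraction:
 assumes "x : X"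
 obtains r where "smooth_at x r" "around x (%z. smooth_at z r & r z : X & (ALL v. fd r z v : T (r z)))"
  "around x (%z. z : X --> r z = z & (ALL v:T z. fd r z v = v))"
  "r x = x" "!!v. v : T x ==> fd r x v = v"
proof -
 obtain M r and kap :: "complex ^ 'm => complex ^ 'm" and pr where M: "open M" "x : M"
  "!!z. z : M ==> smooth_at z r & smooth_at z kap & r z : X"
  "!!z. z : M ==> z : X ==> r z = z"
  "!!z v. z : M ==> z : X ==> v : T z ==> fd r z v = v" "!!v. v : T x ==> pr v = v"
  by (rule local_structure[OF assms], rule that, assumption+)
 have tan: "fd r z v : T (r z)" if zM: "z : M" for z v
 proof (rule tangent_map[OF smooth_deriv M(1) zM])
  show "smooth_at z r" using M(3)[OF zM] by simp
  show "r y : X" if "y : M" for y using M(3)[OF that] by simp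
 qed
 have ev: "around x (%z. z : M)" using M(1,2) by (rule around_open)
 show thesis
 proof (rule that[of r])
  show "smooth_at x r" "r x = x" "!!v. v : T x ==> fd r x v = v" using M(2-5) assms by simp_all
  show "around x (%z. smooth_at z r & r z : X & (ALL v. fd r z v : T (r z)))"
  using ev by (rule eventually_mono) (use M(3) tan in simp)
  show "around x (%z. z : X --> r z = z & (ALL v:T z. fd r z v = v))"
  using ev by (rule eventually_mono) (use M(4,5) in simp)
 qed
qed

text \<open>Two extensions of one function on \<open>X\<close> agree after composition with a retraction, whose derivative is the identity
on tangent vectors.\<close>

lemma tangent_unique:
 fixes G :: "complex ^ 'm => 'b::real_normed_vector"
 assumes x: "x : X" and G: "smooth_at x G" "smooth_at x G'"
  and eq: "around x (%y. y : X --> G y = G' y)" and v: "v : T x"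
 shows "fd G x v = fd G' x v"
proof -
 obtain r where r: "smooth_at x r" "around x (%z. smooth_at z r & r z : X & (ALL v. fd r z v : T (r z)))"
  "r x = x" "!!v. v : T x ==> fd r x v = v"
  by (rule retraction[OF x], rule that, assumption+)
 have "around x (%z. r z : X --> G (r z) = G' (r z))"
  by (rule around_compose[OF r(1)]) (simp add: r(3) eq)
 with r(2) have "around x (%z. G (r z) = G' (r z))" by eventually_elim simp
 then obtain V where V: "open V" "x : V" "!!z. z : V ==> G (r z) = G' (r z)" by (rule around_openE) blast
 have "fd (%z. G (r z)) x v = fd (%z. G' (r z)) x v" using fd_cong[OF V] by simp
 then show ?thesis using fd_compose[OF r(1), of G v] fd_compose[OF r(1), of G' v] G r(3) r(4)[OF v] by simp
qed

definition agree_on_tangents :: "complex ^ 'm => (complex ^ 'm => complex ^ 'm => real) => (complex ^ 'm => complex ^ 'm => real) => bool" where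
 "agree_on_tangents x L L' \<longleftrightarrow> (around x (%y. y : X --> (ALL v:T y. L y v = L' y v)))"

lemma ext_d1_tangent_unique:
 assumes x: "x : X" and L: "smooth_form x L" "smooth_form x L'" and eq: "agree_on_tangents x L L'"
  and v: "v : T x" "w : T x"
 shows "ext_d1 L x v w = ext_d1 L' x v w"
proof -
 obtain r where r: "smooth_at x r" "around x (%z. smooth_at z r & r z : X & (ALL v. fd r z v : T (r z)))"
  "r x = x" "!!v. v : T x ==> fd r x v = v"
  by (rule retraction[OF x], rule that, assumption+)
 show ?thesis
 proof (rule ext_d1_eq_along[OF r(1,3) r(4)[OF v(1)] r(4)[OF v(2)] L])
  have "around x (%z. r z : X --> (ALL v:T (r z). L (r z) v = L' (r z) v))"
  by (rule around_compose[OF r(1)]) (use eq in \<open>simp add: r(3) agree_on_tangents_def\<close>)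
  with r(2) show "around x (%z. ALL u. L (r z) (fd r z u) = L' (r z) (fd r z u))"
  by eventually_elim blast
 qed
qed

lemma ext_d1_tangent_unique_product:
 fixes L :: "(complex ^ 'm) \<times> real => (complex ^ 'm) \<times> real => real"
 assumes x: "x : X" and L: "smooth_form (x, t) L" "smooth_form (x, t) L'"
  and eq: "around (x, t) (%y. fst y : X --> (ALL v. fst v : T (fst y) --> L y v = L' y v))"
  and v: "fst v : T x" "fst w : T x"
 shows "ext_d1 L (x, t) v w = ext_d1 L' (x, t) v w"
proof -
 obtain r where r: "smooth_at x r" "around x (%z. smooth_at z r & r z : X & (ALL v. fd r z v : T (r z)))"
  "r x = x" "!!v. v : T x ==> fd r x v = v"
  by (rule retraction[OF x], rule that, assumption+)
 define phi where "phi y = (r (fst y), snd y)" for y :: "(complex ^ 'm) \<times> real"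
 have sphi: "smooth_at y phi" if "smooth_at (fst y) r" for y unfolding phi_def[abs_def]
  by (intro smooth_Pair smooth_compose[OF smooth_fst_id] smooth_snd_id that)
 have fdphi: "fd phi y u = (fd r (fst y) (fst u), snd u)" if "smooth_at (fst y) r" for y u
 proof -
  have "((%y. (r (fst y), snd y)) has_derivative (%u. (fd r (fst y) (fst u), snd u))) (at y)"
  using diff_chain_at[OF deriv_bl[OF bounded_linear_fst] smooth_deriv[OF that]]
  by (intro has_derivative_Pair deriv_bl bounded_linear_snd) (simp add: o_def)
  from fun_cong[OF fd_eq[OF this]] show ?thesis by (simp add: phi_def[abs_def])
 qed
 have ev: "around (x, t) (%y. smooth_at (fst y) r & r (fst y) : X & (ALL v. fd r (fst y) v : T (r (fst y))))"
  by (rule around_compose[OF smooth_fst_id]) (simp add: r(2))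
 have s: "smooth_at (x, t) phi" using sphi r(1) by simp
 show ?thesis
 proof (rule ext_d1_eq_along[OF s _ _ _ L])
  show "phi (x, t) = (x, t)" by (simp add: phi_def r(3))
  show "fd phi (x, t) v = v" "fd phi (x, t) w = w" using fdphi[of "(x, t)"] r(1) r(4) v by simp_all
  have "around (x, t) (%z. fst (phi z) : X --> (ALL v. fst v : T (fst (phi z)) --> L (phi z) v = L' (phi z) v))"
  by (rule around_compose[OF s]) (use eq in \<open>simp add: phi_def r(3)\<close>)
  with ev show "around (x, t) (%z. ALL u. L (phi z) (fd phi z u) = L' (phi z) (fd phi z u))"
  proof eventually_elim
  case (elim z)
  have "fst (fd phi z u) : T (fst (phi z))" for u using elim(1) fdphi[of z u] by (simp add: phi_def)
  moreover have "fst (phi z) : X" using elim(1) by (simp add: phi_def)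
  ultimately show ?case using elim(2) by blast
  qed
 qed
qed

definition DX :: "(complex ^ 'm => real) => complex ^ 'm => complex ^ 'm => real" where
 "DX f x v = fd (SOME G. smooth_at x G & (around x (%y. y : X --> f y = G y))) x v"

lemma DX_eq:
 assumes "x : X" "smooth_at x G" "around x (%y. y : X --> f y = G y)" "v : T x"
 shows "DX f x v = fd G x v"
proof -
 let ?P = "%G. smooth_at x G & (around x (%y. y : X --> f y = G y))"
 define G' where "G' = (SOME G. ?P G)"
 have "?P G'" unfolding G'_def by (rule someI[of ?P G]) (use assms in blast)
 then have P: "smooth_at x G'" and e: "around x (%y. y : X --> f y = G' y)" by blast+
 have "around x (%y. y : X --> G' y = G y)" using e assms(3) by eventually_elim simp
 then have "fd G' x v = fd G x v" by (rule tangent_unique[OF assms(1) P assms(2) _ assms(4)])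
 then show ?thesis by (simp add: DX_def G'_def)
qed

end

section \<open>The interpolating closed form\<close>

text \<open>A very ample bundle with sections \<open>s l\<close> in the trivialisations \<open>k\<close>, a hermitian metric \<open>h\<close>, a form \<open>\<eta>\<close> such that \<open>\<omega>\<close> is the
Chern form plus \<open>d \<eta>\<close>, and the coefficients \<open>c i\<close> of the sections that are to vanish at the base point.\<close>

locale polarized = smooth_cone X n for X :: "(complex ^ 'm::finite) set" and n +
 fixes W :: "'k => (complex ^ 'm) set" and N :: nat and s :: "nat => 'k => complex ^ 'm => complex"
  and h :: "'k => complex ^ 'm => real"
  and \<omega> :: "complex ^ 'm => complex ^ 'm => complex ^ 'm => real"
  and \<eta> :: "complex ^ 'm => complex ^ 'm => real"
  and I :: "'n::finite set" and c :: "'n => nat => complex"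
 assumes W_cover: "(\<Union>k. W k) = X"
  and W_open: "!!x k. x : W k ==> around x (%y. y : X --> y : W k)"
  and s_holo: "!!x k l. x : W k ==> l <= N ==> EX G. holo_at x G & (around x (%y. y : X --> s l k y = G y))"
  and scaling: "!!x k u. x : W k ==> u ~= 0 ==>
  u *s x : W k & h k (u *s x) = h k x & (ALL l<=N. s l k (u *s x) = s l k x)"
  and base_point_free: "!!x k. x : W k ==> EX l<=N. s l k x ~= 0"
  and cocycle: "!!x k k'. x : W k ==> x : W k' ==>
  EX u. (ALL l<=N. s l k x = u * s l k' x) & h k' x = (cmod u)\<^sup>2 * h k x"
  and h_pos: "!!x k. x : W k ==> h k x > 0"
  and \<eta>_scale: "!!x u v. x : X ==> u ~= 0 ==> v : T x ==> \<eta> (u *s x) (u *s v) = \<eta> x v"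
  and \<eta>_radial: "!!x u. x : X ==> \<eta> x (u *s x) = 0"
  and curvature: "!!x k. x : W k ==> EX th e. smooth_at x th & smooth_form x e &
  (around x (%y. y : X --> th y = ln (h k y) & (ALL v:T y. e y v = \<eta> y v))) &
  (ALL v:T x. ALL w:T x. \<omega> x v w = ext_d1 (%y v. e y v + fd th y (\<i> *s v) / (4 * pi)) x v w)"
  and \<omega>_scale: "!!x u v w. x : X ==> u ~= 0 ==> v : T x ==> w : T x ==> \<omega> (u *s x) (u *s v) (u *s w) = \<omega> x v w"
  and \<omega>_radial: "!!x u v. x : X ==> v : T x ==> \<omega> x (u *s x) v = 0"
  and \<omega>_pos: "!!x v. x : X ==> v : T x ==> (!!u. v ~= u *s x) ==> \<omega> x v (\<i> *s v) > 0"
begin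

definition idx :: "('n + nat) set" where "idx = Inl ` I \<union> Inr ` {..N}"

lemma finite_idx: "finite idx" by (simp add: idx_def)

text \<open>At \<open>t = 0\<close> only the sections that vanish at the base point are left.\<close>

definition Zfam :: "(nat => complex ^ 'm => complex) => 'n + nat => (complex ^ 'm) \<times> real => complex" where
 "Zfam S j y = (case j of Inl i => (SUM l<=N. c i l * S l (fst y)) | Inr l => of_real (snd y) * S l (fst y))"

definition norm2 :: "(nat => complex ^ 'm => complex) => (complex ^ 'm) \<times> real => real" where
 "norm2 S y = Re (herm idx (%j. Zfam S j y) (%j. Zfam S j y))"

lemma norm2_pos: "l <= N ==> S l (fst y) ~= 0 ==> snd y ~= 0 ==> norm2 S y > 0"
 unfolding norm2_def by (rule herm_self_pos[OF finite_idx, of "Inr l"]) (auto simp: idx_def Zfam_def)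

lemma norm2_scale:
 assumes "!!l. l <= N ==> S l (fst y) = u * S' l (fst y)" shows "norm2 S y = (cmod u)\<^sup>2 * norm2 S' y"
proof -
 have e: "Zfam S j y = u * Zfam S' j y" if "j : idx" for j
  using that assms by (auto simp: Zfam_def idx_def sum_distrib_left mult_ac intro!: sum.cong)
 show ?thesis unfolding norm2_def Re_herm_self
  by (simp add: e norm_mult power_mult_distrib sum_distrib_left)
qed

definition pot :: "real => complex ^ 'm => real" where
 "pot t x = (let k = SOME k. x : W k in ln (h k x * norm2 (%l. s l k) (x, t)))"

lemma pot_eq:
 assumes "x : W k" shows "pot t x = ln (h k x * norm2 (%l. s l k) (x, t))"
proof -
 define k' where "k' = (SOME k. x : W k)"
 have k': "x : W k'" unfolding k'_def using assms by (rule someI)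
 obtain u where u: "!!l. l <= N ==> s l k x = u * s l k' x" "h k' x = (cmod u)\<^sup>2 * h k x"
  using cocycle[OF assms k'] by blast
 have "norm2 (%l. s l k) (x, t) = (cmod u)\<^sup>2 * norm2 (%l. s l k') (x, t)"
  by (rule norm2_scale) (simp add: u)
 then have "h k' x * norm2 (%l. s l k') (x, t) = h k x * norm2 (%l. s l k) (x, t)" by (simp add: u(2))
 then show ?thesis by (simp add: pot_def Let_def k'_def[symmetric])
qed

text \<open>Ambient extensions, near the point \<open>x\<close> of the cone, of all the data in the trivialisation \<open>k\<close>.\<close>

definition frame :: "complex ^ 'm => 'k => (nat => complex ^ 'm => complex) => (complex ^ 'm => real) =>
  (complex ^ 'm => complex ^ 'm => real) => bool" where
 "frame x k S th e \<longleftrightarrow> x : W k & (ALL l<=N. holo_at x (S l)) & smooth_at x th & smooth_form x e &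
  (around x (%y. y : X --> (ALL l<=N. s l k y = S l y) & th y = ln (h k y) & (ALL v:T y. e y v = \<eta> y v)))"

lemma W_X: "x : W k ==> x : X"
 using W_cover by blast

lemma frame_X: "frame x k S th e ==> x : X"
 using W_X by (auto simp: frame_def)

lemma frame_exists:
 assumes "x : W k" obtains S th e where "frame x k S th e"
proof -
 obtain th e where 1: "smooth_at x th" "smooth_form x e"
  "around x (%y. y : X --> th y = ln (h k y) & (ALL v:T y. e y v = \<eta> y v))" using curvature[OF assms] by blast
 have "ALL l. EX G. l <= N --> holo_at x G & (around x (%y. y : X --> s l k y = G y))" using s_holo[OF assms] by blast
 then obtain S where S: "!!l. l <= N ==> holo_at x (S l) & (around x (%y. y : X --> s l k y = S l y))" by metis
 have "around x (%y. ALL l:{..N}. y : X --> s l k y = S l y)"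
  using S by (intro eventually_ball_finite) auto
 with 1(3) have "around x (%y. y : X --> (ALL l<=N. s l k y = S l y) & th y = ln (h k y) & (ALL v:T y. e y v = \<eta> y v))"
  by eventually_elim auto
 then show thesis using that assms 1 S unfolding frame_def by blast
qed

lemma frame_around:
 assumes "frame x k S th e" shows "around x (%y. y : X --> frame y k S th e)"
proof -
 have 1: "around x (%y. ALL l:{..N}. holo_at y (S l))"
  using assms holo_at_eventually unfolding frame_def by (intro eventually_ball_finite) auto
 have 2: "around x (%y. smooth_at y th)" using assms smooth_around unfolding frame_def by blast
 have 3: "around x (%y. linear (e y) & smooth_form y e)" using assms form_around unfolding frame_def by blast
 have 4: "around x (%y. around y (%y. y : X --> (ALL l<=N. s l k y = S l y) & th y = ln (h k y) & (ALL v:T y. e y v = \<eta> y v)))"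
  using assms unfolding frame_def eventually_eventually by blast
 have 5: "around x (%y. y : X --> y : W k)" using assms W_open unfolding frame_def by blast
 show ?thesis using 1 2 3 4 5 by eventually_elim (simp add: frame_def)
qed

text \<open>A local primitive of \<open>\<omega>\<close>.\<close>

definition mu :: "(complex ^ 'm => real) => (complex ^ 'm => complex ^ 'm => real) => complex ^ 'm => complex ^ 'm => real" where
 "mu th e y v = e y v + fd th y (\<i> *s v) / (4 * pi)"

lemma smooth_form_mu:
 assumes "smooth_at x th" "smooth_form x e" shows "smooth_form x (mu th e)"
proof -
 have l: "linear (%v. \<i> *s v :: complex ^ 'm)" using bl_vscale by (simp add: lin_bl)
 have "around x (%y. linear (%v. fd th y (\<i> *s v)))"
  using smooth_around[OF assms(1)]
  by (rule eventually_mono) (use linear_compose[OF l smooth_lin] in \<open>auto simp: o_def\<close>)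
 moreover have "smooth_at x (%y. fd th y (\<i> *s v))" for v by (rule smooth_fd[OF assms(1)])
 ultimately have "smooth_form x (%y v. fd th y (\<i> *s v))" by (simp add: smooth_form_def)
 from form_scale[OF smooth_const this, of "inverse (4 * pi)"]
 moreover have "(%y v. inverse (4 * pi) * fd th y (\<i> *s v)) = (%y v. fd th y (\<i> *s v) / (4 * pi))"
  by (simp add: fun_eq_iff field_simps)
 ultimately have "smooth_form x (%y v. fd th y (\<i> *s v) / (4 * pi))" by simp
 from smooth_form_add[OF assms(2) this] show ?thesis by (simp add: mu_def[abs_def])
qed

lemma frame_mu: "frame x k S th e ==> smooth_form x (mu th e)"
 by (auto simp: frame_def intro: smooth_form_mu)

lemma frame_\<omega>:
 assumes f: "frame x k S th e" and v: "v : T x" "w : T x" shows "\<omega> x v w = ext_d1 (mu th e) x v w"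
proof -
 have x: "x : X" "x : W k" using f frame_X by (auto simp: frame_def)
 obtain th' e' where 1: "smooth_at x th'" "smooth_form x e'"
  "around x (%y. y : X --> th' y = ln (h k y) & (ALL v:T y. e' y v = \<eta> y v))"
  "!!v w. v : T x ==> w : T x ==> \<omega> x v w = ext_d1 (mu th' e') x v w"
  using curvature[OF x(2)] unfolding mu_def[abs_def] by blast
 have "ext_d1 (mu th' e') x v w = ext_d1 (mu th e) x v w"
 proof (rule ext_d1_tangent_unique[OF x(1) smooth_form_mu[OF 1(1,2)] frame_mu[OF f] _ v])
  have E: "around x (%y. around y (%z. z : X --> th' z = ln (h k z) & (ALL v:T z. e' z v = \<eta> z v)))"
  using 1(3) unfolding eventually_eventually .
  show "agree_on_tangents x (mu th' e') (mu th e)"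
  unfolding agree_on_tangents_def using smooth_around[OF 1(1)] E frame_around[OF f]
  proof eventually_elim
  case (elim y)
  show ?case
  proof (intro impI ballI)
  fix v assume y: "y : X" and v: "v : T y"
  have fy: "frame y k S th e" using elim y by blast
  have g: "around y (%z. z : X --> (ALL l<=N. s l k z = S l z) & th z = ln (h k z) & (ALL v:T z. e z v = \<eta> z v))"
  using fy by (simp add: frame_def)
  have "around y (%z. z : X --> th' z = th z)" using elim(2) g by eventually_elim simp
  then have "fd th' y (\<i> *s v) = fd th y (\<i> *s v)"
  using tangent_unique[OF y elim(1)] fy T_scale[OF y v] by (simp add: frame_def)
  moreover have "e' y v = \<eta> y v" "e y v = \<eta> y v"
  using around_self[OF elim(2)] around_self[OF g] y v by auto
  ultimately show "mu th' e' y v = mu th e y v" by (simp add: mu_def)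
  qed
  qed
 qed
 then show ?thesis using 1(4)[OF v] by simp
qed

end

context polarized
begin

abbreviation nZ where "nZ == connection_form idx"

lemma smooth_Zfam:
 assumes "!!l. l <= N ==> smooth_at (fst y) (S l)" "j : idx" shows "smooth_at y (Zfam S j)"
proof -
 have s: "smooth_at y (%y. S l (fst y))" if "l <= N" for l
  by (rule smooth_compose[OF smooth_fst_id assms(1)[OF that]])
 show ?thesis using assms(2)
  by (auto simp: Zfam_def[abs_def] idx_def
  intro!: smooth_sum smooth_mult s smooth_of_real smooth_snd_id)
qed

lemma fd_Zfam:
 assumes S: "!!l. l <= N ==> smooth_at (fst y) (S l)" and j: "j : idx"
 shows "fd (Zfam S j) y v = (case j of Inl i => (SUM l<=N. c i l * fd (S l) (fst y) (fst v))
  | Inr l => of_real (snd y) * fd (S l) (fst y) (fst v) + of_real (snd v) * S l (fst y))"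
proof -
 have d: "((%y. S l (fst y)) has_derivative (%v. fd (S l) (fst y) (fst v))) (at y)" if "l <= N" for l
  using diff_chain_at[OF deriv_bl[OF bounded_linear_fst] smooth_deriv[OF S[OF that]]]
  by (simp add: o_def)
 have t: "((%y. complex_of_real (snd y)) has_derivative (%v. of_real (snd v))) (at y)"
  by (intro deriv_bl bounded_linear_compose[OF bounded_linear_of_real bounded_linear_snd])
 show ?thesis
 proof (cases j)
  case (Inl i)
  have "((%y. SUM l<=N. c i l * S l (fst y)) has_derivative (%v. SUM l<=N. c i l * fd (S l) (fst y) (fst v))) (at y)"
  by (intro has_derivative_sum has_derivative_mult_right d) simp
  from fun_cong[OF fd_eq[OF this]] show ?thesis by (simp add: Zfam_def[abs_def] Inl)
 next
  case (Inr l)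
  then have l: "l <= N" using j by (auto simp: idx_def)
  from fun_cong[OF fd_eq[OF has_derivative_mult[OF t d[OF l]]]] show ?thesis
  by (simp add: Zfam_def[abs_def] Inr)
 qed
qed

lemma frame_smooth: "frame x k S th e ==> l <= N ==> smooth_at x (S l)"
 by (simp add: frame_def holo_at_def)

lemma frame_fd_Zfam:
 assumes "frame x k S th e" "j : idx"
 shows "fd (Zfam S j) (x, t) v = (case j of Inl i => (SUM l<=N. c i l * fd (S l) x (fst v))
  | Inr l => of_real t * fd (S l) x (fst v) + of_real (snd v) * S l x)"
 using frame_smooth[OF assms(1)] assms(2) by (subst fd_Zfam) (simp_all split: sum.split)

lemma frame_point:
 assumes "frame x k S th e"
 shows "th x = ln (h k x)" "v : T x ==> e x v = \<eta> x v" "l <= N ==> s l k x = S l x"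
proof -
 have "around x (%y. y : X --> (ALL l<=N. s l k y = S l y) & th y = ln (h k y) & (ALL v:T y. e y v = \<eta> y v))"
  using assms by (simp add: frame_def)
 from around_self[OF this] frame_X[OF assms]
 show "th x = ln (h k x)" "v : T x ==> e x v = \<eta> x v" "l <= N ==> s l k x = S l x" by auto
qed

lemmas frame_value = frame_point(3)

lemma norm2_cong: "(!!l. l <= N ==> S l (fst y) = S' l (fst y)) ==> norm2 S y = norm2 S' y"
 using norm2_scale[of S y 1 S'] by simp

lemma frame_norm2_pos:
 assumes f: "frame x k S th e" and t: "t ~= 0" shows "norm2 S (x, t) > 0"
proof -
 have "x : W k" using f by (simp add: frame_def)
 from base_point_free[OF this] obtain l where "l <= N" "s l k x ~= 0" by blast
 then show ?thesis using frame_value[OF f, of l] norm2_pos[of l S "(x, t)"] t by simp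
qed

lemma frame_i_derivative:
 assumes f: "frame x k S th e" and j: "j : idx"
 shows "fd (Zfam S j) (x, t) (\<i> *s v, 0) = \<i> * fd (Zfam S j) (x, t) (v, 0)"
proof -
 have h: "fd (S l) x (\<i> *s v) = \<i> * fd (S l) x v" if "l <= N" for l
  using f that holo_at_fd unfolding frame_def by blast
 have *: "Inr l : idx ==> l <= N" for l by (auto simp: idx_def)
 show ?thesis using j unfolding frame_fd_Zfam[OF f j]
  by (auto simp: h sum_distrib_left mult_ac * split: sum.split intro!: sum.cong)
qed

text \<open>The derivative in the parameter does not contribute to the connection form, because the
 parameter enters the sections through real factors.\<close>

lemma frame_connection_fst:
 assumes f: "frame x k S th e"
 shows "nZ (Zfam S) (x, t) v = nZ (Zfam S) (x, t) (fst v, 0)"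
proof -
 have "Im (herm idx (%j. fd (Zfam S j) (x, t) v) (%j. Zfam S j (x, t)))
  = Im (herm idx (%j. fd (Zfam S j) (x, t) (fst v, 0)) (%j. Zfam S j (x, t)))"
  unfolding herm_def Im_sum
 proof (intro sum.cong refl)
  fix j assume j: "j : idx"
  have "Im ((complex_of_real a * z) * cnj (of_real b * z)) = 0" for a b z by (simp add: mult.commute)
  then show "Im (fd (Zfam S j) (x, t) v * cnj (Zfam S j (x, t))) = Im (fd (Zfam S j) (x, t) (fst v, 0) * cnj (Zfam S j (x, t)))"
  unfolding frame_fd_Zfam[OF f j] by (cases j) (simp_all add: Zfam_def distrib_right del: times_complex.simps complex_cnj_mult)
 qed
 then show ?thesis by (simp add: connection_form_def)
qed

text \<open>The difference between the connection form of the family and \<open>mu\<close>. While both depend on the trivialisation, their difference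
is a global form on \<open>X\<close>, since \<open>pot\<close> and \<open>\<eta>\<close> are global.\<close>

definition nu :: "real => complex ^ 'm => complex ^ 'm => real" where
 "nu t x v = - DX (pot t) x (\<i> *s v) / (4 * pi) - \<eta> x v"

lemma frame_pot:
 assumes f: "frame x k S th e" and t: "t ~= 0"
 shows "smooth_at x (%y. norm2 S (y, t))" "smooth_at x (%y. th y + ln (norm2 S (y, t)))"
  "around x (%y. y : X --> pot t y = th y + ln (norm2 S (y, t)))"
proof -
 have sZ: "smooth_at (x, t) (Zfam S j)" if "j : idx" for j
  by (rule smooth_Zfam) (use frame_smooth[OF f] that in auto)
 have sn: "smooth_at (x, t) (norm2 S)" unfolding norm2_def[abs_def] by (intro smooth_Re smooth_herm sZ)
 have si: "smooth_at x (%y. (y, t))" by (intro smooth_Pair smooth_ident smooth_const)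
 show snt: "smooth_at x (%y. norm2 S (y, t))" by (rule smooth_compose[OF si sn])
 show "smooth_at x (%y. th y + ln (norm2 S (y, t)))"
  using f frame_norm2_pos[OF f t] by (intro smooth_add smooth_ln snt) (auto simp: frame_def)
 show "around x (%y. y : X --> pot t y = th y + ln (norm2 S (y, t)))"
  using frame_around[OF f]
 proof eventually_elim
  case (elim y)
  show ?case
  proof
  assume "y : X"
  then have fy: "frame y k S th e" using elim by blast
  have yW: "y : W k" using fy by (simp add: frame_def)
  have "norm2 (%l. s l k) (y, t) = norm2 S (y, t)" by (rule norm2_cong) (simp add: frame_value[OF fy])
  then show "pot t y = th y + ln (norm2 S (y, t))"
  using pot_eq[OF yW, of t] frame_norm2_pos[OF fy t] h_pos[OF yW] by (simp add: frame_point(1)[OF fy] ln_mult)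
  qed
 qed
qed

lemma nu_frame:
 assumes f: "frame x k S th e" and t: "t ~= 0" and v: "fst v : T x"
 shows "nu t x (fst v) = nZ (Zfam S) (x, t) v - mu th e x (fst v)"
proof -
 have x: "x : X" using frame_X[OF f] .
 have s: "smooth_at x (S l)" if "l <= N" for l using frame_smooth[OF f that] .
 have sZ: "smooth_at (x, t) (Zfam S j)" if "j : idx" for j by (rule smooth_Zfam) (use s that in auto)
 have pos: "norm2 S (x, t) > 0" by (rule frame_norm2_pos[OF f t])
 let ?n = "%y. norm2 S (y, t)"
 define h' where "h' v = herm idx (%j. fd (Zfam S j) (x, t) (v, 0)) (%j. Zfam S j (x, t))" for v
 have sn: "smooth_at (x, t) (norm2 S)" unfolding norm2_def[abs_def] by (intro smooth_Re smooth_herm sZ)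
 have si: "smooth_at x (%y. (y, t))" by (intro smooth_Pair smooth_ident smooth_const)
 have snt: "smooth_at x ?n" by (rule frame_pot(1)[OF f t])
 have fdi: "fd (%y. (y, t)) x u = (u, 0)" for u
  using fun_cong[OF fd_eq[OF has_derivative_Pair[OF has_derivative_ident has_derivative_const]]] by metis
 have dn: "fd ?n x u = 2 * Re (h' u)" for u
 proof -
  have "((%y. Re (SUM j:idx. Zfam S j y * cnj (Zfam S j y))) has_derivative
  (%v. Re (SUM j:idx. Zfam S j (x, t) * cnj (fd (Zfam S j) (x, t) v) + fd (Zfam S j) (x, t) v * cnj (Zfam S j (x, t))))) (at (x, t))"
  by (intro has_derivative_Re has_derivative_sum has_derivative_mult has_derivative_cnj smooth_deriv sZ)
  from fun_cong[OF fd_eq[OF this], of "(u, 0)"]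
  have "fd (norm2 S) (x, t) (u, 0) = 2 * Re (h' u)"
  by (simp add: norm2_def[abs_def] herm_def h'_def sum_distrib_left mult_ac)
  then show ?thesis using fd_compose[OF si, of "norm2 S" u] sn by (simp add: fdi)
 qed
 define G where "G y = th y + ln (?n y)" for y
 note P = frame_pot[OF f t, folded G_def]
 have fG: "fd G x u = fd th x u + 2 * Re (h' u) / ?n x" for u
 proof -
  have "((%y. ln (?n y)) has_derivative (%u. fd ?n x u * inverse (?n x))) (at x)"
  using has_derivative_ln[OF pos smooth_deriv[OF snt]] by (simp add: mult.commute)
  moreover have "smooth_at x th" using f by (simp add: frame_def)
  ultimately have "(G has_derivative (%u. fd th x u + fd ?n x u * inverse (?n x))) (at x)"
  unfolding G_def[abs_def] by (intro has_derivative_add smooth_deriv)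
  from fun_cong[OF fd_eq[OF this]] show ?thesis by (simp add: dn divide_inverse)
 qed
 have "DX (pot t) x (\<i> *s fst v) = fd G x (\<i> *s fst v)"
  by (rule DX_eq[OF x P(2,3) T_scale[OF x v]])
 also have "... = fd th x (\<i> *s fst v) - 2 * Im (h' (fst v)) / ?n x"
  by (simp add: fG h'_def frame_i_derivative[OF f] herm_scale_left cong: sum.cong)
  (simp add: herm_def frame_i_derivative[OF f] sum_distrib_left[symmetric] mult.assoc)
 finally have D: "DX (pot t) x (\<i> *s fst v) = fd th x (\<i> *s fst v) - 2 * Im (h' (fst v)) / ?n x" .
 have "e x (fst v) = \<eta> x (fst v)" by (rule frame_point(2)[OF f v])
 moreover have "nZ (Zfam S) (x, t) v = Im (h' (fst v)) / (2 * pi * ?n x)"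
  unfolding frame_connection_fst[OF f, of t v] by (simp add: connection_form_def h'_def norm2_def)
 ultimately show ?thesis using pos by (simp add: nu_def D mu_def field_simps)
qed

text \<open>The value \<open>1\<close> at \<open>t = 0\<close> leaves only the Fubini-Study part there, the value \<open>0\<close> at \<open>t = 1\<close> leaves only \<open>\<omega>\<close>, and
values below \<open>1\<close> in between keep the slices positive.\<close>

definition weight :: "real => real" where "weight t = (1 - t)\<^sup>2"

definition lam :: "(complex ^ 'm) \<times> real => (complex ^ 'm) \<times> real => real" where
 "lam y v = weight (snd y) * nu (snd y) (fst y) (fst v)"

definition lam_ext where
 "lam_ext S th e y v = weight (snd y) * (nZ (Zfam S) y v - mu th e (fst y) (fst v))"

definition prim where
 "prim S th e y v = weight (snd y) * nZ (Zfam S) y v + (1 - weight (snd y)) * mu th e (fst y) (fst v)"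

text \<open>\<open>Om = \<omega> + d (weight nu)\<close>, a closed form on the product with the time axis. \<open>lam_ext\<close> provides the
extension of \<open>lam\<close> that is selected, and \<open>prim\<close> is the resulting local primitive of \<open>Om\<close>.\<close>

definition Om :: "complex ^ 'm => real => (complex ^ 'm) \<times> real => (complex ^ 'm) \<times> real => real" where
 "Om x t v w = \<omega> x (fst v) (fst w) + ext_d1 (SOME L. smooth_form (x, t) L &
  (around (x, t) (%y. fst y : X --> (ALL v. fst v : T (fst y) --> lam y v = L y v)))) (x, t) v w"

lemma smooth_weight: "smooth_at y (%y :: (complex ^ 'm) \<times> real. weight (snd y))"
 unfolding weight_def[abs_def] by (intro smooth_power smooth_diff smooth_const smooth_snd_id)

lemma fd_weight: "fd (%y :: (complex ^ 'm) \<times> real. weight (snd y)) y v = - 2 * (1 - snd y) * snd v"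
proof -
 have "((%y :: (complex ^ 'm) \<times> real. (1 - snd y)\<^sup>2) has_derivative (%v. - 2 * (1 - snd y) * snd v)) (at y)"
  by (auto intro!: derivative_eq_intros simp: algebra_simps)
 from fun_cong[OF fd_eq[OF this]] show ?thesis by (simp add: weight_def[abs_def])
qed

lemma frame_forms:
 assumes f: "frame x k S th e" and t: "t ~= 0"
 shows "smooth_form (x, t) (nZ (Zfam S))" "smooth_form (x, t) (%y v. mu th e (fst y) (fst v))"
  "ext_d1 (%y v. mu th e (fst y) (fst v)) (x, t) v w = ext_d1 (mu th e) x (fst v) (fst w)"
  "smooth_form (x, t) (prim S th e)" "smooth_form (x, t) (lam_ext S th e)"
proof -
 have p: "(%y v. mu th e (fst y) (fst v)) = pullback fst (mu th e)"
  by (simp add: fun_eq_iff pullback_def fd_fst)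
 have m: "smooth_form (fst (x, t)) (mu th e)" using frame_mu[OF f] by simp
 show A: "smooth_form (x, t) (nZ (Zfam S))"
  using frame_norm2_pos[OF f t] frame_smooth[OF f]
  by (intro smooth_form_connection finite_idx smooth_Zfam) (auto simp: norm2_def)
 show B: "smooth_form (x, t) (%y v. mu th e (fst y) (fst v))"
  unfolding p by (rule smooth_form_pullback[OF smooth_fst_id m])
 show "ext_d1 (%y v. mu th e (fst y) (fst v)) (x, t) v w = ext_d1 (mu th e) x (fst v) (fst w)"
  unfolding p using ext_d1_pullback[OF smooth_fst_id m, of v w] by (simp add: fd_fst)
 have "smooth_at (x, t) (%y :: (complex ^ 'm) \<times> real. 1 - weight (snd y))"
  by (intro smooth_diff smooth_const smooth_weight)
 then show "smooth_form (x, t) (prim S th e)" unfolding prim_def[abs_def]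
  by (intro smooth_form_add form_scale A B smooth_weight)
 have "smooth_form (x, t) (%y v. - 1 * mu th e (fst y) (fst v))"
  by (intro form_scale smooth_const B)
 from form_scale[OF smooth_weight smooth_form_add[OF A this]]
 show "smooth_form (x, t) (lam_ext S th e)" by (simp add: lam_ext_def[abs_def])
qed

lemma frame_around_prod:
 assumes "frame x k S th e" "t ~= (0 :: real)"
 shows "around (x, t) (%y. fst y : X --> frame (fst y) k S th e & snd y ~= 0)"
proof -
 have "around (x, t) (%y. fst y : X --> frame (fst y) k S th e)"
  using around_compose[OF smooth_fst_id[of "(x, t)"], of "%y. y : X --> frame y k S th e"]
  frame_around[OF assms(1)] by simp
 moreover have "around (x, t) (%y. snd y ~= 0)"
  using around_compose[OF smooth_snd_id[of "(x, t)"], of "%r. r ~= 0"]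
  assms(2) around_open[of "- {0}" t] by (simp add: open_Compl)
 ultimately show ?thesis by eventually_elim simp
qed

lemma Om_eq:
 assumes f: "frame x k S th e" and t: "t ~= 0" and v: "fst v : T x" "fst w : T x"
 shows "Om x t v w = ext_d1 (prim S th e) (x, t) v w"
proof -
 let ?P = "%L. smooth_form (x, t) L & (around (x, t) (%y. fst y : X --> (ALL v. fst v : T (fst y) --> lam y v = L y v)))"
 have ag: "around (x, t) (%y. fst y : X --> (ALL v. fst v : T (fst y) --> lam y v = lam_ext S th e y v))"
  using frame_around_prod[OF f t]
  by (rule eventually_mono) (use nu_frame in \<open>auto simp: lam_def lam_ext_def\<close>)
 have E: "?P (lam_ext S th e)" using frame_forms(5)[OF f t] ag by blast
 define L where "L = (SOME L. ?P L)"
 have L: "?P L" unfolding L_def by (rule someI[of ?P, OF E])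
 have "around (x, t) (%y. fst y : X --> (ALL v. fst v : T (fst y) --> L y v = lam_ext S th e y v))"
  using L[THEN conjunct2] ag by eventually_elim simp
 then have "ext_d1 L (x, t) v w = ext_d1 (lam_ext S th e) (x, t) v w"
  by (rule ext_d1_tangent_unique_product[OF frame_X[OF f] L[THEN conjunct1] frame_forms(5)[OF f t] _ v])
 moreover have "prim S th e = (%y v. lam_ext S th e y v + mu th e (fst y) (fst v))"
  by (simp add: fun_eq_iff prim_def lam_ext_def algebra_simps)
 moreover have "Om x t v w = \<omega> x (fst v) (fst w) + ext_d1 L (x, t) v w" by (simp only: Om_def L_def)
 ultimately show ?thesis
  using ext_d1_add[OF frame_forms(5,2)[OF f t]] frame_\<omega>[OF f v]
  by (simp add: frame_forms(3)[OF f t])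
qed

text \<open>The slices are convex combinations of semipositive forms and \<open>\<omega>\<close>; the terms with time components
are the price of closedness.\<close>

lemma Om_formula:
 assumes f: "frame x k S th e" and t: "t ~= 0" and v: "fst v : T x" "fst w : T x"
 shows "Om x t v w = weight t * fubini_study idx (%j. Zfam S j (x, t)) (%j. fd (Zfam S j) (x, t) v) (%j. fd (Zfam S j) (x, t) w)
  + (1 - weight t) * \<omega> x (fst v) (fst w)
  - 2 * (1 - t) * (snd v * nu t x (fst w) - snd w * nu t x (fst v))"
proof -
 have s1: "smooth_at (x, t) (%y :: (complex ^ 'm) \<times> real. 1 - weight (snd y))"
  by (intro smooth_diff smooth_const smooth_weight)
 have fd1: "fd (%y :: (complex ^ 'm) \<times> real. 1 - weight (snd y)) (x, t) u = 2 * (1 - t) * snd u" for u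
  using fd_diff[OF smooth_const[of "(x, t)" "1 :: real"] smooth_weight[of "(x, t)"], of u] by (simp add: fd_weight algebra_simps)
 note ff = frame_forms[OF f t]
 have FS: "ext_d1 (nZ (Zfam S)) (x, t) v w = fubini_study idx (%j. Zfam S j (x, t)) (%j. fd (Zfam S j) (x, t) v) (%j. fd (Zfam S j) (x, t) w)"
  using frame_norm2_pos[OF f t] frame_smooth[OF f]
  by (intro ext_d1_connection finite_idx smooth_Zfam) (auto simp: norm2_def)
 have "ext_d1 (prim S th e) (x, t) v w
  = (weight t * ext_d1 (nZ (Zfam S)) (x, t) v w + (- 2 * (1 - t) * snd v) * nZ (Zfam S) (x, t) w - (- 2 * (1 - t) * snd w) * nZ (Zfam S) (x, t) v)
  + ((1 - weight t) * \<omega> x (fst v) (fst w) + (2 * (1 - t) * snd v) * mu th e x (fst w) - (2 * (1 - t) * snd w) * mu th e x (fst v))"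
  unfolding prim_def[abs_def]
  using ext_d1_add[OF form_scale[OF smooth_weight ff(1)] form_scale[OF s1 ff(2)], of v w]
  ext_d1_scale[OF smooth_weight ff(1), of v w] ext_d1_scale[OF s1 ff(2), of v w]
  by (simp add: fd_weight fd1 ff(3) frame_\<omega>[OF f v])
 then show ?thesis unfolding Om_eq[OF assms] FS nu_frame[OF f t v(1)] nu_frame[OF f t v(2)]
  by (simp add: algebra_simps)
qed

lemma frame_at: "x : X ==> EX k S th e. frame x k S th e"
 using W_cover frame_exists by (metis UN_E)

lemma weight_range: "0 < t ==> t < 2 ==> 0 <= weight t & weight t < 1"
 by (simp add: weight_def abs_square_less_1)

lemma Om_pos:
 assumes x: "x : X" and t: "0 < t" "t < 2" and v: "v : T x" "!!u. v ~= u *s x"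
 shows "Om x t (v, 0) (\<i> *s v, 0) > 0"
proof -
 obtain k S th e where f: "frame x k S th e" using frame_at[OF x] by blast
 have t0: "t ~= 0" using t by simp
 have "fubini_study idx (%j. Zfam S j (x, t)) (%j. fd (Zfam S j) (x, t) (v, 0)) (%j. fd (Zfam S j) (x, t) (\<i> *s v, 0))
  = fubini_study idx (%j. Zfam S j (x, t)) (%j. fd (Zfam S j) (x, t) (v, 0)) (%j. \<i> * fd (Zfam S j) (x, t) (v, 0))"
  unfolding fubini_study_def herm_def by (simp add: frame_i_derivative[OF f] cong: sum.cong)
 also have "... >= 0"
  using frame_norm2_pos[OF f t0] by (intro fubini_study_nonneg) (simp add: norm2_def)
 finally have "weight t * fubini_study idx (%j. Zfam S j (x, t)) (%j. fd (Zfam S j) (x, t) (v, 0)) (%j. fd (Zfam S j) (x, t) (\<i> *s v, 0)) >= 0"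
  using weight_range[OF t] by simp
 moreover have "(1 - weight t) * \<omega> x v (\<i> *s v) > 0"
  using weight_range[OF t] \<omega>_pos[OF x v] by simp
 ultimately show ?thesis
  using Om_formula[OF f t0, of "(v, 0)" "(\<i> *s v, 0)"] v(1) T_scale[OF x v(1)] by simp
qed

lemma Om_one: "x : X ==> v : T x ==> w : T x ==> Om x 1 (v, 0) (w, 0) = \<omega> x v w"
 using frame_at[of x] Om_formula[of x _ _ _ _ 1 "(v, 0)" "(w, 0)"] by (auto simp: weight_def)

lemma fd_along_orbit:
 fixes S :: "complex ^ 'm => 'b::real_normed_vector"
 assumes x: "x : X" and S: "smooth_at x S" and inv: "around x (%y. y : X --> S y = g y)"
  and g: "!!u. u ~= 0 ==> g (u *s x) = g x"
 shows "fd S x (u *s x) = 0"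
proof -
 have d: "((%r :: real. (1 + of_real r * u) *s x) has_derivative (%r. (of_real r * u) *s x)) (at 0)"
 proof -
  have "((%r :: real. 1 + of_real r * u) has_derivative (%r. of_real r * u)) (at 0)"
  by (auto intro!: derivative_eq_intros deriv_bl bounded_linear_of_real)
  from bounded_linear.has_derivative[OF bl_vscale_left this] show ?thesis .
 qed
 let ?p = "%r :: real. (1 + of_real r * u) *s x"
 have p0: "?p 0 = x" by simp
 have D: "((%r. S (?p r)) has_derivative (%r. fd S x ((of_real r * u) *s x))) (at 0)"
  using diff_chain_at[OF d, of S "fd S x"] smooth_deriv[OF S] by (simp add: o_def)
 have cont: "isCont ?p 0" using has_derivative_continuous[OF d] .
 have "around 0 (%r. ?p r : X --> S (?p r) = g (?p r))"
 proof -
  have "filterlim ?p (nhds x) (nhds 0)"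
  using cont tendsto_at_iff_tendsto_nhds[of ?p 0] by (simp add: isCont_def)
  from eventually_compose_filterlim[OF inv this] show ?thesis .
 qed
 moreover have "around 0 (%r. 1 + complex_of_real r * u ~= 0)"
 proof -
  have "isCont (%r :: real. 1 + complex_of_real r * u) 0" by (intro continuous_intros)
  then have "filterlim (%r :: real. 1 + complex_of_real r * u) (nhds 1) (nhds 0)"
  using tendsto_at_iff_tendsto_nhds[of "%r :: real. 1 + complex_of_real r * u" 0] by (simp add: isCont_def)
  moreover have "around (1::complex) (%z. z ~= 0)"
  using around_open[of "- {0::complex}" 1] by (simp add: open_Compl)
  ultimately show ?thesis by (rule eventually_compose_filterlim[rotated])
 qed
 ultimately have "around 0 (%r. S (?p r) = g x)"
 proof eventually_elim
  case (elim r)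
  have "?p r : X" by (rule scale_X[OF x elim(2)])
  then show ?case using elim(1) g[OF elim(2)] by simp
 qed
 then obtain V where V: "open V" "0 : V" "!!r. r : V ==> S (?p r) = g x" by (rule around_openE) blast
 have "((%r. S (?p r)) has_derivative (%r. 0)) (at 0)"
  by (rule deriv_transform[OF has_derivative_const[of "g x"] V(1,2)]) (rule V(3)[symmetric])
 from fun_cong[OF has_derivative_unique[OF D this], of 1] show ?thesis by simp
qed

lemma frame_radial:
 assumes f: "frame x k S th e"
 shows "l <= N ==> fd (S l) x (u *s x) = 0" "fd th x (u *s x) = 0"
proof -
 have x: "x : X" "x : W k" using frame_X[OF f] f by (auto simp: frame_def)
 have ev: "around x (%y. y : X --> (ALL l<=N. s l k y = S l y) & th y = ln (h k y) & (ALL v:T y. e y v = \<eta> y v))"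
  using f by (simp add: frame_def)
 show "fd (S l) x (u *s x) = 0" if "l <= N"
 proof (rule fd_along_orbit[OF x(1) frame_smooth[OF f that], where g="s l k"])
  show "around x (%y. y : X --> S l y = s l k y)" using ev by eventually_elim (use that in simp)
 qed (use scaling[OF x(2)] that in simp)
 show "fd th x (u *s x) = 0"
 proof (rule fd_along_orbit[OF x(1), where g="%y. ln (h k y)"])
  show "smooth_at x th" using f by (simp add: frame_def)
  show "around x (%y. y : X --> th y = ln (h k y))" using ev by eventually_elim simp
 qed (use scaling[OF x(2)] in simp)
qed

lemma frame_Zfam_radial:
 assumes "frame x k S th e" "j : idx" shows "fd (Zfam S j) (x, t) (u *s x, 0) = 0"
proof -
 have *: "Inr l : idx ==> l <= N" for l by (auto simp: idx_def)
 show ?thesis using assms(2) unfolding frame_fd_Zfam[OF assms]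
  by (auto simp: frame_radial[OF assms(1)] * split: sum.split)
qed

lemma nu_radial: "x : X ==> t ~= 0 ==> nu t x (u *s x) = 0"
proof -
 assume x: "x : X" and t: "t ~= 0"
 obtain k S th e where f: "frame x k S th e" using frame_at[OF x] by blast
 have "e x (u *s x) = \<eta> x (u *s x)"
  by (rule frame_point(2)[OF f radial_T[OF x]])
 then have "mu th e x (u *s x) = 0"
  using \<eta>_radial[OF x] frame_radial(2)[OF f, of "\<i> * u"] by (simp add: mu_def vs_assoc)
 moreover have "nZ (Zfam S) (x, t) (u *s x, 0) = 0"
  by (simp add: connection_form_def herm_def frame_Zfam_radial[OF f])
 ultimately show ?thesis using nu_frame[OF f t, of "(u *s x, 0)"] radial_T[OF x] by simp
qed

lemma Om_radial:
 assumes x: "x : X" and t: "t ~= 0" and w: "fst w : T x" shows "Om x t (u *s x, 0) w = 0"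
proof -
 obtain k S th e where f: "frame x k S th e" using frame_at[OF x] by blast
 have "fubini_study idx (%j. Zfam S j (x, t)) (%j. fd (Zfam S j) (x, t) (u *s x, 0)) (%j. fd (Zfam S j) (x, t) w) = 0"
  by (simp add: fubini_study_def herm_def frame_Zfam_radial[OF f])
 then show ?thesis
  using Om_formula[OF f t _ w, of "(u *s x, 0)"] radial_T[OF x] \<omega>_radial[OF x w] nu_radial[OF x t] by simp
qed

lemma Om_skew: "x : X ==> t ~= 0 ==> fst v : T x ==> fst w : T x ==> Om x t v w = - Om x t w v"
proof -
 assume a: "x : X" "t ~= 0" "fst v : T x" "fst w : T x"
 obtain k S th e where f: "frame x k S th e" using frame_at[OF a(1)] by blast
 show ?thesis unfolding Om_eq[OF f a(2,3,4)] Om_eq[OF f a(2,4,3)] by (rule ext_d1_skew)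
qed

lemma Om_add_left: "x : X ==> t ~= 0 ==> fst u : T x ==> fst v : T x ==> fst w : T x ==>
  Om x t (u + v) w = Om x t u w + Om x t v w"
proof -
 assume a: "x : X" "t ~= 0" "fst u : T x" "fst v : T x" "fst w : T x"
 obtain k S th e where f: "frame x k S th e" using frame_at[OF a(1)] by blast
 have "fst (u + v) : T x" using a T_add by simp
 then show ?thesis
  using Om_eq[OF f a(2)] a bilinear_ladd[OF ext_d1_bilinear[OF frame_forms(4)[OF f a(2)]]] by simp
qed

lemma vscale_smooth: "smooth_at x (%y. u *s (y :: complex ^ 'm))"
 by (rule smooth_bl[OF bl_vscale smooth_ident])

lemma fd_vscale: "fd (%y. u *s (y :: complex ^ 'm)) x v = u *s v"
 using fun_cong[OF fd_eq[OF deriv_bl[OF bl_vscale]]] .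

lemma eventually_vscale:
 assumes "around (u *s x) (%y. y : X --> P y)" "u ~= 0"
 shows "around x (%y. y : X --> P (u *s y))"
proof -
 have "around x (%y. u *s y : X --> P (u *s y))"
  by (rule around_compose[OF vscale_smooth]) (rule assms(1))
 then show ?thesis by eventually_elim (use scale_X[OF _ assms(2)] in blast)
qed

lemma nu_scale:
 assumes x: "x : X" and t: "t ~= 0" and u: "u ~= 0" and v: "v : T x" shows "nu t (u *s x) (u *s v) = nu t x v"
proof -
 have ux: "u *s x : X" by (rule scale_X[OF x u])
 obtain k S th e where f: "frame (u *s x) k S th e" using frame_at[OF ux] by blast
 have pots: "pot t (u *s y) = pot t y" if y: "y : X" for y
 proof -
  obtain k where k: "y : W k" using y W_cover by blast
  have "norm2 (%l. s l k) (u *s y, t) = norm2 (%l. s l k) (y, t)"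
  using scaling[OF k u] by (auto simp: norm2_def herm_def Zfam_def idx_def intro!: sum.cong arg_cong[where f=Re])
  then show ?thesis using pot_eq[OF k] pot_eq[of "u *s y" k t] scaling[OF k u] by simp
 qed
 define G where "G y = th y + ln (norm2 S (y, t))" for y
 note P = frame_pot[OF f t, folded G_def]
 have "DX (pot t) (u *s x) (\<i> *s (u *s v)) = fd G (u *s x) (\<i> *s (u *s v))"
  using T_cone[OF x u] by (intro DX_eq[OF ux P(2,3)] T_scale[OF ux]) (simp add: T_scale[OF x v] v)
 also have "... = fd (%y. G (u *s y)) x (\<i> *s v)"
  using fd_compose[OF vscale_smooth P(2)] by (simp add: fd_vscale vs_assoc mult.commute)
 also have "... = DX (pot t) x (\<i> *s v)"
 proof (rule DX_eq[symmetric, OF x _ _ T_scale[OF x v]])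
  show "smooth_at x (%y. G (u *s y))" by (rule smooth_compose[OF vscale_smooth P(2)])
  show "around x (%y. y : X --> pot t y = G (u *s y))"
  using eventually_vscale[OF P(3) u] by eventually_elim (simp add: pots)
 qed
 finally show ?thesis using \<eta>_scale[OF x u v] by (simp add: nu_def)
qed

lemma fubini_study_cong:
 assumes "!!j. j : J ==> z j = z' j & v j = v' j & w j = w' j"
 shows "fubini_study J z v w = fubini_study J z' v' w'"
proof -
 have "herm J f g = herm J f' g'" if "!!j. j : J ==> f j = f' j" "!!j. j : J ==> g j = g' j" for f g f' g' :: "_ => complex"
  unfolding herm_def by (intro sum.cong refl) (simp add: that)
 note h = this
 have "herm J v w = herm J v' w'" "herm J z z = herm J z' z'" "herm J v z = herm J v' z'" "herm J z w = herm J z' w'"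
  using assms by (blast intro: h)+
 then show ?thesis by (simp add: fubini_study_def)
qed

lemma Om_scale:
 assumes x: "x : X" and t: "t ~= 0" and u: "u ~= 0" and v: "v : T x" and w: "w : T x"
 shows "Om (u *s x) t (u *s v, a) (u *s w, b) = Om x t (v, a) (w, b)"
proof -
 have ux: "u *s x : X" by (rule scale_X[OF x u])
 obtain k S' th' e' where f': "frame x k S' th' e'" using frame_at[OF x] by blast
 have "u *s x : W k" using f' scaling[OF _ u] by (simp add: frame_def)
 then obtain S th e where f: "frame (u *s x) k S th e" by (rule frame_exists)
 have ev: "around (u *s x) (%y. y : X --> (ALL l<=N. s l k y = S l y) & y : W k)"
  using frame_around[OF f]
 proof eventually_elim
  case (elim y) show ?case using elim frame_value[of y k S th e] frame_def[of y k S th e] by simp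
 qed
 have ev': "around x (%y. y : X --> (ALL l<=N. s l k y = S' l y) & y : W k)"
  using frame_around[OF f']
 proof eventually_elim
  case (elim y) show ?case using elim frame_value[of y k S' th' e'] frame_def[of y k S' th' e'] by simp
 qed
 have dS: "fd (S l) (u *s x) (u *s v) = fd (S' l) x v" if l: "l <= N" and v: "v : T x" for l v
 proof -
  have "fd (%y. S l (u *s y)) x v = fd (S' l) x v"
  proof (rule tangent_unique[OF x _ frame_smooth[OF f' l] _ v])
  show "smooth_at x (%y. S l (u *s y))" by (rule smooth_compose[OF vscale_smooth frame_smooth[OF f l]])
  show "around x (%y. y : X --> S l (u *s y) = S' l y)"
  using eventually_vscale[OF ev u] ev'
  proof eventually_elim
  case (elim y)
  show ?case
  proof
  assume "y : X"
  then have "s l k (u *s y) = S l (u *s y)" "s l k y = S' l y" "y : W k" using elim l by auto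
  then show "S l (u *s y) = S' l y" using scaling[OF \<open>y : W k\<close> u] l by simp
  qed
  qed
  qed
  then show ?thesis using fd_compose[OF vscale_smooth frame_smooth[OF f l], of v] by (simp add: fd_vscale)
 qed
 have vS: "S l (u *s x) = S' l x" if "l <= N" for l
  using frame_value[OF f that] frame_value[OF f' that] scaling[of x k u] f' u that by (simp add: frame_def)
 have *: "Inr l : idx ==> l <= N" for l by (auto simp: idx_def)
 have Z: "Zfam S j (u *s x, t) = Zfam S' j (x, t) & fd (Zfam S j) (u *s x, t) (u *s v, a) = fd (Zfam S' j) (x, t) (v, a)"
  if j: "j : idx" and v: "v : T x" for j v a
 proof (cases j)
  case (Inl i)
  have "(SUM l<=N. c i l * S l (u *s x)) = (SUM l<=N. c i l * S' l x)"
  "(SUM l<=N. c i l * fd (S l) (u *s x) (u *s v)) = (SUM l<=N. c i l * fd (S' l) x v)"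
  by (rule sum.cong[OF refl], simp add: vS dS v)+
  then show ?thesis unfolding frame_fd_Zfam[OF f j] frame_fd_Zfam[OF f' j] by (simp add: Zfam_def Inl)
 next
  case (Inr l)
  then have "l <= N" using j *[of l] by simp
  then show ?thesis unfolding frame_fd_Zfam[OF f j] frame_fd_Zfam[OF f' j] by (simp add: Zfam_def Inr vS dS v)
 qed
 have FS: "fubini_study idx (%j. Zfam S j (u *s x, t)) (%j. fd (Zfam S j) (u *s x, t) (u *s v, a)) (%j. fd (Zfam S j) (u *s x, t) (u *s w, b))
  = fubini_study idx (%j. Zfam S' j (x, t)) (%j. fd (Zfam S' j) (x, t) (v, a)) (%j. fd (Zfam S' j) (x, t) (w, b))"
  by (rule fubini_study_cong) (simp add: Z[OF _ v] Z[OF _ w])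
 have Tu: "T (u *s x) = T x" by (rule T_cone[OF x u])
 have "Om (u *s x) t (u *s v, a) (u *s w, b) = weight t * fubini_study idx (%j. Zfam S j (u *s x, t))
  (%j. fd (Zfam S j) (u *s x, t) (u *s v, a)) (%j. fd (Zfam S j) (u *s x, t) (u *s w, b))
  + (1 - weight t) * \<omega> (u *s x) (u *s v) (u *s w) - 2 * (1 - t) * (a * nu t (u *s x) (u *s w) - b * nu t (u *s x) (u *s v))"
  using Om_formula[OF f t, of "(u *s v, a)" "(u *s w, b)"] T_scale[OF x v] T_scale[OF x w] by (simp add: Tu)
 also have "... = Om x t (v, a) (w, b)"
  unfolding nu_scale[OF x t u v] nu_scale[OF x t u w] \<omega>_scale[OF x u v w] FS
  using Om_formula[OF f' t, of "(v, a)" "(w, b)"] v w by simp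
 finally show ?thesis .
qed

end

section \<open>The kernel vector field\<close>

lemma eventually_inj:
 fixes A :: "'a::euclidean_space => 'b::euclidean_space => 'c::euclidean_space"
 assumes lin: "around x (%y. linear (A y))" and sm: "!!b. smooth_at x (%y. A y b)" and inj: "inj (A x)"
 shows "around x (%y. inj (A y))"
proof -
 have lx: "linear (A x)" using lin by (rule around_self)
 obtain c where c: "c > 0" "!!v. norm v <= c * norm (A x v)" by (rule linear_inj_bounded_below[OF lx inj]) blast
 define q where "q = 1 / (2 * c * DIM('b))"
 have q: "q > 0" using c(1) by (simp add: q_def)
 have "around x (%y. ALL b:Basis. norm (A y b - A x b) < q)"
 proof (intro eventually_ball_finite ballI)
  fix b :: 'b assume "b : Basis"
  note around_compose[OF sm[of b], where P="%z. z : ball (A x b) q"]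
  moreover from q have "around (A x b) (%z. z : ball (A x b) q)" by (intro around_open) auto
  ultimately have "around x (%y. A y b : ball (A x b) q)" by blast
  then show "around x (%y. norm (A y b - A x b) < q)" by eventually_elim (simp add: dist_norm norm_minus_commute)
 qed simp
 with lin show ?thesis
 proof eventually_elim
  case (elim y)
  have l: "linear (%v. A y v - A x v)" using linear_compose_sub[OF elim(1) lx] by simp
  have bd: "norm (A y v - A x v) <= norm v / (2 * c)" for v
  proof -
  have "norm (A y v - A x v) = norm (SUM b:Basis. (v \<bullet> b) *r (A y b - A x b))"
  using linear_expand[OF l, of v] by simp
  also have "... <= (SUM b:(Basis :: 'b set). norm v * q)"
  by (intro order_trans[OF norm_sum] sum_mono)
  (use elim(2) Basis_le_norm in \<open>auto simp: less_imp_le intro!: mult_mono\<close>)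
  also have "... = norm v / (2 * c)" by (simp add: q_def)
  finally show ?thesis .
  qed
  show "inj (A y)" unfolding linear_injective_0[OF elim(1)]
  proof (intro allI impI)
  fix v assume "A y v = 0"
  then have "norm (A x v) <= norm v / (2 * c)" using bd[of v] by simp
  then have "norm v <= c * (norm v / (2 * c))" using c(2)[of v] c(1) by (meson mult_left_mono order_trans less_imp_le)
  then show "v = 0" using c(1) by (simp add: field_simps)
  qed
 qed
qed

text \<open>Solves \<open>B y (Y, b) = c y b\<close> for \<open>Y\<close> in the image of a projection \<open>Q y\<close> that depends smoothly on \<open>y\<close>, by adding the equation
\<open>Y - Q y Y = 0\<close>; nondegeneracy at one point makes the system injective nearby, and the solution is smooth.\<close>

lemma moser_solve:
 fixes Q :: "'a::euclidean_space => 'b::euclidean_space => 'b" and B :: "'a => 'b => 'b => real" and c :: "'a => 'b => real"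
 assumes Q: "around x (%y. linear (Q y))" "!!b. smooth_at x (%y. Q y b)"
  and B: "around x (%y. bilinear (B y))" "!!a b. smooth_at x (%y. B y a b)"
  and c: "around x (%y. linear (c y))" "!!b. smooth_at x (%y. c y b)"
  and idem: "!!a. Q x (Q x a) = Q x a"
  and nondeg: "!!a. Q x a = a ==> (!!b. B x a (Q x b) = 0) ==> a = 0"
 obtains Y where "smooth_at x Y"
  "around x (%y. (ALL a. Q y (Q y a) = Q y a) --> Q y (Y y) = Y y & (ALL b. B y (Y y) (Q y b) = c y (Q y b)))"
proof -
 define m where "m y a b = B y (Q y a) (Q y b) + (a - Q y a) \<bullet> (b - Q y b)" for y a b
 define M where "M y a = (SUM b:Basis. m y a b *r b)" for y a
 define C where "C y = (SUM b:Basis. c y (Q y b) *r b)" for y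
 have mlin: "linear (%a. m y a b)" "linear (m y a)" if "linear (Q y)" "bilinear (B y)" for y a b
  using that unfolding m_def
  by (auto intro!: linearI simp: bilinear_ladd bilinear_radd bilinear_lmul bilinear_rmul linear_add linear_scale
  inner_add inner_diff inner_right_distrib inner_left_distrib algebra_simps)
 have Mlin: "linear (M y)" if "linear (Q y)" "bilinear (B y)" for y
  unfolding M_def by (intro linear_compose_sum ballI linear_scaleR_left mlin(1)[OF that, THEN linear_compose[of _ "%s. s *r _", unfolded o_def]])
 have Mm: "M y a \<bullet> b = m y a b" if "linear (Q y)" "bilinear (B y)" for y a b
 proof -
  have "m y a b = (SUM e:Basis. (b \<bullet> e) *r m y a e)" by (rule linear_expand[OF mlin(2)[OF that]])
  then show ?thesis by (simp only: M_def inner_sum_left inner_scaleR_left real_scaleR_def inner_commute[of b] mult.commute)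
 qed
 have Cc: "C y \<bullet> b = c y (Q y b)" if "linear (Q y)" "linear (c y)" for y b
 proof -
  have "c y (Q y b) = (SUM e:Basis. (b \<bullet> e) *r c y (Q y e))"
  using linear_expand[OF linear_compose[OF that], of b] by simp
  then show ?thesis by (simp only: C_def inner_sum_left inner_scaleR_left real_scaleR_def inner_commute[of b] mult.commute)
 qed
 have proj: "Q y a = a & (ALL b. B y a (Q y b) = f b)"
  if l: "linear (Q y)" "bilinear (B y)" and Qi: "!!a. Q y (Q y a) = Q y a" and f: "!!b. m y a b = f b" "!!b. f (b - Q y b) = 0" for y a f
 proof -
  have "Q y (b - Q y b) = 0" for b by (simp add: linear_diff[OF l(1)] Qi)
  then have "(a - Q y a) \<bullet> (a - Q y a) = 0"
  using f(1)[of "a - Q y a"] f(2)[of a] by (simp add: m_def bilinear_rzero[OF l(2)])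
  then have "Q y a = a" by simp
  then show ?thesis using f(1) by (simp add: m_def)
 qed
 have lx: "linear (Q x)" "bilinear (B x)" using Q(1) B(1) by (auto dest: around_self)
 have inj: "inj (M x)" unfolding linear_injective_0[OF Mlin[OF lx]]
 proof (intro allI impI)
  fix a assume "M x a = 0"
  then have "m x a b = 0" for b using Mm[OF lx, of a b] by simp
  from proj[OF lx idem this refl] show "a = 0" using nondeg by blast
 qed
 have ev: "around x (%y. linear (Q y) & bilinear (B y) & linear (c y))"
  using Q(1) B(1) c(1) by eventually_elim simp
 have sQ: "smooth_at x (%y. B y (v y) (w y))" if "smooth_at x v" "smooth_at x w" for v w
 proof (rule smooth_linear_family[where A="%y. B y (v y)", OF _ _ that(2)])
  show "around x (%y. linear (B y (v y)))" using B(1) by eventually_elim (simp add: bilinear_def)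
  show "smooth_at x (%y. B y (v y) b)" for b
  by (rule smooth_linear_family[where A="%y a. B y a b", OF _ B(2) that(1)])
  (use B(1) in eventually_elim, simp add: bilinear_def)
 qed
 have sM: "smooth_at x (%y. M y a)" for a unfolding M_def m_def
  by (intro smooth_sum smooth_scaleR smooth_add smooth_inner smooth_diff smooth_const Q(2) sQ)
 have sC: "smooth_at x C" unfolding C_def[abs_def]
  by (intro smooth_sum smooth_scaleR smooth_const smooth_linear_family[OF c] Q(2))
 have "around x (%y. linear (M y))" using ev by eventually_elim (simp add: Mlin)
 from eventually_inj[OF this sM inj] ev
 have "around x (%y. inj (M y) & linear (Q y) & bilinear (B y) & linear (c y))" by eventually_elim simp
 then obtain V where V: "open V" "x : V" "!!y. y : V ==> inj (M y) & linear (Q y) & bilinear (B y) & linear (c y)"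
  by (rule around_openE) blast
 have "EX a. M y a = C y" if "y : V" for y
  using linear_injective_imp_surjective[OF Mlin] V(3)[OF that] by (metis surjD)
 then obtain Y where Y: "!!y. y : V ==> M y (Y y) = C y" by metis
 have "around x (%y. (ALL b:Basis. smooth_at y (%z. M z b)) & smooth_at y C)"
  using smooth_eventually_all[OF finite_Basis sM] smooth_around[OF sC] by eventually_elim simp
 then obtain V' where V': "open V'" "x : V'" "!!y. y : V' ==> (ALL b:Basis. smooth_at y (%z. M z b)) & smooth_at y C"
  by (rule around_openE) blast
 have o: "open (V \<inter> V')" "x : V \<inter> V'" using V V' by auto
 have Ck: "Ck_on k (V \<inter> V') Y" for k
 proof (rule Ck_on_solve[OF o(1), where A=M and c=C])
  show "linear (M y)" "inj (M y)" "M y (Y y) = C y" if "y : V \<inter> V'" for y using that V(3) Mlin Y by auto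
  show "Ck_on k (V \<inter> V') (%x. M x b)" if "b : Basis" for b
  using V'(3) that o(1) smooth_on_open_iff[OF o(1), of "%x. M x b"] unfolding smooth_on_def by blast
  show "Ck_on k (V \<inter> V') C" using V'(3) smooth_on_open_iff[OF o(1), of C] unfolding smooth_on_def by blast
 qed
 show thesis
 proof (rule that[of Y])
  show "smooth_at x Y" by (rule smooth_atI_Ck[OF o Ck])
  show "around x (%y. (ALL a. Q y (Q y a) = Q y a) --> Q y (Y y) = Y y & (ALL b. B y (Y y) (Q y b) = c y (Q y b)))"
  using around_open[OF V(1,2)]
  proof eventually_elim
  case (elim y)
  note l = V(3)[OF elim]
  show ?case
  proof
  assume i: "ALL a. Q y (Q y a) = Q y a"
  have "m y (Y y) b = c y (Q y b)" for b using Y[OF elim] Mm[of y "Y y" b] Cc[of y b] l by simp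
  then show "Q y (Y y) = Y y & (ALL b. B y (Y y) (Q y b) = c y (Q y b))"
  using i l by (intro proj) (simp_all add: linear_diff linear_0)
  qed
  qed
 qed
qed

context polarized
begin

text \<open>\<open>(Y, 1)\<close> spans the kernel of \<open>Om\<close>. On the cone, where radial vectors lie in the kernel as well, orthogonality to the
orbit of \<open>x\<close> makes the solution unique, tangent to the spheres and equivariant.\<close>

definition moser :: "complex ^ 'm => real => complex ^ 'm => bool" where
 "moser x t Y \<longleftrightarrow> Y : T x & Y \<bullet> x = 0 & Y \<bullet> (\<i> *s x) = 0 & (ALL b:T x. Om x t (Y, 1) (b, 0) = 0)"

lemma inner_vscale: "(u *s x) \<bullet> (w *s y) = Re (u * cnj w) * (x \<bullet> y) - Im (u * cnj w) * (x \<bullet> (\<i> *s y))"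
 for x y :: "complex ^ 'm"
 unfolding inner_vec_def sum_distrib_left sum_subtractf[symmetric]
 by (intro sum.cong refl) (simp add: inner_complex_def algebra_simps)

lemma inner_i: "x \<bullet> (\<i> *s x) = 0" for x :: "complex ^ 'm"
 unfolding inner_vec_def by (intro sum.neutral) (simp add: inner_complex_def)

lemma inner_radial: "(u *s x) \<bullet> x = Re u * (x \<bullet> x)" "(u *s x) \<bullet> (\<i> *s x) = Im u * (x \<bullet> x)" for x :: "complex ^ 'm"
 using inner_vscale[of u x 1 x] inner_vscale[of u x \<i> x] by (simp_all add: inner_i)

lemma moser_unique:
 assumes x: "x : X" and t: "0 < t" "t < 2" and Y: "moser x t Y" "moser x t Y'" shows "Y = Y'"
proof -
 define D where "D = Y - Y'"
 have T: "Y : T x" "Y' : T x" "D : T x" using Y T_diff[OF x] by (auto simp: moser_def D_def)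
 have "Om x t (D, 0) (b, 0) = 0" if b: "b : T x" for b
  using Om_add_left[OF x, of t "(D, 0)" "(Y', 1)" "(b, 0)"] T b t Y by (simp add: moser_def D_def)
 then have "Om x t (D, 0) (\<i> *s D, 0) = 0" using T_scale[OF x T(3)] by blast
 then obtain u where u: "D = u *s x" using Om_pos[OF x t T(3)] by force
 have "D \<bullet> x = 0" "D \<bullet> (\<i> *s x) = 0" using Y by (simp_all add: D_def moser_def inner_diff_left)
 then have "u = 0" using inner_radial[of u x] x zero_notin_X by (auto simp: u complex_eq_iff)
 then show ?thesis using u by (simp add: D_def)
qed

lemma moser_scale:
 assumes x: "x : X" and t: "t ~= 0" and u: "u ~= 0" and Y: "moser x t Y" shows "moser (u *s x) t (u *s Y)"
 unfolding moser_def
proof (intro conjI ballI)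
 have Y': "Y : T x" using Y by (simp add: moser_def)
 show "u *s Y : T (u *s x)" using T_cone[OF x u] T_scale[OF x Y'] by simp
 show "(u *s Y) \<bullet> (u *s x) = 0" using Y by (simp add: inner_vscale moser_def)
 show "(u *s Y) \<bullet> (\<i> *s (u *s x)) = 0"
  using Y inner_vscale[of u Y "\<i> * u" x] by (simp add: moser_def vs_assoc)
 fix b assume "b : T (u *s x)"
 then have b: "inverse u *s b : T x" "b = u *s (inverse u *s b)"
  using T_cone[OF x u] T_scale[OF x] u by (auto simp: vs_assoc)
 show "Om (u *s x) t (u *s Y, 1) (b, 0) = 0"
  by (subst b(2), subst Om_scale[OF x t u Y' b(1)]) (use Y b(1) in \<open>simp add: moser_def\<close>)
qed

definition horizontal :: "complex ^ 'm => complex ^ 'm => complex ^ 'm" where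
 "horizontal y v = v - (v \<bullet> y / (y \<bullet> y)) *r y - (v \<bullet> (\<i> *s y) / (y \<bullet> y)) *r (\<i> *s y)"

lemma horizontal_radial: "horizontal y v = v - Complex (v \<bullet> y / (y \<bullet> y)) (v \<bullet> (\<i> *s y) / (y \<bullet> y)) *s y"
 by (simp add: horizontal_def vec_eq_iff complex_eq_iff)

lemma linear_horizontal: "linear (horizontal y)"
 by (rule linearI) (simp_all add: horizontal_def inner_add_left algebra_simps add_divide_distrib)

lemma horizontal_T: "y : X ==> v : T y ==> horizontal y v : T y"
 unfolding horizontal_radial by (intro T_diff radial_T)

lemma horizontal_orthogonal:
 assumes "y ~= 0" shows "horizontal y v \<bullet> y = 0" "horizontal y v \<bullet> (\<i> *s y) = 0" "horizontal y (horizontal y v) = horizontal y v"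
proof -
 have i: "(\<i> *s y) \<bullet> (\<i> *s y) = y \<bullet> y" "(\<i> *s y) \<bullet> y = 0" "y \<bullet> (\<i> *s y) = 0"
  using inner_vscale[of \<i> y \<i> y] by (simp_all add: inner_i inner_commute)
 show a: "horizontal y v \<bullet> y = 0" "horizontal y v \<bullet> (\<i> *s y) = 0"
  using assms by (simp_all add: horizontal_def inner_diff_left i)
 show "horizontal y (horizontal y v) = horizontal y v"
  unfolding horizontal_def[of y "horizontal y v"] a by simp
qed

lemma smooth_horizontal:
 assumes "smooth_at x y" "smooth_at x v" "y x ~= 0" shows "smooth_at x (%z. horizontal (y z) (v z))"
 unfolding horizontal_def
 by (intro smooth_diff smooth_scaleR smooth_divide smooth_inner smooth_bl[OF bl_vscale] assms)
  (use assms in auto)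

lemma moser_field:
 assumes x: "x : X" and t: "0 < t" "t < 2"
 obtains Y where "smooth_at (x, t) Y" "around (x, t) (%y. fst y : X --> moser (fst y) (snd y) (Y y))"
proof -
 obtain k S th e where f: "frame x k S th e" using frame_at[OF x] by blast
 obtain r where r: "smooth_at x r" "around x (%z. smooth_at z r & r z : X & (ALL v. fd r z v : T (r z)))"
  "around x (%z. z : X --> r z = z & (ALL v:T z. fd r z v = v))" "r x = x"
  by (rule retraction[OF x], rule that, assumption+)
 have t0: "t ~= 0" using t by simp
 have x0: "x ~= 0" using x zero_notin_X by blast
 define L where "L = prim S th e"
 have L: "smooth_form (x, t) L" unfolding L_def by (rule frame_forms(4)[OF f t0])
 define Q where "Q y v = horizontal (fst y) (fd r (fst y) v)" for y :: "(complex ^ 'm) \<times> real" and v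
 have rev: "around (x, t) (%y. smooth_at (fst y) r & (fst y : X --> r (fst y) = fst y & (ALL v. fd r (fst y) v : T (fst y)) & (ALL v:T (fst y). fd r (fst y) v = v)))"
 proof -
  have "around x (%z. smooth_at z r & (z : X --> r z = z & (ALL v. fd r z v : T z) & (ALL v:T z. fd r z v = v)))"
  using r(2,3) by eventually_elim (metis (no_types))
  then show ?thesis by (intro around_compose[OF smooth_fst_id]) simp
 qed
 have Qi: "Q y (Q y a) = Q y a & Q y a : T (fst y)" if "fst y : X" "!!v. fd r (fst y) v : T (fst y)" "!!v. v : T (fst y) ==> fd r (fst y) v = v" for y a
 proof -
  have "fst y ~= 0" using that(1) zero_notin_X by metis
  then show ?thesis using that horizontal_T[OF that(1,2)] by (simp add: Q_def horizontal_orthogonal)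
 qed
 have lev: "around (x, t) (%y. bilinear (ext_d1 L y))"
  using form_around[OF L] by eventually_elim (simp add: ext_d1_bilinear)
 have here: "fd r x v : T x" "v : T x ==> fd r x v = v" for v
  using around_self[OF rev] x by simp_all
 have sL: "smooth_at (x, t) (%y. ext_d1 L y v w)" for v w by (rule smooth_ext_d1[OF L])
 obtain Y where Y: "smooth_at (x, t) Y" "around (x, t) (%y. (ALL a. Q y (Q y a) = Q y a) -->
  Q y (Y y) = Y y & (ALL b. ext_d1 L y (Y y, 0) (Q y b, 0) = - ext_d1 L y (0, 1) (Q y b, 0)))"
 proof (rule moser_solve[where x="(x, t)" and Q=Q and B="%y a b. ext_d1 L y (a, 0) (b, 0)" and c="%y b. - ext_d1 L y (0, 1) (b, 0)"])
  show "around (x, t) (%y. linear (Q y))" using rev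
  proof eventually_elim
  case (elim y)
  then have "linear (fd r (fst y))" using smooth_lin by blast
  from linear_compose[OF this linear_horizontal] show ?case by (simp add: Q_def[abs_def] o_def)
  qed
  show "smooth_at (x, t) (%y. Q y b)" for b unfolding Q_def
  by (intro smooth_horizontal smooth_fst_id smooth_compose[OF smooth_fst_id, where g="%y. fd r y b"] smooth_fd)
  (use r(1) x0 in simp_all)
  show "around (x, t) (%y. bilinear (%a b. ext_d1 L y (a, 0) (b, 0)))" using lev
  proof eventually_elim
  case (elim y)
  have p: "(a + b, 0 :: real) = (a, 0) + (b, 0)" "(r *r a, 0 :: real) = r *r (a, 0)" for a b :: "complex ^ 'm" and r by simp_all
  show ?case unfolding bilinear_def
  by (auto intro!: linearI simp only: p bilinear_ladd[OF elim] bilinear_radd[OF elim] bilinear_lmul[OF elim] bilinear_rmul[OF elim])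
  qed
  show "around (x, t) (%y. linear (%b. - ext_d1 L y (0, 1) (b, 0)))" using lev
  proof eventually_elim
  case (elim y)
  have p: "(a + b, 0 :: real) = (a, 0) + (b, 0)" "(r *r a, 0 :: real) = r *r (a, 0)" for a b :: "complex ^ 'm" and r by simp_all
  show ?case
  by (rule linearI) (simp_all only: p bilinear_radd[OF elim] bilinear_rmul[OF elim] minus_add_distrib scaleR_minus_right)
  qed
  show "smooth_at (x, t) (%y. ext_d1 L y (a, 0) (b, 0))" "smooth_at (x, t) (%y. - ext_d1 L y (0, 1) (b, 0))" for a b
  by (intro sL smooth_minus)+
  show "Q (x, t) (Q (x, t) a) = Q (x, t) a" for a using Qi[of "(x, t)"] x here by simp
 next
  fix a assume a: "Q (x, t) a = a" and 0: "!!b. ext_d1 L (x, t) (a, 0) (Q (x, t) b, 0) = 0"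
  have aT: "a : T x" and orth: "a \<bullet> x = 0" "a \<bullet> (\<i> *s x) = 0"
  using Qi[of "(x, t)" a] x here a horizontal_orthogonal(1,2)[OF x0, of "fd r x a"] by (simp_all add: Q_def)
  have iT: "\<i> *s a : T x" by (rule T_scale[OF x aT])
  have "Q (x, t) (\<i> *s a) = \<i> *s a"
  using here(2)[OF iT] inner_vscale[of \<i> a 1 x] inner_vscale[of \<i> a \<i> x] orth
  by (simp add: Q_def horizontal_def)
  then have "Om x t (a, 0) (\<i> *s a, 0) = 0" using 0[of "\<i> *s a"] Om_eq[OF f t0, of "(a, 0)" "(\<i> *s a, 0)"] aT iT by (simp add: L_def)
  then obtain u where u: "a = u *s x" using Om_pos[OF x t aT] by force
  then have "u = 0" using inner_radial[of u x] orth x0 by (auto simp: complex_eq_iff)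
  then show "a = 0" by (simp add: u)
 qed
 show thesis
 proof (rule that[OF Y(1)])
  have tev: "around (x, t) (%y. 0 < snd y & snd y < 2)"
  using around_compose[OF smooth_snd_id[of "(x, t)"], of "%t. t : {0<..<2}"]
  around_open[of "{0<..<2}" t] t by simp
  show "around (x, t) (%y. fst y : X --> moser (fst y) (snd y) (Y y))"
  using Y(2) rev lev tev frame_around_prod[OF f t0]
  proof eventually_elim
  case (elim y)
  show ?case
  proof
  assume yX: "fst y : X"
  obtain z s where y: "y = (z, s)" by (cases y)
  have z: "z : X" "z ~= 0" and s0: "s ~= 0" using yX elim(4) zero_notin_X by (auto simp: y)
  have fy: "frame z k S th e" using elim(5) yX by (simp add: y)
  have h: "!!v. fd r z v : T z" "!!v. v : T z ==> fd r z v = v" using elim(2) yX by (simp_all add: y)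
  have q: "Q y (Q y a) = Q y a & Q y a : T z" for a using Qi[of y a] h yX by (simp add: y)
  have YQ: "Q y (Y y) = Y y" and YB: "!!b. ext_d1 L y (Y y, 0) (Q y b, 0) = - ext_d1 L y (0, 1) (Q y b, 0)"
  using elim(1) q by blast+
  have YT: "Y y : T z" using q[of "Y y"] YQ by simp
  have "Om z s (Y y, 1) (b, 0) = 0" if b: "b : T z" for b
  proof -
  define u where "u = Complex (b \<bullet> z / (z \<bullet> z)) (b \<bullet> (\<i> *s z) / (z \<bullet> z))"
  have Qb: "Q y b = b - u *s z" using h(2)[OF b] by (simp add: Q_def y horizontal_radial u_def)
  have "ext_d1 L y (Y y, 1) (Q y b, 0) = 0"
  using bilinear_ladd[OF elim(3), of "(Y y, 0)" "(0, 1)" "(Q y b, 0)"] YB[of b] by simp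
  then have "Om z s (Y y, 1) (Q y b, 0) = 0"
  using Om_eq[OF fy s0, of "(Y y, 1)" "(Q y b, 0)"] YT q[of b] by (simp add: L_def y)
  moreover have "Om z s (u *s z, 0) (Y y, 1) = 0" using Om_radial[OF z(1) s0] YT by simp
  moreover have "Om z s (b, 0) (Y y, 1) = Om z s (Q y b, 0) (Y y, 1) + Om z s (u *s z, 0) (Y y, 1)"
  using Om_add_left[OF z(1) s0, of "(Q y b, 0)" "(u *s z, 0)" "(Y y, 1)"] q[of b] radial_T[OF z(1)] YT by (simp add: Qb)
  ultimately show ?thesis
  using Om_skew[OF z(1) s0, of "(Y y, 1)" "(b, 0)"] Om_skew[OF z(1) s0, of "(Y y, 1)" "(Q y b, 0)"] YT b q[of b] by simp
  qed
  moreover have "Y y \<bullet> z = 0" "Y y \<bullet> (\<i> *s z) = 0"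
  using horizontal_orthogonal(1,2)[OF z(2), of "fd r z (Y y)"] YQ by (simp_all add: Q_def y)
  ultimately show "moser (fst y) (snd y) (Y y)" using YT by (simp add: moser_def y)
  qed
  qed
 qed
qed

end

section \<open>Flows that preserve a form\<close>

lemma eventually_isCont:
 assumes "isCont g x" "around (g x) (%y. P y)" shows "around x (%z. P (g z))"
proof -
 have "filterlim g (nhds (g x)) (nhds x)" using assms(1) tendsto_at_iff_tendsto_nhds[of g x] by (simp add: isCont_def)
 from eventually_compose_filterlim[OF assms(2) this] show ?thesis .
qed

lemma positive_lower_bound: "finite A ==> (!!a. a : A ==> a > (0 :: real)) ==> EX d>0. ALL a:A. d <= a"
 by (intro exI[of _ "Min (insert 1 A)"]) auto

text \<open>The flow of \<open>Y\<close> on the image of a retraction \<open>r\<close>, extended to the ambient space by first applying \<open>r\<close>. Along an orbit the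
defect \<open>x - r x\<close> obeys a linear differential inequality, since \<open>Y\<close> is tangent to the image, so it stays \<open>0\<close> by
\<open>ode_bound\<close>. It serves twice: on \<open>X\<close> for \<open>t > 0\<close>, and on affine space near \<open>t = 0\<close>.\<close>

lemma constrained_flow:
 fixes Y :: "'a::euclidean_space \<times> real => 'a"
 assumes Y: "smooth_at (x0, t0) Y" and r: "smooth_at x0 r" "r x0 = x0" and L: "smooth_form (x0, t0) L"
  and P: "around (x0, t0) (%z. P z)" and idem: "around x0 (%x. r (r x) = r x)"
  and tan: "around (x0, t0) (%z. r (fst z) = fst z --> fd r (fst z) (Y z) = Y z &
  (ALL v. fd r (fst z) v = v --> ext_d1 L z (v, 0) (Y z, 1) = 0))"
 obtains d rho Gam where "d > 0" "rho > 0" "!!s y. Gam s s y = r y"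
  "!!s t y. s : {t0 - d<..<t0 + d} ==> t : {t0 - d<..<t0 + d} ==> y : ball x0 rho ==>
  smooth_at y (Gam s t) & r (Gam s t y) = Gam s t y & P (Gam s t y, t) &
  ((%t. Gam s t y) has_vd Y (Gam s t y, t)) (at t)"
  "!!s t y v w. s : {t0 - d<..<t0 + d} ==> t : {t0 - d<..<t0 + d} ==> y : ball x0 rho ==>
  fd r (Gam s t y) (fd (Gam s t) y v) = fd (Gam s t) y v &
  ext_d1 L (Gam s t y, t) (fd (Gam s t) y v, 0) (fd (Gam s t) y w, 0) = ext_d1 L (r y, s) (fd r y v, 0) (fd r y w, 0)"
proof -
 let ?z0 = "(x0, t0)"
 define V where "V z = (Y z, 1 :: real)" for z
 have sV: "smooth_at ?z0 V" unfolding V_def[abs_def] by (intro smooth_Pair smooth_const Y)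
 define N where "N z = Y z - fd r (fst z) (Y z)" for z
 have sN: "smooth_at ?z0 N" unfolding N_def[abs_def]
  using r(1) by (intro smooth_diff Y smooth_fd_compose[OF _ smooth_fst_id Y]) simp
 obtain r1 K where K: "r1 > 0" "K > 0" "!!x y. x : cball ?z0 r1 ==> y : cball ?z0 r1 ==> norm (N x - N y) <= K * norm (x - y)"
  by (rule smooth_second_order[OF sN], rule that, assumption+)
 define R where "R z = (r (fst z), snd z)" for z :: "'a \<times> real"
 have sR: "smooth_at ?z0 R" unfolding R_def[abs_def]
  using r(1) by (intro smooth_Pair smooth_compose[OF smooth_fst_id] smooth_snd_id) simp
 define good where "good z \<longleftrightarrow> z : cball ?z0 r1 & smooth_at (fst z) r & smooth_form z L & P z & r (r (fst z)) = r (fst z) &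
  (r (fst z) = fst z --> fd r (fst z) (Y z) = Y z & (ALL v. fd r (fst z) v = v --> ext_d1 L z (v, 0) (Y z, 1) = 0))" for z
 have 1: "around ?z0 (%z. smooth_at (fst z) r & r (r (fst z)) = r (fst z))"
  using idem smooth_around[OF r(1)]
  by (intro around_compose[OF smooth_fst_id, where P="%z. smooth_at z r & r (r z) = r z"]) (simp add: eventually_conj)
 have 2: "around ?z0 (%z. z : cball ?z0 r1)"
  using around_open[of "ball ?z0 r1" ?z0] K(1) by (auto elim: eventually_mono)
 have g: "around ?z0 (%z. good z)"
  using 1 2 P tan form_around[OF L] unfolding good_def by eventually_elim auto
 then have "around ?z0 (%z. good (R z))" by (intro around_compose[OF sR]) (simp add: R_def r(2))
 with g have "around ?z0 (%z. good z & good (R z))" by eventually_elim simp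
 then obtain e where e: "e > 0" "!!z. dist z ?z0 < e ==> good z & good (R z)"
  unfolding eventually_nhds_metric by blast
 have G0: "good z & good (R z)" if "z : cball ?z0 (e / 2)" for z using e that by (auto simp: dist_commute)
 have e2: "e / 2 > 0" using e by simp
 obtain d1 q phi where F: "d1 > 0" "q > 0" "!!z. phi 0 z = z"
  "smooth_on ({-d1<..<d1} \<times> ball ?z0 q) (%p. phi (fst p) (snd p))"
  "!!t z. t : {-d1<..<d1} ==> z : ball ?z0 q ==> phi t z : cball ?z0 (e / 2) & smooth_at (phi t z) V &
  ((%s. phi s z) has_vd V (phi t z)) (at t)"
  by (rule flow_box[OF sV e2], rule that, assumption+)
 have dd: "((%s. fst (phi s z)) has_vd Y (phi t z)) (at t)"
  "((%s. snd (phi s z)) has_real_derivative 1) (at t)" if "t : {-d1<..<d1}" "z : ball ?z0 q" for t z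
 proof -
  have D: "((%s. phi s z) has_vd (Y (phi t z), 1)) (at t)" using F(5)[OF that] by (simp add: V_def)
  from bounded_linear.has_vector_derivative[OF bounded_linear_fst D] bounded_linear.has_vector_derivative[OF bounded_linear_snd D]
  show "((%s. fst (phi s z)) has_vd Y (phi t z)) (at t)" "((%s. snd (phi s z)) has_real_derivative 1) (at t)"
  by (simp_all add: has_real_derivative_iff_has_vector_derivative)
 qed
 have sndphi: "snd (phi t z) = snd z + t" if t: "t : {-d1<..<d1}" and z: "z : ball ?z0 q" for t z
 proof -
  have "((%s. snd (phi s z) - s) has_real_derivative 0) (at s within {-d1<..<d1})" if "s : {-d1<..<d1}" for s
  using has_field_derivative_at_within[OF DERIV_diff[OF dd(2)[OF that z] DERIV_ident]] by simp
  from has_field_derivative_zero_constant[OF convex_real_interval(8) this]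
  obtain c where "!!s. s : {-d1<..<d1} ==> snd (phi s z) - s = c" by blast
  from this[of 0] this[OF t] show ?thesis using F(1,3) by simp
 qed
 have inv: "r (fst (phi t z)) = fst (phi t z)" if t: "\<bar>t\<bar> < d1" "\<bar>t\<bar> < 1 / (4 * K)" and z: "z : ball ?z0 q" "r (fst z) = fst z" for t z
 proof -
  define e' where "e' s = fst (phi s z) - r (fst (phi s z))" for s
  have I: "s : {-d1<..<d1}" if "s : {-\<bar>t\<bar>..\<bar>t\<bar>}" for s using that t by auto
  have "norm (e' t) <= 2 * (norm (e' 0) + (\<bar>t\<bar> - - \<bar>t\<bar>) * 0)"
  proof (rule ode_bound[where e'="%s. N (phi s z)" and L=K])
  fix s assume s: "s : {-\<bar>t\<bar>..\<bar>t\<bar>}"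
  have G: "good (phi s z)" "good (R (phi s z))" using G0[OF conjunct1[OF F(5)[OF I[OF s] z(1)]]] by simp_all
  have rd: "(r has_derivative fd r (fst (phi s z))) (at (fst (phi s z)))"
  using G(1) smooth_deriv unfolding good_def by blast
  from diff_chain_at[OF dd(1)[OF I[OF s] z(1), unfolded has_vector_derivative_def] this]
  have "((%s. r (fst (phi s z))) has_vd fd r (fst (phi s z)) (Y (phi s z))) (at s)"
  using linear_scale[OF has_derivative_linear[OF rd]] by (simp add: has_vector_derivative_def o_def)
  from has_vector_derivative_diff[OF dd(1)[OF I[OF s] z(1)] this]
  show "(e' has_vd N (phi s z)) (at s within {-\<bar>t\<bar>..\<bar>t\<bar>})"
  unfolding e'_def[abs_def] N_def by (rule has_vector_derivative_at_within)
  have "N (R (phi s z)) = 0" using G by (simp add: good_def R_def N_def)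
  moreover have "norm (N (phi s z) - N (R (phi s z))) <= K * norm (phi s z - R (phi s z))"
  using G by (intro K(3)) (simp_all add: good_def)
  moreover have "phi s z - R (phi s z) = (e' s, 0)" by (simp add: R_def e'_def prod_eq_iff)
  ultimately show "norm (N (phi s z)) <= K * norm (e' s) + 0" by (simp add: norm_Pair)
  qed (use t K(2) in \<open>auto simp: field_simps\<close>)
  then show ?thesis using z(2) by (simp add: e'_def F(3))
 qed
 have "around x0 (%y. r y : ball x0 (q / 2))"
  using F(2) by (intro around_compose[OF r(1), of "%z. z : ball x0 (q / 2)"] around_open) (simp_all add: r(2))
 with idem smooth_around[OF r(1)] have "around x0 (%y. r y : ball x0 (q / 2) & smooth_at y r & r (r y) = r y)"
  by eventually_elim simp
 then obtain rho where rho: "rho > 0" "!!y. y : ball x0 rho ==> r y : ball x0 (q / 2) & smooth_at y r & r (r y) = r y"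
  unfolding eventually_nhds_metric by (auto simp: dist_commute)
 define d where "d = min (d1 / 2) (min (1 / (8 * K)) (q / 2))"
 have d: "d > 0" "d <= d1 / 2" "d <= 1 / (8 * K)" "d <= q / 2" using F(1,2) K(2) by (auto simp: d_def)
 define J where "J = {t0 - d<..<t0 + d}"
 have J: "t - s : {-d1<..<d1}" "\<bar>t - s\<bar> < d1" "\<bar>t - s\<bar> < 1 / (4 * K)" if "s : J" "t : J" for s t
  using that d(2,3) by (auto simp: J_def field_simps abs_if split: if_splits)
 have start: "(r y, s) : ball ?z0 q" if "y : ball x0 rho" "s : J" for y s
 proof -
  have "dist ?z0 (r y, s) <= dist x0 (r y) + dist t0 s" by (simp add: dist_Pair_Pair sqrt_sum_squares_le_sum)
  also have "... < q" using rho(2)[OF that(1)] that(2) d(4) by (auto simp: J_def dist_real_def)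
  finally show ?thesis by simp
 qed
 define Psi where "Psi s p = phi (snd p - s) (r (fst p), s)" for s p
 define Gam where "Gam s t y = fst (Psi s (y, t))" for s t y
 let ?O = "ball x0 rho \<times> J"
 have oO: "open ?O" unfolding J_def by (intro open_Times) auto
 have sPsi: "smooth_at p (Psi s)" if s: "s : J" and p: "p : ?O" for s p
 proof -
  have o: "open ({-d1<..<d1} \<times> ball ?z0 q)" by (intro open_Times) auto
  have "smooth_at (snd p - s, (r (fst p), s)) (%p. phi (fst p) (snd p))"
  using F(4) J(1)[OF s, of "snd p"] start[OF _ s, of "fst p"] p unfolding smooth_on_open_iff[OF o] by auto
  moreover have "smooth_at p (%p. (snd p - s, (r (fst p), s)))"
  using rho(2)[of "fst p"] p by (intro smooth_Pair smooth_diff smooth_snd_id smooth_const smooth_compose[OF smooth_fst_id]) auto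
  ultimately have "smooth_at p (%p. (%p. phi (fst p) (snd p)) (snd p - s, (r (fst p), s)))" by (rule smooth_compose[rotated])
  then show ?thesis by (simp add: Psi_def[abs_def])
 qed
 have Psir: "r (fst (Psi s p)) = fst (Psi s p)" "snd (Psi s p) = snd p" "good (Psi s p)" if s: "s : J" and p: "p : ?O" for s p
 proof -
  have p': "fst p : ball x0 rho" "snd p : J" using p by auto
  show "r (fst (Psi s p)) = fst (Psi s p)" "snd (Psi s p) = snd p"
  using J[OF s p'(2)] start[OF p'(1) s] rho(2)[OF p'(1)] inv[of "snd p - s" "(r (fst p), s)"] sndphi[of "snd p - s" "(r (fst p), s)"]
  by (simp_all add: Psi_def)
  show "good (Psi s p)" using G0[OF conjunct1[OF F(5)[OF J(1)[OF s p'(2)] start[OF p'(1) s]]]] by (simp add: Psi_def)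
 qed
 have PsiGam: "Psi s (y, t) = (Gam s t y, t)" if "s : J" "t : J" "y : ball x0 rho" for s t y
  using Psir(2)[OF that(1), of "(y, t)"] that by (simp add: Gam_def prod_eq_iff)
 have dt: "((%t. Psi s (y, t)) has_vd (Y (Psi s (y, t)), 1)) (at t)" if s: "s : J" and t: "t : J" and y: "y : ball x0 rho" for s y t
 proof -
  have "((%tau. tau - s) has_vd 1) (at t)" by (auto intro!: derivative_eq_intros)
  moreover have "((%t. phi t (r y, s)) has_vd V (phi (t - s) (r y, s))) (at (t - s))"
  using F(5)[OF J(1)[OF s t] start[OF y s]] by blast
  ultimately show ?thesis using vector_diff_chain_at[of "%tau. tau - s" 1 t "%t. phi t (r y, s)"] by (simp add: o_def Psi_def V_def)
 qed
 have fdPsi: "snd (fd (Psi s) p u) = snd u" "fd r (fst (Psi s p)) (fst (fd (Psi s) p u)) = fst (fd (Psi s) p u)" if s: "s : J" and p: "p : ?O" for s p u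
 proof -
  have "snd (fd (Psi s) p u) = fd (%p. snd (Psi s p)) p u" using fd_bl[OF bounded_linear_snd sPsi[OF s p]] by simp
  also have "... = fd snd p u" using fd_cong[OF oO p, of "%p. snd (Psi s p)" snd] Psir(2)[OF s] by simp
  finally show "snd (fd (Psi s) p u) = snd u" by (simp add: fd_snd)
  have "fd (%p. r (fst (Psi s p))) p u = fd (%p. fst (Psi s p)) p u"
  using fd_cong[OF oO p, of "%p. r (fst (Psi s p))" "%p. fst (Psi s p)"] Psir(1)[OF s] by simp
  then show "fd r (fst (Psi s p)) (fst (fd (Psi s) p u)) = fst (fd (Psi s) p u)"
  using fd_compose[OF smooth_fst[OF sPsi[OF s p]], of r u] Psir(3)[OF s p] fd_bl[OF bounded_linear_fst sPsi[OF s p], of u]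
  by (simp add: good_def)
 qed
 have par: "smooth_at y (Gam s t)" "fd (Psi s) (y, t) (v, 0) = (fd (Gam s t) y v, 0)" "fd (Psi s) (y, t) (0, 1) = (Y (Gam s t y, t), 1)"
  if s: "s : J" and t: "t : J" and y: "y : ball x0 rho" for s y t v
 proof -
  have p: "(y, t) : ?O" using y t by simp
  have si: "smooth_at y (%a. (a, t))" by (intro smooth_Pair smooth_ident smooth_const)
  have ss: "smooth_at (y, t) (Psi s)" by (rule sPsi[OF s p])
  show "smooth_at y (Gam s t)" unfolding Gam_def[abs_def] by (rule smooth_fst[OF smooth_compose[OF si ss]])
  have fi: "fd (%a. (a, t)) y v = (v, 0)"
  using fun_cong[OF fd_eq[OF has_derivative_Pair[OF has_derivative_ident has_derivative_const]]] by metis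
  have "fd (%a. Psi s (a, t)) y v = fd (Psi s) (y, t) (v, 0)" using fd_compose[OF si ss, of v] fi by simp
  then have "fst (fd (Psi s) (y, t) (v, 0)) = fd (Gam s t) y v"
  using fd_bl[OF bounded_linear_fst smooth_compose[OF si ss], of v] by (simp add: Gam_def[abs_def])
  then show "fd (Psi s) (y, t) (v, 0) = (fd (Gam s t) y v, 0)" using fdPsi(1)[OF s p, of "(v, 0)"] by (simp add: prod_eq_iff)
  have "((%t. (y, t)) has_vd (0, 1)) (at t)" by (rule has_vector_derivative_Pair[OF has_vector_derivative_const has_vector_derivative_id])
  from diff_chain_at[OF this[unfolded has_vector_derivative_def] smooth_deriv[OF ss]]
  have "((%t. Psi s (y, t)) has_vd fd (Psi s) (y, t) (0, 1)) (at t)"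
  by (simp only: has_vector_derivative_def o_def linear_scale[OF smooth_lin[OF ss]])
  from vector_derivative_unique_at[OF this dt[OF s t y]] show "fd (Psi s) (y, t) (0, 1) = (Y (Gam s t y, t), 1)"
  by (simp add: PsiGam[OF s t y])
 qed
 have Gamg: "r (Gam s t y) = Gam s t y" "good (Gam s t y, t)" "fd r (Gam s t y) (fd (Gam s t) y v) = fd (Gam s t) y v"
  if "s : J" "t : J" "y : ball x0 rho" for s t y v
  using Psir[OF that(1), of "(y, t)"] fdPsi(2)[OF that(1), of "(y, t)" "(v, 0)"] that by (simp_all add: PsiGam[OF that] par[OF that])
 have GamGam: "Gam s s = r" for s by (simp add: fun_eq_iff Gam_def Psi_def F(3))
 show thesis
 proof (rule that[of d rho Gam, folded J_def, OF d(1) rho(1)])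
  show "Gam s s y = r y" for s y by (simp add: GamGam)
  fix s t y assume a: "s : J" "t : J" "y : ball x0 rho"
  show "smooth_at y (Gam s t) & r (Gam s t y) = Gam s t y & P (Gam s t y, t) & ((%t. Gam s t y) has_vd Y (Gam s t y, t)) (at t)"
  using par(1)[OF a] Gamg(1,2)[OF a] bounded_linear.has_vector_derivative[OF bounded_linear_fst dt[OF a]]
  by (simp add: Gam_def[symmetric] PsiGam[OF a] good_def)
  fix v w
  define H where "H tau = ext_d1 L (Psi s (y, tau)) (fd (Psi s) (y, tau) (v, 0)) (fd (Psi s) (y, tau) (w, 0))" for tau
  have "(H has_real_derivative 0) (at tau within J)" if tau: "tau : J" for tau
  proof -
  have p: "(y, tau) : ?O" using a tau by simp
  have "around (y, tau) (%q. ALL v. ext_d1 L (Psi s q) (fd (Psi s) q (v, 0)) (fd (Psi s) q (0, 1)) = 0)"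
  using around_open[OF oO p]
  proof (rule eventually_mono, intro allI)
  fix q v assume "q : ?O"
  then obtain b sig where q: "q = (b, sig)" "b : ball x0 rho" "sig : J" by auto
  note bs = a(1) q(3,2)
  show "ext_d1 L (Psi s q) (fd (Psi s) q (v, 0)) (fd (Psi s) q (0, 1)) = 0"
  using Gamg[OF bs] unfolding q(1) PsiGam[OF bs] par(2,3)[OF bs] good_def by simp
  qed
  moreover have "smooth_form (Psi s (y, tau)) L" using Psir(3)[OF a(1) p] by (simp add: good_def)
  ultimately show ?thesis unfolding H_def[abs_def]
  using has_field_derivative_at_within[OF flow_invariance[OF sPsi[OF a(1) p], of L v w]] by blast
  qed
  then obtain c where "!!tau. tau : J ==> H tau = c" using has_field_derivative_zero_constant[of J H] by (auto simp: J_def)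
  then have "H t = H s" using a by simp
  then show "fd r (Gam s t y) (fd (Gam s t) y v) = fd (Gam s t) y v &
  ext_d1 L (Gam s t y, t) (fd (Gam s t) y v, 0) (fd (Gam s t) y w, 0) = ext_d1 L (r y, s) (fd r y v, 0) (fd r y w, 0)"
  using Gamg(3)[OF a] unfolding H_def par(2)[OF a] par(2)[OF a(1,1,3)] PsiGam[OF a] PsiGam[OF a(1,1,3)] by (simp add: GamGam)
 qed
qed

context polarized
begin

definition orbit :: "(real => complex ^ 'm) => real => real => bool" where
 "orbit gam a b \<longleftrightarrow> (ALL t:{a<..<b}. gam t : X & (EX Y. moser (gam t) t Y & (gam has_vd Y) (at t)))"

lemma orbit_isCont: "orbit gam a b ==> t : {a<..<b} ==> isCont gam t"
 unfolding orbit_def by (blast intro: has_vector_derivative_continuous)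

lemma orbit_unique:
 assumes ab: "0 <= a" "b <= 2" and orb: "orbit gam a b" "orbit gam' a b"
  and t1: "t1 : {a<..<b}" "gam t1 = gam' t1" and t: "t : {a<..<b}"
 shows "gam t = gam' t"
proof (rule connected_induction_simple[of "{a<..<b}" t1 t "%t. gam t = gam' t", OF _ t1(1) t t1(2)])
 show "connected {a<..<b}" by simp
 fix tau assume tau: "tau : {a<..<b}"
 have c: "isCont gam tau" "isCont gam' tau" using orb tau orbit_isCont by blast+
 have ev: "around tau (%sig. sig : {a<..<b})" by (rule around_open) (use tau in auto)
 have "around tau (%sig. (gam tau = gam' tau) = (gam sig = gam' sig))"
 proof (cases "gam tau = gam' tau")
  case False
  have "isCont (%sig. gam sig - gam' sig) tau" using c by (intro continuous_intros)
  moreover have "around (gam tau - gam' tau) (%z. z : - {0})" by (rule around_open) (use False in \<open>auto simp: open_Compl\<close>)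
  ultimately have "around tau (%sig. gam sig - gam' sig : - {0})" by (rule eventually_isCont)
  then show ?thesis by eventually_elim (use False in simp)
 next
  case True
  define x where "x = gam tau"
  have x: "x : X" using orb(1) tau by (simp add: orbit_def x_def)
  have t02: "0 < tau" "tau < 2" using tau ab by auto
  obtain Y where Y: "smooth_at (x, tau) Y" "around (x, tau) (%y. fst y : X --> moser (fst y) (snd y) (Y y))"
  by (rule moser_field[OF x t02])
  from smooth_around[OF Y(1)] Y(2)
  have "around (x, tau) (%y. smooth_at y Y & (fst y : X --> moser (fst y) (snd y) (Y y)))" by eventually_elim simp
  then obtain M where M: "open M" "(x, tau) : M" "!!y. y : M ==> smooth_at y Y & (fst y : X --> moser (fst y) (snd y) (Y y))"
  by (rule around_openE) blast
  have pM: "around tau (%sig. (g sig, sig) : M)" if "isCont g tau" "g tau = x" for g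
  proof -
  have "isCont (%sig. (g sig, sig)) tau" using that(1) by (intro continuous_intros)
  from eventually_isCont[OF this, of "%z. z : M"] around_open[OF M(1,2)] that(2) show ?thesis by simp
  qed
  have g2: "gam' tau = x" using True by (simp add: x_def)
  from pM[OF c(1) x_def[symmetric]] pM[OF c(2) g2] ev
  have "around tau (%sig. (gam sig, sig) : M & (gam' sig, sig) : M & sig : {a<..<b})" by eventually_elim simp
  then obtain d where d: "d > 0" "!!sig. dist sig tau < d ==> (gam sig, sig) : M & (gam' sig, sig) : M & sig : {a<..<b}"
  unfolding eventually_nhds_metric by blast
  have sV: "smooth_at y (%y. (Y y, 1 :: real))" if "y : M" for y
  using M(3)[OF that] by (intro smooth_Pair smooth_const) simp
  have der: "((%sig. (g sig, sig)) has_vd (Y (g sig, sig), 1)) (at sig)"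
  if g: "orbit g a b" and m: "(g sig, sig) : M" and sig: "sig : {a<..<b}" for g sig
  proof -
  obtain Y' where Y': "g sig : X" "moser (g sig) sig Y'" "(g has_vd Y') (at sig)"
  using g sig unfolding orbit_def by blast
  have "moser (g sig) sig (Y (g sig, sig))" using M(3)[OF m] Y'(1) by simp
  then have "Y' = Y (g sig, sig)" using moser_unique[OF Y'(1) _ _ Y'(2)] ab sig by auto
  then show ?thesis using Y'(3) by (intro has_vector_derivative_Pair) auto
  qed
  have "gam sig = gam' sig" if sig: "dist sig tau < d" for sig
  proof -
  let ?e = "\<bar>sig - tau\<bar>"
  have in_d: "dist sig' tau < d" if "sig' : {tau - ?e .. tau + ?e}" for sig' using that sig by (auto simp: dist_real_def)
  have c: "(gam t, t) : M & ((%sig. (gam sig, sig)) has_vd (Y (gam t, t), 1)) (at t within {tau - ?e..tau + ?e})"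
  "(gam' t, t) : M & ((%sig. (gam' sig, sig)) has_vd (Y (gam' t, t), 1)) (at t within {tau - ?e..tau + ?e})"
  if "t : {tau - ?e..tau + ?e}" for t
  using d(2)[OF in_d[OF that]] der[OF orb(1)] der[OF orb(2)] by (auto intro: has_vector_derivative_at_within)
  have "(gam sig, sig) = (gam' sig, sig)"
  using ode_unique[OF sV c, of tau "sig"] True by (simp add: abs_if split: if_splits)
  then show ?thesis by simp
  qed
  then show ?thesis using d(1) True unfolding eventually_nhds_metric by auto
 qed
 then obtain V where V: "open V" "tau : V" "!!sig. sig : V ==> (gam tau = gam' tau) = (gam sig = gam' sig)" by (rule around_openE) blast
 show "EX T. openin (top_of_set {a<..<b}) T & tau : T & (ALL x:T. ALL y:T. gam x = gam' x --> gam y = gam' y)"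
  using V tau by (intro exI[of _ "{a<..<b} \<inter> V"]) (auto intro: openin_open_Int)
qed

lemma local_flow:
 assumes x0: "x0 : X" and t0: "0 < t0" "t0 < 2"
 obtains del O' Gam where "del > 0" "open O'" "x0 : O'" "{t0 - del<..<t0 + del} \<subseteq> {0<..<2}"
  "!!s tau y. s : {t0 - del<..<t0 + del} ==> tau : {t0 - del<..<t0 + del} ==> y : O' ==> smooth_at y (Gam s tau)"
  "!!s y. s : {t0 - del<..<t0 + del} ==> y : O' ==> y : X ==> orbit (%tau. Gam s tau y) (t0 - del) (t0 + del) & Gam s s y = y"
  "!!s tau y v w. s : {t0 - del<..<t0 + del} ==> tau : {t0 - del<..<t0 + del} ==> y : O' ==> y : X ==> v : T y ==> w : T y ==>
  fd (Gam s tau) y v : T (Gam s tau y) & Om (Gam s tau y) tau (fd (Gam s tau) y v, 0) (fd (Gam s tau) y w, 0) = Om y s (v, 0) (w, 0)"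
proof -
 have t00: "t0 ~= 0" using t0 by simp
 obtain k S th e where f: "frame x0 k S th e" using frame_at[OF x0] by blast
 obtain r where r: "smooth_at x0 r" "around x0 (%z. smooth_at z r & r z : X & (ALL v. fd r z v : T (r z)))"
  "around x0 (%z. z : X --> r z = z & (ALL v:T z. fd r z v = v))" "r x0 = x0"
  by (rule retraction[OF x0], rule that, assumption+)
 obtain Y where Y: "smooth_at (x0, t0) Y" "around (x0, t0) (%y. fst y : X --> moser (fst y) (snd y) (Y y))"
  by (rule moser_field[OF x0 t0])
 define near where "near x \<longleftrightarrow> smooth_at x r & r x : X & (ALL v. fd r x v : T (r x)) & (x : X --> r x = x & (ALL v:T x. fd r x v = v))" for x
 have n0: "around x0 (%x. near x)" using r(2,3) unfolding near_def by eventually_elim simp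
 define P where "P z \<longleftrightarrow> near (fst z) & snd z : {0<..<2} &
  (fst z : X --> moser (fst z) (snd z) (Y z) & frame (fst z) k S th e & snd z ~= 0)" for z
 have "around (x0, t0) (%z. near (fst z))"
  using n0 by (intro around_compose[OF smooth_fst_id]) simp
 moreover have "around (x0, t0) (%z. snd z : {0<..<2})"
  using t0 by (intro around_compose[OF smooth_snd_id, where P="%z. z : {0<..<2}"] around_open) auto
 ultimately have P: "around (x0, t0) (%z. P z)"
  using Y(2) frame_around_prod[OF f t00] unfolding P_def by eventually_elim simp
 have ker: "fd r (fst z) (Y z) = Y z & (ALL v. fd r (fst z) v = v --> ext_d1 (prim S th e) z (v, 0) (Y z, 1) = 0)"
  if Pz: "P z" and rz: "r (fst z) = fst z" for z
 proof -
  obtain x tau where z: "z = (x, tau)" by (cases z)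
  have x: "near x" "x : X" using Pz rz unfolding P_def near_def z by auto
  then have m: "moser x tau (Y z)" "frame x k S th e" "tau ~= 0" using Pz by (auto simp: P_def z)
  have YT: "Y z : T x" using m(1) by (simp add: moser_def)
  have "ext_d1 (prim S th e) z (v, 0) (Y z, 1) = 0" if "fd r x v = v" for v
  proof -
  have v: "v : T x" using x that rz unfolding near_def z by (metis fst_conv)
  have "ext_d1 (prim S th e) (x, tau) (v, 0) (Y z, 1) = - Om x tau (Y z, 1) (v, 0)"
  using Om_eq[OF m(2,3), of "(v, 0)" "(Y z, 1)"] Om_skew[OF x(2) m(3), of "(v, 0)" "(Y z, 1)"] v YT by simp
  then show ?thesis using m(1) v by (simp add: z moser_def)
  qed
  then show ?thesis using x YT by (simp add: z near_def)
 qed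
 have idem: "around x0 (%x. r (r x) = r x)"
 proof -
  have "around x0 (%x. near (r x))" by (rule around_compose[OF r(1)]) (simp add: r(4) n0)
  with n0 show ?thesis by eventually_elim (simp add: near_def)
 qed
 have "around (x0, t0) (%z. r (fst z) = fst z --> fd r (fst z) (Y z) = Y z &
  (ALL v. fd r (fst z) v = v --> ext_d1 (prim S th e) z (v, 0) (Y z, 1) = 0))"
  using P by (rule eventually_mono) (use ker in blast)
 from constrained_flow[OF Y(1) r(1,4) frame_forms(4)[OF f t00] P idem this]
 obtain del rho Gam where F: "del > 0" "rho > 0" "!!s y. Gam s s y = r y"
  "!!s t y. s : {t0 - del<..<t0 + del} ==> t : {t0 - del<..<t0 + del} ==> y : ball x0 rho ==>
  smooth_at y (Gam s t) & r (Gam s t y) = Gam s t y & P (Gam s t y, t) &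
  ((%t. Gam s t y) has_vd Y (Gam s t y, t)) (at t)"
  "!!s t y v w. s : {t0 - del<..<t0 + del} ==> t : {t0 - del<..<t0 + del} ==> y : ball x0 rho ==>
  fd r (Gam s t y) (fd (Gam s t) y v) = fd (Gam s t) y v &
  ext_d1 (prim S th e) (Gam s t y, t) (fd (Gam s t) y v, 0) (fd (Gam s t) y w, 0) = ext_d1 (prim S th e) (r y, s) (fd r y v, 0) (fd r y w, 0)"
  by blast
 define J where "J = {t0 - del<..<t0 + del}"
 note F4 = F(4)[folded J_def] and F5 = F(5)[folded J_def]
 have GamX: "Gam s t y : X" "moser (Gam s t y) t (Y (Gam s t y, t))" "frame (Gam s t y) k S th e" "near (Gam s t y)" "t : {0<..<2}"
  if "s : J" "t : J" "y : ball x0 rho" for s t y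
 proof -
  have "P (Gam s t y, t)" "r (Gam s t y) = Gam s t y" using F4[OF that] by simp_all
  moreover from this show "Gam s t y : X" by (metis P_def near_def fst_conv)
  ultimately show "moser (Gam s t y) t (Y (Gam s t y, t))" "frame (Gam s t y) k S th e" "near (Gam s t y)" "t : {0<..<2}"
  by (simp_all add: P_def)
 qed
 have t0J: "t0 : J" and x0b: "x0 : ball x0 rho" using F(1,2) by (simp_all add: J_def)
 obtain rho' where rho': "rho' > 0" "!!y. y : ball x0 rho' ==> near y"
  using n0 unfolding eventually_nhds_metric by (auto simp: dist_commute)
 show thesis
 proof (rule that[of del "ball x0 rho \<inter> ball x0 rho'" Gam, folded J_def, OF F(1)])
  show "open (ball x0 rho \<inter> ball x0 rho')" "x0 : ball x0 rho \<inter> ball x0 rho'" using F(2) rho'(1) by auto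
  show "J \<subseteq> {0<..<2}" using GamX(5)[OF t0J _ x0b] by blast
  show "smooth_at y (Gam s tau)" if "s : J" "tau : J" "y : ball x0 rho \<inter> ball x0 rho'" for s tau y using F4[OF that(1,2)] that(3) by blast
  fix s y assume s: "s : J" and y: "y : ball x0 rho \<inter> ball x0 rho'" "y : X"
  have y': "y : ball x0 rho" "r y = y" "!!v. v : T y ==> fd r y v = v" using y rho'(2)[of y] by (auto simp: near_def)
  show "orbit (%tau. Gam s tau y) (t0 - del) (t0 + del) & Gam s s y = y"
  unfolding orbit_def J_def[symmetric] F(3) y'(2) using F4[OF s _ y'(1)] GamX(1,2)[OF s _ y'(1)] by blast
  fix tau v w assume tau: "tau : J" and v: "v : T y" "w : T y"
  have in_T: "fd (Gam s tau) y v : T (Gam s tau y)" for v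
  using F5[OF s tau y'(1), of v v] F4[OF s tau y'(1)] GamX(4)[OF s tau y'(1)] unfolding near_def by metis
  have fr: "frame y k S th e" using GamX(3)[OF s s y'(1)] by (simp add: F(3) y'(2))
  show "fd (Gam s tau) y v : T (Gam s tau y) & Om (Gam s tau y) tau (fd (Gam s tau) y v, 0) (fd (Gam s tau) y w, 0) = Om y s (v, 0) (w, 0)"
  using Om_eq[OF GamX(3)[OF s tau y'(1)], of tau "(fd (Gam s tau) y v, 0)" "(fd (Gam s tau) y w, 0)"] Om_eq[OF fr, of s "(v, 0)" "(w, 0)"]
  F5[OF s tau y'(1), of v w] GamX(5)[OF s tau y'(1)] GamX(5)[OF s s y'(1)] in_T v y' by simp
 qed
qed

end

section \<open>Completeness of the flow\<close>

context smooth_cone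
begin

lemma compact_unit_X: "compact (X \<inter> sphere 0 1)"
proof (rule X_eqs)
 fix P assume P: "P \<subseteq> (\<Union>d. hpoly UNIV d)" "X = {x. x ~= 0 & (ALL p:P. p (vec_nth x) = 0)}"
 have c: "closed {x :: complex ^ 'm. p (vec_nth x) = 0}" if p: "p : P" for p
 proof -
  have "polyf (%x :: complex ^ 'm. p (vec_nth x))" using p P(1) hpoly_polyf by blast
  from smooth_isCont[OF polyf_smooth[OF this]]
  have "continuous_on UNIV (%x :: complex ^ 'm. p (vec_nth x))" by (simp add: continuous_at_imp_continuous_on)
  then show ?thesis by (rule closed_Collect_eq) (rule continuous_on_const)
 qed
 have "X \<inter> sphere 0 1 = (\<Inter>p\<in>P. {x. p (vec_nth x) = 0}) \<inter> sphere 0 1"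
  unfolding P(2) by auto
 moreover have "closed (\<Inter>p\<in>P. {x :: complex ^ 'm. p (vec_nth x) = 0})" using c by (intro closed_INT ballI)
 ultimately show "compact (X \<inter> sphere 0 1)" by (simp add: closed_Int_compact)
qed

end

context polarized
begin

lemma orbit_subset: "orbit gam a b ==> a <= a' ==> b' <= b ==> orbit gam a' b'"
 by (auto simp: orbit_def)

lemma orbit_cong:
 assumes "orbit gam a b" "t : {a<..<b}" "!!t. t : {a<..<b} ==> gam t = zet t"
 shows "zet t : X & (EX Y. moser (zet t) t Y & (zet has_vd Y) (at t))"
proof -
 obtain Y where Y: "gam t : X" "moser (gam t) t Y" "(gam has_vd Y) (at t)" using assms(1,2) unfolding orbit_def by blast
 have "(zet has_vd Y) (at t)"
  by (rule has_vector_derivative_transform_within_open[OF Y(3) _ assms(2,3)]) auto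
 then show ?thesis using Y assms(3)[OF assms(2)] by auto
qed

lemma orbit_scale:
 assumes "orbit gam a b" "0 <= a" "u ~= 0" shows "orbit (%t. u *s gam t) a b"
 unfolding orbit_def
proof (intro ballI conjI)
 fix t assume t: "t : {a<..<b}"
 obtain Y where Y: "gam t : X" "moser (gam t) t Y" "(gam has_vd Y) (at t)" using assms(1) t unfolding orbit_def by blast
 show "u *s gam t : X" by (rule scale_X[OF Y(1) assms(3)])
 have "t ~= 0" using t assms(2) by auto
 from moser_scale[OF Y(1) this assms(3) Y(2)] bounded_linear.has_vector_derivative[OF bl_vscale Y(3)]
 show "EX Y. moser (u *s gam t) t Y & ((%t. u *s gam t) has_vd Y) (at t)" by blast
qed

lemma orbit_glue:
 assumes o: "orbit gam a b" "orbit gam' a' b'" and ab: "0 <= a" "b <= 2" "0 <= a'" "b' <= 2"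
  and t: "t : {a<..<b}" "t : {a'<..<b'}" "gam t = gam' t"
 obtains zet where "orbit zet (min a a') (max b b')" "!!t. t : {a<..<b} ==> zet t = gam t"
proof -
 define zet where "zet t = (if t : {a<..<b} then gam t else gam' t)" for t
 have eq: "gam r = gam' r" if "r : {a<..<b}" "r : {a'<..<b'}" for r
  by (rule orbit_unique[of "max a a'" "min b b'" _ _ t]) (use that t ab o orbit_subset in auto)
 have "orbit zet (min a a') (max b b')" unfolding orbit_def
 proof
  fix r assume "r : {min a a'<..<max b b'}"
  then have "r : {a<..<b} \<or> r : {a'<..<b'}" using t by (auto simp: min_def max_def split: if_splits)
  then show "zet r : X & (EX Y. moser (zet r) r Y & (zet has_vd Y) (at r))"
  using orbit_cong[OF o(1), of r zet] orbit_cong[OF o(2), of r zet] eq by (auto simp: zet_def)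
 qed
 then show thesis by (rule that) (simp add: zet_def)
qed

text \<open>Orbits exist for a time that is locally uniform in the initial point; compactness of \<open>X\<close> in the unit sphere and
equivariance make it uniform.\<close>

lemma uniform_existence:
 assumes t: "0 < tau" "tau < 2"
 obtains eps where "eps > 0" "{tau - eps<..<tau + eps} \<subseteq> {0<..<2}"
  "!!r x. r : {tau - eps<..<tau + eps} ==> x : X ==> EX gam. orbit gam (tau - eps) (tau + eps) & gam r = x"
proof -
 have "EX del O'. del > 0 & open O' & x0 : O' & {tau - del<..<tau + del} \<subseteq> {0<..<2} &
  (ALL r:{tau - del<..<tau + del}. ALL y:O' \<inter> X. EX gam. orbit gam (tau - del) (tau + del) & gam r = y)" if x0: "x0 : X" for x0
 proof (rule local_flow[OF x0 t])
  fix del O' and Gam :: "real => real => complex ^ 'm => complex ^ 'm"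
  assume F: "del > 0" "open O'" "x0 : O'" "{tau - del<..<tau + del} \<subseteq> {0<..<2}"
  and o: "!!r y. r : {tau - del<..<tau + del} ==> y : O' ==> y : X ==> orbit (%t. Gam r t y) (tau - del) (tau + del) & Gam r r y = y"
  show ?thesis
  proof (intro exI[of _ del] exI[of _ O'] conjI ballI F)
  fix r y assume "r : {tau - del<..<tau + del}" "y : O' \<inter> X"
  then show "EX gam. orbit gam (tau - del) (tau + del) & gam r = y" using o[of r y] by (intro exI[of _ "%t. Gam r t y"]) simp
  qed
 qed
 then obtain del O' where L: "!!x0. x0 : X ==> del x0 > 0 & open (O' x0) & x0 : O' x0 & {tau - del x0<..<tau + del x0} \<subseteq> {0<..<2} &
  (ALL r:{tau - del x0<..<tau + del x0}. ALL y:O' x0 \<inter> X. EX gam. orbit gam (tau - del x0) (tau + del x0) & gam r = y)"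
  by metis
 have "X \<inter> sphere 0 1 \<subseteq> (\<Union>x\<in>X. O' x)" using L by blast
 then obtain C where C: "C \<subseteq> X" "finite C" "X \<inter> sphere 0 1 \<subseteq> (\<Union>x\<in>C. O' x)"
  using compactE_image[OF compact_unit_X, of X O'] L by blast
 have "EX d>0. ALL a:insert (min tau (2 - tau)) (del ` C). d <= a" using L C t by (intro positive_lower_bound) auto
 then obtain eps where eps: "eps > 0" "eps <= tau" "eps <= 2 - tau" "!!x. x : C ==> eps <= del x" by auto
 show thesis
 proof (rule that[OF eps(1)])
  show sub: "{tau - eps<..<tau + eps} \<subseteq> {0<..<2}" using eps by auto
  fix r x assume r: "r : {tau - eps<..<tau + eps}" and x: "x : X"
  define u where "u = complex_of_real (norm x)"
  have u: "u ~= 0" using x zero_notin_X by (auto simp: u_def)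
  define y where "y = inverse u *s x"
  have y: "y : X" "u *s y = x" "y : sphere 0 1"
  using scale_X[OF x, of "inverse u"] u by (auto simp: y_def norm_vscale u_def norm_inverse vs_assoc)
  then obtain x0 where x0: "x0 : C" "y : O' x0" using C(3) by blast
  have "r : {tau - del x0<..<tau + del x0}" using r eps(4)[OF x0(1)] by auto
  then obtain gam where gam: "orbit gam (tau - del x0) (tau + del x0)" "gam r = y" using L x0 C(1) y(1) by blast
  have "orbit gam (tau - eps) (tau + eps)" using orbit_subset[OF gam(1)] eps(4)[OF x0(1)] by simp
  from orbit_scale[OF this _ u] show "EX gam. orbit gam (tau - eps) (tau + eps) & gam r = x"
  using gam(2) y(2) eps(2) by (intro exI[of _ "%t. u *s gam t"]) simp
 qed
qed

text \<open>The times that are reached by orbits through \<open>x\<close> form an open and closed set, since by \<open>uniform_existence\<close> the length of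
a step is bounded below near each time.\<close>

lemma orbit_exists:
 assumes x: "x : X" and r: "r : {0<..<2}" shows "EX gam. orbit gam 0 2 & gam r = x"
proof -
 define P where "P t \<longleftrightarrow> (EX gam a b. orbit gam a b & 0 <= a & b <= 2 & r : {a<..<b} & t : {a<..<b} & gam r = x)" for t
 have P: "P t" if t: "t : {0<..<2}" for t
 proof (rule connected_induction_simple[of "{0<..<2}" r t P, OF _ r t])
  show "connected {0<..<2::real}" by simp
  have "0 < r" "r < 2" using r by auto
  obtain eps where "eps > 0" "{r - eps<..<r + eps} \<subseteq> {0<..<2}"
  "!!r' x. r' : {r - eps<..<r + eps} ==> x : X ==> EX gam. orbit gam (r - eps) (r + eps) & gam r' = x"
  by (rule uniform_existence[OF \<open>0 < r\<close> \<open>r < 2\<close>], rule that, assumption+)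
  note U = this
  have m: "r : {r - eps<..<r + eps}" using U(1) by simp
  obtain gam where "orbit gam (r - eps) (r + eps)" "gam r = x" using U(3)[OF m x] by blast
  moreover have "0 <= r - eps" "r + eps <= 2" using U(1,2) by (auto simp: greaterThanLessThan_subseteq_greaterThanLessThan)
  ultimately show "P r" unfolding P_def using m by blast
  fix tau :: real assume tau: "tau : {0<..<2}"
  then have "0 < tau" "tau < 2" by auto
  obtain eps where e: "eps > 0" "{tau - eps<..<tau + eps} \<subseteq> {0<..<2}"
  "!!r x. r : {tau - eps<..<tau + eps} ==> x : X ==> EX gam. orbit gam (tau - eps) (tau + eps) & gam r = x"
  by (rule uniform_existence[OF \<open>0 < tau\<close> \<open>tau < 2\<close>], rule that, assumption+)
  have e': "0 <= tau - eps" "tau + eps <= 2" using e(1,2) by (auto simp: greaterThanLessThan_subseteq_greaterThanLessThan)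
  have adv: "P t2" if t: "t1 : {tau - eps<..<tau + eps}" "t2 : {tau - eps<..<tau + eps}" and "P t1" for t1 t2
  proof -
  obtain gam a b where g: "orbit gam a b" "0 <= a" "b <= 2" "r : {a<..<b}" "t1 : {a<..<b}" "gam r = x"
  using \<open>P t1\<close> unfolding P_def by blast
  have "gam t1 : X" using g by (auto simp: orbit_def)
  then obtain gam' where g': "orbit gam' (tau - eps) (tau + eps)" "gam' t1 = gam t1" using e(3)[OF t(1)] by blast
  obtain zet where h: "orbit zet (min a (tau - eps)) (max b (tau + eps))" "!!t. t : {a<..<b} ==> zet t = gam t"
  by (rule orbit_glue[OF g(1) g'(1) g(2,3) e' g(5) t(1) g'(2)[symmetric]], rule that, assumption+)
  have "zet r = x" using h(2)[OF g(4)] g(6) by simp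
  moreover have "r : {min a (tau - eps)<..<max b (tau + eps)}" "t2 : {min a (tau - eps)<..<max b (tau + eps)}"
  using g(4) t(2) by (auto simp: min_less_iff_disj less_max_iff_disj)
  ultimately show ?thesis unfolding P_def using h(1) g(2,3) e' by (intro exI[of _ zet] exI) (rule conjI, assumption, simp)
  qed
  show "EX T. openin (top_of_set {0<..<2}) T & tau : T & (ALL x:T. ALL y:T. P x --> P y)"
  proof (rule exI[of _ "{0<..<2} \<inter> {tau - eps<..<tau + eps}"], rule conjI, rule openin_open_Int, simp, rule conjI)
  show "tau : {0<..<2} \<inter> {tau - eps<..<tau + eps}" using tau e(1) by simp
  qed (use adv in blast)
 qed
 obtain g a b where g: "!!t. t : {0<..<2} ==> orbit (g t) (a t) (b t) & 0 <= a t & b t <= 2 & r : {a t<..<b t} & t : {a t<..<b t} & g t r = x"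
  using P unfolding P_def by metis
 define zet where "zet t = g t t" for t
 have eq: "g t t' = zet t'" if t: "t : {0<..<2}" "t' : {a t<..<b t}" for t t'
 proof -
  have t': "t' : {0<..<2}" using t g[OF t(1)] by auto
  show ?thesis unfolding zet_def
  by (rule orbit_unique[of "max (a t) (a t')" "min (b t) (b t')" _ _ r]) (use g[OF t(1)] g[OF t'] t orbit_subset in auto)
 qed
 have "orbit zet 0 2" unfolding orbit_def
 proof
  fix t :: real assume t: "t : {0<..<2}"
  have "orbit (g t) (a t) (b t)" "t : {a t<..<b t}" using g[OF t] by simp_all
  from orbit_cong[OF this eq[OF t]] show "zet t : X & (EX Y. moser (zet t) t Y & (zet has_vd Y) (at t))" by simp
 qed
 moreover have "zet r = x" using g[OF r] by (simp add: zet_def)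
 ultimately show ?thesis by blast
qed

definition flow :: "real => real => complex ^ 'm => complex ^ 'm" where
 "flow r t x = (SOME gam. orbit gam 0 2 & gam r = x) t"

lemma flow_orbit:
 assumes "x : X" "r : {0<..<2}" shows "orbit (%t. flow r t x) 0 2" "flow r r x = x"
 using someI_ex[OF orbit_exists[OF assms]] by (simp_all add: flow_def[abs_def])

lemma flow_X: "x : X ==> r : {0<..<2} ==> t : {0<..<2} ==> flow r t x : X"
 using flow_orbit unfolding orbit_def by blast

lemma flow_eq:
 assumes o: "orbit gam a b" "0 <= a" "b <= 2" and r: "r : {a<..<b}" "t : {a<..<b}" shows "flow r t (gam r) = gam t"
proof -
 have x: "gam r : X" using o r by (auto simp: orbit_def)
 have r2: "r : {0<..<2}" using o r by auto
 show ?thesis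
  by (rule orbit_unique[OF o(2,3) orbit_subset[OF flow_orbit(1)[OF x r2]] o(1) r(1) flow_orbit(2)[OF x r2] r(2)]) (use o in auto)
qed

lemma flow_flow: "x : X ==> r : {0<..<2} ==> t : {0<..<2} ==> t' : {0<..<2} ==> flow t t' (flow r t x) = flow r t' x"
 by (rule flow_eq[OF flow_orbit(1)]) auto

lemma flow_scale: "x : X ==> r : {0<..<2} ==> t : {0<..<2} ==> u ~= 0 ==> flow r t (u *s x) = u *s flow r t x"
 using flow_eq[OF orbit_scale[OF flow_orbit(1)], of x r u r t] flow_orbit(2)[of x r] by simp

text \<open>The set of times for which the claim holds is open and closed, by composition with the local flows.\<close>

lemma flow_smooth:
 assumes x: "x : X" and r: "r : {0<..<2}" and t: "t : {0<..<2}"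
 shows "EX G. smooth_at x G & (around x (%y. y : X --> G y = flow r t y)) & (ALL v:T x. fd G x v : T (flow r t x)) &
  (ALL v:T x. ALL w:T x. Om (flow r t x) t (fd G x v, 0) (fd G x w, 0) = Om x r (v, 0) (w, 0))"
proof -
 define Q where "Q t G \<longleftrightarrow> smooth_at x G & (around x (%y. y : X --> G y = flow r t y)) & (ALL v:T x. fd G x v : T (flow r t x)) &
  (ALL v:T x. ALL w:T x. Om (flow r t x) t (fd G x v, 0) (fd G x w, 0) = Om x r (v, 0) (w, 0))" for t G
 have "EX G. Q t G"
proof (rule connected_induction_simple[of "{0<..<2}" r t "%t. EX G. Q t G", OF _ r t])
 show "connected {0<..<2::real}" by simp
 have e: "flow r r y = y" if "y : X" for y by (rule flow_orbit(2)[OF that r])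
 have i: "fd (%y. y) x = (%v. v)" by (rule fd_eq[OF has_derivative_ident])
 have "Q r (%y. y)" unfolding Q_def
 proof (intro conjI ballI)
  show "around x (%y. y : X --> y = flow r r y)" by (intro always_eventually allI impI) (rule e[symmetric])
 qed (simp_all only: i e[OF x] smooth_ident)
 then show "EX G. Q r G" by (rule exI[of _ "%y. y"])
 fix tau :: real assume tau: "tau : {0<..<2}"
 then have tau': "0 < tau" "tau < 2" by auto
 have x1: "flow r tau x : X" by (rule flow_X[OF x r tau])
 obtain del O' Gam where F: "del > 0" "open O'" "flow r tau x : O'" "{tau - del<..<tau + del} \<subseteq> {0<..<2}"
  "!!r t y. r : {tau - del<..<tau + del} ==> t : {tau - del<..<tau + del} ==> y : O' ==> smooth_at y (Gam r t)"
  "!!r y. r : {tau - del<..<tau + del} ==> y : O' ==> y : X ==> orbit (%t. Gam r t y) (tau - del) (tau + del) & Gam r r y = y"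
  "!!r t y v w. r : {tau - del<..<tau + del} ==> t : {tau - del<..<tau + del} ==> y : O' ==> y : X ==> v : T y ==> w : T y ==>
  fd (Gam r t) y v : T (Gam r t y) & Om (Gam r t y) t (fd (Gam r t) y v, 0) (fd (Gam r t) y w, 0) = Om y r (v, 0) (w, 0)"
  by (rule local_flow[OF x1 tau'], rule that, assumption+)
 have d: "0 <= tau - del" "tau + del <= 2" using F(1,4) by (auto simp: greaterThanLessThan_subseteq_greaterThanLessThan)
 have fe: "Gam t1 t2 y = flow t1 t2 y" if "t1 : {tau - del<..<tau + del}" "t2 : {tau - del<..<tau + del}" "y : O'" "y : X" for t1 t2 y
  using flow_eq[OF _ d that(1,2), of "%t. Gam t1 t y"] F(6)[OF that(1,3,4)] by simp
 have "isCont (%t. flow r t x) tau" by (rule orbit_isCont[OF flow_orbit(1)[OF x r] tau])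
 from eventually_isCont[OF this, of "%z. z : O'"] have "around tau (%t. flow r t x : O')" using F(2,3) by (simp add: around_open)
 moreover have "around tau (%t. t : {tau - del<..<tau + del})" by (rule around_open) (use F(1) in auto)
 ultimately have "around tau (%t. flow r t x : O' & t : {tau - del<..<tau + del})" by eventually_elim simp
 then obtain V where V: "open V" "tau : V" "!!t. t : V ==> flow r t x : O' & t : {tau - del<..<tau + del}"
  by (rule around_openE) blast
 have adv: "EX G. Q t2 G" if t1: "t1 : V" and t2: "t2 : V" and G: "Q t1 G" for t1 t2 G
 proof -
  have J: "t1 : {tau - del<..<tau + del}" "t2 : {tau - del<..<tau + del}" "flow r t1 x : O'" using V(3) t1 t2 by blast+
  have J2: "t1 : {0<..<2}" "t2 : {0<..<2}" using J F(4) by blast+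
  note x1 = flow_X[OF x r J2(1)]
  note G = G[unfolded Q_def]
  have Gx: "G x = flow r t1 x" using G x by (auto dest: around_self)
  have sG: "smooth_at x G" using G by blast
  have s2: "smooth_at (G x) (Gam t1 t2)" unfolding Gx by (rule F(5)[OF J])
  have fdc: "fd (%y. Gam t1 t2 (G y)) x v = fd (Gam t1 t2) (flow r t1 x) (fd G x v)" for v
  using fd_compose[OF sG s2] by (simp add: Gx)
  have fl: "Gam t1 t2 (flow r t1 x) = flow r t2 x" using fe[OF J x1] flow_flow[OF x r J2] by simp
  have "Q t2 (%y. Gam t1 t2 (G y))" unfolding Q_def
  proof (intro conjI ballI)
  show "smooth_at x (%y. Gam t1 t2 (G y))" by (rule smooth_compose[OF sG s2])
  have "around x (%y. G y : O')"
  by (rule around_compose[OF sG]) (use J(3) F(2) in \<open>simp add: Gx around_open\<close>)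
  moreover have "around x (%y. y : X --> G y = flow r t1 y)" using G by blast
  ultimately show "around x (%y. y : X --> Gam t1 t2 (G y) = flow r t2 y)"
  by eventually_elim (use fe[OF J(1,2)] flow_flow[OF _ r J2] flow_X[OF _ r J2(1)] in auto)
  show "fd (%y. Gam t1 t2 (G y)) x v : T (flow r t2 x)" if v: "v : T x" for v
  using F(7)[OF J x1] G v unfolding fdc fl[symmetric] by blast
  show "Om (flow r t2 x) t2 (fd (%y. Gam t1 t2 (G y)) x v, 0) (fd (%y. Gam t1 t2 (G y)) x w, 0) = Om x r (v, 0) (w, 0)"
  if v: "v : T x" and w: "w : T x" for v w
  proof -
  have T: "fd G x v : T (flow r t1 x)" "fd G x w : T (flow r t1 x)"
  and e: "Om (flow r t1 x) t1 (fd G x v, 0) (fd G x w, 0) = Om x r (v, 0) (w, 0)" using G v w by blast+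
  show ?thesis using F(7)[OF J x1 T] e unfolding fdc fl by simp
  qed
  qed
  then show ?thesis by (rule exI[of _ "%y. Gam t1 t2 (G y)"])
 qed
 have step: "ALL x:{0<..<2} \<inter> V. ALL y:{0<..<2} \<inter> V. (EX G. Q x G) --> (EX G. Q y G)"
 proof (intro ballI impI)
  fix t1 t2 assume a: "t1 : {0<..<2} \<inter> V" "t2 : {0<..<2} \<inter> V" and "EX G. Q t1 G"
  then obtain G where G: "Q t1 G" by (elim exE)
  show "EX G. Q t2 G" by (rule adv[OF _ _ G]) (use a in simp_all)
 qed
 show "EX T. openin (top_of_set {0<..<2}) T & tau : T & (ALL x:T. ALL y:T. (EX G. Q x G) --> (EX G. Q y G))"
 proof (rule exI[of _ "{0<..<2} \<inter> V"], rule conjI, rule openin_open_Int[OF V(1)], rule conjI)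
  show "tau : {0<..<2} \<inter> V" using tau V(2) by blast
  show "ALL x:{0<..<2} \<inter> V. ALL y:{0<..<2} \<inter> V. (EX G. Q x G) --> (EX G. Q y G)" by (rule step)
 qed
qed
 then show ?thesis by (simp only: Q_def)
qed

end

section \<open>A chart at the base point\<close>

context polarized
begin

definition PI :: "complex ^ 'n => complex ^ 'n" where "PI x = (\<chi> i. if i : I then x $ i else 0)"

text \<open>The coordinates \<open>\<sigma>\<^sub>i / s\<^sub>*\<close>, with \<open>s\<^sub>*\<close> the section of index \<open>j0\<close>; coordinates outside \<open>I\<close> are set to \<open>0\<close>.\<close>

definition xi :: "nat => (nat => complex ^ 'm => complex) => complex ^ 'm => complex ^ 'n" where
 "xi j0 S z = (\<chi> i. if i : I then (SUM l<=N. c i l * S l z) / S j0 z else 0)"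

lemma PI_xi: "PI (xi j0 S z) = xi j0 S z"
 by (simp add: PI_def xi_def vec_eq_iff)

lemma PI_PI: "PI (PI x) = PI x"
 by (simp add: PI_def vec_eq_iff)

lemma linear_PI: "linear PI"
 by (rule linearI) (simp_all add: PI_def vec_eq_iff)

lemma norm_PI: "norm (PI x) <= norm x"
 unfolding norm_vec_def by (rule L2_set_mono) (simp_all add: PI_def)

lemma smooth_xi:
 assumes "!!l. l <= N ==> smooth_at z (S l)" "j0 <= N" "S j0 z ~= 0" shows "smooth_at z (xi j0 S)"
proof -
 have "smooth_at z (%z. if i : I then (SUM l<=N. c i l * S l z) / S j0 z else 0)" for i
  by (cases "i : I") (auto intro!: smooth_divide smooth_sum smooth_mult assms)
 then show ?thesis unfolding xi_def[abs_def] by (rule smooth_vec_lambda)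
qed

lemma xi_cong: "(!!l. l <= N ==> S l z = S' l z') ==> j0 <= N ==> xi j0 S z = xi j0 S' z'"
 by (auto simp: xi_def vec_eq_iff intro!: sum.cong arg_cong2[where f="(/)"])

end

text \<open>A smooth parametrisation \<open>chi'\<close>, inverse to \<open>xi\<close>, of the part of \<open>X\<close> near the base point; the linear form \<open>ell\<close>
normalises the representatives in the cone.\<close>

locale charted = polarized X n W N s h \<omega> \<eta> I c for X :: "(complex ^ 'm::finite) set" and n
 and W :: "'k => (complex ^ 'm) set" and N s h \<omega> \<eta> and I :: "'n::finite set" and c +
 fixes kp :: 'k and j0 :: nat and S th e and del :: real and chi' :: "complex ^ 'n => complex ^ 'm" and ell :: "complex ^ 'm => complex"
 assumes del_pos: "del > 0" and j0: "j0 <= N" and ell: "bounded_linear ell" "!!u z. ell (u *s z) = u * ell z"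
  and chart: "!!x. x : ball 0 del ==> frame (chi' x) kp S th e & smooth_at x chi' & S j0 (chi' x) ~= 0 &
  xi j0 S (chi' x) = PI x & ell (chi' x) = 1 &
  (around (chi' x) (%z. z : X --> xi j0 S z : ball 0 del & z = ell z *s chi' (xi j0 S z)))"

context polarized
begin

text \<open>As the vectors \<open>b\<close> are dual to the \<open>\<sigma>\<^sub>i\<close>, the pair \<open>(xi, ell)\<close> is bijective to first order on \<open>X\<close> at \<open>p\<close>; together with the
equations \<open>kap\<close> of \<open>X\<close> it gives a local diffeomorphism of the ambient space.\<close>

lemma chart_exists:
 assumes p: "p : W kp" and j0: "j0 <= N" "s j0 kp p ~= 0"
  and vanish: "!!i. i : I ==> (SUM l<=N. c i l * s l kp p) = 0"
  and b: "!!i. i : I ==> b i : T p" and span: "!!v. v : T p ==> EX x u. v = (SUM i:I. x i *s b i) + u *s p"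
  and dual: "!!S th e i j. frame p kp S th e ==> i : I ==> j : I ==>
  (SUM l<=N. c i l * fd (S l) p (b j)) = (if i = j then s j0 kp p else 0)"
 obtains S th e del chi' ell where "charted X n W N s h \<omega> \<eta> I c kp j0 S th e del chi' ell"
proof -
 have pX: "p : X" by (rule W_X[OF p])
 have p0: "p ~= 0" using pX zero_notin_X by blast
 obtain S th e where f: "frame p kp S th e" by (rule frame_exists[OF p])
 obtain N' r pr and kap :: "complex ^ 'm => complex ^ 'm" where M: "open N'" "p : N'"
  "!!z. z : N' ==> smooth_at z r & smooth_at z kap & r z : X" "!!z. z : N' ==> z : X \<longleftrightarrow> kap z = 0"
  "!!z. z : N' ==> z : X ==> r z = z" "!!v. pr v : T p" "!!v. v : T p ==> pr v = v" "linear pr"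
  "fd r p = pr" "!!v. fd kap p v = v - pr v" "!!z. pr (kap z) = 0"
  by (rule local_structure[OF pX], rule that, assumption+)
 define ell where "ell z = (SUM j:UNIV. z $ j * cnj (p $ j)) / (SUM j:UNIV. p $ j * cnj (p $ j))" for z
 have pp: "(SUM j:UNIV. p $ j * cnj (p $ j)) ~= 0"
 proof -
  obtain j where "p $ j ~= 0" using p0 by (auto simp: vec_eq_iff)
  then have "Re (herm UNIV (($) p) (($) p)) > 0" by (intro herm_self_pos) auto
  then show ?thesis unfolding herm_def by (metis less_irrefl zero_complex.simps(1))
 qed
 have ell_lin: "ell (u *s z) = u * ell z" "ell (z + w) = ell z + ell w" for u z w
  by (simp add: ell_def sum_distrib_left mult.assoc) (simp add: ell_def distrib_right sum.distrib add_divide_distrib)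
 have ell_p: "ell p = 1" using pp by (simp add: ell_def)
 have vs: "r *r z = complex_of_real r *s z" for r and z :: "complex ^ 'm"
  by (simp add: vector_scalar_mult_def scaleR_vec_def scaleR_conv_of_real)
 have ell_bl: "bounded_linear ell" unfolding lin_bl[symmetric]
  by (rule linearI) (simp_all only: ell_lin vs scaleR_conv_of_real)
 define K where "K x = (SUM i:I. (x $ i) *s b i)" for x
 have KT: "K x : T p" for x unfolding K_def by (intro vec.subspace_sum subspace_T[OF pX] T_scale[OF pX b])
 have Klin: "linear K" unfolding K_def
  by (rule linearI) (simp_all add: vector_sadd_rdistrib sum.distrib vs scaleR_conv_of_real[where 'a=complex] vec.scale_sum_right vs_assoc)
 define d where "d v = (\<chi> i. if i : I then (SUM l<=N. c i l * fd (S l) p v) / S j0 p else 0)" for v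
 have lS: "linear (fd (S l) p)" if "l <= N" for l using smooth_lin frame_smooth[OF f that] .
 have Sj: "S j0 p ~= 0" "S j0 p = s j0 kp p" using frame_value[OF f j0(1)] j0 by auto
 have sxi: "smooth_at p (xi j0 S)" by (rule smooth_xi) (use frame_smooth[OF f] j0(1) Sj(1) in auto)
 have fdxi: "fd (xi j0 S) p v = d v" for v
 proof -
  have "fd (%z. xi j0 S z $ i) p v = d v $ i" for i
  proof (cases "i : I")
  case True
  have n: "((%z. SUM l<=N. c i l * S l z) has_derivative (%v. SUM l<=N. c i l * fd (S l) p v)) (at p)"
  by (intro has_derivative_sum has_derivative_mult_right smooth_deriv frame_smooth[OF f]) simp
  have z: "(SUM l<=N. c i l * S l p) = 0" using vanish[OF True] frame_value[OF f] by (simp cong: sum.cong_simp)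
  from fun_cong[OF fd_eq[OF has_derivative_divide[OF n smooth_deriv[OF frame_smooth[OF f j0(1)]] Sj(1)]], of v]
  show ?thesis using True by (simp add: xi_def d_def z)
  qed (use fd_eq[OF has_derivative_const] in \<open>simp add: xi_def d_def fun_eq_iff\<close>)
  then show ?thesis using fd_bl[OF bounded_linear_vec_nth sxi] by (simp add: vec_eq_iff)
 qed
 have "fd (xi j0 S) p = d" by (rule ext) (rule fdxi)
 then have dlin: "linear d" using smooth_lin[OF sxi] by simp
 have d_scale: "d (u *s v) = u *s d v" for u v
 proof -
  have "fd (S l) p (u *s v) = u * fd (S l) p v" if "l <= N" for l
  using f holo_at_fd_scale that unfolding frame_def by blast
  then show ?thesis by (simp add: d_def vec_eq_iff sum_distrib_left mult_ac cong: sum.cong_simp)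
 qed
 have d_p: "d (u *s p) = 0" for u by (simp add: d_def vec_eq_iff frame_radial(1)[OF f])
 have db: "d (b j) = axis j 1" if "j : I" for j
  using dual[OF f _ that] Sj that by (auto simp: d_def vec_eq_iff axis_def)
 have dK: "d (K x) = PI x" for x
 proof -
  have "d (K x) = (SUM j:I. d ((x $ j) *s b j))" unfolding K_def by (rule linear_sum[OF dlin])
  also have "... = PI x" by (simp add: d_scale db vec_eq_iff PI_def axis_def sum_component if_distrib cong: if_cong)
  finally show ?thesis .
 qed
 have coeff: "PI x = PI y & u = w" if "K x + u *s p = K y + w *s p" for x y u w
 proof -
  have "PI x = PI y" using arg_cong[OF that, of d] by (simp add: linear_add[OF dlin] dK d_p)
  moreover have "K z = K (PI z)" for z by (simp add: K_def PI_def)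
  ultimately have "K x = K y" by metis
  then have "u = w" using that p0 by simp
  then show ?thesis using \<open>PI x = PI y\<close> by simp
 qed
 \<comment> \<open>\<open>r\<close> and \<open>kap\<close> split the ambient space into \<open>X\<close> and the directions transverse to it.\<close>
 define Tht where "Tht z = K (xi j0 S (r z)) + ell (r z) *s p + kap z" for z
 have rp: "r p = p" by (rule M(5)[OF M(2) pX])
 have sr: "smooth_at p r" "smooth_at p kap" using M(3)[OF M(2)] by simp_all
 have sxr: "smooth_at p (%z. xi j0 S (r z))" by (rule smooth_compose[OF sr(1)]) (simp add: rp sxi)
 have spl: "smooth_at p (%z. ell (r z))" by (rule smooth_bl[OF ell_bl sr(1)])
 have bK: "bounded_linear K" using Klin by (simp add: lin_bl)
 have bp: "bounded_linear (%u. u *s p)" by (rule bl_vscale_left)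
 have sTht: "smooth_at p Tht" unfolding Tht_def[abs_def]
  by (intro smooth_add smooth_bl[OF bK] smooth_bl[OF bp] sxr spl sr)
 have fdTht: "fd Tht p v = K (d (pr v)) + ell (pr v) *s p + (v - pr v)" for v
 proof -
  have 1: "fd (%z. K (xi j0 S (r z))) p v = K (d (pr v))"
  using fd_bl[OF bK sxr] fd_compose[OF sr(1), of "xi j0 S"] sxi by (simp add: rp fdxi M(9))
  have 2: "fd (%z. ell (r z) *s p) p v = ell (pr v) *s p"
  using fd_bl[OF bp spl] fd_bl[OF ell_bl sr(1)] by (simp add: M(9))
  show ?thesis unfolding Tht_def[abs_def]
  using fd_add[OF smooth_add[OF smooth_bl[OF bK sxr] smooth_bl[OF bp spl]] sr(2)]
  fd_add[OF smooth_bl[OF bK sxr] smooth_bl[OF bp spl]] by (simp add: 1 2 M(10))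
 qed
 have inj: "inj (fd Tht p)" unfolding linear_injective_0[OF smooth_lin[OF sTht]]
 proof (intro allI impI)
  fix v assume 0: "fd Tht p v = 0"
  define w where "w = K (d (pr v)) + ell (pr v) *s p"
  have w: "w : T p" unfolding w_def by (intro T_add pX KT radial_T)
  have 00: "w + (v - pr v) = 0" using 0 by (simp add: fdTht w_def)
  have "pr (w + (v - pr v)) = w" by (simp add: linear_add[OF M(8)] linear_diff[OF M(8)] M(7)[OF w] M(7)[OF M(6)])
  then have w0: "w = 0" using linear_0[OF M(8)] by (simp add: 00)
  then have v: "pr v = v" using 00 by simp
  note w0 = w0[unfolded w_def]
  obtain x u where xu: "v = (SUM i:I. x i *s b i) + u *s p" using span[of v] M(6)[of v] v by auto
  then have vK: "v = K (\<chi> i. x i) + u *s p" by (simp add: K_def)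
  have "d v = PI (\<chi> i. x i)" unfolding vK by (simp add: linear_add[OF dlin] dK d_p)
  then have "K (d v) = K (\<chi> i. x i)" by (simp add: K_def PI_def)
  then have "v = u *s p - ell v *s p" using w0 v vK by (simp add: algebra_simps)
  then have m: "v = (u - ell v) *s p" by (simp add: vector_sub_rdistrib)
  then have "d v = 0" using d_p by metis
  then have "ell v *s p = 0" using w0 v linear_0[OF Klin] by simp
  then have "ell v = 0" using p0 by simp
  moreover have "ell v = u - ell v" using m by (metis ell_lin(1) ell_p mult.right_neutral)
  ultimately show "v = 0" using m by simp
 qed
 obtain U V g where UV: "open U" "p : U" "open V" "Tht p : V" "!!z. z : U ==> Tht z : V & g (Tht z) = z"
  "!!y. y : V ==> g y : U & Tht (g y) = y & smooth_at y g"
 proof (rule smooth_inverse_function[OF sTht inj])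
  fix U V g assume "open U" "p : U" "open V" "Tht p : V" "!!x. x : U ==> Tht x : V & g (Tht x) = x & smooth_at x Tht & inj (fd Tht x)"
  "!!y. y : V ==> g y : U & Tht (g y) = y & smooth_at y g"
  then show thesis by (intro that[of U V g]) auto
 qed
 have xip: "xi j0 S p = 0" using vanish frame_value[OF f] by (simp add: xi_def vec_eq_iff cong: sum.cong_simp)
 have Thtp: "Tht p = p" using M(4)[OF M(2)] pX by (simp add: Tht_def rp xip ell_p linear_0[OF Klin])
 have "around p (%z. S j0 z : - {0})"
  by (rule around_compose[OF frame_smooth[OF f j0(1)]], rule around_open) (use Sj(1) in \<open>auto simp: open_Compl\<close>)
 moreover have "around p (%z. z : N' \<inter> U)" by (rule around_open) (use M(1,2) UV(1,2) in auto)
 ultimately have "around p (%z. z : N' & z : U & S j0 z ~= 0 & (z : X --> frame z kp S th e))"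
  using frame_around[OF f] by eventually_elim auto
 then obtain M' where M': "open M'" "p : M'" "!!z. z : M' ==> z : N' & z : U & S j0 z ~= 0 & (z : X --> frame z kp S th e)"
  by (rule around_openE) blast
 have ThtX: "Tht z = K (xi j0 S z) + ell z *s p" if "z : N'" "z : X" for z
  using M(4,5)[OF that(1)] that(2) by (simp add: Tht_def)
 define chi' where "chi' x = g (K x + p)" for x
 have sKp: "smooth_at x (%x. K x + p)" for x by (intro smooth_add smooth_bl[OF bK] smooth_ident smooth_const)
 have sg: "smooth_at x chi'" if "K x + p : V" for x
  unfolding chi'_def[abs_def] by (rule smooth_compose[OF sKp]) (use UV(6)[OF that] in blast)
 have K0: "K 0 + p : V" using UV(4) by (simp add: linear_0[OF Klin] Thtp)
 have chi0: "chi' 0 = p" using UV(5)[OF UV(2)] by (simp add: chi'_def linear_0[OF Klin] Thtp)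
 have "around 0 (%x. chi' x : M')" by (rule around_compose[OF sg[OF K0]]) (use M'(1,2) in \<open>simp add: chi0 around_open\<close>)
 moreover have "around 0 (%x. K x + p : V)"
  by (rule around_compose[OF sKp, where P="%y. y : V"], rule around_open[OF UV(3) K0])
 ultimately have "around 0 (%x. chi' x : M' & K x + p : V)" by eventually_elim simp
 then obtain del where del: "del > 0" "!!x. dist x 0 < del ==> chi' x : M' & K x + p : V"
  unfolding eventually_nhds_metric by blast
 have "charted X n W N s h \<omega> \<eta> I c kp j0 S th e del chi' ell"
 proof (intro charted.intro charted_axioms.intro)
  show "polarized X n W N s h \<omega> \<eta>" by (rule polarized_axioms)
  show "0 < del" "j0 <= N" "bounded_linear ell" "!!u z. ell (u *s z) = u * ell z"
  by (rule del(1) j0(1) ell_bl ell_lin(1))+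
 next
  fix x :: "complex ^ 'n" assume x: "x : ball 0 del"
  let ?z = "chi' x"
  have z: "?z : N'" "?z : U" "S j0 ?z ~= 0" "?z : M'" and Kx: "K x + p : V" using del(2)[of x] x M'(3) by (auto simp: dist_commute)
  have Tz: "Tht ?z = K x + p" using UV(6)[OF Kx] by (simp add: chi'_def)
  define a where "a = K (xi j0 S (r ?z)) + ell (r ?z) *s p"
  have aT: "a : T p" "K x + p : T p" unfolding a_def using radial_T[OF pX, of 1] by (auto intro!: T_add pX KT radial_T)
  have "a + kap ?z = K x + p" using Tz by (simp add: Tht_def a_def)
  moreover have "pr (a + kap ?z) = a" by (simp add: linear_add[OF M(8), of a] M(11) M(7)[OF aT(1)])
  ultimately have "a = K x + p" using M(7)[OF aT(2)] by simp
  moreover note \<open>a + kap ?z = K x + p\<close>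
  ultimately have zX: "?z : X" using M(4)[OF z(1)] by simp
  have "PI (xi j0 S ?z) = PI x & ell ?z = 1" using coeff[of "xi j0 S ?z" "ell ?z" x 1] ThtX[OF z(1) zX] Tz by simp
  then have xiz: "xi j0 S ?z = PI x" and ez: "ell ?z = 1" by (simp_all add: PI_xi)
  have fz: "frame ?z kp S th e" using M'(3)[OF z(4)] zX by blast
  have sxz: "smooth_at ?z (xi j0 S)" by (rule smooth_xi) (use frame_smooth[OF fz] j0(1) z(3) in auto)
  define w where "w z = inverse (ell z) *s z" for z
  have sw: "smooth_at ?z w" unfolding w_def[abs_def]
  by (intro smooth_vscale smooth_inverse smooth_bl[OF ell_bl] smooth_ident) (simp add: ez)
  have 1: "around ?z (%z. w z : M')"
  by (rule around_compose[OF sw]) (use M'(1) z(4) in \<open>simp add: w_def ez around_open\<close>)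
  have 2: "around ?z (%z. z : M')" by (rule around_open[OF M'(1) z(4)])
  have 3: "around ?z (%z. xi j0 S z : ball 0 del)"
  by (rule around_compose[OF sxz], rule around_open) (use norm_PI[of x] x in \<open>auto simp: xiz\<close>)
  have 4: "around ?z (%z. ell z : - {0})"
  by (rule around_compose[OF smooth_bl[OF ell_bl smooth_ident]], rule around_open)
  (auto simp: ez open_Compl)
  have "around ?z (%z. z : X --> xi j0 S z : ball 0 del & z = ell z *s chi' (xi j0 S z))"
  using 1 2 3 4
  proof eventually_elim
  case (elim y)
  show ?case
  proof
  assume y: "y : X"
  have e0: "ell y ~= 0" "inverse (ell y) ~= 0" using elim(4) by auto
  have wX: "w y : X" unfolding w_def by (rule scale_X[OF y e0(2)])
  have fy: "frame y kp S th e" "frame (w y) kp S th e" and wU: "w y : N'" "w y : U" using M'(3) elim(1,2) y wX by blast+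
  have "y : W kp" using fy(1) by (simp add: frame_def)
  have xw: "xi j0 S (w y) = xi j0 S y"
  using frame_value[OF fy(1)] frame_value[OF fy(2)] scaling[OF \<open>y : W kp\<close> e0(2)] by (intro xi_cong j0(1)) (simp add: w_def)
  have "ell (w y) = 1" using e0 by (simp add: w_def ell_lin)
  then have "Tht (w y) = K (xi j0 S y) + p" using ThtX[OF wU(1) wX] by (simp add: xw)
  then have "w y = chi' (xi j0 S y)" using UV(5)[OF wU(2)] by (simp add: chi'_def)
  then have "ell y *s w y = ell y *s chi' (xi j0 S y)" by simp
  then show "xi j0 S y : ball 0 del & y = ell y *s chi' (xi j0 S y)" using elim(3) e0 by (simp add: w_def vs_assoc)
  qed
  qed
  then show "frame ?z kp S th e & smooth_at x chi' & S j0 ?z ~= 0 & xi j0 S ?z = PI x & ell ?z = 1 &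
  (around ?z (%z. z : X --> xi j0 S z : ball 0 del & z = ell z *s chi' (xi j0 S z)))"
  using fz sg[OF Kx] z(3) xiz ez by blast
 qed
 then show thesis by (rule that)
qed

end

section \<open>The form in rescaled coordinates\<close>

lemma bounded_bilinear_vscale: "bounded_bilinear (%u z. u *s (z :: complex ^ 'm))"
 unfolding bilinear_conv_bounded_bilinear[symmetric] bilinear_def lin_bl
 by (intro conjI allI bl_vscale bl_vscale_left)

lemma bilinear_first:
 assumes "bilinear (B :: 'a::real_vector \<times> real => 'a \<times> real => real)"
 shows "bilinear (%a b. B (a, 0) (b, 0))" "linear (%b. - B (0, 1) (b, 0))"
proof -
 have p: "(a + b, 0 :: real) = (a, 0) + (b, 0)" "(r *r a, 0 :: real) = r *r (a, 0)" for a b :: 'a and r by simp_all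
 show "bilinear (%a b. B (a, 0) (b, 0))" unfolding bilinear_def
  by (auto intro!: linearI simp only: p bilinear_ladd[OF assms] bilinear_radd[OF assms] bilinear_lmul[OF assms] bilinear_rmul[OF assms])
 show "linear (%b. - B (0, 1) (b, 0))"
  by (rule linearI) (simp_all only: p bilinear_radd[OF assms] bilinear_rmul[OF assms] minus_add_distrib scaleR_minus_right)
qed

context polarized
begin

text \<open>A path in the cone whose velocity lies in the kernel of \<open>Om\<close> need not be orthogonal to the orbits of scaling. Multiplying
it by the solution \<open>k\<close> of a scalar linear equation removes the radial part.\<close>

lemma projective_orbit:
 assumes ab: "0 <= a" "b <= 2"
  and z: "!!tau. tau : {a<..<b} ==> z tau : X & (z has_vd z' tau) (at tau) & isCont z' tau"
  and ker: "!!tau v. tau : {a<..<b} ==> v : T (z tau) ==> Om (z tau) tau (z' tau, 1) (v, 0) = 0"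
  and r: "r : {a<..<b}" and t: "t : {a<..<b}"
 shows "EX k. k ~= 0 & flow r t (z r) = k *s z t"
proof -
 \<comment> \<open>\<open>m\<close> is the radial component of the velocity.\<close>
 define m where "m tau = Complex (z' tau \<bullet> z tau / (z tau \<bullet> z tau)) (z' tau \<bullet> (\<i> *s z tau) / (z tau \<bullet> z tau))" for tau
 have z0: "z tau ~= 0" if "tau : {a<..<b}" for tau using z[OF that] zero_notin_X by metis
 have mos: "moser (z tau) tau (z' tau - m tau *s z tau)" if tau: "tau : {a<..<b}" for tau
 proof -
  have zX: "z tau : X" and tau0: "tau ~= 0" using z[OF tau] tau ab by auto
  have "1 *r z' tau : T (z tau)"
  by (rule tangent_map[of z "%h. h *r z' tau" tau "{a<..<b}"]) (use z tau in \<open>auto simp: has_vector_derivative_def\<close>)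
  then have zT: "z' tau : T (z tau)" by simp
  have YT: "z' tau - m tau *s z tau : T (z tau)" by (intro T_diff zX zT radial_T)
  have "Om (z tau) tau (z' tau - m tau *s z tau, 1) (v, 0) = 0" if v: "v : T (z tau)" for v
  using Om_add_left[OF zX tau0, of "(z' tau - m tau *s z tau, 1)" "(m tau *s z tau, 0)" "(v, 0)"] YT radial_T[OF zX] v ker[OF tau v]
  Om_radial[OF zX tau0, of "(v, 0)"] by simp
  moreover have "z tau \<bullet> z tau ~= 0" using z0[OF tau] by simp
  ultimately show ?thesis using YT by (simp add: moser_def inner_diff_left inner_radial m_def)
 qed
 obtain a' where a': "a < a'" "a' < min r t" using dense[of a "min r t"] r t by auto
 obtain b' where b': "max r t < b'" "b' < b" using dense[of "max r t" b] r t by auto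
 have sub: "tau : {a<..<b}" if "tau : {a'..b'}" for tau using that a' b' by auto
 have cm: "continuous_on {a'..b'} m"
 proof (intro continuous_at_imp_continuous_on ballI)
  fix tau assume "tau : {a'..b'}"
  note tau = sub[OF this]
  have c: "isCont z tau" "isCont z' tau" using z[OF tau] has_vector_derivative_continuous by blast+
  have "isCont (%tau. \<i> *s z tau) tau" by (rule bounded_linear.isCont[OF bl_vscale c(1)])
  then have "isCont (%tau. complex_of_real (z' tau \<bullet> z tau / (z tau \<bullet> z tau)) + \<i> * of_real (z' tau \<bullet> (\<i> *s z tau) / (z tau \<bullet> z tau))) tau"
  using c z0[OF tau] by (intro continuous_intros) auto
  then show "isCont m tau" by (simp add: m_def[abs_def] Complex_eq)
 qed
 define M where "M tau = integral {a'..tau} m" for tau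
 define cc where "cc tau = exp (- M tau)" for tau
 have dc: "(cc has_vd - m tau * cc tau) (at tau)" if tau: "tau : {a'<..<b'}" for tau
 proof -
  have "tau : {a'..b'}" using tau by auto
  from integral_has_vector_derivative[OF cm this] have "(M has_vd m tau) (at tau within {a'..b'})" by (simp add: M_def[abs_def])
  moreover have "at tau within {a'..b'} = at tau" by (rule at_within_interior) (use tau in auto)
  ultimately have "((%tau. - M tau) has_vd - m tau) (at tau)" by (simp add: has_vector_derivative_minus)
  from field_vector_diff_chain_at[OF this DERIV_exp] show ?thesis by (simp add: cc_def[abs_def] o_def)
 qed
 define gam where "gam tau = cc tau *s z tau" for tau
 have c0: "cc tau ~= 0" for tau by (simp add: cc_def)
 have orb: "orbit gam a' b'" unfolding orbit_def
 proof
  fix tau assume tau: "tau : {a'<..<b'}"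
  then have "tau : {a'..b'}" by auto
  note tau' = sub[OF this]
  have zX: "z tau : X" and tau0: "tau ~= 0" and dz: "(z has_vd z' tau) (at tau)" using z[OF tau'] tau' ab by auto
  have "(gam has_vd (cc tau *s z' tau + (- m tau * cc tau) *s z tau)) (at tau)"
  using bounded_bilinear.has_vector_derivative[OF bounded_bilinear_vscale dc[OF tau] dz] by (simp add: gam_def[abs_def])
  moreover have "cc tau *s z' tau + (- m tau * cc tau) *s z tau = cc tau *s (z' tau - m tau *s z tau)"
  by (simp add: vec_eq_iff algebra_simps)
  ultimately have "(gam has_vd cc tau *s (z' tau - m tau *s z tau)) (at tau)" by (simp only:)
  moreover have "moser (gam tau) tau (cc tau *s (z' tau - m tau *s z tau))" "gam tau : X"
  unfolding gam_def by (rule moser_scale[OF zX tau0 c0 mos[OF tau']], rule scale_X[OF zX c0])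
  ultimately show "gam tau : X & (EX Y. moser (gam tau) tau Y & (gam has_vd Y) (at tau))" by blast
 qed
 have in': "r : {a'<..<b'}" "t : {a'<..<b'}" using a' b' by auto
 have "flow r t (cc r *s z r) = cc t *s z t" using flow_eq[OF orb _ _ in'] a' b' ab by (simp add: gam_def)
 moreover have "flow r t (cc r *s z r) = cc r *s flow r t (z r)" using z[OF r] r t ab c0 by (intro flow_scale) auto
 ultimately have "inverse (cc r) *s (cc r *s flow r t (z r)) = inverse (cc r) *s (cc t *s z t)" by simp
 then have "flow r t (z r) = (inverse (cc r) * cc t) *s z t" using c0 by (simp add: vs_assoc)
 then show ?thesis using c0 by (intro exI[of _ "inverse (cc r) * cc t"]) simp
qed

end

context charted
begin

definition dom :: "(complex ^ 'n) \<times> real => bool" where "dom y \<longleftrightarrow> snd y *r fst y : ball 0 del"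

definition J :: "(complex ^ 'n) \<times> real => complex ^ 'm" where "J y = chi' (snd y *r fst y)"

text \<open>The family \<open>Zfam\<close> divided by its common factor \<open>t s\<^sub>*\<close>. It has no zeros and is smooth also at \<open>t = 0\<close>.\<close>

definition ZU :: "'n + nat => (complex ^ 'n) \<times> real => complex" where
 "ZU j y = (case j of Inl i => fst y $ i | Inr l => S l (J y) / S j0 (J y))"

text \<open>The pullback of \<open>prim\<close>, in a form that makes sense at \<open>t = 0\<close>: the factor \<open>t\<close> is real and does not contribute, and the factor
\<open>s\<^sub>*\<close> contributes a closed form.\<close>

definition primU where
 "primU y v = weight (snd y) * (nZ ZU y v + connection_form {()} (%_ y. S j0 (J y)) y v) + (1 - weight (snd y)) * pullback J (mu th e) y v"

lemma smooth_dilation: "smooth_at y (%y. snd y *r (fst y :: complex ^ 'n))"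
 by (intro smooth_scaleR smooth_snd_id smooth_fst_id)

lemma dom_eventually: "dom y ==> around y (%y. dom y)"
 unfolding dom_def
 by (rule around_compose[OF smooth_dilation, where P="%x. x : ball 0 del"], rule around_open) auto

lemma smooth_J: "dom y ==> smooth_at y J"
 unfolding J_def[abs_def] dom_def by (rule smooth_compose[OF smooth_dilation]) (use chart in blast)

lemma J_frame: "dom y ==> frame (J y) kp S th e" "dom y ==> S j0 (J y) ~= 0" "dom y ==> J y : X"
 using chart frame_X unfolding J_def dom_def by blast+

lemma smooth_SJ: "dom y ==> l <= N ==> smooth_at y (%y. S l (J y))"
 by (rule smooth_compose[OF smooth_J frame_smooth[OF J_frame(1)]])

lemma smooth_ZU: "dom y ==> j : idx ==> smooth_at y (ZU j)"
 by (auto simp: ZU_def[abs_def] idx_def intro!: smooth_divide smooth_SJ smooth_vec_nth smooth_fst_id j0 J_frame(2))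

lemma ZU_pos: "dom y ==> Re (herm idx (%j. ZU j y) (%j. ZU j y)) > 0"
 by (rule herm_self_pos[OF finite_idx, of "Inr j0"]) (use j0 J_frame(2) in \<open>auto simp: idx_def ZU_def\<close>)

lemma smooth_primU_parts:
 assumes d: "dom y"
 shows "smooth_form y (nZ ZU)" "smooth_form y (connection_form {()} (%_ y. S j0 (J y)))" "smooth_form y (pullback J (mu th e))"
proof -
 show "smooth_form y (nZ ZU)" by (intro smooth_form_connection finite_idx smooth_ZU ZU_pos d)
 have "Re (herm {()} (%_. S j0 (J y)) (%_. S j0 (J y))) > 0"
  by (rule herm_self_pos[of _ "()"]) (use J_frame(2)[OF d] in auto)
 then show "smooth_form y (connection_form {()} (%_ y. S j0 (J y)))" by (intro smooth_form_connection smooth_SJ j0 d) auto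
 show "smooth_form y (pullback J (mu th e))" by (rule smooth_form_pullback[OF smooth_J[OF d] frame_mu[OF J_frame(1)[OF d]]])
qed

lemma smooth_weight': "smooth_at y (%y :: (complex ^ 'n) \<times> real. weight (snd y))"
 unfolding weight_def[abs_def] by (intro smooth_power smooth_diff smooth_const smooth_snd_id)

lemma smooth_primU: "dom y ==> smooth_form y primU"
 unfolding primU_def[abs_def]
 by (intro smooth_form_add form_scale smooth_primU_parts smooth_weight' smooth_diff smooth_const)

lemma fd_J: "dom y ==> fd J y v : T (J y)"
proof -
 assume d: "dom y"
 obtain V where V: "open V" "y : V" "!!y. y : V ==> dom y" using dom_eventually[OF d] by (rule around_openE) blast
 show ?thesis by (rule tangent_map[OF smooth_deriv[OF smooth_J[OF d]] V(1,2) J_frame(3)[OF V(3)]])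
qed

lemma pullback_prim:
 assumes d: "dom y" and t: "snd y ~= 0"
 shows "pullback (%y. (J y, snd y)) (prim S th e) y v = primU y v"
proof -
 let ?P = "%y. (J y, snd y)" and ?g = "%y :: (complex ^ 'n) \<times> real. complex_of_real (snd y)" and ?s = "%y. S j0 (J y)"
 have sP: "smooth_at y ?P" by (intro smooth_Pair smooth_J d smooth_snd_id)
 have fP: "fd ?P y v = (fd J y v, snd v)"
  using fun_cong[OF fd_eq[OF has_derivative_Pair[OF smooth_deriv[OF smooth_J[OF d]] smooth_deriv[OF smooth_snd_id]]]]
  by (simp add: fd_snd)
 have ZS: "smooth_at (?P y) (Zfam S j)" if "j : idx" for j
  by (rule smooth_Zfam) (use frame_smooth[OF J_frame(1)[OF d]] that in auto)
 have eq: "Zfam S j (?P y') = (?g y' * ?s y') * ZU j y'" if y': "dom y'" and j: "j : idx" for j y'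
 proof (cases j)
  case (Inl i)
  have "xi j0 S (J y') = PI (snd y' *r fst y')" using chart y' unfolding J_def dom_def by blast
  then have "xi j0 S (J y') $ i = snd y' *r (fst y' $ i)" using Inl j by (auto simp: PI_def idx_def)
  then show ?thesis using Inl j J_frame(2)[OF y'] by (auto simp: xi_def Zfam_def ZU_def idx_def field_simps scaleR_conv_of_real)
 qed (use J_frame(2)[OF y'] in \<open>simp add: Zfam_def ZU_def\<close>)
 obtain V where V: "open V" "y : V" "!!y. y : V ==> dom y" using dom_eventually[OF d] by (rule around_openE) blast
 have sg: "smooth_at y ?g" by (intro smooth_of_real smooth_snd_id)
 have ss: "smooth_at y ?s" by (rule smooth_SJ[OF d j0])
 have "connection_form idx (%j y. Zfam S j (?P y)) y v = connection_form idx (%j y. (?g y * ?s y) * ZU j y) y v"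
 proof -
  have "fd (%y. Zfam S j (?P y)) y v = fd (%y. (?g y * ?s y) * ZU j y) y v" if "j : idx" for j
  using fd_cong[OF V(1,2), of "%y. Zfam S j (?P y)" "%y. (?g y * ?s y) * ZU j y"] eq[OF V(3) that] by simp
  then have "herm idx (%j. fd (%y. Zfam S j (?P y)) y v) (%j. Zfam S j (?P y)) =
  herm idx (%j. fd (%y. (?g y * ?s y) * ZU j y) y v) (%j. (?g y * ?s y) * ZU j y)"
  "herm idx (%j. Zfam S j (?P y)) (%j. Zfam S j (?P y)) = herm idx (%j. (?g y * ?s y) * ZU j y) (%j. (?g y * ?s y) * ZU j y)"
  unfolding herm_def using eq[OF d] by (auto intro!: sum.cong)
  then show ?thesis by (simp add: connection_form_def)
 qed
 also have "... = nZ ZU y v + connection_form {()} (%_ y. ?g y * ?s y) y v"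
  by (rule connection_form_mult) (use smooth_ZU[OF d] sg ss t J_frame(2)[OF d] ZU_pos[OF d] in \<open>auto intro: smooth_mult\<close>)
 also have "connection_form {()} (%_ y. ?g y * ?s y) y v = connection_form {()} (%_. ?s) y v + connection_form {()} (%_. ?g) y v"
 proof (rule connection_form_mult[where Z="%_. ?s"])
  show "Re (herm {()} (%j. S j0 (J y)) (%j. S j0 (J y))) > 0"
  by (rule herm_self_pos[of _ "()"]) (use J_frame(2)[OF d] in auto)
 qed (use sg ss t in auto)
 also have "connection_form {()} (%_. ?g) y v = 0"
  using fd_bl[OF bounded_linear_of_real[where 'a=complex] smooth_snd_id, of y v]
  by (simp add: connection_form_def herm_def fd_snd flip: of_real_mult)
 finally have "nZ (Zfam S) (?P y) (fd ?P y v) = nZ ZU y v + connection_form {()} (%_. ?s) y v"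
  using connection_form_pullback[of y ?P idx "Zfam S" v, OF sP ZS] by (simp add: pullback_def)
 then show ?thesis by (simp add: pullback_def prim_def primU_def fP)
qed

lemma ext_primU:
 assumes d: "dom y" and t: "snd y ~= 0"
 shows "ext_d1 primU y a b = Om (J y) (snd y) (fd J y a, snd a) (fd J y b, snd b)"
proof -
 let ?P = "%y. (J y, snd y)"
 have sP: "smooth_at y ?P" by (intro smooth_Pair smooth_J d smooth_snd_id)
 have fP: "fd ?P y v = (fd J y v, snd v)" for v
  using fun_cong[OF fd_eq[OF has_derivative_Pair[OF smooth_deriv[OF smooth_J[OF d]] smooth_deriv[OF smooth_snd_id]]]]
  by (simp add: fd_snd)
 have "around y (%y. snd y : - {0})"
  by (rule around_compose[OF smooth_snd_id], rule around_open) (use t in \<open>auto simp: open_Compl\<close>)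
 with dom_eventually[OF d] have "around y (%y. dom y & snd y ~= 0)" by eventually_elim simp
 then obtain V where V: "open V" "y : V" "!!y. y : V ==> dom y & snd y ~= 0" by (rule around_openE) blast
 have "ext_d1 primU y a b = ext_d1 (pullback ?P (prim S th e)) y a b"
  by (rule ext_d1_cong[OF V(1,2)]) (use pullback_prim V(3) in simp)
 also have "... = ext_d1 (prim S th e) (?P y) (fd ?P y a) (fd ?P y b)"
  by (rule ext_d1_pullback[OF sP frame_forms(4)[OF J_frame(1)[OF d] t]])
 also have "... = Om (J y) (snd y) (fd ?P y a) (fd ?P y b)"
  by (rule Om_eq[OF J_frame(1)[OF d] t, symmetric]) (use fd_J[OF d] in \<open>auto simp: fP\<close>)
 finally show ?thesis by (simp add: fP)
qed

definition Z0 :: "complex ^ 'n => 'n + nat => complex" where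
 "Z0 u j = (case j of Inl i => u $ i | Inr l => S l (chi' 0) / S j0 (chi' 0))"

definition dZ0 :: "complex ^ 'n => 'n + nat => complex" where
 "dZ0 v j = (case j of Inl i => v $ i | Inr l => 0)"

lemma dom_zero: "dom (u, 0)"
 using del_pos by (simp add: dom_def)

text \<open>At \<open>t = 0\<close> the weight is \<open>1\<close>, and \<open>J\<close> is constant on the slice. So only the connection form
of \<open>u\<close> and constants is left.\<close>

lemma ext_primU_zero: "ext_d1 primU (u, 0) (v, 0) (w, 0) = fubini_study idx (Z0 u) (dZ0 v) (dZ0 w)"
proof -
 note d = dom_zero[of u]
 note parts = smooth_primU_parts[OF d]
 have fw: "fd (%y :: (complex ^ 'n) \<times> real. weight (snd y)) (u, 0) (v, 0) = 0" "fd (%y :: (complex ^ 'n) \<times> real. 1 - weight (snd y)) (u, 0) (v, 0) = 0" for v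
 proof -
  have "((%y :: (complex ^ 'n) \<times> real. (1 - snd y)\<^sup>2) has_derivative (%v. - 2 * snd v)) (at (u, 0))"
  by (auto intro!: derivative_eq_intros)
  from fun_cong[OF fd_eq[OF this]] show 1: "fd (%y :: (complex ^ 'n) \<times> real. weight (snd y)) (u, 0) (v, 0) = 0" by (simp add: weight_def[abs_def])
  show "fd (%y :: (complex ^ 'n) \<times> real. 1 - weight (snd y)) (u, 0) (v, 0) = 0"
  using fd_diff[OF smooth_const[of "(u, 0)" "1 :: real"] smooth_weight'[of "(u, 0)"], of "(v, 0)"] 1
  fun_cong[OF fd_eq[OF has_derivative_const[of "1 :: real" "at (u, 0 :: real)"]]] by simp
 qed
 have sw: "smooth_at (u, 0) (%y :: (complex ^ 'n) \<times> real. 1 - weight (snd y))" by (intro smooth_diff smooth_const smooth_weight')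
 have "ext_d1 primU (u, 0) (v, 0) (w, 0) = ext_d1 (nZ ZU) (u, 0) (v, 0) (w, 0) + ext_d1 (connection_form {()} (%_ y. S j0 (J y))) (u, 0) (v, 0) (w, 0)"
  unfolding primU_def[abs_def]
  using ext_d1_add[OF form_scale[OF smooth_weight' smooth_form_add[OF parts(1,2)]] form_scale[OF sw parts(3)]]
  ext_d1_scale[OF smooth_weight' smooth_form_add[OF parts(1,2)]] ext_d1_scale[OF sw parts(3)] ext_d1_add[OF parts(1,2)]
  by (simp add: fw) (simp add: weight_def)
 also have "ext_d1 (connection_form {()} (%_ y. S j0 (J y))) (u, 0) (v, 0) (w, 0) = 0"
  by (rule ext_d1_connection_single[OF smooth_SJ[OF d j0] J_frame(2)[OF d]])
 also have "ext_d1 (nZ ZU) (u, 0) (v, 0) (w, 0) = fubini_study idx (%j. ZU j (u, 0)) (%j. fd (ZU j) (u, 0) (v, 0)) (%j. fd (ZU j) (u, 0) (w, 0))"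
  by (rule ext_d1_connection[OF finite_idx smooth_ZU[OF d] ZU_pos[OF d]])
 also have "... = fubini_study idx (Z0 u) (dZ0 v) (dZ0 w)"
 proof (rule fubini_study_cong)
  have D: "fd (ZU j) (u, 0) (v, 0) = dZ0 v j" if j: "j : idx" for j v
  proof (cases j)
  case (Inl i)
  have "((%y. fst y $ i) has_derivative (%v. fst v $ i)) (at (u, 0 :: real))"
  by (intro deriv_bl bounded_linear_compose[OF bounded_linear_vec_nth bounded_linear_fst])
  from fun_cong[OF fd_eq[OF this]] show ?thesis by (simp add: Inl ZU_def[abs_def] dZ0_def)
  next
  case (Inr l)
  have si: "smooth_at u (%u. (u, 0 :: real))" by (intro smooth_Pair smooth_ident smooth_const)
  have fi: "fd (%u. (u, 0 :: real)) u v = (v, 0)"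
  using fun_cong[OF fd_eq[OF has_derivative_Pair[OF has_derivative_ident has_derivative_const]]] by metis
  have "fd (ZU j) (u, 0) (v, 0) = fd (%u. ZU j (u, 0)) u v" using fd_compose[OF si smooth_ZU[OF d j]] fi by simp
  also have "(%u. ZU j (u, 0)) = (%u. Z0 0 j)" by (simp add: ZU_def Z0_def J_def Inr)
  finally show ?thesis using fun_cong[OF fd_eq[OF has_derivative_const]] by (simp add: dZ0_def Inr)
  qed
  show "ZU j (u, 0) = Z0 u j & fd (ZU j) (u, 0) (v, 0) = dZ0 v j & fd (ZU j) (u, 0) (w, 0) = dZ0 w j" if "j : idx" for j
  using D[OF that] by (simp add: ZU_def Z0_def J_def split: sum.split)
 qed
 finally show ?thesis by simp
qed

lemma primU_nondegenerate:
 assumes a: "PI a = a" and z: "!!b. ext_d1 primU (u, 0) (a, 0) (PI b, 0) = 0" shows "a = 0"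
proof -
 let ?A = "Inl ` I :: ('n + nat) set" and ?B = "Inr ` {..N} :: ('n + nat) set"
 have un: "herm idx f g = herm ?A f g + herm ?B f g" for f g
  unfolding herm_def idx_def by (rule sum.union_disjoint) auto
 have B0: "herm ?B (dZ0 a) g = 0" for g by (auto simp: herm_def dZ0_def intro!: sum.neutral)
 have pA: "Re (herm ?A (Z0 u) (Z0 u)) >= 0" unfolding Re_herm_self by (intro sum_nonneg) auto
 have pB: "Re (herm ?B (Z0 u) (Z0 u)) > 0"
  by (rule herm_self_pos[of _ "Inr j0"]) (use j0 J_frame(2)[OF dom_zero] in \<open>auto simp: Z0_def J_def\<close>)
 have pos: "Re (herm idx (Z0 u) (Z0 u)) > 0" using pA pB by (simp add: un)
 have ia: "PI (\<i> *s a) = \<i> *s a" using a by (auto simp: PI_def vec_eq_iff split: if_splits)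
 have "dZ0 (\<i> *s a) = (%j. \<i> * dZ0 a j)" by (auto simp: dZ0_def split: sum.split)
 then have "fubini_study idx (Z0 u) (dZ0 a) (%j. \<i> * dZ0 a j) = 0" using z[of "\<i> *s a"] by (simp add: ia ext_primU_zero)
 then have "Re (herm ?A (dZ0 a) (dZ0 a)) * Re (herm idx (Z0 u) (Z0 u)) = (cmod (herm ?A (dZ0 a) (Z0 u)))\<^sup>2"
  using pos by (simp add: fubini_study_i[OF pos] un[of "dZ0 a"] B0)
 also have "... <= Re (herm ?A (dZ0 a) (dZ0 a)) * Re (herm ?A (Z0 u) (Z0 u))" by (rule herm_Cauchy_Schwarz)
 finally have "Re (herm ?A (dZ0 a) (dZ0 a)) * Re (herm ?B (Z0 u) (Z0 u)) <= 0" by (simp add: un algebra_simps)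
 then have h: "~ Re (herm ?A (dZ0 a) (dZ0 a)) > 0" using pB mult_pos_pos not_le by blast
 have "a $ i = 0" for i
 proof (cases "i : I")
  case True
  then show ?thesis using h herm_self_pos[of ?A "Inl i" "dZ0 a"] by (auto simp: dZ0_def)
 next
  case False
  then show ?thesis using arg_cong[OF a, of "%v. v $ i"] by (simp add: PI_def)
 qed
 then show ?thesis by (simp add: vec_eq_iff)
qed

lemma T_chart:
 assumes d: "dom y" and t: "snd y ~= 0" and a: "a : T (J y)"
 obtains \<beta> k where "PI \<beta> = \<beta>" "a = fd J y (\<beta>, 0) + k *s J y"
proof -
 let ?x = "snd y *r fst y" and ?x' = "xi j0 S"
 have ch: "frame (J y) kp S th e" "smooth_at ?x chi'" "S j0 (J y) ~= 0" "?x' (J y) = PI ?x" "ell (J y) = 1"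
  "around (J y) (%z. z : X --> ?x' z : ball 0 del & z = ell z *s chi' (?x' z))"
  using chart[of ?x] d by (simp_all add: J_def dom_def)
 have sx: "smooth_at (J y) ?x'" by (rule smooth_xi) (use frame_smooth[OF ch(1)] j0 ch(3) in auto)
 have Pb: "PI ?x : ball 0 del" using d norm_PI[of ?x] by (simp add: dom_def)
 have cP: "chi' (PI ?x) = J y"
  using around_self[OF ch(6)] J_frame(3)[OF d] by (simp add: ch(4,5))
 have sc: "smooth_at (PI ?x) chi'" using chart[OF Pb] by blast
 have sc': "smooth_at (J y) (%z. chi' (?x' z))" by (rule smooth_compose[OF sx]) (simp add: ch(4) sc)
 have se: "smooth_at z ell" for z by (rule smooth_bl[OF ell(1) smooth_ident])
 have "fd (%z. z) (J y) a = fd (%z. ell z *s chi' (?x' z)) (J y) a"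
 proof (rule tangent_unique[OF J_frame(3)[OF d] smooth_ident smooth_vscale[OF se sc'] _ a])
  show "around (J y) (%z. z : X --> z = ell z *s chi' (?x' z))" using ch(6) by eventually_elim blast
 qed
 also have "... = ell (J y) *s fd (%z. chi' (?x' z)) (J y) a + fd ell (J y) a *s chi' (?x' (J y))"
  using fun_cong[OF fd_eq[OF bounded_bilinear.FDERIV[OF bounded_bilinear_vscale smooth_deriv[OF se] smooth_deriv[OF sc']]]] by simp
 also have "... = fd chi' (PI ?x) (fd ?x' (J y) a) + fd ell (J y) a *s J y"
  using fd_compose[OF sx, of chi' a] sc by (simp add: ch(4,5) cP)
 finally have a': "a = fd chi' (PI ?x) (fd ?x' (J y) a) + fd ell (J y) a *s J y"
  using fd_eq[OF has_derivative_ident] by (metis (no_types))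
 define \<beta> where "\<beta> = inverse (snd y) *r fd ?x' (J y) a"
 have bPI: "bounded_linear PI" using linear_PI by (simp add: lin_bl)
 have "PI (fd ?x' (J y) a) = fd ?x' (J y) a" using fd_bl[OF bPI sx, of a] unfolding PI_xi by (rule sym)
 then have \<beta>: "PI \<beta> = \<beta>" by (simp add: \<beta>_def linear_scale[OF linear_PI])
 have "fd J y (\<beta>, 0) = fd chi' (PI ?x) (fd ?x' (J y) a)"
 proof -
  have JP: "J y' = chi' (PI (snd y' *r fst y'))" if "dom y'" for y'
  proof -
  have c: "?x' (J y') = PI (snd y' *r fst y')" "ell (J y') = 1"
  "around (J y') (%z. z : X --> ?x' z : ball 0 del & z = ell z *s chi' (?x' z))"
  using chart[of "snd y' *r fst y'"] that by (simp_all add: J_def dom_def)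
  from around_self[OF c(3)] J_frame(3)[OF that] have "J y' = ell (J y') *s chi' (?x' (J y'))" by blast
  then show ?thesis unfolding c(1,2) by simp
  qed
  obtain V where V: "open V" "y : V" "!!y. y : V ==> dom y" using dom_eventually[OF d] by (rule around_openE) blast
  have sPd: "smooth_at y (%y. PI (snd y *r fst y))" by (rule smooth_bl[OF bPI smooth_dilation])
  have "((%y. snd y *r fst y) has_derivative (%v. snd y *r fst v + snd v *r fst y)) (at y)"
  by (intro has_derivative_scaleR deriv_bl bounded_linear_fst bounded_linear_snd)
  then have "fd (%y. PI (snd y *r fst y)) y (\<beta>, 0) = PI (snd y *r \<beta>)"
  using fd_bl[OF bPI smooth_dilation, of y "(\<beta>, 0)"] by (simp add: fd_eq)
  also have "... = fd ?x' (J y) a" using t \<beta> by (simp add: linear_scale[OF linear_PI]) (simp add: \<beta>_def)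
  finally have "fd (%y. chi' (PI (snd y *r fst y))) y (\<beta>, 0) = fd chi' (PI ?x) (fd ?x' (J y) a)"
  using fd_compose[OF sPd, of chi' "(\<beta>, 0)"] sc by simp
  moreover have "fd J y (\<beta>, 0) = fd (%y. chi' (PI (snd y *r fst y))) y (\<beta>, 0)"
  using fd_cong[OF V(1,2), of J "%y. chi' (PI (snd y *r fst y))"] JP[OF V(3)] by simp
  ultimately show ?thesis by simp
 qed
 then show thesis using that[OF \<beta>, of "fd ell (J y) a"] a' by simp
qed

end

section \<open>The flow starting from the degenerate fibre\<close>

context charted
begin

lemma bounded_linear_PI: "bounded_linear PI"
 using linear_PI by (simp add: lin_bl)

text \<open>In rescaled coordinates the kernel of \<open>Om\<close> extends across \<open>t = 0\<close>, as the form is nondegenerate there. For \<open>t > 0\<close> its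
flow is the flow on \<open>X\<close>, up to scaling.\<close>

lemma chart_flow:
 assumes u0: "PI u0 = u0"
 obtains d rho Gam where "0 < d" "d < 2" "rho > 0" "!!r y. PI y = y ==> Gam r r y = y"
  "!!r t y. r : {-d<..<d} ==> t : {-d<..<d} ==> y : ball u0 rho ==>
  smooth_at y (Gam r t) & isCont (%t. Gam r t y) t & dom (Gam r t y, t) & PI (Gam r t y) = Gam r t y"
  "!!r y t1 t2. r : {-d<..<d} ==> y : ball u0 rho ==> t1 : {0<..<d} ==> t2 : {0<..<d} ==>
  EX k. k ~= 0 & flow t1 t2 (J (Gam r t1 y, t1)) = k *s J (Gam r t2 y, t2)"
  "!!r t y y'. r : {-d<..<d} ==> t : {-d<..<d} ==> y : ball u0 rho ==> y' : ball u0 rho ==> PI y = y ==> PI y' = y' ==>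
  Gam r t y = Gam r t y' ==> y = y'"
  "!!r t y v w. r : {-d<..<d} ==> t : {-d<..<d} ==> y : ball u0 rho ==> PI y = y ==> PI v = v ==> PI w = w ==>
  ext_d1 primU (Gam r t y, t) (fd (Gam r t) y v, 0) (fd (Gam r t) y w, 0) = ext_d1 primU (y, r) (v, 0) (w, 0)"
proof -
 have lev: "around (u0, 0) (%y. bilinear (ext_d1 primU y))"
  using form_around[OF smooth_primU[OF dom_zero]] by eventually_elim (simp add: ext_d1_bilinear)
 have sL: "smooth_at (u0, 0) (%y. ext_d1 primU y v w)" for v w by (rule smooth_ext_d1[OF smooth_primU[OF dom_zero]])
 obtain Y where Y: "smooth_at (u0, 0) Y" "around (u0, 0) (%y. (ALL a. PI (PI a) = PI a) -->
  PI (Y y) = Y y & (ALL b. ext_d1 primU y (Y y, 0) (PI b, 0) = - ext_d1 primU y (0, 1) (PI b, 0)))"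
 proof (rule moser_solve[where x="(u0, 0 :: real)" and Q="%y. PI" and B="%y a b. ext_d1 primU y (a, 0) (b, 0)" and c="%y b. - ext_d1 primU y (0, 1) (b, 0)"])
  show "around (u0, 0) (%y. bilinear (%a b. ext_d1 primU y (a, 0) (b, 0)))" using lev by eventually_elim (rule bilinear_first)
  show "around (u0, 0) (%y. linear (%b. - ext_d1 primU y (0, 1) (b, 0)))" using lev by eventually_elim (rule bilinear_first)
  show "smooth_at (u0, 0) (%y. ext_d1 primU y (a, 0) (b, 0))" "smooth_at (u0, 0) (%y. - ext_d1 primU y (0, 1) (b, 0))" for a b
  by (intro sL smooth_minus)+
  show "a = 0" if "PI a = a" "!!b. ext_d1 primU (u0, 0) (a, 0) (PI b, 0) = 0" for a by (rule primU_nondegenerate[OF that])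
 qed (simp_all add: linear_PI PI_PI)
 define good where "good z \<longleftrightarrow> smooth_at z Y & dom z & \<bar>snd z\<bar> < 1 & PI (Y z) = Y z & (ALL b. ext_d1 primU z (Y z, 1) (PI b, 0) = 0)" for z
 have "around (u0, 0) (%z. \<bar>snd z\<bar> < (1 :: real))"
  by (intro around_compose[OF smooth_snd_id, where P="%z. \<bar>z\<bar> < (1 :: real)"])
  (use around_open[of "{-1<..<1 :: real}" 0] in \<open>auto elim: eventually_mono\<close>)
 then have evg: "around (u0, 0) (%y. good y)"
  using Y(2) lev smooth_around[OF Y(1)] dom_eventually[OF dom_zero[of u0]]
 proof eventually_elim
  case (elim y)
  then have "ext_d1 primU y (Y y, 1) (PI b, 0) = 0" for b
  using bilinear_ladd[OF elim(3), of "(Y y, 0)" "(0, 1)" "(PI b, 0)"] by (simp add: PI_PI)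
  then show ?case using elim by (simp add: good_def PI_PI)
 qed
 have fdPI: "fd PI y = PI" for y by (rule fd_eq[OF deriv_bl[OF bounded_linear_PI]])
 have idem: "around u0 (%x. PI (PI x) = PI x)" by (simp add: PI_PI)
 have "around (u0, 0) (%z. PI (fst z) = fst z --> fd PI (fst z) (Y z) = Y z &
  (ALL v. fd PI (fst z) v = v --> ext_d1 primU z (v, 0) (Y z, 1) = 0))"
  using evg
 proof eventually_elim
  case (elim z)
  then have "ext_d1 primU z (v, 0) (Y z, 1) = 0" if "PI v = v" for v
  using ext_d1_skew[of primU z "(v, 0)"] that unfolding good_def by (metis neg_equal_0_iff_equal)
  then show ?case using elim by (simp add: fdPI good_def)
 qed
 from constrained_flow[OF Y(1) smooth_bl[OF bounded_linear_PI] u0 smooth_primU[OF dom_zero] evg idem this]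
 obtain d rho Gam where F: "d > 0" "rho > 0" "!!s y. Gam s s y = PI y"
  "!!s t y. s : {0 - d<..<0 + d} ==> t : {0 - d<..<0 + d} ==> y : ball u0 rho ==>
  smooth_at y (Gam s t) & PI (Gam s t y) = Gam s t y & good (Gam s t y, t) &
  ((%t. Gam s t y) has_vd Y (Gam s t y, t)) (at t)"
  "!!s t y v w. s : {0 - d<..<0 + d} ==> t : {0 - d<..<0 + d} ==> y : ball u0 rho ==>
  fd PI (Gam s t y) (fd (Gam s t) y v) = fd (Gam s t) y v &
  ext_d1 primU (Gam s t y, t) (fd (Gam s t) y v, 0) (fd (Gam s t) y w, 0) = ext_d1 primU (PI y, s) (fd PI y v, 0) (fd PI y w, 0)"
  by blast
 define Jd where "Jd = {-d<..<d}"
 note F4 = F(4)[unfolded diff_0 add_0, folded Jd_def] and F5 = F(5)[unfolded diff_0 add_0, folded Jd_def]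
 have "d < 2"
 proof (rule ccontr)
  assume "~ d < 2"
  then show False using F4[of 1 1 u0] F(2) by (simp add: good_def Jd_def)
 qed
 note d = F(1) this
 show thesis
 proof (rule that[of d rho Gam, folded Jd_def, OF d F(2)])
  show "Gam r r y = y" if "PI y = y" for r y using that by (simp add: F(3))
 next
  fix r t y assume a: "r : Jd" "t : Jd" "y : ball u0 rho"
  show "smooth_at y (Gam r t) & isCont (%t. Gam r t y) t & dom (Gam r t y, t) & PI (Gam r t y) = Gam r t y"
  using F4[OF a] has_vector_derivative_continuous[of "%t. Gam r t y" _ t UNIV] by (auto simp: good_def)
 next
  fix r y t1 t2 assume r: "r : Jd" and y: "y : ball u0 rho" and t: "t1 : {0<..<d}" "t2 : {0<..<d}"
  let ?w = "%t. (Gam r t y, t)"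
  show "EX k. k ~= 0 & flow t1 t2 (J (Gam r t1 y, t1)) = k *s J (Gam r t2 y, t2)"
  proof (rule projective_orbit[of 0 d "%t. J (?w t)" "%t. fd J (?w t) (Y (?w t), 1)", OF _ _ _ _ t])
  fix tau assume tau: "tau : {0<..<d}"
  then have tauJ: "tau : Jd" by (auto simp: Jd_def)
  note GamF = F4[OF r tauJ y]
  have g: "good (?w tau)" using GamF by simp
  then have dm: "dom (?w tau)" and sY: "smooth_at (?w tau) Y" by (simp_all add: good_def)
  have dw: "(?w has_vd (Y (?w tau), 1)) (at tau)" using GamF by (intro has_vector_derivative_Pair has_vector_derivative_id) simp
  from diff_chain_at[OF this[unfolded has_vector_derivative_def] smooth_deriv[OF smooth_J[OF dm]]]
  have 1: "((%t. J (?w t)) has_vd fd J (?w tau) (Y (?w tau), 1)) (at tau)"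
  by (simp only: has_vector_derivative_def o_def linear_scale[OF smooth_lin[OF smooth_J[OF dm]]])
  have "isCont (%q. fd J q (Y q, 1)) (?w tau)"
  by (rule smooth_isCont[OF smooth_fd_app[OF smooth_J[OF dm] smooth_Pair[OF sY smooth_const]]])
  from isCont_o2[OF has_vector_derivative_continuous[OF dw] this]
  show "J (?w tau) : X & ((%t. J (?w t)) has_vd fd J (?w tau) (Y (?w tau), 1)) (at tau) & isCont (%t. fd J (?w t) (Y (?w t), 1)) tau"
  using 1 J_frame(3)[OF dm] by simp
  fix a assume a: "a : T (J (?w tau))"
  have tau0: "snd (?w tau) ~= 0" "tau ~= 0" using tau by auto
  obtain \<beta> k where b: "PI \<beta> = \<beta>" "a = fd J (?w tau) (\<beta>, 0) + k *s J (?w tau)" by (rule T_chart[OF dm tau0(1) a])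
  note JX = J_frame(3)[OF dm]
  let ?O = "Om (J (?w tau)) tau" and ?V = "(fd J (?w tau) (Y (?w tau), 1), 1 :: real)"
  have VT: "fst ?V : T (J (?w tau))" using fd_J[OF dm] by simp
  have "ext_d1 primU (?w tau) (Y (?w tau), 1) (PI \<beta>, 0) = 0" using g unfolding good_def by blast
  then have "?O ?V (fd J (?w tau) (\<beta>, 0), 0) = 0"
  using ext_primU[OF dm tau0(1), of "(Y (?w tau), 1)" "(\<beta>, 0)"] b(1) by simp
  then have "?O (fd J (?w tau) (\<beta>, 0), 0) ?V = 0" using Om_skew[OF JX tau0(2), of "(fd J (?w tau) (\<beta>, 0), 0)" ?V] VT fd_J[OF dm] by simp
  then have "?O (a, 0) ?V = 0"
  using Om_add_left[OF JX tau0(2), of "(fd J (?w tau) (\<beta>, 0), 0)" "(k *s J (?w tau), 0)" ?V] VT fd_J[OF dm] radial_T[OF JX]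
  Om_radial[OF JX tau0(2) VT] b(2) by simp
  then show "Om (J (?w tau)) tau (fd J (?w tau) (Y (?w tau), 1), 1) (a, 0) = 0" using Om_skew[OF JX tau0(2), of "(a, 0)" ?V] VT a by simp
  qed (use d in auto)
 next
  fix r t y y' assume r: "r : Jd" and t: "t : Jd" and y: "y : ball u0 rho" "y' : ball u0 rho" "PI y = y" "PI y' = y'" and eq: "Gam r t y = Gam r t y'"
  have sub: "tau : Jd" if "tau : {min r t..max r t}" for tau using that r t by (auto simp: Jd_def)
  have sV: "smooth_at z (%z. (Y z, 1 :: real))" if "z : {z. good z}" for z using that by (intro smooth_Pair smooth_const) (simp add: good_def)
  have c: "(Gam r tau y, tau) : {z. good z} & ((%tau. (Gam r tau y, tau)) has_vd (Y (Gam r tau y, tau), 1)) (at tau within {min r t..max r t})"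
  if y: "y : ball u0 rho" and tau: "tau : {min r t..max r t}" for y tau
  using F4[OF r sub[OF tau] y] by (simp add: has_vector_derivative_at_within has_vector_derivative_Pair has_vector_derivative_id)
  have "(Gam r r y, r) = (Gam r r y', r)" using ode_unique[OF sV c[OF y(1)] c[OF y(2)], of t r] eq by simp
  then show "y = y'" using y by (simp add: F(3))
 next
  fix r t y v w assume r: "r : Jd" and t: "t : Jd" and y: "y : ball u0 rho" "PI y = y" and v: "PI v = v" "PI w = w"
  show "ext_d1 primU (Gam r t y, t) (fd (Gam r t) y v, 0) (fd (Gam r t) y w, 0) = ext_d1 primU (y, r) (v, 0) (w, 0)"
  using F5[OF r t y(1), of v w] by (simp add: fdPI y(2) v)
 qed
qed

end

section \<open>The symplectomorphism with the torus\<close>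

lemma group_closure_standard:
 fixes I :: "'n::finite set"
 defines "A == insert 0 ((%i. axis i 1) ` I) :: (int ^ 'n) set"
 shows "group_closure {\<beta> - gam |\<beta> gam. \<beta> : A & gam : A} = lattice I" "A \<subseteq> lattice I"
proof -
 let ?G = "group_closure {\<beta> - gam |\<beta> gam. \<beta> : A & gam : A}"
 show A: "A \<subseteq> lattice I" by (auto simp: A_def lattice_def axis_def)
 have "x : lattice I" if "x : ?G" for x
  using that by (induction rule: group_closure.induct) (use A in \<open>auto simp: lattice_def subset_iff\<close>)
 moreover have "\<beta> : ?G" if \<beta>: "\<beta> : lattice I" for \<beta>
 proof -
  have 1: "axis i k : ?G" if i: "i : I" for i k
  proof (induction k rule: int_induct[where k=0])
  case base
  have "axis i (0 :: int) = 0" by (simp add: axis_def vec_eq_iff)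
  then show ?case by (simp only: zero_in_group_closure)
  next
  have a: "axis i 1 : ?G" using i by (intro group_closure.base insertI2 CollectI exI[of _ "axis i 1"] exI[of _ 0]) (simp add: A_def)
  case (step1 k)
  have "axis i (k + 1) = axis i k + axis i (1 :: int)" by (simp add: axis_def vec_eq_iff)
  then show ?case using group_closure_add[OF step1(2) a] by simp
  next
  have a: "axis i 1 : ?G" using i by (intro group_closure.base insertI2 CollectI exI[of _ "axis i 1"] exI[of _ 0]) (simp add: A_def)
  case (step2 k)
  have "axis i (k - 1) = axis i k - axis i (1 :: int)" by (simp add: axis_def vec_eq_iff)
  then show ?case using group_closure.diff[OF step2(2) a] by simp
  qed
  have s: "(SUM i:F. axis i (\<beta> $ i)) : ?G" if "F \<subseteq> I" for F
  using finite[of F] that by (induction F rule: finite_induct) (auto intro: group_closure_add 1)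
  have "(SUM i:I. axis i (\<beta> $ i)) = \<beta>"
  using \<beta> by (auto simp: vec_eq_iff sum_component axis_def lattice_def if_distrib cong: if_cong)
  then show ?thesis using s[OF order_refl] by (simp only:)
 qed
 ultimately show "?G = lattice I" by blast
qed

lemma monomial_axis: "monomial_at (axis i 1) y = y $ i" and monomial_zero: "monomial_at 0 y = 1"
proof -
 have "(y $ j) powi (axis i 1 $ j) = (if j = i then y $ i else 1)" for j by (simp add: axis_def)
 then show "monomial_at (axis i 1) y = y $ i" by (simp add: monomial_at_def)
qed (simp add: monomial_at_def)

lemma torus_open:
 fixes u :: "complex ^ 'n"
 assumes "ALL i. i ~: I --> u $ i = 0" "ALL i:I. u $ i ~= 0" shows "u : torus I"
 using assms by (auto simp: torus_def)

context charted
begin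

abbreviation "co == xi j0 (%l. s l kp)"

definition in_dom :: "complex ^ 'm => bool" where
 "in_dom z \<longleftrightarrow> (EX x k. x : ball 0 del & PI x = x & k ~= 0 & z = k *s chi' x)"

lemma co_chart:
 assumes "x : ball 0 del" "k ~= 0" shows "co (k *s chi' x) = PI x"
proof -
 have f: "frame (chi' x) kp S th e" "xi j0 S (chi' x) = PI x" using chart[OF assms(1)] by simp_all
 have "chi' x : W kp" using f(1) by (simp add: frame_def)
 then have "co (k *s chi' x) = xi j0 S (chi' x)"
  using scaling[OF _ assms(2)] frame_value[OF f(1)] by (intro xi_cong j0) simp
 then show ?thesis using f(2) by simp
qed

lemma co_J: "dom (y, t) ==> PI y = y ==> k ~= 0 ==> in_dom (k *s J (y, t)) & co (k *s J (y, t)) = t *r y"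
 using co_chart[of "t *r y" k] linear_scale[OF linear_PI, of t y] unfolding dom_def in_dom_def J_def
 by (intro conjI exI[of _ "t *r y"] exI[of _ k]) simp_all

lemma in_dom_scale: "in_dom z ==> k ~= 0 ==> in_dom (k *s z) & co (k *s z) = co z"
proof -
 assume "in_dom z" and k: "k ~= 0"
 then obtain x k' where x: "x : ball 0 del" "PI x = x" "k' ~= 0" "z = k' *s chi' x" unfolding in_dom_def by blast
 have "k *s z = (k * k') *s chi' x" "k * k' ~= 0" using x k by (simp_all add: vs_assoc)
 then show ?thesis using co_chart[OF x(1)] x unfolding in_dom_def by metis
qed

text \<open>The orbit through \<open>x\<close> enters the chart and its rescaled coordinates tend to \<open>u\<close> as \<open>t\<close> tends to \<open>0\<close>: the inverse of the map
from the degenerate fibre to \<open>X\<close>.\<close>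

definition limit :: "complex ^ 'm => complex ^ 'n => bool" where
 "limit x u \<longleftrightarrow> (\<forall>\<^sub>F t in at_right 0. in_dom (flow 1 t x)) & ((%t. inverse t *r co (flow 1 t x)) \<longlongrightarrow> u) (at_right 0)"

lemma limit_unique: "limit x u ==> limit x u' ==> u = u'"
 unfolding limit_def using tendsto_unique[OF trivial_limit_at_right_real] by blast

lemma one_range: "(1 :: real) : {0<..<2}"
 by simp

lemma limit_scale:
 assumes x: "x : X" and k: "k ~= 0" and l: "limit x u" shows "limit (k *s x) u"
proof -
 have 1: "\<forall>\<^sub>F t in at_right 0. t : {0<..<2::real}" using eventually_at_right_real[of 0 2] by simp
 have "\<forall>\<^sub>F t in at_right 0. in_dom (flow 1 t x)" using l by (simp add: limit_def)
 with 1 have ev: "\<forall>\<^sub>F t in at_right 0. in_dom (flow 1 t (k *s x)) & inverse t *r co (flow 1 t x) = inverse t *r co (flow 1 t (k *s x))"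
  by eventually_elim (simp add: flow_scale[OF x one_range _ k] in_dom_scale k)
 then have "\<forall>\<^sub>F t in at_right 0. inverse t *r co (flow 1 t x) = inverse t *r co (flow 1 t (k *s x))" by (rule eventually_mono) blast
 from Lim_transform_eventually[OF conjunct2[OF l[unfolded limit_def]] this]
 have "((%t. inverse t *r co (flow 1 t (k *s x))) \<longlongrightarrow> u) (at_right 0)" .
 then show ?thesis using ev unfolding limit_def by (auto elim: eventually_mono)
qed

lemma path_limit:
 assumes x: "x : X" and eps: "eps : {0<..<d}" and d: "d < 2" and k: "k ~= 0" and fl: "flow 1 eps x = k *s J (w eps, eps)"
  and w: "!!t. t : {0<..<d} ==> dom (w t, t) & PI (w t) = w t"
  "!!t. t : {0<..<d} ==> EX k. k ~= 0 & flow eps t (J (w eps, eps)) = k *s J (w t, t)" "isCont w 0"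
 shows "limit x (w 0)"
proof -
 have *: "in_dom (flow 1 t x) & co (flow 1 t x) = t *r w t" if t: "t : {0<..<d}" for t
 proof -
  have r: "eps : {0<..<2}" "t : {0<..<2}" using eps t d by auto
  obtain k' where k': "k' ~= 0" "flow eps t (J (w eps, eps)) = k' *s J (w t, t)" using w(2)[OF t] by blast
  have "flow 1 t x = flow eps t (k *s J (w eps, eps))" using flow_flow[OF x one_range r] fl by simp
  also have "... = (k * k') *s J (w t, t)" using flow_scale[OF J_frame(3) r k, of "(w eps, eps)"] w(1)[OF eps] k'(2) by (simp add: vs_assoc)
  finally show ?thesis using co_J[of "w t" t "k * k'"] w(1)[OF t] k k'(1) by simp
 qed
 have ev: "\<forall>\<^sub>F t in at_right 0. t : {0<..<d}" using eventually_at_right_real[of 0 d] eps by simp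
 have "(w \<longlongrightarrow> w 0) (at_right 0)" using w(3) unfolding isCont_def by (rule tendsto_mono[OF at_le[OF subset_UNIV]])
 moreover have "\<forall>\<^sub>F t in at_right 0. w t = inverse t *r co (flow 1 t x)" using ev by eventually_elim (use * in simp)
 ultimately have "((%t. inverse t *r co (flow 1 t x)) \<longlongrightarrow> w 0) (at_right 0)" by (rule Lim_transform_eventually)
 moreover have "\<forall>\<^sub>F t in at_right 0. in_dom (flow 1 t x)" using ev by eventually_elim (use * in simp)
 ultimately show ?thesis by (simp add: limit_def)
qed

lemma limit_point:
 assumes l: "limit x u" and rho: "rho > 0"
 shows "\<forall>\<^sub>F t in at_right 0. EX k y. k ~= 0 & y : ball u rho & PI y = y & dom (y, t) & flow 1 t x = k *s J (y, t)"
proof -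
 have 1: "\<forall>\<^sub>F t in at_right 0. t : {0<..<1::real}" using eventually_at_right_real[of 0 1] by simp
 have 2: "\<forall>\<^sub>F t in at_right 0. dist (inverse t *r co (flow 1 t x)) u < rho" by (rule tendstoD[OF conjunct2[OF l[unfolded limit_def]] rho])
 have 3: "\<forall>\<^sub>F t in at_right 0. in_dom (flow 1 t x)" using l by (simp add: limit_def)
 show ?thesis using 1 2 3
 proof eventually_elim
  case (elim t)
  obtain x' k where x': "x' : ball 0 del" "PI x' = x'" "k ~= 0" "flow 1 t x = k *s chi' x'" using elim(3) unfolding in_dom_def by blast
  have c: "co (flow 1 t x) = x'" using co_chart[OF x'(1,3)] x' by simp
  have t: "t *r (inverse t *r x') = x'" using elim(1) by simp
  show ?case
  proof (intro exI conjI)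
  show "flow 1 t x = k *s J (inverse t *r x', t)" "dom (inverse t *r x', t)" using x' t by (simp_all add: J_def dom_def)
  show "inverse t *r x' : ball u rho" using elim(2) by (simp add: c dist_commute)
  qed (use x' in \<open>simp_all add: linear_scale[OF linear_PI]\<close>)
 qed
qed

lemma torus_PI: "u : torus I ==> PI u = u"
 by (auto simp: torus_def PI_def vec_eq_iff)

lemma Om_radial_shift:
 assumes x: "x : X" "t ~= 0" and a: "a : T x" "b : T x"
 shows "Om x t (m *s x + a, 0) (m' *s x + b, 0) = Om x t (a, 0) (b, 0)"
proof -
 have r: "m *s x : T x" "m' *s x : T x" "m' *s x + b : T x" using radial_T[OF x(1)] T_add[OF x(1)] a by auto
 have "Om x t (m *s x + a, 0) (m' *s x + b, 0) = Om x t (a, 0) (m' *s x + b, 0)"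
  using Om_add_left[OF x, of "(m *s x, 0)" "(a, 0)" "(m' *s x + b, 0)"] Om_radial[OF x, of "(m' *s x + b, 0)" m] r a by simp
 also have "... = - Om x t (m' *s x + b, 0) (a, 0)" using Om_skew[OF x, of "(a, 0)" "(m' *s x + b, 0)"] r a by simp
 also have "... = - Om x t (b, 0) (a, 0)"
  using Om_add_left[OF x, of "(m' *s x, 0)" "(b, 0)" "(a, 0)"] Om_radial[OF x, of "(a, 0)" m'] r a by simp
 also have "... = Om x t (a, 0) (b, 0)" using Om_skew[OF x, of "(a, 0)" "(b, 0)"] a by simp
 finally show ?thesis .
qed

lemma limit_exists:
 assumes u0: "u0 : torus I"
 obtains V sig where "open V" "u0 : V" "smooth_on V sig" "!!u. u : V ==> u : torus I ==> sig u : X & limit (sig u) u"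
proof -
 show thesis
 proof (rule chart_flow[OF torus_PI[OF u0]], goal_cases)
 case F: (1 d rho Gam)
 define eps where "eps = d / 2"
 have eps: "eps : {0<..<d}" "eps : {-d<..<d}" "eps : {0<..<2}" and z: "0 : {-d<..<d}" using F(1,2) by (auto simp: eps_def)
 define q where "q u = J (Gam 0 eps u, eps)" for u
 have sq: "smooth_at u q" "q u : X" if u: "u : ball u0 rho" for u
 proof -
  have f: "smooth_at u (Gam 0 eps)" "dom (Gam 0 eps u, eps)" using F(5)[OF z eps(2) u] by simp_all
  show "q u : X" unfolding q_def by (rule J_frame(3)[OF f(2)])
  show "smooth_at u q" unfolding q_def[abs_def]
  by (rule smooth_compose[OF smooth_Pair[OF f(1) smooth_const] smooth_J[OF f(2)]])
 qed
 have u0b: "u0 : ball u0 rho" using F(3) by simp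
 obtain G1 where G1: "smooth_at (q u0) G1" "around (q u0) (%y. y : X --> G1 y = flow eps 1 y)"
  using flow_smooth[OF sq(2)[OF u0b] eps(3) one_range] by blast
 define sig where "sig u = G1 (q u)" for u
 have ssig: "smooth_at u0 sig" unfolding sig_def[abs_def] by (rule smooth_compose[OF sq(1)[OF u0b] G1(1)])
 have "around u0 (%u. q u : X --> G1 (q u) = flow eps 1 (q u))" by (rule around_compose[OF sq(1)[OF u0b] G1(2)])
 with smooth_around[OF ssig] around_open[OF open_ball u0b]
 have "around u0 (%u. smooth_at u sig & u : ball u0 rho & sig u = flow eps 1 (q u))"
  by eventually_elim (simp add: sig_def sq(2))
 then obtain V where V: "open V" "u0 : V" "!!u. u : V ==> smooth_at u sig & u : ball u0 rho & sig u = flow eps 1 (q u)"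
  by (rule around_openE) blast
 show thesis
 proof (rule that[OF V(1,2)])
  show "smooth_on V sig" using V(3) by (simp add: smooth_on_open_iff[OF V(1)])
  fix u assume uV: "u : V" and ut: "u : torus I"
  have u: "u : ball u0 rho" "sig u = flow eps 1 (q u)" using V(3)[OF uV] by simp_all
  have X: "sig u : X" unfolding u(2) by (rule flow_X[OF sq(2)[OF u(1)] eps(3) one_range])
  have "flow 1 eps (sig u) = 1 *s J (Gam 0 eps u, eps)"
  using flow_flow[OF sq(2)[OF u(1)] eps(3) one_range eps(3)] flow_orbit(2)[OF sq(2)[OF u(1)] eps(3)] by (simp add: u(2)) (simp add: q_def)
  note fl = this
  have "limit (sig u) (Gam 0 0 u)"
  by (rule path_limit[where w="%t. Gam 0 t u", OF X eps(1) F(2) one_neq_zero fl])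
  (use F(5)[OF z _ u(1)] F(6)[OF z u(1) eps(1)] z F(1) in simp_all)
  then show "sig u : X & limit (sig u) u" using X F(4)[OF torus_PI[OF ut]] by simp
 qed
 qed
qed

lemma limit_injective:
 assumes x: "x : X" "y : X" and u: "limit x u" "limit y u" "u : torus I" shows "EX k. k ~= 0 & y = k *s x"
proof -
 show ?thesis
 proof (rule chart_flow[OF torus_PI[OF u(3)]], goal_cases)
 case F: (1 d rho Gam)
 have "\<forall>\<^sub>F t in at_right 0. t : {0<..<d}" using eventually_at_right_real[of 0 d] F(1) by simp
 with limit_point[OF u(1) F(3)] limit_point[OF u(2) F(3)]
 have "\<forall>\<^sub>F t in at_right 0. t : {0<..<d} & (EX k y. k ~= 0 & y : ball u rho & PI y = y & flow 1 t x = k *s J (y, t)) &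
  (EX k y'. k ~= 0 & y' : ball u rho & PI y' = y' & flow 1 t y = k *s J (y', t))" by eventually_elim blast
 from eventually_happens'[OF trivial_limit_at_right_real this]
 obtain eps k1 y1 k2 y2 where e: "eps : {0<..<d}" and 1: "k1 ~= 0" "y1 : ball u rho" "PI y1 = y1" "flow 1 eps x = k1 *s J (y1, eps)"
  and 2: "k2 ~= 0" "y2 : ball u rho" "PI y2 = y2" "flow 1 eps y = k2 *s J (y2, eps)" by blast
 have r: "eps : {-d<..<d}" "0 : {-d<..<d}" "eps : {0<..<2}" using e F(1,2) by auto
 have lim: "limit x (Gam eps 0 y)" if x: "x : X" and k: "k ~= 0" "y : ball u rho" "PI y = y" "flow 1 eps x = k *s J (y, eps)" for x k y
  by (rule path_limit[OF x e F(2) k(1), of "%t. Gam eps t y"])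
  (use k(4) F(4)[OF k(3)] F(5)[OF r(1) _ k(2)] F(6)[OF r(1) k(2) e] r(2) F(1) in auto)
 have "Gam eps 0 y1 = u" "Gam eps 0 y2 = u" using limit_unique[OF lim[OF x(1) 1] u(1)] limit_unique[OF lim[OF x(2) 2] u(2)] .
 then have y: "y1 = y2" using F(7)[OF r(1,2) 1(2) 2(2) 1(3) 2(3)] by simp
 have c: "k2 * inverse k1 ~= 0" using 1 2 by simp
 have "flow 1 eps y = (k2 * inverse k1) *s flow 1 eps x" using 1 2 y by (simp add: vs_assoc)
 then have "flow 1 eps y = flow 1 eps ((k2 * inverse k1) *s x)" using flow_scale[OF x(1) one_range r(3) c] by simp
 then have "flow eps 1 (flow 1 eps y) = flow eps 1 (flow 1 eps ((k2 * inverse k1) *s x))" by simp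
 then have "y = (k2 * inverse k1) *s x"
  using flow_flow[OF x(2) one_range r(3) one_range] flow_flow[OF scale_X[OF x(1) c] one_range r(3) one_range]
  flow_orbit(2)[OF x(2) one_range] flow_orbit(2)[OF scale_X[OF x(1) c] one_range] by simp
 then show ?thesis using c by blast
 qed
qed

text \<open>Flow from \<open>1\<close> to a small time \<open>eps\<close> on \<open>X\<close>, pass to rescaled coordinates, and flow from \<open>eps\<close> to \<open>0\<close> there. Each step is smooth and
preserves the form.\<close>

lemma limit_smooth:
 assumes x: "x : X" and l: "limit x u0" and u0: "u0 : torus I"
 obtains V G where "open V" "x : V" "smooth_on V G" "!!z. z : V ==> z : X ==> G z : torus I & limit z (G z)"
  "!!v w. v : T x ==> w : T x ==> \<omega> x v w = ext_d1 primU (u0, 0) (fd G x v, 0) (fd G x w, 0)"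
proof -
 show thesis
 proof (rule chart_flow[OF torus_PI[OF u0]], goal_cases)
 case F: (1 d rho Gam)
 have "\<forall>\<^sub>F t in at_right 0. t : {0<..<d}" using eventually_at_right_real[of 0 d] F(1) by simp
 with limit_point[OF l F(3)]
 have "\<forall>\<^sub>F t in at_right 0. t : {0<..<d} & (EX k y. k ~= 0 & y : ball u0 rho & PI y = y & dom (y, t) & flow 1 t x = k *s J (y, t))"
  by eventually_elim blast
 from eventually_happens'[OF trivial_limit_at_right_real this]
 obtain eps k y0 where e: "eps : {0<..<d}" and y0: "k ~= 0" "y0 : ball u0 rho" "PI y0 = y0" "dom (y0, eps)" "flow 1 eps x = k *s J (y0, eps)" by blast
 have r: "eps : {-d<..<d}" "0 : {-d<..<d}" "eps : {0<..<2}" "eps ~= 0" using e F(1,2) by auto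
 have ik: "inverse k ~= 0" using y0(1) by simp
 obtain G0 where G0: "smooth_at x G0" "around x (%y. y : X --> G0 y = flow 1 eps y)" "!!v. v : T x ==> fd G0 x v : T (flow 1 eps x)"
  "!!v w. v : T x ==> w : T x ==> Om (flow 1 eps x) eps (fd G0 x v, 0) (fd G0 x w, 0) = Om x 1 (v, 0) (w, 0)"
  using flow_smooth[OF x one_range r(3)] by blast
 let ?j = "J (y0, eps)"
 have G0x: "G0 x = k *s ?j" using around_self[OF G0(2)] x y0(5) by simp
 define B where "B z = inverse k *s G0 z" for z
 have sB: "smooth_at x B" unfolding B_def[abs_def] by (rule smooth_bl[OF bl_vscale G0(1)])
 have Bx: "B x = ?j" using y0(1) by (simp add: B_def G0x vs_assoc)
 have c0: "eps *r y0 : ball 0 del" using y0(4) by (simp add: dom_def)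
 have ch: "frame ?j kp S th e" "S j0 ?j ~= 0" "xi j0 S ?j = eps *r y0" "ell ?j = 1"
  "around ?j (%z. z : X --> xi j0 S z : ball 0 del & z = ell z *s chi' (xi j0 S z))"
  using chart[OF c0] linear_scale[OF linear_PI, of eps y0] by (simp_all add: J_def y0(3))
 have sx: "smooth_at ?j (xi j0 S)" by (rule smooth_xi) (use frame_smooth[OF ch(1)] j0 ch(2) in auto)
 define Y where "Y z = inverse eps *r xi j0 S (B z)" for z
 have sY: "smooth_at x Y" unfolding Y_def[abs_def]
  by (intro smooth_scaleR smooth_const smooth_compose[OF sB]) (simp add: Bx sx)
 have Yx: "Y x = y0" using r(4) by (simp add: Y_def Bx ch(3))
 have PIY: "PI (Y z) = Y z" for z by (simp add: Y_def linear_scale[OF linear_PI] PI_xi)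
 define G where "G z = Gam eps 0 (Y z)" for z
 have sG0: "smooth_at y0 (Gam eps 0)" using F(5)[OF r(1,2) y0(2)] by blast
 have sG: "smooth_at x G" unfolding G_def[abs_def] by (rule smooth_compose[OF sY]) (simp add: Yx sG0)
 have se: "smooth_at x (%z. ell (B z))" by (rule smooth_bl[OF ell(1) sB])
 have e1: "around x (%z. B z : X --> xi j0 S (B z) : ball 0 del & B z = ell (B z) *s chi' (xi j0 S (B z)))"
  by (rule around_compose[OF sB]) (simp only: Bx ch(5))
 have e2: "around x (%z. ell (B z) : - {0})"
  by (rule around_compose[OF se], rule around_open) (auto simp: Bx ch(4) open_Compl)
 have e3: "around x (%z. Y z : ball u0 rho)"
  by (rule around_compose[OF sY], rule around_open) (use y0(2) in \<open>simp_all add: Yx\<close>)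
 have near: "around x (%z. z : X --> ell (B z) ~= 0 & B z = ell (B z) *s J (Y z, eps) & dom (Y z, eps) &
  flow 1 eps z = (k * ell (B z)) *s J (Y z, eps) & Y z : ball u0 rho)"
  using e1 e2 e3 G0(2)
 proof eventually_elim
  case (elim z)
  show ?case
  proof
  assume z: "z : X"
  have f: "G0 z = flow 1 eps z" using elim(4) z by simp
  have "B z : X" unfolding B_def f by (rule scale_X[OF flow_X[OF z one_range r(3)] ik])
  then have b: "xi j0 S (B z) : ball 0 del" "B z = ell (B z) *s chi' (xi j0 S (B z))" using elim(1) by blast+
  have eY: "eps *r Y z = xi j0 S (B z)" using r(4) by (simp add: Y_def)
  have bJ: "B z = ell (B z) *s J (Y z, eps)" using b(2) by (simp add: J_def eY)
  have "flow 1 eps z = k *s B z" using y0(1) f by (simp add: B_def vs_assoc)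
  also have "... = (k * ell (B z)) *s J (Y z, eps)" by (subst bJ) (simp add: vs_assoc)
  finally show "ell (B z) ~= 0 & B z = ell (B z) *s J (Y z, eps) & dom (Y z, eps) & flow 1 eps z = (k * ell (B z)) *s J (Y z, eps) & Y z : ball u0 rho"
  using bJ elim(2,3) b(1) by (simp add: dom_def eY)
  qed
 qed
 have lim: "limit z (Gam eps 0 y)" if z: "z : X" and k: "k ~= 0" "y : ball u0 rho" "PI y = y" "flow 1 eps z = k *s J (y, eps)" for z k y
  by (rule path_limit[OF z e F(2) k(1), of "%t. Gam eps t y"])
  (use k(4) F(4)[OF k(3)] F(5)[OF r(1) _ k(2)] F(6)[OF r(1) k(2) e] r(2) F(1) in auto)
 have Gx: "G x = u0" using limit_unique[OF lim[OF x y0(1,2,3,5)] l] by (simp add: G_def Yx)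
 have "around x (%z. ALL i:I. G z $ i ~= 0)"
 proof (rule eventually_ball_finite[OF finite], rule ballI)
  fix i assume i: "i : I"
  have "G x $ i : - {0}" using u0 i by (simp add: Gx torus_def)
  then have "around x (%z. G z $ i : - {0})"
  using around_compose[OF smooth_vec_nth[OF sG, of i], of "%z. z : - {0}"] around_open[of "- {0 :: complex}" "G x $ i"]
  by (simp add: open_Compl)
  then show "around x (%z. G z $ i ~= 0)" by eventually_elim simp
 qed
 with near smooth_around[OF sG] have "around x (%z. smooth_at z G & (z : X --> G z : torus I & limit z (G z)))"
 proof eventually_elim
  case (elim z)
  have "G z : torus I & limit z (G z)" if z: "z : X"
  proof
  have n: "k * ell (B z) ~= 0" "Y z : ball u0 rho" "flow 1 eps z = (k * ell (B z)) *s J (Y z, eps)" using elim(1) z y0(1) by auto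
  show "limit z (G z)" unfolding G_def by (rule lim[OF z n(1,2) PIY n(3)])
  have "PI (G z) = G z" using F(5)[OF r(1,2) n(2)] by (simp add: G_def)
  then have "PI (G z) $ i = G z $ i" for i by simp
  then have "ALL i. i ~: I --> G z $ i = 0" unfolding PI_def by (metis (mono_tags) vec_lambda_beta)
  then show "G z : torus I" using elim(3) by (rule torus_open)
  qed
  then show ?case using elim(2) by blast
 qed
 then obtain V where V: "open V" "x : V" "!!z. z : V ==> smooth_at z G & (z : X --> G z : torus I & limit z (G z))"
  by (rule around_openE) blast
 show thesis
 proof (rule that[OF V(1,2)])
  show "smooth_on V G" using V(3) by (simp add: smooth_on_open_iff[OF V(1)])
  show "G z : torus I & limit z (G z)" if "z : V" "z : X" for z using V(3) that by blast
  fix v w assume vw: "v : T x" "w : T x"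
  have jX: "?j : X" by (rule J_frame(3)[OF y0(4)])
  have sJY: "smooth_at x (%z. J (Y z, eps))"
  by (rule smooth_compose[OF smooth_Pair[OF sY smooth_const]]) (simp add: Yx smooth_J y0(4))
  have dB: "EX m. inverse k *s fd G0 x v = m *s ?j + fd J (y0, eps) (fd Y x v, 0)" if v: "v : T x" for v
  proof -
  have "inverse k *s fd G0 x v = fd B x v"
  using fd_bl[OF bl_vscale G0(1)] by (simp add: B_def[abs_def])
  also have "... = fd (%z. ell (B z) *s J (Y z, eps)) x v"
  by (rule tangent_unique[OF x sB smooth_vscale[OF se sJY] _ v]) (use near in \<open>eventually_elim, blast\<close>)
  also have "... = ell (B x) *s fd (%z. J (Y z, eps)) x v + fd (%z. ell (B z)) x v *s J (Y x, eps)"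
  using fun_cong[OF fd_eq[OF bounded_bilinear.FDERIV[OF bounded_bilinear_vscale smooth_deriv[OF se] smooth_deriv[OF sJY]]]] .
  also have "fd (%z. J (Y z, eps)) x v = fd J (y0, eps) (fd Y x v, 0)"
  proof -
  have "fd (%z. (Y z, eps)) x v = (fd Y x v, 0)"
  using fun_cong[OF fd_eq[OF has_derivative_Pair[OF smooth_deriv[OF sY] has_derivative_const]]] .
  then show ?thesis using fd_compose[of x "%z. (Y z, eps)" J v, OF smooth_Pair[OF sY smooth_const]] by (simp add: Yx smooth_J y0(4))
  qed
  finally show ?thesis by (intro exI[of _ "fd (%z. ell (B z)) x v"]) (simp add: Bx ch(4) Yx add.commute)
  qed
  obtain m where m: "inverse k *s fd G0 x v = m *s ?j + fd J (y0, eps) (fd Y x v, 0)" using dB[OF vw(1)] by blast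
  obtain m' where m': "inverse k *s fd G0 x w = m' *s ?j + fd J (y0, eps) (fd Y x w, 0)" using dB[OF vw(2)] by blast
  have fX: "flow 1 eps x : X" by (rule flow_X[OF x one_range r(3)])
  have fj: "inverse k *s flow 1 eps x = ?j" using y0(1) by (simp add: y0(5) vs_assoc)
  have PIdY: "PI (fd Y x v) = fd Y x v" for v using fd_bl[OF bounded_linear_PI sY, of v] unfolding PIY by (rule sym)
  have dG: "fd G x v = fd (Gam eps 0) y0 (fd Y x v)" for v
  using fd_compose[OF sY, of "Gam eps 0" v] sG0 by (simp add: G_def[abs_def] Yx)
  have "\<omega> x v w = Om (flow 1 eps x) eps (fd G0 x v, 0) (fd G0 x w, 0)" using G0(4)[OF vw] Om_one[OF x vw] by simp
  also have "... = Om ?j eps (inverse k *s fd G0 x v, 0) (inverse k *s fd G0 x w, 0)"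
  using Om_scale[OF fX r(4) ik G0(3)[OF vw(1)] G0(3)[OF vw(2)], of 0 0] by (simp only: fj)
  also have "... = Om ?j eps (fd J (y0, eps) (fd Y x v, 0), 0) (fd J (y0, eps) (fd Y x w, 0), 0)"
  unfolding m m' by (rule Om_radial_shift[OF jX r(4) fd_J[OF y0(4)] fd_J[OF y0(4)]])
  also have "... = ext_d1 primU (y0, eps) (fd Y x v, 0) (fd Y x w, 0)" using ext_primU[OF y0(4), of "(fd Y x v, 0)" "(fd Y x w, 0)"] r(4) by simp
  also have "... = ext_d1 primU (Gam eps 0 y0, 0) (fd G x v, 0) (fd G x w, 0)"
  unfolding dG by (rule F(8)[OF r(1,2) y0(2,3) PIdY PIdY, symmetric])
  finally show "\<omega> x v w = ext_d1 primU (u0, 0) (fd G x v, 0) (fd G x w, 0)" using Gx by (simp add: G_def Yx)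
 qed
 qed
qed

definition expo :: "(int ^ 'n) set" where "expo = insert 0 ((%i. axis i 1) ` I)"

text \<open>The constant sections \<open>s\<^sub>l(p) / s\<^sub>*(p)\<close> of the degenerate fibre contribute to the form through the sum of their squares only, so that
one exponent \<open>0\<close> with this coefficient replaces them.\<close>

definition cf :: "int ^ 'n => complex" where
 "cf \<beta> = (if \<beta> = 0 then of_real (sqrt (Re (herm (Inr ` {..N}) (Z0 0) (Z0 0)))) else 1)"

lemma cf_nonzero: "cf \<beta> ~= 0"
proof -
 have "Re (herm (Inr ` {..N} :: ('n + nat) set) (Z0 0) (Z0 0)) > 0"
  by (rule herm_self_pos[of _ "Inr j0"]) (use j0 J_frame(2)[OF dom_zero] in \<open>auto simp: Z0_def J_def\<close>)
 then show ?thesis by (simp add: cf_def)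
qed

lemma toric_form_limit: "toric_form expo cf u v w = ext_d1 primU (u, 0) (v, 0) (w, 0)"
proof -
 let ?A = "Inl ` I :: ('n + nat) set" and ?B = "Inr ` {..N} :: ('n + nat) set"
 have ax: "axis i (1 :: int) ~= 0" for i :: 'n by (simp add: axis_eq_0_iff)
 have E: "herm expo f g = f 0 * cnj (g 0) + (SUM i:I. f (axis i 1) * cnj (g (axis i 1)))" for f g
 proof -
  have "inj_on (%i. axis i (1 :: int)) I" by (auto simp: inj_on_def axis_eq_axis)
  moreover have "(0 :: int ^ 'n) ~: (%i. axis i 1) ` I" using ax by force
  ultimately show ?thesis by (simp add: herm_def expo_def sum.reindex)
 qed
 have D: "herm idx f g = (SUM i:I. f (Inl i) * cnj (g (Inl i))) + herm ?B f g" for f g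
  unfolding herm_def idx_def by (subst sum.union_disjoint) (auto simp: sum.reindex)
 have B0: "herm ?B (dZ0 v) g = 0" "herm ?B g (dZ0 v) = 0" for v g by (auto simp: herm_def dZ0_def intro!: sum.neutral)
 have BZ: "herm ?B (Z0 u) (Z0 u) = cf 0 * cnj (cf 0)"
 proof -
  have "herm ?B (Z0 u) (Z0 u) = herm ?B (Z0 0) (Z0 0)" by (auto simp: herm_def Z0_def intro!: sum.cong)
  also have "... = of_real (Re (herm ?B (Z0 0) (Z0 0)))" unfolding Re_herm_self by (rule herm_self)
  also have "... = cf 0 * cnj (cf 0)"
  using sum_nonneg[of ?B "%j. (cmod (Z0 0 j))\<^sup>2"] by (simp add: cf_def Re_herm_self flip: of_real_mult)
  finally show ?thesis .
 qed
 have d0: "fd (%y. monomial_at 0 y * cf 0) u v = 0" for v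
  using fun_cong[OF fd_eq[OF has_derivative_const]] by (simp add: monomial_zero)
 have d1: "fd (%y. monomial_at (axis i 1) y * cf (axis i 1)) u v = v $ i" for v i
  using fun_cong[OF fd_eq[OF deriv_bl[OF bounded_linear_vec_nth]]] by (simp add: monomial_axis cf_def ax)
 show ?thesis unfolding toric_form_def fubini_study_def ext_primU_zero E D B0 BZ d0 d1
  by (simp add: monomial_axis monomial_zero cf_def ax dZ0_def Z0_def add.commute)
qed

theorem symplectic_torus:
 "EX U. classical_open_in X U & symplectomorphic_to_torus X U \<omega> I (toric_form expo cf)"
proof -
 define U where "U = {x : X. EX u:torus I. limit x u}"
 define Psi where "Psi x = (THE u. limit x u)" for x
 have Psi: "Psi x = u" if "limit x u" for x u unfolding Psi_def using that limit_unique by blast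
 have UPsi: "limit x (Psi x)" "Psi x : torus I" "x : X" if "x : U" for x using that Psi by (auto simp: U_def)
 have in_U: "x : U & Psi x = u" if "x : X" "u : torus I" "limit x u" for x u using that Psi by (auto simp: U_def)
 have "EX V. openin (top_of_set X) V & x : V & V \<subseteq> U" if x: "x : U" for x
 proof -
  obtain V G where V: "open V" "x : V" "!!z. z : V ==> z : X ==> G z : torus I & limit z (G z)"
  by (rule limit_smooth[OF UPsi(3,1,2)[OF x]], rule that, assumption+)
  then show ?thesis using UPsi(3)[OF x] in_U by (intro exI[of _ "X \<inter> V"]) (auto intro: openin_open_Int)
 qed
 then have "openin (top_of_set X) U" using openin_subopen by blast
 moreover have "k *s x : U" if "x : U" "k ~= 0" for x k
  using in_U[OF scale_X UPsi(2) limit_scale] UPsi that by blast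
 ultimately have open_U: "classical_open_in X U" by (simp add: classical_open_in_def)
 have "symplectomorphism X U \<omega> I (toric_form expo cf) Psi" unfolding symplectomorphism_def
 proof (intro conjI ballI)
  have "u : Psi ` U" if u: "u : torus I" for u
  proof -
  obtain V sig where "u : V" "!!u. u : V ==> u : torus I ==> sig u : X & limit (sig u) u"
  by (rule limit_exists[OF u], rule that, assumption+)
  then have "sig u : X" "limit (sig u) u" using u by blast+
  then show ?thesis using in_U[OF _ u, of "sig u"] by (metis imageI)
  qed
  then show "Psi ` U = torus I" using UPsi(2) by blast
 next
  fix x y assume x: "x : U" and y: "y : U"
  show "Psi x = Psi y \<longleftrightarrow> (EX t. t ~= 0 & y = t *s x)"
  proof
  assume "Psi x = Psi y"
  then show "EX t. t ~= 0 & y = t *s x"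
  using limit_injective[OF UPsi(3)[OF x] UPsi(3)[OF y] UPsi(1)[OF x] _ UPsi(2)[OF x]] UPsi(1)[OF y] by simp
  next
  assume "EX t. t ~= 0 & y = t *s x"
  then have "limit y (Psi x)" using limit_scale[OF UPsi(3)[OF x] _ UPsi(1)[OF x]] by blast
  then show "Psi x = Psi y" using Psi by simp
  qed
 next
  fix x assume x: "x : U"
  obtain V G where V: "open V" "x : V" "smooth_on V G" "!!z. z : V ==> z : X ==> G z : torus I & limit z (G z)"
  "!!v w. v : T x ==> w : T x ==> \<omega> x v w = ext_d1 primU (Psi x, 0) (fd G x v, 0) (fd G x w, 0)"
  by (rule limit_smooth[OF UPsi(3,1,2)[OF x]], rule that, assumption+)
  have "G z = Psi z" if "z : U \<inter> V" for z using Psi[of z "G z"] V(4)[of z] UPsi(3)[of z] that by simp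
  then have "smooth_ext U Psi x G" unfolding smooth_ext_def using V(1-3) by blast
  then show "EX G. smooth_ext U Psi x G & (ALL v:T x. ALL w:T x. \<omega> x v w = toric_form expo cf (Psi x) (fd G x v) (fd G x w))"
  using V(5) by (intro exI[of _ G]) (simp add: toric_form_limit)
 next
  fix u assume u: "u : torus I"
  obtain V sig where V: "open V" "u : V" "smooth_on V sig" "!!u. u : V ==> u : torus I ==> sig u : X & limit (sig u) u"
  by (rule limit_exists[OF u], rule that, assumption+)
  have "sig y : U & Psi (sig y) = y" if "y : V \<inter> torus I" for y using in_U[of "sig y" y] V(4)[of y] that by blast
  then show "EX V sig. open V & u : V & smooth_on V sig & (ALL y:V \<inter> torus I. sig y : U & Psi (sig y) = y)"
  using V(1-3) by (intro exI[of _ V] exI[of _ sig]) simp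
 qed
 then show ?thesis using open_U unfolding symplectomorphic_to_torus_def by blast
qed

end

section \<open>From line bundles to interpolating forms\<close>

lemma zariski_open:
 assumes V: "zariski_open_in X V" and x: "(x :: complex ^ 'm::finite) : V" "x ~= 0"
 shows "around x (%y. y : X --> y : V)" "u ~= 0 ==> u *s x : X ==> u *s x : V"
proof -
 obtain Z where Z: "proj_closed Z" "V = X - Z" using V unfolding zariski_open_in_def by blast
 obtain P where P: "P \<subseteq> (\<Union>d. hpoly UNIV d)" "Z = {x. x ~= 0 & (ALL p:P. p (vec_nth x) = 0)}" by (rule proj_closed_eqs[OF Z(1)])
 obtain p d where p: "p : P" "p (vec_nth x) ~= 0" "p : hpoly UNIV d" using x Z(2) P by blast
 have "smooth_at x (%y. p (vec_nth y))" by (rule polyf_smooth[OF hpoly_polyf[OF p(3)]])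
 from around_compose[OF this, of "%z. z : - {0}"] around_open[of "- {0 :: complex}" "p (vec_nth x)"] p(2)
 have "around x (%y. p (vec_nth y) ~= 0)" by (simp add: open_Compl)
 then show "around x (%y. y : X --> y : V)" by eventually_elim (use p(1) in \<open>auto simp: Z(2) P(2)\<close>)
 show "u *s x : V" if "u ~= 0" "u *s x : X"
 proof -
  have "vec_nth (u *s x) = (%j. u * x $ j)" by (simp add: fun_eq_iff)
  then have "p (vec_nth (u *s x)) ~= 0" using hpoly_scale[OF p(3), of u "vec_nth x"] p(2) that(1) by simp
  then show ?thesis using p(1) that by (auto simp: Z(2) P(2))
 qed
qed

lemma holo_divide:
 assumes f: "holo_at x f" and g: "holo_at x g" "g x ~= 0" shows "holo_at x (%y. f y / g y)"
proof -
 have s: "smooth_at x f" "smooth_at x g" using f g by (simp_all add: holo_at_def)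
 have "around x (%y. g y : - {0})"
  by (rule around_compose[OF s(2)], rule around_open) (use g(2) in \<open>auto simp: open_Compl\<close>)
 with holo_at_eventually[OF f] holo_at_eventually[OF g(1)]
 have "around x (%y. ALL v. fd (%y. f y / g y) y (\<i> *s v) = \<i> * fd (%y. f y / g y) y v)"
 proof eventually_elim
  case (elim y)
  have d: "(f has_derivative fd f y) (at y)" "(g has_derivative fd g y) (at y)" "g y ~= 0"
  using elim smooth_deriv by (auto simp: holo_at_def)
  have i: "fd f y (\<i> *s v) = \<i> * fd f y v" "fd g y (\<i> *s v) = \<i> * fd g y v" for v
  using elim(1,2) holo_at_fd by blast+
  show ?case unfolding fd_eq[OF has_derivative_divide[OF d]] i by (simp add: algebra_simps diff_divide_distrib)
 qed
 then show ?thesis using s g(2) by (simp add: holo_at_def smooth_divide)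
qed

lemma holo_hpoly: "p : hpoly UNIV d ==> holo_at x (%y. p (vec_nth y))"
 using hpoly_polyf[of p d] by (simp add: holo_at_def polyf_smooth fd_polyf_scale always_eventually)

lemma regular_holo:
 assumes r: "regular_on X V f" and x: "x : V" "x ~= 0"
 shows "EX G. holo_at x G & (around x (%y. y : X --> f y = G y))" "u ~= 0 ==> u *s x : X ==> f (u *s x) = f x"
proof -
 obtain V' d p q where V: "p : hpoly UNIV d" "q : hpoly UNIV d" "zariski_open_in X V'" "x : V'"
  "!!y. y : V' ==> q (vec_nth y) ~= 0 & f y = p (vec_nth y) / q (vec_nth y)"
  using r x unfolding regular_on_def by blast
 have "holo_at x (%y. p (vec_nth y) / q (vec_nth y))" using V by (intro holo_divide holo_hpoly) auto
 moreover have "around x (%y. y : X --> f y = p (vec_nth y) / q (vec_nth y))"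
  using zariski_open(1)[OF V(3,4) x(2)] by eventually_elim (use V(5) in blast)
 ultimately show "EX G. holo_at x G & (around x (%y. y : X --> f y = G y))" by blast
 assume u: "u ~= 0" "u *s x : X"
 have e: "vec_nth (u *s x) = (%j. u * x $ j)" by (simp add: fun_eq_iff)
 have "f (u *s x) = p (vec_nth (u *s x)) / q (vec_nth (u *s x))" using V(5)[OF zariski_open(2)[OF V(3,4) x(2) u]] by blast
 also have "... = (u ^ d * p (vec_nth x)) / (u ^ d * q (vec_nth x))" unfolding e hpoly_scale[OF V(1)] hpoly_scale[OF V(2)] ..
 also have "... = f x" using V(5)[OF V(4)] u(1) by simp
 finally show "f (u *s x) = f x" .
qed

lemma flat_hpoly:
 fixes f :: "'j => 'a::euclidean_space => complex"
 assumes q: "q : hpoly J d" and f: "!!j. j : J ==> smooth_at x (f j) & fd (f j) x v = 0"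
 shows "smooth_at x (%y. q (%j. f j y)) & fd (%y. q (%j. f j y)) x v = 0"
proof -
 define flat where "flat g \<longleftrightarrow> smooth_at x g & fd g x v = 0" for g :: "'a => complex"
 have c: "flat (%y. a)" for a using fun_cong[OF fd_eq[OF has_derivative_const]] by (simp add: flat_def)
 have m: "flat (%y. g y * h y)" if "flat g" "flat h" for g h using that by (simp add: flat_def smooth_mult fd_mult)
 have a: "flat (%y. g y + h y)" if "flat g" "flat h" for g h using that by (simp add: flat_def smooth_add fd_add)
 have pw: "flat (%y. g y ^ k)" if "flat g" for g k using that by (induction k) (auto intro: c m)
 have pr: "flat (%y. PROD j:K. f j y ^ e j)" if "K \<subseteq> J" for K e
  using that
 proof (induction K rule: infinite_finite_induct)
  case (insert j K)
  then have "flat (f j)" using f by (auto simp: flat_def)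
  then show ?case using insert m[OF pw] by simp
 qed (auto intro: c)
 have "flat (%y. SUM e:E. b e * (PROD j:J. f j y ^ e j))" for E b
 proof (induction E rule: infinite_finite_induct)
  case (insert e E)
  then show ?case using a[OF m[OF c pr[OF order_refl]] insert.IH] by simp
 qed (simp_all add: c)
 then show ?thesis using q unfolding hpoly_def flat_def by auto
qed

context polarized
begin

lemma frame_derivative_unique:
 assumes "frame p kp S th e" "frame p kp S' th' e'" "l <= N" "v : T p" shows "fd (S l) p v = fd (S' l) p v"
proof (rule tangent_unique[OF frame_X[OF assms(1)] frame_smooth[OF assms(1,3)] frame_smooth[OF assms(2,3)] _ assms(4)])
 show "around p (%y. y : X --> S l y = S' l y)"
  using frame_around[OF assms(1)] frame_around[OF assms(2)]
  by eventually_elim (use frame_value assms(3) in metis)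
qed

text \<open>As the sections separate tangent directions at \<open>p\<close>, the derivatives of \<open>s\<^sub>l / s\<^sub>*\<close> are injective on the \<open>n\<close>-dimensional
space of tangent directions. The Gram matrix of these derivatives is invertible, and its inverse
supplies the coefficients \<open>c'\<close> of sections dual to a basis.\<close>

lemma dual_frame:
 assumes f: "frame p kp S th e" and j0: "j0 <= N" "S j0 p ~= 0" and cI: "card I = n"
  and imm: "!!v. v : T p ==> (!!l. l <= N ==> S j0 p * fd (S l) p v = S l p * fd (S j0) p v) ==> EX u. v = u *s p"
 obtains b and c' :: "'n => nat => complex" where "!!i. i : I ==> (SUM l<=N. c' i l * S l p) = 0" "!!i. i : I ==> b i : T p"
  "!!v. v : T p ==> EX x u. v = (SUM i:I. x i *s b i) + u *s p"
  "!!i j. i : I ==> j : I ==> (SUM l<=N. c' i l * fd (S l) p (b j)) = (if i = j then S j0 p else 0)"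
proof -
 have pX: "p : X" by (rule frame_X[OF f])
 have p0: "p ~= 0" using pX zero_notin_X by blast
 have "{p} \<subseteq> T p" using radial_T[OF pX, of 1] by simp
 moreover have "vec.independent {p}" using p0 by simp
 ultimately obtain B where B: "{p} \<subseteq> B" "B \<subseteq> T p" "vec.independent B" "T p \<subseteq> vec.span B" by (rule vec.maximal_independent_subset_extend)
 have cB: "card B = n + 1" using vec.basis_card_eq_dim[OF B(2,4,3)] dim_T[OF pX] by simp
 then have fB: "finite B" using card.infinite by fastforce
 have "card (B - {p}) = card I" using cB B(1) fB cI by simp
 then obtain b where b: "bij_betw b I (B - {p})" using finite_same_card_bij[of I "B - {p}"] fB by auto
 have bT: "b i : T p" if "i : I" for i using b that B(2) by (auto simp: bij_betw_def)
 have sumB: "(SUM w:B. u w *s w) = (SUM i:I. u (b i) *s b i) + u p *s p" for u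
  using sum.remove[OF fB, of p "%w. u w *s w"] B(1) sum.reindex_bij_betw[OF b, of "%w. u w *s w"] by (simp add: add.commute)
 have span: "EX x u. v = (SUM i:I. x i *s b i) + u *s p" if v: "v : T p" for v
 proof -
  have "v : vec.span B" using v B(4) by blast
  then obtain u where "v = (SUM w:B. u w *s w)" unfolding vec.span_finite[OF fB] by blast
  then show ?thesis unfolding sumB by (intro exI[of _ "%i. u (b i)"] exI[of _ "u p"])
 qed
 have indep: "x i = 0" if i: "i : I" and e: "(SUM i:I. x i *s b i) = u *s p" for x u i
 proof -
  define g where "g w = (if w = p then - u else x (inv_into I b w))" for w
  have bi: "b i ~= p" "inv_into I b (b i) = i" if "i : I" for i using b that by (auto simp: bij_betw_def)
  have "(SUM w:B. g w *s w) = 0" unfolding sumB using e by (simp add: g_def bi cong: sum.cong)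
  moreover have "b i : B" using b i by (auto simp: bij_betw_def)
  ultimately have "g (b i) = 0" using vec.independentD[OF B(3) fB order_refl] by blast
  then show ?thesis using bi[OF i] by (simp add: g_def)
 qed
 define D where "D l v = fd (S l) p v - S l p / S j0 p * fd (S j0) p v" for l v
 have lS: "linear (fd (S l) p)" if "l <= N" for l using smooth_lin frame_smooth[OF f that] .
 have hS: "fd (S l) p (u *s v) = u * fd (S l) p v" if "l <= N" for l u v
  using f holo_at_fd_scale that unfolding frame_def by blast
 have D: "D l (SUM i:I. x i *s b i) = (SUM i:I. x i * D l (b i))" if l: "l <= N" for l x
  unfolding D_def linear_sum[OF lS[OF l]] linear_sum[OF lS[OF j0(1)]] hS[OF l] hS[OF j0(1)]
  by (simp add: sum_distrib_left sum_subtractf algebra_simps)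
 define G :: "complex ^ 'n ^ 'n" where
  "G = (\<chi> j k. if j : I & k : I then (SUM l<=N. cnj (D l (b j)) * D l (b k)) else if j = k then 1 else 0)"
 have "inj ((*v) G)" unfolding vec.inj_iff_eq_0
 proof (intro allI impI)
  fix x assume Gx: "G *v x = 0"
  have out: "x $ i = 0" if "i ~: I" for i
  proof -
  have "(G *v x) $ i = (SUM k:UNIV. (if k = i then 1 else 0) * x $ k)"
  unfolding matrix_vector_mult_def G_def using that by (auto intro!: sum.cong)
  then show ?thesis using Gx by (simp add: if_distrib[of "%a. a * _"] cong: if_cong)
  qed
  define y where "y = (SUM k:I. (x $ k) *s b k)"
  have Dy: "D l y = (SUM k:I. x $ k * D l (b k))" if "l <= N" for l using D[OF that] by (simp add: y_def)
  have row: "(SUM l<=N. cnj (D l (b j)) * D l y) = 0" if j: "j : I" for j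
  proof -
  have "(SUM l<=N. cnj (D l (b j)) * D l y) = (SUM l<=N. SUM k:I. cnj (D l (b j)) * D l (b k) * x $ k)"
  by (intro sum.cong refl) (simp add: Dy sum_distrib_left mult_ac)
  also have "... = (SUM k:I. (SUM l<=N. cnj (D l (b j)) * D l (b k)) * x $ k)"
  by (subst sum.swap) (simp add: sum_distrib_right)
  also have "... = (SUM k:I. G $ j $ k * x $ k)" using j by (intro sum.cong refl) (simp add: G_def)
  also have "... = (SUM k:UNIV. G $ j $ k * x $ k)" by (rule sum.mono_neutral_left) (auto simp: out)
  also have "... = (G *v x) $ j" by (simp add: matrix_vector_mult_def)
  finally show ?thesis using Gx by simp
  qed
  have "(SUM l<=N. cnj (D l y) * D l y) = (SUM l<=N. SUM j:I. cnj (x $ j) * (cnj (D l (b j)) * D l y))"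
  proof (intro sum.cong refl)
  fix l assume "l : {..N}"
  then have "cnj (D l y) = (SUM j:I. cnj (x $ j) * cnj (D l (b j)))" by (simp add: Dy)
  then show "cnj (D l y) * D l y = (SUM j:I. cnj (x $ j) * (cnj (D l (b j)) * D l y))" by (simp add: sum_distrib_right mult.assoc)
  qed
  also have "... = (SUM j:I. cnj (x $ j) * (SUM l<=N. cnj (D l (b j)) * D l y))" by (subst sum.swap) (simp add: sum_distrib_left)
  also have "... = 0" by (simp add: row)
  finally have h0: "herm {..N} (%l. D l y) (%l. D l y) = 0" by (simp add: herm_def mult.commute)
  have "D l y = 0" if "l <= N" for l
  proof (rule ccontr)
  assume "D l y ~= 0"
  then have "Re (herm {..N} (%l. D l y) (%l. D l y)) > 0" using that by (intro herm_self_pos[of _ l]) auto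
  then show False by (simp add: h0)
  qed
  moreover have "y : T p" unfolding y_def by (intro vec.subspace_sum subspace_T[OF pX] T_scale[OF pX bT])
  ultimately have "EX u. y = u *s p" using imm[of y] j0(2) by (simp add: D_def field_simps)
  then obtain u where "(SUM i:I. (x $ i) *s b i) = u *s p" unfolding y_def by blast
  then have "x $ i = 0" for i using indep[of i "%i. x $ i" u] out by blast
  then show "x = 0" by (simp add: vec_eq_iff)
 qed
 then obtain M where M: "M ** G = mat 1" using matrix_left_invertible_injective[of G] by blast
 define c1 where "c1 i l = (SUM j:I. M $ i $ j * cnj (D l (b j)))" for i l
 have c1D: "(SUM l<=N. c1 i l * D l (b k)) = (if i = k then 1 else 0)" if k: "k : I" for i k
 proof -
  have "(SUM l<=N. c1 i l * D l (b k)) = (SUM l<=N. SUM j:I. M $ i $ j * (cnj (D l (b j)) * D l (b k)))"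
  by (simp add: c1_def sum_distrib_right mult.assoc)
  also have "... = (SUM j:I. M $ i $ j * G $ j $ k)"
  by (subst sum.swap) (use k in \<open>simp add: G_def sum_distrib_left\<close>)
  also have "... = (SUM j:UNIV. M $ i $ j * G $ j $ k)" by (rule sum.mono_neutral_left) (use k in \<open>auto simp: G_def\<close>)
  also have "... = (M ** G) $ i $ k" by (simp add: matrix_matrix_mult_def)
  finally show ?thesis by (simp add: M mat_def)
 qed
 define m where "m i = (SUM l<=N. c1 i l * S l p) / S j0 p" for i
 define c' where "c' i l = S j0 p * (c1 i l - (if l = j0 then m i else 0))" for i l
 have cs: "(SUM l<=N. c' i l * g l) = S j0 p * ((SUM l<=N. c1 i l * g l) - m i * g j0)" for i and g :: "nat => complex"
 proof -
  have "(SUM l<=N. c' i l * g l) = S j0 p * (SUM l<=N. c1 i l * g l - (if l = j0 then m i * g j0 else 0))"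
  unfolding sum_distrib_left by (intro sum.cong refl) (simp add: c'_def algebra_simps)
  then show ?thesis using j0(1) by (simp add: sum_subtractf)
 qed
 show thesis
 proof (rule that[of c' b])
  show "(SUM l<=N. c' i l * S l p) = 0" for i using j0(2) by (simp add: cs m_def)
  show "b i : T p" if "i : I" for i by (rule bT[OF that])
  show "EX x u. v = (SUM i:I. x i *s b i) + u *s p" if "v : T p" for v by (rule span[OF that])
  fix i j assume ij: "i : I" "j : I"
  have "(SUM l<=N. c1 i l * D l (b j)) = (SUM l<=N. c1 i l * fd (S l) p (b j)) - m i * fd (S j0) p (b j)"
  proof -
  have "m i * fd (S j0) p (b j) = (SUM l<=N. c1 i l * (S l p / S j0 p * fd (S j0) p (b j)))"
  unfolding m_def sum_divide_distrib sum_distrib_right by (intro sum.cong refl) simp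
  then show ?thesis by (simp add: D_def right_diff_distrib sum_subtractf)
  qed
  then have "(SUM l<=N. c1 i l * fd (S l) p (b j)) - m i * fd (S j0) p (b j) = (if i = j then 1 else 0)" unfolding c1D[OF ij(2)] by (rule sym)
  then show "(SUM l<=N. c' i l * fd (S l) p (b j)) = (if i = j then S j0 p else 0)" unfolding cs by (simp only:) simp
 qed
qed

text \<open>The inverse of the embedding is given by homogeneous polynomials in the sections. If all quotients of sections are stationary in
direction \<open>v\<close>, then so is the point of projective space recovered from them, and \<open>v\<close> is radial.\<close>

lemma embedding_immersive:
 assumes f: "frame p kp S th e" and j0: "j0 <= N" "S j0 p ~= 0"
  and q: "!!i. q i : hpoly {..N} d" "q i1 (%j. if j <= N then s j (SOME k. p : W k) p else 0) ~= 0"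
  and inv: "!!y. y : X ==> (EX i. q i (%j. if j <= N then s j (SOME k. y : W k) y else 0) ~= 0) ==>
  EX t. t ~= 0 & (ALL i. q i (%j. if j <= N then s j (SOME k. y : W k) y else 0) = t * y $ i)"
  and v: "v : T p" "!!l. l <= N ==> S j0 p * fd (S l) p v = S l p * fd (S j0) p v"
 shows "EX u. v = u *s p"
proof -
 have pX: "p : X" by (rule frame_X[OF f])
 have p0: "p ~= 0" using pX zero_notin_X by blast
 define F where "F y = (%j. if j <= N then s j (SOME k. y : W k) y else 0)" for y
 define S' where "S' j y = (if j <= N then S j y / S j0 y else 0)" for j y
 define Q where "Q i y = q i (%j. S' j y)" for i y
 have fl: "smooth_at p (S' j) & fd (S' j) p v = 0" if j: "j : {..N}" for j
 proof -
  have jN: "j <= N" using j by simp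
  have e: "S' j = (%y. S j y / S j0 y)" by (simp add: S'_def fun_eq_iff jN)
  have "fd (%y. S j y / S j0 y) p v = 0"
  using fun_cong[OF fd_eq[OF has_derivative_divide[OF smooth_deriv[OF frame_smooth[OF f jN]] smooth_deriv[OF frame_smooth[OF f j0(1)]] j0(2)]], of v]
  v(2)[OF jN] j0(2) by (simp add: field_simps)
  then show ?thesis unfolding e using smooth_divide[OF frame_smooth[OF f jN] frame_smooth[OF f j0(1)] j0(2)] by simp
 qed
 have Q: "smooth_at p (Q i)" "fd (Q i) p v = 0" for i
  using flat_hpoly[OF q(1)[of i] fl] by (simp_all add: Q_def[abs_def])
 have rel: "EX \<mu>. \<mu> ~= 0 & (ALL i. q i (F y) = \<mu> ^ d * Q i y)" if fy: "frame y kp S th e" and S0: "S j0 y ~= 0" for y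
 proof -
  define k where "k = (SOME k. y : W k)"
  have yk: "y : W kp" using fy by (simp add: frame_def)
  have k: "y : W k" unfolding k_def by (rule someI[of _ kp]) (rule yk)
  obtain u where u: "!!l. l <= N ==> s l k y = u * s l kp y" using cocycle[OF k yk] by blast
  obtain l where "l <= N" "s l k y ~= 0" using base_point_free[OF k] by blast
  then have u0: "u ~= 0" using u by auto
  have "F y = (%j. (u * S j0 y) * S' j y)"
  using u frame_value[OF fy] S0 by (auto simp: F_def S'_def k_def[symmetric] fun_eq_iff)
  then have "q i (F y) = (u * S j0 y) ^ d * Q i y" for i using hpoly_scale[OF q(1)[of i], of "u * S j0 y" "%j. S' j y"] by (simp add: Q_def)
  then show ?thesis using u0 S0 by (intro exI[of _ "u * S j0 y"]) simp
 qed
 have ray: "EX t. t ~= 0 & (ALL i. Q i y = t * y $ i)" if fy: "frame y kp S th e" and S0: "S j0 y ~= 0" and n: "Q i1 y ~= 0" for y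
 proof -
  obtain \<mu> where \<mu>: "\<mu> ~= 0" "!!i. q i (F y) = \<mu> ^ d * Q i y" using rel[OF fy S0] by blast
  have "q i1 (F y) ~= 0" using \<mu> n by simp
  then obtain t where t: "t ~= 0" "!!i. q i (F y) = t * y $ i" using inv[OF frame_X[OF fy]] unfolding F_def by blast
  then have "Q i y = (t / \<mu> ^ d) * y $ i" for i using \<mu>(1) \<mu>(2)[of i] by (simp add: field_simps)
  then show ?thesis using t(1) \<mu>(1) by (intro exI[of _ "t / \<mu> ^ d"]) simp
 qed
 have Q1: "Q i1 p ~= 0"
 proof -
  obtain \<mu> where "q i1 (F p) = \<mu> ^ d * Q i1 p" using rel[OF f j0(2)] by blast
  then show ?thesis using q(2) by (auto simp: F_def)
 qed
 obtain t where t: "t ~= 0" "!!i. Q i p = t * p $ i" using ray[OF f j0(2) Q1] by blast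
 obtain i0 where i0: "p $ i0 ~= 0" using p0 by (auto simp: vec_eq_iff)
 have e1: "around p (%y. S j0 y : - {0})"
  by (rule around_compose[OF frame_smooth[OF f j0(1)]], rule around_open) (use j0(2) in \<open>auto simp: open_Compl\<close>)
 have e2: "around p (%y. Q i1 y : - {0})"
  by (rule around_compose[OF Q(1)], rule around_open) (use Q1 in \<open>auto simp: open_Compl\<close>)
 have vi: "v $ i = (v $ i0 / p $ i0) * p $ i" for i
 proof -
  have sc: "smooth_at p (%y. y $ k)" for k by (rule smooth_vec_nth[OF smooth_ident])
  have dc: "fd (%y. y $ k) p v = v $ k" for k
  using fun_cong[OF fd_eq[OF deriv_bl[OF bounded_linear_vec_nth]]] .
  have "fd (%y. Q i y * y $ i0) p v = fd (%y. Q i0 y * y $ i) p v"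
  proof (rule tangent_unique[OF pX smooth_mult[OF Q(1) sc] smooth_mult[OF Q(1) sc] _ v(1)])
  show "around p (%y. y : X --> Q i y * y $ i0 = Q i0 y * y $ i)"
  using frame_around[OF f] e1 e2
  proof eventually_elim
  case (elim y)
  show ?case
  proof
  assume "y : X"
  then obtain t where "!!i. Q i y = t * y $ i" using ray[of y] elim by auto
  then show "Q i y * y $ i0 = Q i0 y * y $ i" by simp
  qed
  qed
  qed
  then have "Q i p * v $ i0 = Q i0 p * v $ i" by (simp add: fd_mult[OF Q(1) sc] Q(2) dc)
  then show ?thesis using t i0 by (simp add: field_simps)
 qed
 show ?thesis by (rule exI[of _ "v $ i0 / p $ i0"], subst vec_eq_iff, rule allI, subst vector_smult_component, rule vi)
qed

end

text \<open>Regular functions are locally quotients of polynomials of the same degree, hence holomorphic and invariant under scaling.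
The form \<open>\<eta>\<close> comes from the hypothesis on the class of \<open>\<omega>\<close>.\<close>

lemma polarized_of_bundle:
 fixes X :: "(complex ^ 'm::finite) set"
 assumes X: "smooth_projective_variety X n" and lb: "line_bundle X W g"
  and s: "!!j. j <= N ==> global_section X W g (s j)" "!!k x. x : W k ==> EX j<=N. s j k x ~= 0"
  and ka: "kaehler_form X \<omega>" and h: "hermitian_metric X W g h" and kap: "chern_form X W h kap"
  and \<eta>: "one_form X \<eta>" "!!x. x : X ==> EX G. form1_ext X \<eta> x G &
  (ALL v : cone_tangent X x. ALL w : cone_tangent X x. \<omega> x v w - kap x v w = ext_d1 G x v w)"
 shows "polarized X n W N s h \<omega> \<eta>"
proof -
 interpret smooth_cone X n
  using X by unfold_locales (auto simp: smooth_projective_variety_def irreducible_closed_def)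
 have WX: "W k \<subseteq> X" and zW: "zariski_open_in X (W k)" for k using lb by (auto simp: line_bundle_def)
 have W0: "x ~= 0" "x : X" if "x : W k" for x k using that WX zero_notin_X by blast+
 have rs: "regular_on X (W k) (s l k)" if "l <= N" for k l using s(1)[OF that] by (simp add: global_section_def)
 have tf: "two_form X \<omega>" using ka by (simp add: kaehler_form_def closed_form_def)
 show ?thesis
 proof (unfold_locales)
  show "(\<Union>k. W k) = X" using lb by (simp add: line_bundle_def)
  show "around x (%y. y : X --> y : W k)" if "x : W k" for x k
  by (rule zariski_open(1)[OF zW that W0(1)[OF that]])
  show "EX G. holo_at x G & (around x (%y. y : X --> s l k y = G y))" if "x : W k" "l <= N" for x k l
  by (rule regular_holo(1)[OF rs[OF that(2)] that(1) W0(1)[OF that(1)]])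
  show "u *s x : W k & h k (u *s x) = h k x & (ALL l<=N. s l k (u *s x) = s l k x)" if x: "x : W k" and u: "u ~= 0" for x k u
  proof -
  note uX = scale_X[OF W0(2)[OF x] u]
  show ?thesis using zariski_open(2)[OF zW x W0(1)[OF x] u uX] regular_holo(2)[OF rs x W0(1)[OF x] u uX] h x u
  unfolding hermitian_metric_def by blast
  qed
  show "EX l<=N. s l k x ~= 0" if "x : W k" for x k by (rule s(2)[OF that])
  show "EX u. (ALL l<=N. s l k x = u * s l k' x) & h k' x = (cmod u)\<^sup>2 * h k x" if x: "x : W k" "x : W k'" for x k k'
  proof (intro exI[of _ "g k k' x"] conjI allI impI)
  show "s l k x = g k k' x * s l k' x" if "l <= N" for l using s(1)[OF that] x unfolding global_section_def by blast
  show "h k' x = (cmod (g k k' x))\<^sup>2 * h k x" using h x unfolding hermitian_metric_def by blast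
  qed
  show "h k x > 0" if "x : W k" for x k using h that unfolding hermitian_metric_def by blast
  show "\<eta> (u *s x) (u *s v) = \<eta> x v" if "x : X" "u ~= 0" "v : T x" for x u v using \<eta>(1) that by (simp add: one_form_def)
  show "\<eta> x (u *s x) = 0" if "x : X" for x u using \<eta>(1) that by (simp add: one_form_def)
  show "\<omega> (u *s x) (u *s v) (u *s w) = \<omega> x v w" if "x : X" "u ~= 0" "v : T x" "w : T x" for x u v w
  using tf that by (simp add: two_form_def)
  show "\<omega> x (u *s x) v = 0" if "x : X" "v : T x" for x u v using tf that by (simp add: two_form_def)
  show "\<omega> x v (\<i> *s v) > 0" if "x : X" "v : T x" "!!u. v ~= u *s x" for x v using ka that by (simp add: kaehler_form_def)
  show "EX th e. smooth_at x th & smooth_form x e & (around x (%y. y : X --> th y = ln (h k y) & (ALL v:T y. e y v = \<eta> y v))) &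
  (ALL v:T x. ALL w:T x. \<omega> x v w = ext_d1 (%y v. e y v + fd th y (\<i> *s v) / (4 * pi)) x v w)" if x: "x : W k" for x k
  proof -
  obtain th where th: "smooth_ext (W k) (%y. ln (h k y)) x th" "!!v w. v : T x ==> w : T x ==> kap x v w = - ddbar th x v w"
  using kap x unfolding chern_form_def by blast
  obtain e where e: "form1_ext X \<eta> x e" "!!v w. v : T x ==> w : T x ==> \<omega> x v w - kap x v w = ext_d1 e x v w"
  using \<eta>(2)[OF W0(2)[OF x]] by blast
  obtain V where V: "open V" "x : V" "smooth_on V th" "!!y. y : W k \<inter> V ==> th y = ln (h k y)" using th(1) unfolding smooth_ext_def by blast
  obtain V' where V': "open V'" "x : V'" "!!y. y : V' ==> linear (e y)" "!!v. smooth_on V' (%y. e y v)"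
  "!!y v. y : X \<inter> V' ==> v : T y ==> e y v = \<eta> y v" using e(1) unfolding form1_ext_def by blast
  have sth: "smooth_at x th" by (rule smooth_atI[OF V(3,1,2)])
  have "around x (%y. linear (e y))" using around_open[OF V'(1,2)] by (rule eventually_mono) (rule V'(3))
  then have se: "smooth_form x e" unfolding smooth_form_def using smooth_atI[OF V'(4,1,2)] by blast
  have ev: "around x (%y. y : X --> th y = ln (h k y) & (ALL v:T y. e y v = \<eta> y v))"
  using around_open[OF V(1,2)] around_open[OF V'(1,2)] zariski_open(1)[OF zW x W0(1)[OF x]]
  by eventually_elim (use V(4) V'(5) in auto)
  have l: "linear (%v. \<i> *s v :: complex ^ 'm)" using bl_vscale by (simp add: lin_bl)
  have "around x (%y. linear (%v. fd th y (\<i> *s v)))"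
  using smooth_around[OF sth] by (rule eventually_mono) (use linear_compose[OF l smooth_lin] in \<open>auto simp: o_def\<close>)
  then have sd: "smooth_form x (%y v. fd th y (\<i> *s v))" unfolding smooth_form_def using smooth_fd[OF sth] by blast
  have z: "fd (%y. inverse (4 * pi)) x v = 0" for v using fun_cong[OF fd_eq[OF has_derivative_const]] .
  have E: "(%y v. e y v + fd th y (\<i> *s v) / (4 * pi)) = (%y v. e y v + inverse (4 * pi) * fd th y (\<i> *s v))"
  by (intro ext) (simp only: divide_inverse mult.commute)
  have "\<omega> x v w = ext_d1 (%y v. e y v + fd th y (\<i> *s v) / (4 * pi)) x v w" if vw: "v : T x" "w : T x" for v w
  proof -
  have "kap x v w = inverse (4 * pi) * ext_d1 (%y v. fd th y (\<i> *s v)) x v w"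
  unfolding th(2)[OF vw] ddbar_def by (simp only: divide_inverse mult_minus_left minus_minus mult.commute)
  moreover have "ext_d1 (%y v. inverse (4 * pi) * fd th y (\<i> *s v)) x v w = inverse (4 * pi) * ext_d1 (%y v. fd th y (\<i> *s v)) x v w"
  unfolding ext_d1_scale[OF smooth_const[of x "inverse (4 * pi)"] sd] z by (simp only: mult_zero_left add_0_right diff_zero)
  ultimately show ?thesis unfolding E ext_d1_add[OF se form_scale[OF smooth_const[of x "inverse (4 * pi)"] sd]]
  using e(2)[OF vw] by linarith
  qed
  then show ?thesis using sth se ev by blast
  qed
 qed
qed

theorem theorem1p1:
 fixes X :: "(complex ^ 'm::finite) set"
  and W :: "'k \<Rightarrow> (complex ^ 'm) set"
  and g :: "'k \<Rightarrow> 'k \<Rightarrow> complex ^ 'm \<Rightarrow> complex"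
  and \<omega> :: "complex ^ 'm \<Rightarrow> complex ^ 'm \<Rightarrow> complex ^ 'm \<Rightarrow> real"
  and n :: nat
  and I :: "'n::finite set"
 assumes "smooth_projective_variety X n"
  and "line_bundle X W g" and "very_ample X W g"
  and "kaehler_form X \<omega>" and "\<omega> \<in> first_chern_class X W g"
  and "card I = n"
 shows "\<exists>U A c. classical_open_in X U \<and>
  finite A \<and> A \<noteq> {} \<and> A \<subseteq> lattice I \<and>
  group_closure {\<beta> - \<gamma> |\<beta> \<gamma>. \<beta> \<in> A \<and> \<gamma> \<in> A} = lattice I \<and>
  (\<forall>\<beta>\<in>A. c \<beta> \<noteq> 0) \<and>
  symplectomorphic_to_torus X U \<omega> I (toric_form A c)"
proof -
 obtain N s where s: "!!j. j <= N ==> global_section X W g (s j)" "!!k x. x : W k ==> EX j<=N. s j k x ~= 0"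
  "closed_embedding X N (%x j. if j <= N then s j (SOME k. x : W k) x else 0)"
  using assms(3) unfolding very_ample_def by blast
 obtain h kap \<eta> where h: "hermitian_metric X W g h" "chern_form X W h kap" "one_form X \<eta>"
  "!!x. x : X ==> EX G. form1_ext X \<eta> x G & (ALL v : cone_tangent X x. ALL w : cone_tangent X x. \<omega> x v w - kap x v w = ext_d1 G x v w)"
  using assms(5) unfolding first_chern_class_def exact_form_def by blast
 have pol: "polarized X n W N s h \<omega> \<eta>"
  by (rule polarized_of_bundle[OF assms(1,2) s(1,2) assms(4) h(1,2,3,4)])
 \<comment> \<open>Frames do not involve the coefficients of the sections \<open>\<sigma>\<^sub>i\<close>, which are chosen with the help of one.\<close>
 interpret P: polarized X n W N s h \<omega> \<eta> I "%_ _. 0" by (rule pol)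
 obtain p where p: "p : X" using assms(1) unfolding smooth_projective_variety_def irreducible_closed_def by blast
 obtain kp S th e where f: "P.frame p kp S th e" using P.frame_at[OF p] by blast
 have pW: "p : W kp" using f by (simp add: P.frame_def)
 obtain j0 where j0: "j0 <= N" "s j0 kp p ~= 0" using s(2)[OF pW] by blast
 have Sp: "s l kp p = S l p" if "l <= N" for l by (rule P.frame_value[OF f that])
 let ?F = "%y j. if j <= N then s j (SOME k. y : W k) y else 0"
 from s(3)[unfolded closed_embedding_def, THEN conjunct2, THEN conjunct2, rule_format, OF p]
 obtain d q where q: "ALL i. q i : hpoly {..N} d" "EX i. q i (?F p) ~= 0"
  "ALL y:X. (EX i. q i (?F y) ~= 0) --> (EX t. t ~= 0 & (ALL i. q i (?F y) = t * y $ i))"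
  by (elim exE conjE) (rule that, assumption, rule exI, assumption, assumption)
 obtain i1 where i1: "q i1 (?F p) ~= 0" using q(2) by (elim exE)
 have Sj: "S j0 p ~= 0" using j0 Sp by simp
 have imm: "EX u. v = u *s p" if "v : P.T p" "!!l. l <= N ==> S j0 p * fd (S l) p v = S l p * fd (S j0) p v" for v
  by (rule P.embedding_immersive[where q=q, OF f j0(1) Sj q(1)[rule_format] i1 q(3)[rule_format] that])
 obtain b and c :: "'n => nat => complex" where bc: "!!i. i : I ==> (SUM l<=N. c i l * S l p) = 0" "!!i. i : I ==> b i : P.T p"
  "!!v. v : P.T p ==> EX x u. v = (SUM i:I. x i *s b i) + u *s p"
  "!!i j. i : I ==> j : I ==> (SUM l<=N. c i l * fd (S l) p (b j)) = (if i = j then S j0 p else 0)"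
  by (rule P.dual_frame[OF f j0(1) Sj assms(6) imm], assumption, assumption, rule that, assumption+)
 have "EX S th e del chi' ell. charted X n W N s h \<omega> \<eta> I c kp j0 S th e del chi' ell"
 proof (rule polarized.chart_exists[OF pol pW j0, of I c b])
  show "(SUM l<=N. c i l * s l kp p) = 0" if "i : I" for i using bc(1)[OF that] Sp by simp
  show "(SUM l<=N. c i l * fd (S' l) p (b j)) = (if i = j then s j0 kp p else 0)" if "P.frame p kp S' th' e'" "i : I" "j : I" for S' th' e' i j
  using bc(4)[OF that(2,3)] P.frame_derivative_unique[OF that(1) f _ bc(2)[OF that(3)]] Sp[OF j0(1)] by simp
 qed (use bc(2,3) in blast)+
 then obtain S th e del chi' ell where "charted X n W N s h \<omega> \<eta> I c kp j0 S th e del chi' ell" by blast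
 then interpret charted X n W N s h \<omega> \<eta> I c kp j0 S th e del chi' ell .
 obtain U where U: "classical_open_in X U" "symplectomorphic_to_torus X U \<omega> I (toric_form expo cf)" using symplectic_torus by blast
 have "finite expo" "expo ~= {}" by (simp_all add: expo_def)
 then show ?thesis using U group_closure_standard[of I, folded expo_def] cf_nonzero by blast
qed

end
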